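(* Let $m,k\in\mathbb N$ with $m\ge 3$, $k\ge 1$, let $0<\alpha\le 1$, and let $R>0$. Let $V$ be a function on $B_R$ for which there exist $C_0>1$ and $\delta\in(0,2]$ such that $$|V(z,t)|\le \frac{C_0}{\rho_\alpha(z,t)^{2-\delta}}\qquad\text{for } (z,t)\in B_R .$$ Let $u\in S^{2,2}(B_R)$ be a solution in $B_R$ of $$\mathscr B_\alpha u = V(z,t)\,u .$$ If $u$ vanishes to infinite order at $(0,0)$, then $u\equiv 0$ in $B_R$.
   Context: Points of $\mathbb R^N$, $N=m+k$, are written $(z,t)$ with $z\in\mathbb R^m$, $t\in\mathbb R^k$. The pseudo-gauge is $\rho_\alpha(z,t)=\bigl(|z|^{2(\alpha+1)}+(\alpha+1)^2|t|^2\bigr)^{\frac{1}{2(\alpha+1)}}$, and $B_r=\{(z,t)\in\mathbb R^{m+k}:\rho_\alpha(z,t)<r\}$ for $r>0$. The vector fields $X_1,\dots,X_N$ are $X_i=\partial_{z_i}$ for $i=1,\dots,m$ and $X_{m+j}=|z|^\alpha\partial_{t_j}$ for $j=1,\dots,k$. The operator is $\mathscr B_\alpha u=\Delta_z u+|z|^{2\alpha}\Delta_t u=\sum_{i=1}^N X_i^2u$. Function spaces: for a multi-index $\beta=(\beta_1,\dots,\beta_N)$ put $X^\beta f=X_1^{\beta_1}\cdots X_N^{\beta_N}f$. For an open set $\Omega\subset\mathbb R^N$, $W^{\ell,p}(\Omega)=\{f\in L^p(\Omega): X^\beta f\in L^p(\Omega),\ |\beta|\le \ell\}$, with norm $\|f\|_{L^p(\Omega)}+\sum_{|\beta|\le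 \ell}\|X^\beta f\|_{L^p(\Omega)}$, and $S^{\ell,p}(\Omega)$ is the closure of $C^\infty(\Omega)\cap W^{\ell,p}(\Omega)$ in $W^{\ell,p}(\Omega)$. For $u\in S^{2,2}(B_R)$ the equation is understood as equality a.e. in $B_R$. Functions are real-valued, and $V$ is measurable; when $\delta<2$ the bound on $V$ is void at the origin. Vanishing to infinite order at $(0,0)$: for every $\ell>0$ one has $\int_{B_r}|u|^2=O(r^\ell)$ as $r\to0$ (integration with respect to Lebesgue measure). *)

theory Defs
  imports "HOL-Analysis.Analysis"
begin

text \<open>Points \<open>(z, t)\<close> live in \<open>(real^'m) \<times> (real^'k)\<close>, so \<open>m = CARD('m)\<close>, \<open>k = CARD('k)\<close> and
  \<open>lebesgue\<close> is Lebesgue measure on the product space. The vector fields are indexed by the sum type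
  \<open>'m + 'k\<close>: \<open>Inl i\<close> stands for differentiation in \<open>z\<^sub>i\<close> and \<open>Inr j\<close> for
  \<open>|z|\<^sup>\<alpha>\<close> times differentiation in \<open>t\<^sub>j\<close>. The linear orders on the index types serve only to order the fields.\<close>

type_synonym ('m, 'k) point = "(real, 'm) vec \<times> (real, 'k) vec"

definition gauge_rho :: "real \<Rightarrow> ('m::finite, 'k::finite) point \<Rightarrow> real" where
  "gauge_rho \<alpha> = (\<lambda>(z, t).
     (norm z powr (2 * (\<alpha> + 1)) + (\<alpha> + 1)\<^sup>2 * (norm t)\<^sup>2) powr (1 / (2 * (\<alpha> + 1))))"

definition gauge_ball :: "real \<Rightarrow> real \<Rightarrow> ('m::finite, 'k::finite) point set" where
  "gauge_ball \<alpha> r = {x. gauge_rho \<alpha> x < r}"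


text \<open>Intended for open \<open>S\<close> only, since the derivatives are taken at full neighbourhoods.\<close>

primrec C_k_on :: "nat \<Rightarrow> ('a::real_normed_vector \<Rightarrow> real) \<Rightarrow> 'a set \<Rightarrow> bool" where
  "C_k_on 0 f S \<longleftrightarrow> continuous_on S f"
| "C_k_on (Suc n) f S \<longleftrightarrow>
     (\<forall>x\<in>S. f differentiable (at x)) \<and> (\<forall>v. C_k_on n (\<lambda>x. frechet_derivative f (at x) v) S)"

definition smooth_on :: "('a::real_normed_vector \<Rightarrow> real) \<Rightarrow> 'a set \<Rightarrow> bool" where
  "smooth_on f S \<longleftrightarrow> (\<forall>n. C_k_on n f S)"

definition test_function :: "'a::real_normed_vector set \<Rightarrow> ('a \<Rightarrow> real) \<Rightarrow> bool" where
  "test_function \<Omega> \<phi> \<longleftrightarrow>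
     smooth_on \<phi> UNIV \<and> (\<exists>K. compact K \<and> K \<subseteq> \<Omega> \<and> (\<forall>x. x \<notin> K \<longrightarrow> \<phi> x = 0))"

definition locally_integrable_on :: "('a::euclidean_space \<Rightarrow> real) \<Rightarrow> 'a set \<Rightarrow> bool" where
  "locally_integrable_on f \<Omega> \<longleftrightarrow> (\<forall>K. compact K \<longrightarrow> K \<subseteq> \<Omega> \<longrightarrow> f absolutely_integrable_on K)"

definition in_Lp :: "'a::euclidean_space set \<Rightarrow> real \<Rightarrow> ('a \<Rightarrow> real) \<Rightarrow> bool" where
  "in_Lp \<Omega> p f \<longleftrightarrow> f \<in> borel_measurable (lebesgue_on \<Omega>) \<and>
     integrable (lebesgue_on \<Omega>) (\<lambda>x. \<bar>f x\<bar> powr p)"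

definition norm_Lp :: "'a::euclidean_space set \<Rightarrow> real \<Rightarrow> ('a \<Rightarrow> real) \<Rightarrow> real" where
  "norm_Lp \<Omega> p f = (integral\<^sup>L (lebesgue_on \<Omega>) (\<lambda>x. \<bar>f x\<bar> powr p)) powr (1 / p)"


fun X_classical :: "real \<Rightarrow> 'm::finite + 'k::finite \<Rightarrow> (('m, 'k) point \<Rightarrow> real) \<Rightarrow> ('m, 'k) point \<Rightarrow> real"
where
  "X_classical \<alpha> (Inl i) \<phi> (z, t) = frechet_derivative \<phi> (at (z, t)) (axis i 1, 0)"
| "X_classical \<alpha> (Inr j) \<phi> (z, t) = norm z powr \<alpha> * frechet_derivative \<phi> (at (z, t)) (0, axis j 1)"

text \<open>\<open>g\<close> is the weak derivative of \<open>f\<close> along the field \<open>i\<close>. The formal adjoint of each field is its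
  negative, because the weight \<open>|z|\<^sup>\<alpha>\<close> does not depend on \<open>t\<close>.\<close>

definition weak_X ::
  "real \<Rightarrow> ('m::finite, 'k::finite) point set \<Rightarrow> 'm + 'k \<Rightarrow>
   (('m, 'k) point \<Rightarrow> real) \<Rightarrow> (('m, 'k) point \<Rightarrow> real) \<Rightarrow> bool" where
  "weak_X \<alpha> \<Omega> i f g \<longleftrightarrow> locally_integrable_on f \<Omega> \<and> locally_integrable_on g \<Omega> \<and>
     (\<forall>\<phi>. test_function \<Omega> \<phi> \<longrightarrow>
        integral\<^sup>L (lebesgue_on \<Omega>) (\<lambda>x. f x * X_classical \<alpha> i \<phi> x)
        = - integral\<^sup>L (lebesgue_on \<Omega>) (\<lambda>x. g x * \<phi> x))"

text \<open>Iterated weak derivatives; the head of the list is the outermost field, applied last.\<close>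

primrec weak_Xs ::
  "real \<Rightarrow> ('m::finite, 'k::finite) point set \<Rightarrow> ('m + 'k) list \<Rightarrow>
   (('m, 'k) point \<Rightarrow> real) \<Rightarrow> (('m, 'k) point \<Rightarrow> real) \<Rightarrow> bool" where
  "weak_Xs \<alpha> \<Omega> [] f g \<longleftrightarrow> g = f"
| "weak_Xs \<alpha> \<Omega> (i # is) f g \<longleftrightarrow> (\<exists>h. weak_Xs \<alpha> \<Omega> is f h \<and> weak_X \<alpha> \<Omega> i h g)"

text \<open>The word \<open>X\<^sub>1 \<dots> X\<^sub>1 X\<^sub>2 \<dots> X\<^sub>2 \<dots> X\<^sub>N \<dots> X\<^sub>N\<close> of a multi-index, the fields in \<open>z\<close> preceding those in \<open>t\<close>.\<close>

definition field_list :: "('m::{finite,linorder} + 'k::{finite,linorder}) list" where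
  "field_list = map Inl (sorted_list_of_set UNIV) @ map Inr (sorted_list_of_set UNIV)"

definition multi_word ::
  "('m::{finite,linorder} + 'k::{finite,linorder} \<Rightarrow> nat) \<Rightarrow> ('m + 'k) list" where
  "multi_word \<beta> = concat (map (\<lambda>i. replicate (\<beta> i) i) field_list)"

definition multi_indices :: "nat \<Rightarrow> ('a::finite \<Rightarrow> nat) set" where
  "multi_indices l = {\<beta>. (\<Sum>i\<in>UNIV. \<beta> i) \<le> l}"

lemma finite_multi_indices: "finite (multi_indices l :: ('a::finite \<Rightarrow> nat) set)"
proof (rule finite_subset)
  show "multi_indices l \<subseteq> (PiE (UNIV :: 'a set) (\<lambda>_. {..l}))"
    unfolding multi_indices_def
    by (auto simp: PiE_iff intro: order_trans[OF member_le_sum[OF UNIV_I]])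
  show "finite (PiE (UNIV :: 'a set) (\<lambda>_. {..l}))"
    by (rule finite_PiE) auto
qed

definition has_X_beta ::
  "real \<Rightarrow> ('m::{finite,linorder}, 'k::{finite,linorder}) point set \<Rightarrow> ('m + 'k \<Rightarrow> nat) \<Rightarrow>
   (('m, 'k) point \<Rightarrow> real) \<Rightarrow> (('m, 'k) point \<Rightarrow> real) \<Rightarrow> bool" where
  "has_X_beta \<alpha> \<Omega> \<beta> f g \<longleftrightarrow> weak_Xs \<alpha> \<Omega> (multi_word \<beta>) f g"

text \<open>On open sets weak derivatives are unique almost everywhere, so the choice does not matter.\<close>

definition X_beta ::
  "real \<Rightarrow> ('m::{finite,linorder}, 'k::{finite,linorder}) point set \<Rightarrow> ('m + 'k \<Rightarrow> nat) \<Rightarrow>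
   (('m, 'k) point \<Rightarrow> real) \<Rightarrow> ('m, 'k) point \<Rightarrow> real" where
  "X_beta \<alpha> \<Omega> \<beta> f = (SOME g. has_X_beta \<alpha> \<Omega> \<beta> f g)"


definition W_space ::
  "real \<Rightarrow> nat \<Rightarrow> real \<Rightarrow> ('m::{finite,linorder}, 'k::{finite,linorder}) point set \<Rightarrow>
   (('m, 'k) point \<Rightarrow> real) set" where
  "W_space \<alpha> l p \<Omega> = {f. in_Lp \<Omega> p f \<and>
     (\<forall>\<beta>\<in>multi_indices l. \<exists>g. has_X_beta \<alpha> \<Omega> \<beta> f g \<and> in_Lp \<Omega> p g)}"

definition W_norm ::
  "real \<Rightarrow> nat \<Rightarrow> real \<Rightarrow> ('m::{finite,linorder}, 'k::{finite,linorder}) point set \<Rightarrow>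
   (('m, 'k) point \<Rightarrow> real) \<Rightarrow> real" where
  "W_norm \<alpha> l p \<Omega> f = norm_Lp \<Omega> p f + (\<Sum>\<beta>\<in>multi_indices l. norm_Lp \<Omega> p (X_beta \<alpha> \<Omega> \<beta> f))"

definition S_space ::
  "real \<Rightarrow> nat \<Rightarrow> real \<Rightarrow> ('m::{finite,linorder}, 'k::{finite,linorder}) point set \<Rightarrow>
   (('m, 'k) point \<Rightarrow> real) set" where
  "S_space \<alpha> l p \<Omega> = {f \<in> W_space \<alpha> l p \<Omega>. \<forall>\<epsilon>>0.
     \<exists>h \<in> W_space \<alpha> l p \<Omega>. smooth_on h \<Omega> \<and> W_norm \<alpha> l p \<Omega> (\<lambda>x. f x - h x) < \<epsilon>}"

definition baouendi ::
  "real \<Rightarrow> ('m::{finite,linorder}, 'k::{finite,linorder}) point set \<Rightarrow>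
   (('m, 'k) point \<Rightarrow> real) \<Rightarrow> ('m, 'k) point \<Rightarrow> real" where
  "baouendi \<alpha> \<Omega> u x = (\<Sum>i\<in>UNIV. X_beta \<alpha> \<Omega> (\<lambda>j. if j = i then 2 else 0) u x)"

definition vanishes_to_infinite_order :: "real \<Rightarrow> (('m::finite, 'k::finite) point \<Rightarrow> real) \<Rightarrow> bool" where
  "vanishes_to_infinite_order \<alpha> u \<longleftrightarrow> (\<forall>l::real. l > 0 \<longrightarrow>
     (\<lambda>r. integral\<^sup>L (lebesgue_on (gauge_ball \<alpha> r)) (\<lambda>x. \<bar>u x\<bar>\<^sup>2)) \<in> O[at_right 0](\<lambda>r. r powr l))"

end

theory Submission
  imports Defs
begin

text \<open>The proof is a Carleman estimate obtained from multipliers. Put \<open>s = ln \<rho>\<close>, let \<open>D\<close> be the generator of the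
  anisotropic dilations, \<open>W = |X s|\<^sup>2 = |z|\<^bsup>2\<alpha>\<^esup> / \<rho>\<^bsup>2(\<alpha>+1)\<^esup>\<close> and \<open>\<kappa> = (Q - 2) / 2\<close> with \<open>Q\<close> the homogeneous dimension.
  Testing the operator against \<open>a(s) D u\<close> (Rellich) and \<open>b(s) u\<close> (energy), and integrating \<open>D (c(s) W u\<^sup>2)\<close>, gives three
  exact identities for radial weights supported in a shell. They hold for \<open>C\<^sup>2\<close> functions and pass to the limit in the
  Sobolev space; the term \<open>D u\<close> is controlled by the Hardy inequality in \<open>z\<close>, which needs \<open>m \<ge> 3\<close>. With \<open>a = E \<omega>\<close>,
  \<open>E = exp (- 2 \<phi>(s))\<close>, \<open>\<phi>' = t (2 - \<eta>)\<close>, \<open>\<eta> = (\<rho> / R)\<^bsup>2\<delta>\<^esup>\<close> and \<open>b = \<kappa> a + a' / 2\<close> the energy densities \<open>|X u|\<^sup>2\<close> cancel,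
  and the concavity of \<open>\<phi>\<close> yields \<open>t\<^sup>2 \<integral> E \<omega> \<eta> W u\<^sup>2\<close> at the price of \<open>t\<^sup>-\<^sup>1 \<integral> E \<omega> |V|\<^sup>2 u\<^sup>2 / W\<close>. Since
  \<open>|V|\<^sup>2 / W \<le> const \<cdot> \<eta> / |z|\<^sup>2\<close> (this uses \<open>\<alpha> \<le> 1\<close>), the Hardy inequality and the energy identity absorb this term
  for large \<open>t\<close>, and only errors from the two transition zones of the cutoff \<open>\<omega>\<close> remain. The inner one vanishes in the limit
  because \<open>u\<close> vanishes to infinite order; in the outer one \<open>E\<close> is exponentially smaller than further inside, so \<open>t \<rightarrow> \<infinity>\<close>
  forces \<open>u = 0\<close>.\<close>

section \<open>Integration by parts\<close>

text \<open>The axis z = 0 shapes the proof: W vanishes there, while V is only bounded by a radial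
  function. Hence |V|^2 u^2 / W cannot be absorbed pointwise into the gain, and a circle of three
  inequalities takes its place. With one common weight let H, U, G be the integrals of u^2 / |z|^2,
  W u^2 and |X u|^2. Up to constants and cutoff errors, t^2 U is at most H / t, G at most H / t^2 +
  t^2 U, and H at most G + t^2 U, so H returns with a factor 1 / t. The exponent in \<eta> is that
  of the bound for |V|^2 times the fourth power of the gauge, so the concavity has the strength that
  the potential demands, while \<eta> \<le> 1 keeps the slope between t and 2 t. The axis is also
  why second derivatives enter: D u contains the t-derivatives |z|^(-\<alpha>) X u, which
  square-integrability of X u does not control. The Hardy inequality is applied to the t-components
  of X, whose z-derivatives are mixed second derivatives; \<alpha> \<le> 1 makes |z|^(-\<alpha>) no
  worse than the Hardy weight.\<close>

definition dderiv :: "'a::real_normed_vector \<Rightarrow> ('a \<Rightarrow> real) \<Rightarrow> real \<Rightarrow> 'a \<Rightarrow> bool" where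
  "dderiv e F D x \<longleftrightarrow> ((\<lambda>s. F (x + s *\<^sub>R e)) has_real_derivative D) (at 0)"

lemma dderiv_const [intro]: "dderiv e (\<lambda>_. c) 0 x"
  by (simp add: dderiv_def)

lemma dderiv_add: "dderiv e F a x \<Longrightarrow> dderiv e G b x \<Longrightarrow> dderiv e (\<lambda>y. F y + G y) (a + b) x"
  unfolding dderiv_def by (rule DERIV_add)

lemma dderiv_mult:
  "dderiv e F a x \<Longrightarrow> dderiv e G b x \<Longrightarrow> dderiv e (\<lambda>y. F y * G y) (a * G x + b * F x) x"
  unfolding dderiv_def using DERIV_mult[of "\<lambda>s. F (x + s *\<^sub>R e)" a 0 UNIV "\<lambda>s. G (x + s *\<^sub>R e)" b] by simp

lemma dderiv_sum:
  "(\<And>i. i \<in> I \<Longrightarrow> dderiv e (F i) (a i) x) \<Longrightarrow> dderiv e (\<lambda>y. \<Sum>i\<in>I. F i y) (\<Sum>i\<in>I. a i) x"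
  unfolding dderiv_def by (rule DERIV_sum)

lemma dderiv_chain:
  assumes "(g has_real_derivative g') (at (F x))" "dderiv e F a x"
  shows "dderiv e (\<lambda>y. g (F y)) (g' * a) x"
  using DERIV_chain2[of g g' "\<lambda>s. F (x + s *\<^sub>R e)" 0 a] assms by (simp add: dderiv_def)

lemma dderiv_has_derivative:
  assumes "(F has_derivative F') (at x)"
  shows "dderiv e F (F' e) x"
proof -
  have "((\<lambda>s. F (x + s *\<^sub>R e)) has_derivative (\<lambda>s. F' (s *\<^sub>R e))) (at 0)"
    by (rule has_derivative_compose[where g = F, where f = "\<lambda>s. x + s *\<^sub>R e", simplified])
       (use assms in \<open>auto intro!: derivative_eq_intros\<close>)
  moreover have "(\<lambda>s. F' (s *\<^sub>R e)) = (*) (F' e)"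
    using linear_cmul[OF has_derivative_linear[OF assms]] by auto
  ultimately show ?thesis
    by (simp add: dderiv_def has_field_derivative_def)
qed

lemma dderiv_frechet:
  "F differentiable (at x) \<Longrightarrow> dderiv e F (frechet_derivative F (at x) e) x"
  by (rule dderiv_has_derivative) (simp add: frechet_derivative_works)

lemma dderiv_linear: "bounded_linear L \<Longrightarrow> dderiv e L (L e) x"
  by (rule dderiv_has_derivative) (rule bounded_linear_imp_has_derivative)

lemma dderiv_unique: "dderiv e F a x \<Longrightarrow> dderiv e F b x \<Longrightarrow> a = b"
  unfolding dderiv_def by (rule DERIV_unique)

lemma eventually_line_in_open:
  fixes x :: "'a::real_normed_vector"
  assumes "open S" "x \<in> S"
  shows "\<forall>\<^sub>F s in nhds (0::real). x + s *\<^sub>R e \<in> S"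
proof -
  have "continuous_on UNIV (\<lambda>s::real. x + s *\<^sub>R e)" by (intro continuous_intros)
  then have "isCont (\<lambda>s. x + s *\<^sub>R e) (0::real)" by (simp add: continuous_on_eq_continuous_at)
  then have "((\<lambda>s. x + s *\<^sub>R e) \<longlongrightarrow> x + 0 *\<^sub>R e) (nhds 0)"
    using tendsto_at_iff_tendsto_nhds[of "\<lambda>s. x + s *\<^sub>R e" 0] by (simp only: isCont_def)
  then show ?thesis
    using topological_tendstoD[of "\<lambda>s. x + s *\<^sub>R e" x "nhds 0" S] assms by simp
qed

lemma dderiv_transform:
  assumes "open S" "x \<in> S" "\<And>y. y \<in> S \<Longrightarrow> F y = G y" "dderiv e F a x"
  shows "dderiv e G a x"
proof -
  have "\<forall>\<^sub>F s in nhds (0::real). F (x + s *\<^sub>R e) = G (x + s *\<^sub>R e)"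
    using eventually_line_in_open[OF assms(1,2)] by eventually_elim (use assms(3) in auto)
  from DERIV_cong_ev[OF refl this refl] show ?thesis
    using assms(4) unfolding dderiv_def by blast
qed

lemma dderiv_zero_off:
  assumes "open S" "closed K" "x \<in> S" "x \<notin> K" "\<And>y. y \<in> S - K \<Longrightarrow> F y = 0" "dderiv e F a x"
  shows "a = 0"
proof -
  have "dderiv e (\<lambda>_. 0) a x"
    by (rule dderiv_transform[of "S - K" x F]) (use assms in auto)
  from dderiv_unique[OF this dderiv_const] show ?thesis .
qed

lemma continuous_zero_extension:
  fixes f :: "'a::euclidean_space \<Rightarrow> real"
  assumes "open S" "compact K" "K \<subseteq> S" "continuous_on S f" "\<And>x. x \<in> S - K \<Longrightarrow> f x = 0"
  shows "continuous_on UNIV (\<lambda>x. if x \<in> K then f x else 0)"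
proof -
  have "continuous_on S (\<lambda>x. if x \<in> K then f x else 0)"
    by (rule continuous_on_eq[OF assms(4)]) (use assms(5) in auto)
  moreover have "continuous_on (- K) (\<lambda>x. if x \<in> K then f x else 0)"
    by (rule continuous_on_eq[OF continuous_on_const[of _ 0]]) auto
  ultimately have "continuous_on (S \<union> - K) (\<lambda>x. if x \<in> K then f x else 0)"
    using assms by (intro continuous_on_open_Un) (auto simp: compact_imp_closed)
  then show ?thesis by (rule continuous_on_subset) (use assms(3) in auto)
qed

lemma compact_support_bounded:
  fixes f :: "'a::euclidean_space \<Rightarrow> real"
  assumes "compact K" "K \<subseteq> S" "continuous_on S f" "\<And>x. x \<in> S - K \<Longrightarrow> f x = 0"
  obtains B where "B \<ge> 0" "\<And>x. x \<in> S \<Longrightarrow> \<bar>f x\<bar> \<le> B"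
proof -
  have "compact (f ` K)"
    using assms by (intro compact_continuous_image) (auto intro: continuous_on_subset)
  then obtain B where B: "\<And>x. x \<in> K \<Longrightarrow> \<bar>f x\<bar> \<le> B"
    by (metis bounded_real compact_imp_bounded imageI)
  have "\<bar>f x\<bar> \<le> \<bar>B\<bar>" if "x \<in> S" for x
    using B[of x] assms(4)[of x] that by (cases "x \<in> K") auto
  then show ?thesis using that[of "\<bar>B\<bar>"] by auto
qed

lemma integrable_lborel_compact_support:
  fixes f :: "'a::euclidean_space \<Rightarrow> real"
  assumes "continuous_on UNIV f" "compact K" "\<And>x. x \<notin> K \<Longrightarrow> f x = 0"
  shows "integrable lborel f"
proof -
  obtain B where B: "\<And>x. \<bar>f x\<bar> \<le> B"
    by (rule compact_support_bounded[of K UNIV f]) (use assms in auto)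
  have "integrable lborel (\<lambda>x. indicator K x *\<^sub>R f x)"
  proof (rule integrableI_bounded_set_indicator[where B = B])
    show "emeasure lborel K < \<infinity>"
      using assms(2) by (rule emeasure_compact_finite)
    show "f \<in> borel_measurable lborel"
      using assms(1) by (simp add: borel_measurable_continuous_onI)
      show "K \<in> sets lborel" using assms(2) by (simp add: borel_compact)
  qed (use B in auto)
  moreover have "(\<lambda>x. indicator K x *\<^sub>R f x) = f"
    using assms(3) by (auto simp: indicator_def fun_eq_iff)
  ultimately show ?thesis by simp
qed

lemma lebesgue_on_zero_extension:
  fixes f :: "'a::euclidean_space \<Rightarrow> real"
  assumes "open S" "compact K" "K \<subseteq> S" "continuous_on S f" "\<And>x. x \<in> S - K \<Longrightarrow> f x = 0"
  shows "integrable (lebesgue_on S) f"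
    and "integral\<^sup>L (lebesgue_on S) f = integral\<^sup>L lborel (\<lambda>x. if x \<in> K then f x else 0)"
proof -
  let ?g = "\<lambda>x. if x \<in> K then f x else 0"
  note c = continuous_zero_extension[OF assms]
  have i: "integrable lborel ?g"
    by (rule integrable_lborel_compact_support[OF c assms(2)]) auto
  have eq: "(\<lambda>x. indicator S x *\<^sub>R f x) = ?g"
    using assms(3,5) by (auto simp: indicator_def fun_eq_iff)
  have S: "S \<inter> space lebesgue \<in> sets lebesgue" using assms(1) by auto
  show "integrable (lebesgue_on S) f"
    unfolding integrable_restrict_space[OF S] eq by (rule integrable_completion[THEN iffD2]) (use i in auto)
  show "integral\<^sup>L (lebesgue_on S) f = integral\<^sup>L lborel ?g"
    unfolding integral_restrict_space[OF S] eq by (rule integral_completion) (use i in auto)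
qed

lemma integral_translation_lborel:
  fixes F :: "'a::euclidean_space \<Rightarrow> real"
  assumes "F \<in> borel_measurable borel"
  shows "integral\<^sup>L lborel (\<lambda>x. F (x + v)) = integral\<^sup>L lborel F"
proof -
  have "integral\<^sup>L lborel F = integral\<^sup>L (distr lborel borel ((+) v)) F"
    by (simp add: lborel_distr_plus)
  also have "\<dots> = integral\<^sup>L lborel (\<lambda>x. F (v + x))"
    by (rule integral_distr) (use assms in auto)
  finally show ?thesis by (simp add: add.commute)
qed

lemma integrable_translation_lborel:
  fixes F :: "'a::euclidean_space \<Rightarrow> real"
  assumes "integrable lborel F"
  shows "integrable lborel (\<lambda>x. F (x + v))"
proof -
  have "integrable (distr lborel borel ((+) v)) F" using assms by (simp add: lborel_distr_plus)
  then have "integrable lborel (\<lambda>x. F (v + x))"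
    by (subst (asm) integrable_distr_eq) (use assms in auto)
  then show ?thesis by (simp add: add.commute)
qed

text \<open>Difference quotients along \<open>e\<close> have integral zero by translation
  invariance, and the mean value theorem bounds them by \<open>B\<close> on a fixed ball, so
  dominated convergence applies. Working with the derivative along a single line admits weights such
  as |z|^(2 \<alpha>), which need not be differentiable at z = 0 in every direction.\<close>

lemma integral_dderiv_UNIV:
  fixes F F' :: "'a::euclidean_space \<Rightarrow> real"
  assumes cF: "continuous_on UNIV F" and cF': "continuous_on UNIV F'"
    and K: "compact K" "\<And>x. x \<notin> K \<Longrightarrow> F x = 0"
    and K': "\<And>x. x \<notin> K \<Longrightarrow> F' x = 0"
    and D: "\<And>x. dderiv e F (F' x) x"
  shows "integral\<^sup>L lborel F' = 0"
proof -
  obtain B where B: "B \<ge> 0" "\<And>x. \<bar>F' x\<bar> \<le> B"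
    using compact_support_bounded[of K UNIV F'] K(1) K' cF' by auto
  obtain M where M: "\<And>x. x \<in> K \<Longrightarrow> norm x \<le> M"
    using compact_imp_bounded[OF K(1)] by (auto simp: bounded_iff)
  \<comment> \<open>The ball contains \<open>K\<close> and its translates by vectors of length at
    most \<open>norm e\<close>, hence the supports of all quotients \<open>q n\<close>.\<close>
  define L where "L = cball (0::'a) (M + norm e)"
  have iF: "integrable lborel F" by (rule integrable_lborel_compact_support[OF cF K]) auto
  define q where "q = (\<lambda>n x. real (Suc n) * (F (x + inverse (real (Suc n)) *\<^sub>R e) - F x))"
  have D': "((\<lambda>s. F (x + s *\<^sub>R e)) has_real_derivative F' (x + s *\<^sub>R e)) (at s)" for x s
  proof -
    have "((\<lambda>u. F ((x + s *\<^sub>R e) + u *\<^sub>R e)) has_real_derivative F' (x + s *\<^sub>R e)) (at 0)"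
      using D[of "x + s *\<^sub>R e"] by (simp add: dderiv_def)
    then have "((\<lambda>u. F (x + (s + u) *\<^sub>R e)) has_real_derivative F' (x + s *\<^sub>R e)) (at 0)"
      by (simp add: algebra_simps)
    then show ?thesis
      using DERIV_shift[of "\<lambda>s. F (x + s *\<^sub>R e)" "F' (x + s *\<^sub>R e)" 0 s] by (simp add: add.commute)
  qed
  have bnd: "\<bar>q n x\<bar> \<le> B * indicator L x" for n x
  proof (cases "x \<in> L")
    case True
    let ?h = "inverse (real (Suc n))"
    have "0 < ?h" by simp
    from MVT2[OF this, of "\<lambda>s. F (x + s *\<^sub>R e)" "\<lambda>s. F' (x + s *\<^sub>R e)"] D'
    obtain z where "F (x + ?h *\<^sub>R e) - F x = ?h * F' (x + z *\<^sub>R e)" by auto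
    then have "q n x = F' (x + z *\<^sub>R e)" by (simp add: q_def field_simps)
    then show ?thesis using True B by simp
  next
    case False
    have h: "norm (inverse (real (Suc n)) *\<^sub>R e) \<le> norm e"
      by (simp add: divide_simps mult_le_cancel_right1 field_simps)
    have "norm x > M + norm e" using False by (simp add: L_def)
    moreover have "norm x \<le> norm (x + inverse (real (Suc n)) *\<^sub>R e) + norm (inverse (real (Suc n)) *\<^sub>R e)"
      by (metis add_diff_cancel norm_triangle_ineq4)
    ultimately have "norm (x + inverse (real (Suc n)) *\<^sub>R e) > M" "norm x > M"
      using h norm_ge_zero[of e] by linarith+
    then have "F (x + inverse (real (Suc n)) *\<^sub>R e) = 0" "F x = 0"
      using K M by (meson not_le)+
    then show ?thesis using False by (simp add: q_def)
  qed
  have lim: "(\<lambda>n. q n x) \<longlonglongrightarrow> F' x" for x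
  proof -
    have "((\<lambda>s. (F (x + s *\<^sub>R e) - F x) / s) \<longlongrightarrow> F' x) (at 0)"
      using D[of x] by (simp add: dderiv_def has_field_derivative_iff)
    moreover have "filterlim (\<lambda>n. inverse (real (Suc n))) (at 0) sequentially"
      by (intro filterlim_atI LIMSEQ_inverse_real_of_nat always_eventually) auto
    ultimately have "(\<lambda>n. (F (x + inverse (real (Suc n)) *\<^sub>R e) - F x) / inverse (real (Suc n))) \<longlonglongrightarrow> F' x"
      by (rule filterlim_compose)
    then show ?thesis by (simp add: q_def divide_inverse mult.commute)
  qed
  have mq: "q n \<in> borel_measurable lborel" for n
  proof -
    have "continuous_on UNIV (\<lambda>x. F (x + inverse (real (Suc n)) *\<^sub>R e))"
      by (rule continuous_on_compose2[OF cF]) (intro continuous_intros, simp)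
    then have "continuous_on UNIV (q n)"
      unfolding q_def using cF by (intro continuous_on_mult continuous_on_diff continuous_on_const)
    then show ?thesis
      by (simp add: borel_measurable_continuous_onI)
  qed
  have "(\<lambda>n. integral\<^sup>L lborel (q n)) \<longlonglongrightarrow> integral\<^sup>L lborel F'"
  proof (rule integral_dominated_convergence[where w = "\<lambda>x. B * indicator L x"])
    show "integrable lborel (\<lambda>x. B * indicator L x)"
      unfolding L_def by (intro integrable_mult_right integrable_real_indicator)
        (use emeasure_lborel_cball_finite[of 0 "M + norm e"] in \<open>auto simp: top.not_eq_extremum\<close>)
    show "F' \<in> borel_measurable lborel"
      using cF' by (simp add: borel_measurable_continuous_onI)
  qed (use mq lim bnd in auto)
  moreover have "integral\<^sup>L lborel (q n) = 0" for n
    unfolding q_def using iF integrable_translation_lborel[OF iF] integral_translation_lborel[of F]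
      borel_measurable_continuous_onI[OF cF]
    by (simp add: Bochner_Integration.integral_diff)
  ultimately show ?thesis
    by (simp add: LIMSEQ_const_iff)
qed

text \<open>Extension by zero reduces this to the whole space; \<open>F'\<close> vanishes on
  \<open>S - K\<close> because \<open>F\<close> is zero in a neighbourhood of each of its
  points.\<close>

lemma integral_dderiv:
  fixes F F' :: "'a::euclidean_space \<Rightarrow> real"
  assumes "open S" "compact K" "K \<subseteq> S" "continuous_on S F" "continuous_on S F'"
    and "\<And>x. x \<in> S - K \<Longrightarrow> F x = 0" and "\<And>x. x \<in> S \<Longrightarrow> dderiv e F (F' x) x"
  shows "integral\<^sup>L (lebesgue_on S) F' = 0" and "integrable (lebesgue_on S) F'"
proof -
  have F'0: "F' x = 0" if "x \<in> S - K" for x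
    by (rule dderiv_zero_off[of S K x F e]) (use assms that compact_imp_closed in auto)
  let ?F = "\<lambda>x. if x \<in> K then F x else 0" and ?F' = "\<lambda>x. if x \<in> K then F' x else 0"
  have "dderiv e ?F (?F' x) x" for x
  proof (cases "x \<in> S")
    case True
    have "dderiv e ?F (F' x) x"
      by (rule dderiv_transform[of S x F]) (use assms True in auto)
    moreover have "?F' x = F' x" using F'0 True by auto
    ultimately show ?thesis by simp
  next
    case False
    then have "x \<in> - K" using assms(3) by auto
    have "dderiv e ?F 0 x"
      by (rule dderiv_transform[of "- K" x "\<lambda>_. 0"]) (use assms(2) \<open>x \<in> - K\<close> compact_imp_closed in auto)
    with \<open>x \<in> - K\<close> show ?thesis by simp
  qed
  then have "integral\<^sup>L lborel ?F' = 0"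
    by (intro integral_dderiv_UNIV[OF continuous_zero_extension[OF assms(1-4,6)]
          continuous_zero_extension[OF assms(1-3,5) F'0] assms(2), of e]) auto
  then show "integral\<^sup>L (lebesgue_on S) F' = 0"
    using lebesgue_on_zero_extension(2)[OF assms(1-3,5) F'0] by simp
  show "integrable (lebesgue_on S) F'"
    by (rule lebesgue_on_zero_extension(1)[OF assms(1-3,5) F'0])
qed

section \<open>Test functions and second derivatives\<close>

lemma frechet_derivative_cong_open:
  assumes "open S" "x \<in> S" "\<And>y. y \<in> S \<Longrightarrow> f y = g y"
  shows "frechet_derivative f (at x) = frechet_derivative g (at x)"
    and "f differentiable (at x) \<longleftrightarrow> g differentiable (at x)"
proof -
  have "(f has_derivative D) (at x) \<longleftrightarrow> (g has_derivative D) (at x)" for D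
    using assms has_derivative_transform_within_open[of f D x UNIV S g]
      has_derivative_transform_within_open[of g D x UNIV S f] by (metis)
  then show "frechet_derivative f (at x) = frechet_derivative g (at x)"
    and "f differentiable (at x) \<longleftrightarrow> g differentiable (at x)"
    by (auto simp: frechet_derivative_def differentiable_def)
qed

lemma C_k_on_cong:
  assumes "open S" "\<And>x. x \<in> S \<Longrightarrow> f x = g x"
  shows "C_k_on n f S \<longleftrightarrow> C_k_on n g S"
  using assms(2)
proof (induction n arbitrary: f g)
  case 0
  then show ?case by (simp cong: continuous_on_cong)
next
  case (Suc n)
  have "C_k_on n (\<lambda>x. frechet_derivative f (at x) v) S \<longleftrightarrow> C_k_on n (\<lambda>x. frechet_derivative g (at x) v) S" for v
    by (rule Suc.IH) (use frechet_derivative_cong_open(1)[OF assms(1) _ Suc.prems] in auto)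
  then show ?case using frechet_derivative_cong_open(2)[OF assms(1) _ Suc.prems] by auto
qed

lemma C_k_on_imp_continuous: "open S \<Longrightarrow> C_k_on n f S \<Longrightarrow> continuous_on S f"
  by (cases n) (auto simp: continuous_on_eq_continuous_at intro: differentiable_imp_continuous_within)

lemma C_k_on_Suc_imp: "open S \<Longrightarrow> C_k_on (Suc n) f S \<Longrightarrow> C_k_on n f S"
proof (induction n arbitrary: f)
  case 0
  then show ?case using C_k_on_imp_continuous by fastforce
next
  case (Suc n)
  have "C_k_on n (\<lambda>x. frechet_derivative f (at x) v) S" for v
    by (rule Suc.IH[OF Suc.prems(1)]) (use Suc.prems(2) in simp)
  then show ?case using Suc.prems(2) by simp
qed

lemma C_k_on_const: "C_k_on n (\<lambda>_. c) S"
  by (induction n arbitrary: c) auto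

lemma C_k_on_add:
  assumes "open S" "C_k_on n f S" "C_k_on n g S"
  shows "C_k_on n (\<lambda>x. f x + g x) S"
  using assms(2,3)
proof (induction n arbitrary: f g)
  case (Suc n)
  have d: "((\<lambda>x. f x + g x) has_derivative
      (\<lambda>v. frechet_derivative f (at x) v + frechet_derivative g (at x) v)) (at x)" if "x \<in> S" for x
    using Suc.prems that by (auto intro!: derivative_eq_intros simp: frechet_derivative_works)
  have "C_k_on n (\<lambda>x. frechet_derivative f (at x) v + frechet_derivative g (at x) v) S" for v
    using Suc by auto
  moreover have "frechet_derivative (\<lambda>x. f x + g x) (at x) v =
      frechet_derivative f (at x) v + frechet_derivative g (at x) v" if "x \<in> S" for x v
    using frechet_derivative_at[OF d[OF that]] by metis
  ultimately have "C_k_on n (\<lambda>x. frechet_derivative (\<lambda>x. f x + g x) (at x) v) S" for v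
    using C_k_on_cong[OF assms(1)] by (metis (mono_tags, lifting))
  with d show ?case by (auto simp: differentiable_def)
qed (auto intro: continuous_intros)

lemma C_k_on_mult:
  assumes "open S" "C_k_on n f S" "C_k_on n g S"
  shows "C_k_on n (\<lambda>x. f x * g x) S"
  using assms(2,3)
proof (induction n arbitrary: f g)
  case (Suc n)
  have d: "((\<lambda>x. f x * g x) has_derivative
      (\<lambda>v. f x * frechet_derivative g (at x) v + frechet_derivative f (at x) v * g x)) (at x)" if "x \<in> S" for x
    using Suc.prems that by (auto intro!: has_derivative_mult simp: frechet_derivative_works)
  have "C_k_on n (\<lambda>x. f x * frechet_derivative g (at x) v + frechet_derivative f (at x) v * g x) S" for v
    using Suc.prems C_k_on_Suc_imp[OF assms(1)] by (intro C_k_on_add Suc.IH assms(1)) auto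
  moreover have "frechet_derivative (\<lambda>x. f x * g x) (at x) v =
      f x * frechet_derivative g (at x) v + frechet_derivative f (at x) v * g x" if "x \<in> S" for x v
    using frechet_derivative_at[OF d[OF that]] by metis
  ultimately have "C_k_on n (\<lambda>x. frechet_derivative (\<lambda>x. f x * g x) (at x) v) S" for v
    using C_k_on_cong[OF assms(1)] by (metis (mono_tags, lifting))
  with d show ?case by (auto simp: differentiable_def)
qed (auto intro: continuous_intros)

lemma C_k_on_prod:
  assumes "open S" "finite I" "\<And>i. i \<in> I \<Longrightarrow> C_k_on n (f i) S"
  shows "C_k_on n (\<lambda>x. \<Prod>i\<in>I. f i x) S"
  using assms(2,3) by (induction I) (auto intro: C_k_on_const C_k_on_mult assms(1))

section \<open>Smooth bump functions\<close>

lemma C_k_on_compose_affine: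
  fixes g :: "real \<Rightarrow> real" and L :: "'a::real_normed_vector \<Rightarrow> real"
  assumes L: "\<And>x. (L has_derivative L') (at x)" and g: "C_k_on n g UNIV"
  shows "C_k_on n (\<lambda>x. g (L x)) UNIV"
  using g
proof (induction n arbitrary: g)
  case 0
  have "continuous_on UNIV L"
    using L by (meson continuous_on_eq_continuous_at has_derivative_continuous open_UNIV)
  with 0 show ?case by (auto intro: continuous_on_compose2)
next
  case (Suc n)
  have d: "((\<lambda>x. g (L x)) has_derivative (\<lambda>v. frechet_derivative g (at (L x)) (L' v))) (at x)" for x
    by (rule has_derivative_compose[OF L]) (use Suc.prems in \<open>simp add: frechet_derivative_works[symmetric]\<close>)
  have "frechet_derivative (\<lambda>x. g (L x)) (at x) v = frechet_derivative g (at (L x)) (L' v)" for x v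
    using frechet_derivative_at[OF d] by metis
  moreover have "C_k_on n (\<lambda>x. frechet_derivative g (at (L x)) (L' v)) UNIV" for v
    by (rule Suc.IH) (use Suc.prems in simp)
  moreover have "(\<lambda>x. g (L x)) differentiable (at x)" for x
    using d unfolding differentiable_def by blast
  ultimately show ?case by simp
qed

text \<open>Up to linear combinations this family is closed under differentiation, which turns the
  smoothness of the classical function exp (-1/x) into an induction.\<close>

definition expinv :: "nat \<Rightarrow> real \<Rightarrow> real" where
  "expinv k x = (if x \<le> 0 then 0 else exp (- 1 / x) / x ^ k)"

text \<open>The single term of order k + 2 in the series of exp (1/x) bounds it from below.
  Quadratic smallness at 0 then makes the derivative there vanish.\<close>

lemma expinv_le: "\<bar>expinv k x\<bar> \<le> fact (k + 2) * x\<^sup>2"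
proof (cases "x \<le> 0")
  case False
  then have x: "x > 0" by simp
  have "(1 / x) ^ (k + 2) / fact (k + 2) \<le> (\<Sum>n. (1 / x) ^ n / fact n)"
    using sum_le_suminf[of "\<lambda>n. (1 / x) ^ n / fact n" "{k + 2}"] x summable_exp_generic[of "1 / x"]
    by (simp add: divide_inverse mult.commute)
  also have "\<dots> = exp (1 / x)" by (simp add: exp_def divide_inverse mult.commute)
  finally have "(1 / x) ^ (k + 2) / fact (k + 2) \<le> exp (1 / x)" .
  then have "exp (- 1 / x) \<le> fact (k + 2) * x ^ (k + 2)"
    using x by (simp add: exp_minus field_simps del: fact_Suc)
  then have "exp (- 1 / x) / x ^ k \<le> fact (k + 2) * x\<^sup>2"
    using x by (simp add: divide_le_eq power_add power2_eq_square mult_ac del: fact_Suc)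
  then show ?thesis using x by (simp add: expinv_def del: fact_Suc)
qed (simp add: expinv_def)

lemma DERIV_expinv:
  "(expinv k has_real_derivative (expinv (k + 2) x - real k * expinv (k + 1) x)) (at x)"
proof -
  consider "x < 0" | "x = 0" | "x > 0" by linarith
  then show ?thesis
  proof cases
    case 1
    have "((\<lambda>_. 0::real) has_real_derivative 0) (at x)" by simp
    then have "(expinv k has_real_derivative 0) (at x)"
      by (rule has_field_derivative_transform_within_open[where S = "{..<0}"]) (use 1 in \<open>auto simp: expinv_def\<close>)
    with 1 show ?thesis by (simp add: expinv_def)
  next
    case 2
    have "((\<lambda>h. (expinv k (0 + h) - expinv k 0) / h) \<longlongrightarrow> 0) (at 0)"
    proof (rule Lim_null_comparison)
      show "((\<lambda>h. fact (k + 2) * \<bar>h\<bar>) \<longlongrightarrow> 0) (at (0::real))"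
        by (auto intro!: tendsto_eq_intros)
      show "\<forall>\<^sub>F h in at 0. norm ((expinv k (0 + h) - expinv k 0) / h) \<le> fact (k + 2) * \<bar>h\<bar>"
      proof (rule always_eventually, rule allI)
        fix h :: real
        show "norm ((expinv k (0 + h) - expinv k 0) / h) \<le> fact (k + 2) * \<bar>h\<bar>"
          using expinv_le[of k h] by (cases "h = 0")
            (auto simp: expinv_def[of k 0] divide_le_eq power2_eq_square abs_mult mult_ac abs_mult_self_eq simp del: fact_Suc)
      qed
    qed
    then have "(expinv k has_real_derivative 0) (at 0)" unfolding DERIV_def .
    then show ?thesis using 2 by (simp add: expinv_def)
  next
    case 3
    have "((\<lambda>x. exp (- 1 / x) / x ^ k) has_real_derivative
        (exp (- 1 / x) * (1 / x\<^sup>2) * x ^ k - exp (- 1 / x) * (real k * x ^ (k - 1))) / (x ^ k * x ^ k)) (at x)"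
      using 3 by (auto intro!: derivative_eq_intros simp: power2_eq_square field_simps)
    moreover have "(exp (- 1 / x) * (1 / x\<^sup>2) * x ^ k - exp (- 1 / x) * (real k * x ^ (k - 1))) / (x ^ k * x ^ k)
        = expinv (k + 2) x - real k * expinv (k + 1) x"
      using 3 by (cases k) (auto simp: expinv_def field_simps power2_eq_square)
    ultimately have "((\<lambda>x. exp (- 1 / x) / x ^ k) has_real_derivative
        expinv (k + 2) x - real k * expinv (k + 1) x) (at x)" by simp
    then show ?thesis
      by (rule has_field_derivative_transform_within_open[where S = "{0<..}"]) (use 3 in \<open>auto simp: expinv_def\<close>)
  qed
qed

lemma C_k_on_expinv: "C_k_on n (expinv k) UNIV"
proof (induction n arbitrary: k)
  case 0
  show ?case using DERIV_expinv by (auto intro!: DERIV_continuous_on)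
next
  case (Suc n)
  have d: "(expinv k has_derivative (\<lambda>v. (expinv (k + 2) x - real k * expinv (k + 1) x) * v)) (at x)" for x
    using DERIV_expinv[of k x] by (simp add: has_field_derivative_def)
  have "frechet_derivative (expinv k) (at x) v = (expinv (k + 2) x + (- real k) * expinv (k + 1) x) * v" for x v
    using frechet_derivative_at[OF d, of x] by (metis diff_conv_add_uminus mult_minus_left)
  moreover have "C_k_on n (\<lambda>x. (expinv (k + 2) x + (- real k) * expinv (k + 1) x) * v) UNIV" for v
    by (intro C_k_on_mult C_k_on_add C_k_on_const Suc.IH open_UNIV)
  moreover have "expinv k differentiable (at x)" for x
    using d unfolding differentiable_def by blast
  ultimately show ?case by simp
qed

text \<open>With values in [0, 1] and support in the closed box, these functions tend to the
  indicator of the open box as \<open>n\<close> grows; they carry test-function identities over to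
  boxes.\<close>

definition box_bump :: "nat \<Rightarrow> 'a::euclidean_space \<Rightarrow> 'a \<Rightarrow> 'a \<Rightarrow> real" where
  "box_bump n a b x = (\<Prod>i\<in>Basis. expinv 0 (real n * ((x - a) \<bullet> i)) * expinv 0 (real n * ((b - x) \<bullet> i)))"

lemma smooth_box_bump: "smooth_on (box_bump n a b) UNIV"
  unfolding smooth_on_def box_bump_def
proof (intro allI C_k_on_prod C_k_on_mult C_k_on_compose_affine[OF _ C_k_on_expinv] open_UNIV finite_Basis)
  fix k :: nat and i x :: 'a
  show "((\<lambda>x. real n * ((x - a) \<bullet> i)) has_derivative (\<lambda>v. real n * (v \<bullet> i))) (at x)"
    by (auto intro!: derivative_eq_intros)
  show "((\<lambda>x. real n * ((b - x) \<bullet> i)) has_derivative (\<lambda>v. real n * (- v \<bullet> i))) (at x)"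
    by (auto intro!: derivative_eq_intros)
qed

lemma box_bump_bounds: "0 \<le> box_bump n a b x" "box_bump n a b x \<le> 1"
  unfolding box_bump_def
  by (auto intro!: prod_nonneg prod_le_1 mult_nonneg_nonneg mult_le_one simp: expinv_def)

lemma box_bump_outside: "x \<notin> box a b \<Longrightarrow> box_bump n a b x = 0"
  unfolding box_bump_def mem_box
  by (auto simp: expinv_def inner_diff_left not_less mult_le_0_iff intro!: prod_zero)

lemma box_bump_lim: "(\<lambda>n. box_bump n a b x) \<longlonglongrightarrow> indicator (box a b) x"
proof (cases "x \<in> box a b")
  case True
  have e: "(\<lambda>n. expinv 0 (real n * c)) \<longlonglongrightarrow> 1" if "c > 0" for c
  proof -
    have "(\<lambda>n. exp (- (inverse c * inverse (real n)))) \<longlonglongrightarrow> exp (- (inverse c * 0))"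
      by (intro tendsto_intros LIMSEQ_inverse_real_of_nat) (rule lim_inverse_n)
    then have "(\<lambda>n. exp (- (inverse c * inverse (real n)))) \<longlonglongrightarrow> 1" by simp
    then show ?thesis
      by (rule Lim_transform_eventually)
        (use that in \<open>auto simp: eventually_sequentially expinv_def field_simps mult_le_0_iff intro!: exI[of _ 1]\<close>)
  qed
  have "(\<lambda>n. box_bump n a b x) \<longlonglongrightarrow> (\<Prod>i\<in>(Basis::'a set). 1 * 1)"
    unfolding box_bump_def using True
    by (intro tendsto_prod tendsto_mult e) (auto simp: mem_box inner_diff_left)
  with True show ?thesis by simp
next
  case False
  then show ?thesis by (simp add: box_bump_outside)
qed

lemma test_function_box_bump: "cbox a b \<subseteq> \<Omega> \<Longrightarrow> test_function \<Omega> (box_bump n a b)"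
  unfolding test_function_def using smooth_box_bump box_bump_outside box_subset_cbox
  by (metis compact_cbox subset_iff)

section \<open>The fundamental lemma of the calculus of variations\<close>

lemma AE_zero_if_box_integrals_zero_lborel:
  fixes f :: "'a::euclidean_space \<Rightarrow> real"
  assumes f: "integrable lborel f"
    and 0: "\<And>a b. integral\<^sup>L lborel (\<lambda>x. indicator (box a b) x * f x) = 0"
  shows "AE x in lborel. f x = 0"
proof -
  define p where "p = (\<lambda>x. ennreal (f x))"
  define n where "n = (\<lambda>x. ennreal (- f x))"
  have [measurable]: "f \<in> borel_measurable borel" using f by auto
  have [measurable]: "p \<in> borel_measurable borel" "n \<in> borel_measurable borel"
    unfolding p_def n_def by measurable
  have fin: "integral\<^sup>N lborel p \<noteq> \<infinity>"
    using f unfolding real_integrable_def p_def by auto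
  have eq: "emeasure (density lborel p) (box a b) = emeasure (density lborel n) (box a b)" for a b
  proof -
    let ?g = "\<lambda>x. indicator (box a b) x * f x"
    have i: "integrable lborel ?g"
      using integrable_mult_indicator[OF _ f, of "box a b"] by simp
    have "(\<integral>\<^sup>+x. ennreal (?g x) \<partial>lborel) = (\<integral>\<^sup>+x. ennreal (- ?g x) \<partial>lborel)"
      (is "?A = ?B")
    proof -
      have "?A \<noteq> \<infinity>" "?B \<noteq> \<infinity>" using i unfolding real_integrable_def by auto
      then have "?A = ennreal (enn2real ?A)" "?B = ennreal (enn2real ?B)"
        by (simp_all add: less_top)
      moreover have "enn2real ?A = enn2real ?B"
        using 0[of a b] unfolding real_lebesgue_integral_def[OF i] by simp
      ultimately show ?thesis by metis
    qed
    moreover have "(\<integral>\<^sup>+x. ennreal (?g x) \<partial>lborel) = (\<integral>\<^sup>+x. p x * indicator (box a b) x \<partial>lborel)"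
      by (intro nn_integral_cong) (simp add: p_def indicator_def)
    moreover have "(\<integral>\<^sup>+x. ennreal (- ?g x) \<partial>lborel) = (\<integral>\<^sup>+x. n x * indicator (box a b) x \<partial>lborel)"
      by (intro nn_integral_cong) (simp add: n_def indicator_def)
    ultimately show ?thesis by (simp add: emeasure_density)
  qed
  \<comment> \<open>The positive and the negative part of \<open>f\<close> are densities of measures
    that agree on open boxes, an intersection-stable generator of the Borel sets; uniqueness of
    densities then gives f = 0.\<close>
  have "density lborel p = density lborel n"
  proof (rule measure_eqI_generator_eq[where E = "range (\<lambda>(a, b). box a b::'a set)" and \<Omega> = UNIV
        and A = "\<lambda>n::nat. box (- real n *\<^sub>R One) (real n *\<^sub>R One)"])
    show "Int_stable (range (\<lambda>(a, b). box a b::'a set))"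
      by (auto simp: Int_stable_def box_Int_box)
    show "emeasure (density lborel p) (box (- real i *\<^sub>R One) (real i *\<^sub>R One)) \<noteq> \<infinity>" for i
    proof -
      have "(\<integral>\<^sup>+x. p x * indicator (box (- real i *\<^sub>R One) (real i *\<^sub>R One)) x \<partial>lborel) \<le> integral\<^sup>N lborel p"
        by (intro nn_integral_mono) (auto simp: indicator_def)
      then show ?thesis using fin by (auto simp: emeasure_density top_unique)
    qed
  qed (use eq in \<open>auto simp: borel_eq_box UN_box_eq_UNIV\<close>)
  then have "AE x in lborel. p x = n x"
    by (subst (asm) finite_density_unique) (use fin in auto)
  then show ?thesis
  proof eventually_elim
    case (elim x)
    then show ?case
      by (cases "f x \<le> 0") (auto simp: p_def n_def ennreal_neg ennreal_eq_0_iff dest: sym)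
  qed
qed

lemma AE_zero_if_box_integrals_zero:
  fixes f :: "'a::euclidean_space \<Rightarrow> real"
  assumes f: "integrable lebesgue f"
    and 0: "\<And>a b. integral\<^sup>L lebesgue (\<lambda>x. indicator (box a b) x * f x) = 0"
  shows "AE x in lebesgue. f x = 0"
proof -
  obtain g where g: "g \<in> borel_measurable lborel" "AE x in lborel. f x = g x"
    using completion_ex_borel_measurable_real[of f lborel] f by auto
  have ae: "AE x in lebesgue. f x = g x" using g(2) by (rule AE_completion)
  have g': "g \<in> borel_measurable lebesgue" using g(1) by (rule measurable_completion)
  have "integrable lebesgue g"
    by (rule integrable_cong_AE_imp[OF f g']) (use ae in auto)
  then have i: "integrable lborel g" using integrable_completion[OF g(1)] by simp
  have "AE x in lborel. g x = 0"
  proof (rule AE_zero_if_box_integrals_zero_lborel[OF i])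
    fix a b :: 'a
    have m: "(\<lambda>x. indicator (box a b) x * g x) \<in> borel_measurable lborel"
      using g(1) by measurable
    have "integral\<^sup>L lborel (\<lambda>x. indicator (box a b) x * g x) = integral\<^sup>L lebesgue (\<lambda>x. indicator (box a b) x * g x)"
      by (rule integral_completion[OF m, symmetric])
    also have "\<dots> = integral\<^sup>L lebesgue (\<lambda>x. indicator (box a b) x * f x)"
      using ae f measurable_completion[OF m]
      by (intro integral_cong_AE) (auto intro!: borel_measurable_times borel_measurable_indicator elim: AE_mp)
    finally show "integral\<^sup>L lborel (\<lambda>x. indicator (box a b) x * g x) = 0" using 0 by simp
  qed
  from AE_completion[OF this] ae show ?thesis by eventually_elim simp
qed

text \<open>The bumps show that the integrals over boxes with closure in \<open>\<Omega>\<close>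
  vanish. This settles every closed box inside \<open>\<Omega>\<close>, and countably many of them
  cover \<open>\<Omega>\<close>.\<close>

lemma AE_zero_if_test_integrals_zero:
  fixes f :: "'a::euclidean_space \<Rightarrow> real"
  assumes "open \<Omega>" and f: "locally_integrable_on f \<Omega>"
    and 0: "\<And>\<phi>. test_function \<Omega> \<phi> \<Longrightarrow> integral\<^sup>L (lebesgue_on \<Omega>) (\<lambda>x. f x * \<phi> x) = 0"
  shows "AE x in lebesgue_on \<Omega>. f x = 0"
proof -
  have \<Omega>: "\<Omega> \<inter> space lebesgue \<in> sets lebesgue" using assms(1) by auto
  have box: "integral\<^sup>L lebesgue (\<lambda>x. indicator (box a b) x * f x) = 0" if ab: "cbox a b \<subseteq> \<Omega>" for a b
  proof -
    have i: "integrable lebesgue (\<lambda>x. indicator (cbox a b) x * f x)"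
      using f ab unfolding locally_integrable_on_def set_integrable_def by auto
    have "(\<lambda>n. integral\<^sup>L lebesgue (\<lambda>x. box_bump n a b x * (indicator (cbox a b) x * f x)))
        \<longlonglongrightarrow> integral\<^sup>L lebesgue (\<lambda>x. indicator (box a b) x * (indicator (cbox a b) x * f x))"
    proof (rule integral_dominated_convergence[where w = "\<lambda>x. \<bar>indicator (cbox a b) x * f x\<bar>"])
      have c: "box_bump n a b \<in> borel_measurable borel" for n
        using smooth_box_bump[of n a b] unfolding smooth_on_def
        by (metis C_k_on.simps(1) borel_measurable_continuous_onI)
      show "(\<lambda>x. box_bump n a b x * (indicator (cbox a b) x * f x)) \<in> borel_measurable lebesgue" for n
        by (rule borel_measurable_times[OF measurable_completion borel_measurable_integrable[OF i]])
          (use c in auto)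
      show "(\<lambda>x. indicator (box a b) x * (indicator (cbox a b) x * f x)) \<in> borel_measurable lebesgue"
        by (rule borel_measurable_times[OF borel_measurable_indicator borel_measurable_integrable[OF i]]) auto
      show "AE x in lebesgue. (\<lambda>n. box_bump n a b x * (indicator (cbox a b) x * f x))
          \<longlonglongrightarrow> indicator (box a b) x * (indicator (cbox a b) x * f x)"
        by (intro AE_I2 tendsto_mult box_bump_lim tendsto_const)
      show "AE x in lebesgue. norm (box_bump n a b x * (indicator (cbox a b) x * f x))
          \<le> \<bar>indicator (cbox a b) x * f x\<bar>" for n
        using box_bump_bounds[of n a b] by (auto simp: abs_mult mult_left_le_one_le)
    qed (use i in auto)
    moreover have "integral\<^sup>L lebesgue (\<lambda>x. box_bump n a b x * (indicator (cbox a b) x * f x)) = 0" for n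
    proof -
      have "(\<lambda>x. box_bump n a b x * (indicator (cbox a b) x * f x)) = (\<lambda>x. indicator \<Omega> x *\<^sub>R (f x * box_bump n a b x))"
        using ab box_subset_cbox[of a b] box_bump_outside[of _ a b n] by (auto simp: fun_eq_iff indicator_def)
      then show ?thesis
        using 0[OF test_function_box_bump[OF ab, of n]] by (simp add: integral_restrict_space[OF \<Omega>])
    qed
    moreover have "(\<lambda>x. indicator (box a b) x * (indicator (cbox a b) x * f x)) = (\<lambda>x. indicator (box a b) x * f x)"
      using box_subset_cbox[of a b] by (auto simp: fun_eq_iff indicator_def)
    ultimately show ?thesis by (simp add: LIMSEQ_const_iff)
  qed
  have cb: "AE x in lebesgue. x \<in> cbox a b \<longrightarrow> f x = 0" if ab: "cbox a b \<subseteq> \<Omega>" for a b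
  proof -
    have i: "integrable lebesgue (\<lambda>x. indicator (cbox a b) x * f x)"
      using f ab unfolding locally_integrable_on_def set_integrable_def by auto
    have "integrable lebesgue (\<lambda>x. indicator (box a b) x *\<^sub>R (indicator (cbox a b) x * f x))"
      by (rule integrable_mult_indicator[OF _ i]) auto
    moreover have "(\<lambda>x. indicator (box a b) x *\<^sub>R (indicator (cbox a b) x * f x)) = (\<lambda>x. indicator (box a b) x * f x)"
      using box_subset_cbox[of a b] by (auto simp: fun_eq_iff indicator_def)
    ultimately have ib: "integrable lebesgue (\<lambda>x. indicator (box a b) x * f x)" by simp
    have "AE x in lebesgue. indicator (box a b) x * f x = 0"
    proof (rule AE_zero_if_box_integrals_zero[OF ib])
      fix c d :: 'a
      \<comment> \<open>Boxes are stable under intersection, so \<open>f\<close> cut off to one box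
        again has vanishing integrals over all boxes.\<close>
      obtain p q where pq: "box c d \<inter> box a b = box p q" by (rule that[OF box_Int_box])
      have "(\<lambda>x. indicator (box c d) x * (indicator (box a b) x * f x)) = (\<lambda>x. indicator (box p q) x * f x)"
        unfolding pq[symmetric] by (auto simp: fun_eq_iff indicator_def)
      moreover have "integral\<^sup>L lebesgue (\<lambda>x. indicator (box p q) x * f x) = 0"
      proof (cases "box p q = {}")
        case False
        have "cbox p q \<subseteq> cbox a b"
        proof -
          have "box p q \<subseteq> cbox a b" using pq box_subset_cbox[of a b] by blast
          then have "closure (box p q) \<subseteq> cbox a b" by (rule closure_minimal) (rule closed_cbox)
          then show ?thesis using closure_box[OF False] by simp
        qed
        then show ?thesis using box ab by blast
      qed simp
      ultimately show "integral\<^sup>L lebesgue (\<lambda>x. indicator (box c d) x * (indicator (box a b) x * f x)) = 0"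
        by simp
    qed
    moreover have "AE x in lebesgue. x \<notin> cbox a b - box a b"
      using negligible_frontier_interval[of a b] by (intro AE_not_in) (simp add: negligible_iff_null_sets)
    ultimately show ?thesis by eventually_elim auto
  qed
  obtain D where D: "countable D" "D \<subseteq> Pow \<Omega>" "\<And>X. X \<in> D \<Longrightarrow> \<exists>a b. X = cbox a b" "\<Union>D = \<Omega>"
    using open_countable_Union_open_cbox[OF assms(1)] by metis
  have "AE x in lebesgue. \<forall>X\<in>D. x \<in> X \<longrightarrow> f x = 0"
  proof (rule AE_ball_countable'[OF _ D(1)])
    fix X assume "X \<in> D"
    then obtain a b where "X = cbox a b" "cbox a b \<subseteq> \<Omega>" using D(2,3) by blast
    then show "AE x in lebesgue. x \<in> X \<longrightarrow> f x = 0" using cb by simp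
  qed
  then have "AE x in lebesgue. x \<in> \<Omega> \<longrightarrow> f x = 0"
    by eventually_elim (use D(4) in blast)
  then show ?thesis by (simp add: AE_restrict_space_iff[OF \<Omega>])
qed

section \<open>Symmetry of second derivatives\<close>

lemma second_difference_mean_value:
  fixes f :: "'a::real_normed_vector \<Rightarrow> real"
  assumes f: "\<And>y. y \<in> ball x d \<Longrightarrow> f differentiable (at y)"
    and g: "\<And>y. y \<in> ball x d \<Longrightarrow> (\<lambda>y. frechet_derivative f (at y) v) differentiable (at y)"
    and s: "s > 0" "s * (norm v + norm w) < d"
  obtains y where "y \<in> ball x d"
    "f (x + s *\<^sub>R v + s *\<^sub>R w) - f (x + s *\<^sub>R v) - f (x + s *\<^sub>R w) + f x =
      s\<^sup>2 * frechet_derivative (\<lambda>y. frechet_derivative f (at y) v) (at y) w"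
proof -
  have inb: "x + r *\<^sub>R v + q *\<^sub>R w \<in> ball x d" if "0 \<le> r" "r \<le> s" "0 \<le> q" "q \<le> s" for r q
  proof -
    have "norm (r *\<^sub>R v + q *\<^sub>R w) \<le> r * norm v + q * norm w"
      using that norm_triangle_ineq[of "r *\<^sub>R v" "q *\<^sub>R w"] by simp
    also have "\<dots> \<le> s * norm v + s * norm w"
      using that by (intro add_mono mult_right_mono) auto
    also have "\<dots> < d" using s(2) by (simp add: algebra_simps)
    finally have "norm (r *\<^sub>R v + q *\<^sub>R w) < d" .
    moreover have "x - (x + r *\<^sub>R v + q *\<^sub>R w) = - (r *\<^sub>R v + q *\<^sub>R w)" by simp
    ultimately show ?thesis by (simp only: mem_ball dist_norm norm_minus_cancel)
  qed
  have line: "((\<lambda>r. k (c + r *\<^sub>R e)) has_real_derivative frechet_derivative k (at (c + r *\<^sub>R e)) e) (at r)"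
    if "k differentiable (at (c + r *\<^sub>R e))" for k :: "'a \<Rightarrow> real" and c e r
  proof -
    have "((\<lambda>u. k ((c + r *\<^sub>R e) + u *\<^sub>R e)) has_real_derivative frechet_derivative k (at (c + r *\<^sub>R e)) e) (at 0)"
      using dderiv_frechet[OF that, of e] unfolding dderiv_def .
    then have "((\<lambda>u. k (c + (r + u) *\<^sub>R e)) has_real_derivative frechet_derivative k (at (c + r *\<^sub>R e)) e) (at 0)"
      by (simp add: algebra_simps)
    then show ?thesis
      using DERIV_shift[of "\<lambda>u. k (c + u *\<^sub>R e)" _ 0 r] by (simp add: add.commute)
  qed
  let ?g = "\<lambda>y. frechet_derivative f (at y) v"
  \<comment> \<open>The mean value theorem is used first in the direction \<open>v\<close>, for the
    increment of \<open>f\<close> in the direction \<open>w\<close>, and then in the direction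
    \<open>w\<close>, for the derivative along \<open>v\<close>.\<close>
  have "((\<lambda>r. f ((x + s *\<^sub>R w) + r *\<^sub>R v) - f (x + r *\<^sub>R v)) has_real_derivative
      ?g ((x + s *\<^sub>R w) + r *\<^sub>R v) - ?g (x + r *\<^sub>R v)) (at r)" if "0 \<le> r" "r \<le> s" for r
    using inb[of r s] inb[of r 0] that s(1)
    by (intro DERIV_diff line f) (auto simp: algebra_simps)
  from MVT2[OF s(1), of "\<lambda>r. f ((x + s *\<^sub>R w) + r *\<^sub>R v) - f (x + r *\<^sub>R v)", OF this]
  obtain r where r: "0 < r" "r < s"
    "f ((x + s *\<^sub>R w) + s *\<^sub>R v) - f (x + s *\<^sub>R v) - (f (x + s *\<^sub>R w) - f x) =
      s * (?g ((x + s *\<^sub>R w) + r *\<^sub>R v) - ?g (x + r *\<^sub>R v))" by auto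
  have "((\<lambda>q. ?g ((x + r *\<^sub>R v) + q *\<^sub>R w)) has_real_derivative
      frechet_derivative ?g (at ((x + r *\<^sub>R v) + q *\<^sub>R w)) w) (at q)" if "0 \<le> q" "q \<le> s" for q
    using inb[of r q] r that by (intro line g) auto
  from MVT2[OF s(1), of "\<lambda>q. ?g ((x + r *\<^sub>R v) + q *\<^sub>R w)", OF this]
  obtain q where q: "0 < q" "q < s"
    "?g ((x + r *\<^sub>R v) + s *\<^sub>R w) - ?g (x + r *\<^sub>R v) =
      s * frechet_derivative ?g (at ((x + r *\<^sub>R v) + q *\<^sub>R w)) w" by auto
  show ?thesis
  proof (rule that)
    show "x + r *\<^sub>R v + q *\<^sub>R w \<in> ball x d" using inb[of r q] r q by auto
    show "f (x + s *\<^sub>R v + s *\<^sub>R w) - f (x + s *\<^sub>R v) - f (x + s *\<^sub>R w) + f x =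
        s\<^sup>2 * frechet_derivative ?g (at (x + r *\<^sub>R v + q *\<^sub>R w)) w"
      using r(3) q(3) by (simp add: algebra_simps power2_eq_square)
  qed
qed

text \<open>The second difference is symmetric in \<open>v\<close> and \<open>w\<close> and equals
  the squared step times either mixed derivative at some nearby point. If the two differed at
  \<open>x\<close>, continuity would keep them apart at nearby points.\<close>

lemma frechet_derivative_symmetric:
  fixes f :: "'a::real_normed_vector \<Rightarrow> real"
  assumes S: "open S" "x \<in> S" and f: "C_k_on 2 f S"
  shows "frechet_derivative (\<lambda>y. frechet_derivative f (at y) v) (at x) w =
         frechet_derivative (\<lambda>y. frechet_derivative f (at y) w) (at x) v" (is "?A x = ?B x")
proof (rule ccontr)
  assume neq: "?A x \<noteq> ?B x"
  define e where "e = \<bar>?A x - ?B x\<bar> / 2"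
  have e: "e > 0" using neq by (simp add: e_def)
  have f1: "f differentiable (at y)" if "y \<in> S" for y using f that by (simp add: numeral_2_eq_2)
  have f2: "(\<lambda>y. frechet_derivative f (at y) v) differentiable (at y)" if "y \<in> S" for y v
    using f that by (simp add: numeral_2_eq_2)
  have "continuous_on S ?A" "continuous_on S ?B" using f by (auto simp: numeral_2_eq_2)
  then have "isCont ?A x" "isCont ?B x" using S by (auto simp: continuous_on_eq_continuous_at)
  then obtain d1 d2 where d1: "d1 > 0" "\<And>y. dist y x < d1 \<Longrightarrow> dist (?A y) (?A x) < e"
    and d2: "d2 > 0" "\<And>y. dist y x < d2 \<Longrightarrow> dist (?B y) (?B x) < e"
    using e unfolding continuous_at_eps_delta by metis
  obtain d0 where d0: "d0 > 0" "ball x d0 \<subseteq> S" using S open_contains_ball by blast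
  define d where "d = min d0 (min d1 d2)"
  have d: "d > 0" using d0 d1 d2 by (simp add: d_def)
  define s where "s = d / (norm v + norm w + 1)"
  have p: "norm v + norm w + 1 > 0" by (smt (verit) norm_ge_zero)
  have s: "s > 0" "s * (norm v + norm w) < d" "s * (norm w + norm v) < d"
    using d p by (auto simp: s_def field_simps)
  have bS: "y \<in> S" if "y \<in> ball x d" for y using that d0 by (auto simp: d_def)
  obtain y where y: "y \<in> ball x d"
    "f (x + s *\<^sub>R v + s *\<^sub>R w) - f (x + s *\<^sub>R v) - f (x + s *\<^sub>R w) + f x = s\<^sup>2 * ?A y"
    by (rule second_difference_mean_value[of x d f v s w]) (use f1 f2 bS s in auto)
  obtain y' where y': "y' \<in> ball x d"
    "f (x + s *\<^sub>R w + s *\<^sub>R v) - f (x + s *\<^sub>R w) - f (x + s *\<^sub>R v) + f x = s\<^sup>2 * ?B y'"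
    by (rule second_difference_mean_value[of x d f w s v]) (use f1 f2 bS s in auto)
  have "s\<^sup>2 * ?A y = s\<^sup>2 * ?B y'" using y(2) y'(2) by (simp add: algebra_simps)
  then have "?A y = ?B y'" using s by simp
  moreover have "dist (?A y) (?A x) < e" "dist (?B y') (?B x) < e"
    using y(1) y'(1) d1(2)[of y] d2(2)[of y'] by (simp_all add: d_def dist_commute)
  ultimately show False unfolding e_def dist_real_def by (auto simp: abs_if field_simps split: if_splits)
qed

section \<open>Geometry of the gauge\<close>

definition dir :: "'m::finite + 'k::finite \<Rightarrow> ('m, 'k) point" where
  "dir i = (case i of Inl a \<Rightarrow> (axis a 1, 0) | Inr b \<Rightarrow> (0, axis b 1))"

lemma dir_simps [simp]: "dir (Inl a) = (axis a 1, 0)" "dir (Inr b) = (0, axis b 1)"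
  by (simp_all add: dir_def)

text \<open>The exponents of the dilations that multiply z by a factor and t by its power \<alpha> +
  1; all fields are homogeneous of degree one under them.\<close>

definition dilw :: "real \<Rightarrow> 'm::finite + 'k::finite \<Rightarrow> real" where
  "dilw \<alpha> i = (case i of Inl _ \<Rightarrow> 1 | Inr _ \<Rightarrow> \<alpha> + 1)"

lemma dilw_simps [simp]: "dilw \<alpha> (Inl a) = 1" "dilw \<alpha> (Inr b) = \<alpha> + 1"
  by (simp_all add: dilw_def)

text \<open>The square of the coefficient of the field \<open>i\<close>; quadratic expressions in
  the fields contain the coefficient in this form only.\<close>

definition fldw :: "real \<Rightarrow> 'm::finite + 'k::finite \<Rightarrow> ('m, 'k) point \<Rightarrow> real" where
  "fldw \<alpha> i x = (case i of Inl _ \<Rightarrow> 1 | Inr _ \<Rightarrow> norm (fst x) powr (2 * \<alpha>))"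

lemma fldw_simps [simp]: "fldw \<alpha> (Inl a) x = 1" "fldw \<alpha> (Inr b) x = norm (fst x) powr (2 * \<alpha>)"
  by (simp_all add: fldw_def)

definition pd :: "'m::finite + 'k::finite \<Rightarrow> (('m, 'k) point \<Rightarrow> real) \<Rightarrow> ('m, 'k) point \<Rightarrow> real" where
  "pd i f x = frechet_derivative f (at x) (dir i)"

text \<open>\<open>lrho\<close> is \<open>ln \<rho>\<close>, \<open>dlrho\<close> its gradient, and \<open>radw = |X (ln \<rho>)|\<^sup>2\<close>.\<close>

definition gaugeN :: "real \<Rightarrow> ('m::finite, 'k::finite) point \<Rightarrow> real" where
  "gaugeN \<alpha> x = norm (fst x) powr (2 * (\<alpha> + 1)) + (\<alpha> + 1)\<^sup>2 * (norm (snd x))\<^sup>2"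

definition lrho :: "real \<Rightarrow> ('m::finite, 'k::finite) point \<Rightarrow> real" where
  "lrho \<alpha> x = ln (gaugeN \<alpha> x) / (2 * (\<alpha> + 1))"

definition radw :: "real \<Rightarrow> ('m::finite, 'k::finite) point \<Rightarrow> real" where
  "radw \<alpha> x = norm (fst x) powr (2 * \<alpha>) / gaugeN \<alpha> x"

definition dlrho :: "real \<Rightarrow> 'm::finite + 'k::finite \<Rightarrow> ('m, 'k) point \<Rightarrow> real" where
  "dlrho \<alpha> i x = (case i of
     Inl _ \<Rightarrow> norm (fst x) powr (2 * \<alpha>) * (x \<bullet> dir i) / gaugeN \<alpha> x
   | Inr _ \<Rightarrow> (\<alpha> + 1) * (x \<bullet> dir i) / gaugeN \<alpha> x)"

definition dil :: "real \<Rightarrow> (('m::finite, 'k::finite) point \<Rightarrow> real) \<Rightarrow> ('m, 'k) point \<Rightarrow> real" where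
  "dil \<alpha> f x = (\<Sum>i\<in>UNIV. dilw \<alpha> i * (x \<bullet> dir i) * pd i f x)"

definition gradsq :: "real \<Rightarrow> (('m::finite, 'k::finite) point \<Rightarrow> real) \<Rightarrow> ('m, 'k) point \<Rightarrow> real" where
  "gradsq \<alpha> f x = (\<Sum>i\<in>UNIV. fldw \<alpha> i x * (pd i f x)\<^sup>2)"

text \<open>The square of a field is its squared coefficient times a second partial derivative,
  since the coefficient does not depend on the variable of differentiation.\<close>

definition grushin :: "real \<Rightarrow> (('m::finite, 'k::finite) point \<Rightarrow> real) \<Rightarrow> ('m, 'k) point \<Rightarrow> real" where
  "grushin \<alpha> f x = (\<Sum>i\<in>UNIV. fldw \<alpha> i x * pd i (pd i f) x)"

text \<open>The homogeneous dimension Q, which is also the divergence of the dilation field.\<close>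

definition homdim :: "real \<Rightarrow> 'm itself \<Rightarrow> 'k itself \<Rightarrow> real" where
  "homdim \<alpha> m k = real CARD('m) + (\<alpha> + 1) * real CARD('k)"

lemma sum_UNIV_Plus: "(\<Sum>i\<in>(UNIV :: ('m::finite + 'k::finite) set). f i) = (\<Sum>a\<in>UNIV. f (Inl a)) + (\<Sum>b\<in>UNIV. f (Inr b))"
  using sum.Plus[of UNIV UNIV f] by (simp add: UNIV_Plus_UNIV)

lemma inner_dir [simp]:
  "x \<bullet> (axis a 1, 0) = fst x $ a" "x \<bullet> (0, axis b 1) = snd x $ b"
  by (simp_all add: inner_prod_def inner_axis)

lemma sum_dilw: "(\<Sum>i\<in>(UNIV :: ('m::finite + 'k::finite) set). dilw \<alpha> i) = homdim \<alpha> TYPE('m) TYPE('k)"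
  by (simp add: sum_UNIV_Plus homdim_def)

lemma sum_sq_vec: "(\<Sum>a\<in>UNIV. (z $ a)\<^sup>2) = (norm (z :: real ^ 'n))\<^sup>2"
  unfolding power2_norm_eq_inner inner_vec_def by (simp add: power2_eq_square)

lemma gaugeN_nonneg: "0 \<le> gaugeN \<alpha> x"
  by (simp add: gaugeN_def)

lemma norm_powr_mult_sq: "norm z powr (2 * \<alpha>) * (norm z)\<^sup>2 = norm z powr (2 * (\<alpha> + 1))"
  by (cases "z = 0") (auto simp: powr_add distrib_left simp flip: powr_numeral)

lemma gaugeN_pos:
  assumes "\<alpha> > 0" "x \<noteq> 0" shows "gaugeN \<alpha> x > 0"
proof (cases "fst x = 0")
  case True
  then have "snd x \<noteq> 0" using assms(2) by (auto simp: prod_eq_iff)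
  then show ?thesis using assms(1) by (auto simp: gaugeN_def intro!: add_nonneg_pos)
next
  case False
  then show ?thesis by (auto simp: gaugeN_def intro!: add_pos_nonneg)
qed

text \<open>The X-gradient of the logarithmic gauge points in the direction of the dilations:
  contracting it with X u gives W D u. This makes D u the right multiplier for radial
  weights.\<close>

lemma fldw_dlrho:
  assumes "\<alpha> > 0"
  shows "fldw \<alpha> i x * dlrho \<alpha> i x = radw \<alpha> x * (dilw \<alpha> i * (x \<bullet> dir i))"
  by (cases i) (auto simp: dlrho_def radw_def)

text \<open>Euler's identity: the gauge is homogeneous of degree one, so D maps its logarithm to
  1.\<close>

lemma sum_dilw_dlrho:
  fixes x :: "('m::finite, 'k::finite) point"
  assumes "\<alpha> > 0" "x \<noteq> 0"
  shows "(\<Sum>i\<in>UNIV. dilw \<alpha> i * (x \<bullet> dir i) * dlrho \<alpha> i x) = 1"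
proof -
  have "(\<Sum>i\<in>UNIV. dilw \<alpha> i * (x \<bullet> dir i) * dlrho \<alpha> i x) =
    (norm (fst x) powr (2 * \<alpha>) * (\<Sum>a\<in>UNIV. (fst x $ a)\<^sup>2) + (\<alpha> + 1)\<^sup>2 * (\<Sum>b\<in>UNIV. (snd x $ b)\<^sup>2)) / gaugeN \<alpha> x"
    by (simp add: sum_UNIV_Plus dlrho_def add_divide_distrib sum_distrib_left sum_divide_distrib
        power2_eq_square mult_ac cong: sum.cong)
  also have "\<dots> = 1"
    using gaugeN_pos[OF assms] by (simp add: sum_sq_vec norm_powr_mult_sq gaugeN_def)
  finally show ?thesis .
qed

text \<open>On a line through a point with z = 0 the function is |s|^p up to a constant factor, and
  this is o(s) for p > 1.\<close>

lemma dderiv_norm_fst_powr: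
  fixes x :: "('m::finite, 'k::finite) point"
  assumes "p > 1 \<or> fst x \<noteq> 0"
  shows "dderiv e (\<lambda>x. norm (fst x) powr p) (p * norm (fst x) powr (p - 2) * (fst x \<bullet> fst e)) x"
proof (cases "fst x = 0")
  case True
  with assms have p: "p > 1" by auto
  have "((\<lambda>s. \<bar>s\<bar> powr p) has_real_derivative 0) (at 0)"
    unfolding DERIV_def
  proof (rule Lim_null_comparison)
    show "\<forall>\<^sub>F h in at 0. norm ((\<bar>0 + h\<bar> powr p - \<bar>0\<bar> powr p) / h) \<le> \<bar>h\<bar> powr (p - 1)"
      by (rule always_eventually) (use p in \<open>auto simp: powr_diff\<close>)
    have "((\<lambda>h. \<bar>h\<bar> powr (p - 1)) \<longlongrightarrow> \<bar>0::real\<bar> powr (p - 1)) (at 0)"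
      by (intro tendsto_powr' tendsto_intros) (use p in auto)
    then show "((\<lambda>h. \<bar>h\<bar> powr (p - 1)) \<longlongrightarrow> 0) (at (0::real))" using p by simp
  qed
  then have "((\<lambda>s. norm (fst e) powr p * \<bar>s\<bar> powr p) has_real_derivative norm (fst e) powr p * 0) (at 0)"
    by (rule DERIV_cmult)
  moreover have "(\<lambda>s. norm (fst (x + s *\<^sub>R e)) powr p) = (\<lambda>s. norm (fst e) powr p * \<bar>s\<bar> powr p)"
    using True by (auto simp: powr_mult mult.commute)
  ultimately show ?thesis using True by (simp add: dderiv_def)
next
  case False
  have "((\<lambda>x. norm (fst x)) has_derivative (\<lambda>h. inner (fst h) (sgn (fst x)))) (at x)"
    by (rule has_derivative_compose[where f = fst, OF has_derivative_fst[OF has_derivative_ident], of norm])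
      (use GDERIV_norm[OF False] in \<open>auto simp: gderiv_def\<close>)
  then have d: "dderiv e (\<lambda>x. norm (fst x)) (sgn (fst x) \<bullet> fst e) x"
    using dderiv_has_derivative by (subst inner_commute) blast
  have "((\<lambda>y. y powr p) has_real_derivative p * norm (fst x) powr (p - 1)) (at (norm (fst x)))"
    using False by (intro has_real_derivative_powr) auto
  from dderiv_chain[where g = "\<lambda>y. y powr p", OF this d]
  have "dderiv e (\<lambda>x. norm (fst x) powr p) (p * norm (fst x) powr (p - 1) * (sgn (fst x) \<bullet> fst e)) x" .
  moreover have "norm (fst x) powr (p - 1) * (sgn (fst x) \<bullet> fst e) = norm (fst x) powr (p - 2) * (fst x \<bullet> fst e)"
  proof -
    have "norm (fst x) powr (p - 1) = norm (fst x) powr (p - 2) * norm (fst x)"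
      using False powr_add[of "norm (fst x)" "p - 2" 1] by simp
    then show ?thesis using False by (simp add: sgn_div_norm field_simps)
  qed
  ultimately show ?thesis by (simp add: mult.assoc)
qed

lemma dderiv_gaugeN:
  fixes x :: "('m::finite, 'k::finite) point"
  assumes "\<alpha> > 0"
  shows "dderiv e (gaugeN \<alpha>) (2 * (\<alpha> + 1) * norm (fst x) powr (2 * \<alpha>) * (fst x \<bullet> fst e)
    + 2 * (\<alpha> + 1)\<^sup>2 * (snd x \<bullet> snd e)) x"
proof -
  have "((\<lambda>x::('m, 'k) point. (\<alpha> + 1)\<^sup>2 * (norm (snd x))\<^sup>2) has_derivative
      (\<lambda>h. (\<alpha> + 1)\<^sup>2 * (2 * (snd x \<bullet> snd h)))) (at x)"
    unfolding power2_norm_eq_inner by (auto intro!: derivative_eq_intros simp: inner_commute)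
  from dderiv_has_derivative[OF this, of e]
  have "dderiv e (\<lambda>x::('m, 'k) point. (\<alpha> + 1)\<^sup>2 * (norm (snd x))\<^sup>2) ((\<alpha> + 1)\<^sup>2 * (2 * (snd x \<bullet> snd e))) x" .
  from dderiv_add[OF dderiv_norm_fst_powr[of "2 * (\<alpha> + 1)" x e] this] assms
  show ?thesis unfolding gaugeN_def[abs_def] by (simp add: algebra_simps)
qed

lemma dderiv_lrho:
  fixes x :: "('m::finite, 'k::finite) point"
  assumes "\<alpha> > 0" "x \<noteq> 0"
  shows "dderiv (dir i) (lrho \<alpha>) (dlrho \<alpha> i x) x"
proof -
  have "((\<lambda>y. ln y / (2 * (\<alpha> + 1))) has_real_derivative 1 / gaugeN \<alpha> x / (2 * (\<alpha> + 1))) (at (gaugeN \<alpha> x))"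
    using gaugeN_pos[OF assms] assms(1) by (auto intro!: derivative_eq_intros)
  from dderiv_chain[OF this dderiv_gaugeN[OF assms(1), of "dir i" x]]
  have "dderiv (dir i) (lrho \<alpha>) (1 / gaugeN \<alpha> x / (2 * (\<alpha> + 1)) *
      (2 * (\<alpha> + 1) * norm (fst x) powr (2 * \<alpha>) * (fst x \<bullet> fst (dir i)) + 2 * (\<alpha> + 1)\<^sup>2 * (snd x \<bullet> snd (dir i)))) x"
    unfolding lrho_def[abs_def] .
  moreover have "1 / gaugeN \<alpha> x / (2 * (\<alpha> + 1)) *
      (2 * (\<alpha> + 1) * norm (fst x) powr (2 * \<alpha>) * (fst x \<bullet> fst (dir i)) + 2 * (\<alpha> + 1)\<^sup>2 * (snd x \<bullet> snd (dir i)))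
      = dlrho \<alpha> i x"
  proof -
    have "1 / g / (2 * c) * (2 * c * A + 2 * c\<^sup>2 * B) = (A + c * B) / g" if "c \<noteq> 0" for g c A B :: real
      using that by (cases "g = 0") (simp_all add: power2_eq_square field_simps)
    from this[of "\<alpha> + 1" "gaugeN \<alpha> x" "norm (fst x) powr (2 * \<alpha>) * (fst x \<bullet> fst (dir i))" "snd x \<bullet> snd (dir i)"] assms(1)
    have "1 / gaugeN \<alpha> x / (2 * (\<alpha> + 1)) *
      (2 * (\<alpha> + 1) * norm (fst x) powr (2 * \<alpha>) * (fst x \<bullet> fst (dir i)) + 2 * (\<alpha> + 1)\<^sup>2 * (snd x \<bullet> snd (dir i)))
      = (norm (fst x) powr (2 * \<alpha>) * (fst x \<bullet> fst (dir i)) + (\<alpha> + 1) * (snd x \<bullet> snd (dir i))) / gaugeN \<alpha> x"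
      by (simp only: mult.assoc)
    moreover have "\<dots> = dlrho \<alpha> i x"
      by (cases i) (auto simp: dlrho_def inner_axis)
    ultimately show ?thesis by simp
  qed
  ultimately show ?thesis by simp
qed

lemma dderiv_radial:
  assumes "\<alpha> > 0" "x \<noteq> 0" "\<And>s. (a has_real_derivative a' s) (at s)"
  shows "dderiv (dir i) (\<lambda>x. a (lrho \<alpha> x)) (a' (lrho \<alpha> x) * dlrho \<alpha> i x) x"
  by (rule dderiv_chain[OF assms(3) dderiv_lrho[OF assms(1,2)]])

lemma dderiv_coord: "dderiv (dir i) (\<lambda>x. x \<bullet> dir j) (if i = j then 1 else 0) (x :: ('m::finite, 'k::finite) point)"
proof -
  have "dderiv (dir i) (\<lambda>x. x \<bullet> dir j) (dir i \<bullet> dir j) x"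
    by (rule dderiv_linear) (rule bounded_linear_inner_left)
  moreover have "dir i \<bullet> dir j = (if i = j then 1 else 0)"
    by (cases i; cases j) (auto, simp_all add: axis_def)
  ultimately show ?thesis by simp
qed

lemma dderiv_fldw_self: "dderiv (dir i) (fldw \<alpha> i) 0 x"
proof (cases i)
  case (Inl a)
  then show ?thesis unfolding fldw_def by (simp add: dderiv_const)
next
  case (Inr b)
  then show ?thesis unfolding fldw_def by (simp add: dderiv_def)
qed

text \<open>\<open>cfld \<alpha> l i\<close> is \<open>x\<^sub>l \<partial>\<^sub>l (fldw \<alpha> i)\<close>; at \<open>z = 0\<close> the division by zero gives the correct value 0.\<close>

definition cfld :: "real \<Rightarrow> 'm::finite + 'k::finite \<Rightarrow> 'm + 'k \<Rightarrow> ('m, 'k) point \<Rightarrow> real" where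
  "cfld \<alpha> l i x = (case i of Inl _ \<Rightarrow> 0 | Inr _ \<Rightarrow> (case l of Inr _ \<Rightarrow> 0
     | Inl a \<Rightarrow> 2 * \<alpha> * (norm (fst x) powr (2 * \<alpha>) * ((fst x $ a)\<^sup>2 / (norm (fst x))\<^sup>2))))"

text \<open>For small \<alpha> the weight |z|^(2 \<alpha>) has no z-derivative at z = 0, but its
  product with the coordinate behaves like s |s|^(2 \<alpha>) along the line and has derivative 0.
  The dilation field supplies exactly this coordinate factor.\<close>

lemma dderiv_coord_fldw:
  fixes x :: "('m::finite, 'k::finite) point"
  assumes "\<alpha> > 0"
  shows "dderiv (dir l) (\<lambda>x. (x \<bullet> dir l) * fldw \<alpha> i x) (fldw \<alpha> i x + cfld \<alpha> l i x) x"
proof -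
  have triv: ?thesis if "dderiv (dir l) (fldw \<alpha> i) 0 x" "cfld \<alpha> l i x = 0"
    using dderiv_mult[OF dderiv_coord[of l l x] that(1)] that(2) by simp
  show ?thesis
  proof (cases i)
    case (Inl a)
    then show ?thesis by (intro triv) (auto simp: fldw_def[abs_def] cfld_def intro: dderiv_const)
  next
    case i: (Inr b)
    show ?thesis
    proof (cases l)
      case (Inr c)
      then show ?thesis using i by (intro triv) (auto simp: fldw_def cfld_def dderiv_def)
    next
      case l: (Inl a)
      show ?thesis
      proof (cases "fst x = 0")
        case False
        have 1: "dderiv (dir l) (fldw \<alpha> i) (2 * \<alpha> * norm (fst x) powr (2 * \<alpha> - 2) * (fst x \<bullet> fst (dir l))) x"
          using dderiv_norm_fst_powr[of "2 * \<alpha>" x "dir l"] False i unfolding fldw_def by simp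
        have 2: "norm (fst x) powr (2 * \<alpha> - 2) = norm (fst x) powr (2 * \<alpha>) / (norm (fst x))\<^sup>2"
          using False by (simp add: powr_diff)
        have "fst x \<bullet> fst (dir l) = fst x $ a" using l by (simp add: inner_axis)
        then have "1 * fldw \<alpha> i x + 2 * \<alpha> * norm (fst x) powr (2 * \<alpha> - 2) * (fst x \<bullet> fst (dir l)) * (x \<bullet> dir l)
            = fldw \<alpha> i x + cfld \<alpha> l i x"
          using i l unfolding 2 by (simp add: cfld_def power2_eq_square)
        with dderiv_mult[OF dderiv_coord[of l l x] 1] show ?thesis by simp
      next
        case True
        have "((\<lambda>s. s * \<bar>s\<bar> powr (2 * \<alpha>)) has_real_derivative 0) (at 0)"
          unfolding DERIV_def
        proof (rule Lim_null_comparison)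
          show "\<forall>\<^sub>F h in at 0. norm (((0 + h) * \<bar>0 + h\<bar> powr (2 * \<alpha>) - 0 * \<bar>0\<bar> powr (2 * \<alpha>)) / h) \<le> \<bar>h\<bar> powr (2 * \<alpha>)"
            by (rule always_eventually) auto
          have "((\<lambda>h. \<bar>h\<bar> powr (2 * \<alpha>)) \<longlongrightarrow> \<bar>0::real\<bar> powr (2 * \<alpha>)) (at 0)"
            by (intro tendsto_powr' tendsto_intros) (use assms in auto)
          then show "((\<lambda>h. \<bar>h\<bar> powr (2 * \<alpha>)) \<longlongrightarrow> 0) (at (0::real))" by simp
        qed
        then show ?thesis
          using True i l assms by (simp add: dderiv_def fldw_def cfld_def)
      qed
    qed
  qed
qed

text \<open>Euler's identity again: the weight of the t-fields has degree 2 \<alpha> = 2 (\<alpha> +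
  1) - 2 under the dilations, that of the z-fields degree 0 = 2 - 2.\<close>

lemma sum_cfld:
  fixes x :: "('m::finite, 'k::finite) point"
  assumes "\<alpha> > 0"
  shows "(\<Sum>l\<in>UNIV. dilw \<alpha> l * cfld \<alpha> l i x) = (2 * dilw \<alpha> i - 2) * fldw \<alpha> i x"
proof (cases i)
  case (Inl a)
  then show ?thesis by (simp add: cfld_def)
next
  case (Inr b)
  have "(\<Sum>l\<in>UNIV. dilw \<alpha> l * cfld \<alpha> l i x) =
      2 * \<alpha> * (norm (fst x) powr (2 * \<alpha>) * ((\<Sum>a\<in>UNIV. (fst x $ a)\<^sup>2) / (norm (fst x))\<^sup>2))"
    using Inr by (simp add: sum_UNIV_Plus cfld_def sum_distrib_left sum_divide_distrib)
  then show ?thesis using Inr assms by (cases "fst x = 0") (auto simp: sum_sq_vec)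
qed

section \<open>Continuity of the weights\<close>

lemma continuous_on_norm_fst_powr: "p > 0 \<Longrightarrow> continuous_on S (\<lambda>x. norm (fst x) powr p)"
  by (intro continuous_on_powr' continuous_intros) auto

lemma continuous_on_fldw: "\<alpha> > 0 \<Longrightarrow> continuous_on S (fldw \<alpha> i)"
  by (cases i) (auto simp: fldw_def intro!: continuous_on_norm_fst_powr)

lemma continuous_on_gaugeN: "\<alpha> > 0 \<Longrightarrow> continuous_on S (gaugeN \<alpha>)"
  unfolding gaugeN_def[abs_def] by (intro continuous_intros continuous_on_norm_fst_powr) auto

lemma gaugeN_nonzero: "\<alpha> > 0 \<Longrightarrow> 0 \<notin> S \<Longrightarrow> \<forall>x\<in>S. gaugeN \<alpha> x \<noteq> 0"
  using gaugeN_pos[of \<alpha>] by (metis less_irrefl)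

lemma continuous_on_lrho: "\<alpha> > 0 \<Longrightarrow> 0 \<notin> S \<Longrightarrow> continuous_on S (lrho \<alpha>)"
  unfolding lrho_def[abs_def]
  by (intro continuous_on_divide continuous_on_ln continuous_on_const continuous_on_gaugeN gaugeN_nonzero) auto

lemma continuous_on_radw: "\<alpha> > 0 \<Longrightarrow> 0 \<notin> S \<Longrightarrow> continuous_on S (radw \<alpha>)"
  unfolding radw_def[abs_def]
  by (intro continuous_on_divide continuous_on_norm_fst_powr continuous_on_gaugeN gaugeN_nonzero) auto

lemma continuous_on_dlrho:
  assumes "\<alpha> > 0" "0 \<notin> S"
  shows "continuous_on S (dlrho \<alpha> i)"
proof (cases i)
  case (Inl a)
  then show ?thesis unfolding dlrho_def[abs_def]
    using assms by (simp only: sum.case)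
      (intro continuous_intros continuous_on_norm_fst_powr continuous_on_gaugeN gaugeN_nonzero, auto)
next
  case (Inr a)
  then show ?thesis unfolding dlrho_def[abs_def]
    using assms by (simp only: sum.case)
      (intro continuous_intros continuous_on_gaugeN gaugeN_nonzero, auto)
qed

text \<open>The quotient of squares is at most 1, so near z = 0 the function is dominated by |z|^(2
  \<alpha>), which tends to 0.\<close>

lemma continuous_on_cfld:
  fixes S :: "('m::finite, 'k::finite) point set"
  assumes "\<alpha> > 0"
  shows "continuous_on S (cfld \<alpha> l i)"
proof -
  have "isCont (\<lambda>x::('m, 'k) point. norm (fst x) powr (2 * \<alpha>) * ((fst x $ a)\<^sup>2 / (norm (fst x))\<^sup>2)) x" for a x
  proof (cases "fst x = 0")
    case False
    have "continuous_on UNIV (\<lambda>x::('m, 'k) point. norm (fst x) powr (2 * \<alpha>))"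
      using assms by (intro continuous_on_norm_fst_powr) auto
    then have "isCont (\<lambda>x::('m, 'k) point. norm (fst x) powr (2 * \<alpha>)) x"
      using continuous_on_eq_continuous_at[OF open_UNIV] by blast
    with False show ?thesis
      by (intro continuous_mult continuous_divide continuous_intros) auto
  next
    case True
    have "((\<lambda>x::('m, 'k) point. norm (fst x) powr (2 * \<alpha>) * ((fst x $ a)\<^sup>2 / (norm (fst x))\<^sup>2)) \<longlongrightarrow> 0) (at x)"
    proof (rule Lim_null_comparison)
      have "continuous_on UNIV (\<lambda>x::('m, 'k) point. norm (fst x) powr (2 * \<alpha>))"
        using assms by (intro continuous_on_norm_fst_powr) auto
      then have "isCont (\<lambda>x::('m, 'k) point. norm (fst x) powr (2 * \<alpha>)) x"
        using continuous_on_eq_continuous_at[OF open_UNIV] by blast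
      then show "((\<lambda>x::('m, 'k) point. norm (fst x) powr (2 * \<alpha>)) \<longlongrightarrow> 0) (at x)"
        using True unfolding isCont_def by simp
      have "(fst y $ a)\<^sup>2 / (norm (fst y))\<^sup>2 \<le> 1" for y :: "('m, 'k) point"
        using component_le_norm_cart[of "fst y" a] by (auto simp: divide_le_eq abs_le_square_iff[symmetric])
      then have "norm (norm (fst y) powr (2 * \<alpha>) * ((fst y $ a)\<^sup>2 / (norm (fst y))\<^sup>2))
          \<le> norm (fst y) powr (2 * \<alpha>)" for y :: "('m, 'k) point"
        using mult_left_le[OF _ powr_ge_zero, of "(fst y $ a)\<^sup>2 / (norm (fst y))\<^sup>2" "norm (fst y)" "2 * \<alpha>"]
        by (simp add: abs_mult)
      then show "\<forall>\<^sub>F y in at x. norm (norm (fst y) powr (2 * \<alpha>) * ((fst y $ a)\<^sup>2 / (norm (fst y))\<^sup>2))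
          \<le> norm (fst y) powr (2 * \<alpha>)"
        by (intro always_eventually allI)
    qed
    then show ?thesis using True by (simp add: isCont_def)
  qed
  then have "continuous_on S (\<lambda>x::('m, 'k) point. norm (fst x) powr (2 * \<alpha>) * ((fst x $ a)\<^sup>2 / (norm (fst x))\<^sup>2))" for a
    by (intro continuous_at_imp_continuous_on ballI)
  then have "continuous_on S (\<lambda>x::('m, 'k) point.
      2 * \<alpha> * (norm (fst x) powr (2 * \<alpha>) * ((fst x $ a)\<^sup>2 / (norm (fst x))\<^sup>2)))" for a
    by (rule continuous_on_mult_left)
  then show ?thesis
    by (cases i; cases l) (simp_all only: cfld_def[abs_def] sum.case, auto)
qed

section \<open>The divergence theorem away from the origin\<close>

lemma dderiv_diff: "dderiv e F a x \<Longrightarrow> dderiv e G b x \<Longrightarrow> dderiv e (\<lambda>y. F y - G y) (a - b) x"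
  unfolding dderiv_def by (rule DERIV_diff)

lemma dderiv_cmult: "dderiv e F a x \<Longrightarrow> dderiv e (\<lambda>y. c * F y) (c * a) x"
  unfolding dderiv_def by (rule DERIV_cmult)

lemma dderiv_power2: "dderiv e F a x \<Longrightarrow> dderiv e (\<lambda>y. (F y)\<^sup>2) (2 * F x * a) x"
  using dderiv_mult[of e F a x F a] by (simp add: power2_eq_square mult_ac)

lemma indicator_insert_point:
  "p \<in> T \<Longrightarrow> (\<lambda>x. indicator T x *\<^sub>R f x) = (\<lambda>x. indicator (T - {p}) x *\<^sub>R f x + indicator {p} x * (f p :: real))"
  by (auto simp: indicator_def fun_eq_iff)

lemma lebesgue_on_remove_point:
  fixes f :: "'a::euclidean_space \<Rightarrow> real"
  assumes "T \<in> sets lebesgue" "p \<in> T" "integrable (lebesgue_on (T - {p})) f"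
  shows "integrable (lebesgue_on T) f"
    and "integral\<^sup>L (lebesgue_on T) f = integral\<^sup>L (lebesgue_on (T - {p})) f"
proof -
  have T: "T \<inter> space lebesgue \<in> sets lebesgue" "(T - {p}) \<inter> space lebesgue \<in> sets lebesgue"
    using assms(1) by auto
  have i1: "integrable lebesgue (\<lambda>x. indicator (T - {p}) x *\<^sub>R f x)"
    using assms(3) unfolding integrable_restrict_space[OF T(2)] .
  have i2: "integrable lebesgue (\<lambda>x. indicator {p} x * f p)"
    by (intro integrable_mult_left integrable_real_indicator) auto
  have "AE x in lebesgue. x \<noteq> p" by (rule AE_completion) (rule AE_lborel_singleton)
  then have 0: "integral\<^sup>L lebesgue (\<lambda>x. indicator {p} x * f p) = 0"
    by (intro integral_eq_zero_AE) (auto elim!: eventually_mono)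
  show "integrable (lebesgue_on T) f"
    unfolding integrable_restrict_space[OF T(1)] indicator_insert_point[OF assms(2)]
    by (rule Bochner_Integration.integrable_add[OF i1 i2])
  show "integral\<^sup>L (lebesgue_on T) f = integral\<^sup>L (lebesgue_on (T - {p})) f"
    unfolding integral_restrict_space[OF T(1)] integral_restrict_space[OF T(2)] indicator_insert_point[OF assms(2)]
    by (subst Bochner_Integration.integral_add[OF i1 i2]) (simp add: 0)
qed

text \<open>Radial weights are functions of ln \<rho>, which is singular at the origin, so the field
  lives on \<open>\<Omega> - {0}\<close>. A point is a null set, hence the conclusion can be stated
  on \<open>\<Omega>\<close>.\<close>

lemma integral_divergence:
  fixes \<Phi> \<Phi>' :: "'m::finite + 'k::finite \<Rightarrow> ('m, 'k) point \<Rightarrow> real"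
  assumes S: "open \<Omega>" "compact K" "K \<subseteq> \<Omega> - {0}"
    and c: "\<And>i. continuous_on (\<Omega> - {0}) (\<Phi> i)" "\<And>i. continuous_on (\<Omega> - {0}) (\<Phi>' i)"
    and 0: "\<And>i x. x \<in> \<Omega> - {0} - K \<Longrightarrow> \<Phi> i x = 0"
    and d: "\<And>i x. x \<in> \<Omega> - {0} \<Longrightarrow> dderiv (dir i) (\<Phi> i) (\<Phi>' i x) x"
    and g: "\<And>x. x \<in> \<Omega> - {0} \<Longrightarrow> (\<Sum>i\<in>UNIV. \<Phi>' i x) = g x"
  shows "integrable (lebesgue_on \<Omega>) g" "integral\<^sup>L (lebesgue_on \<Omega>) g = 0"
proof -
  let ?S = "\<Omega> - {0}"
  have o: "open ?S" using S by auto
  have i: "integrable (lebesgue_on ?S) (\<Phi>' i)" "integral\<^sup>L (lebesgue_on ?S) (\<Phi>' i) = 0" for i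
    using integral_dderiv[OF o S(2,3) c 0 d] by auto
  have i': "integrable (lebesgue_on ?S) (\<lambda>x. \<Sum>i\<in>UNIV. \<Phi>' i x)"
      "integral\<^sup>L (lebesgue_on ?S) (\<lambda>x. \<Sum>i\<in>UNIV. \<Phi>' i x) = 0"
    using i by (auto simp: Bochner_Integration.integral_sum)
  have sp: "space (lebesgue_on ?S) = ?S" by simp
  have ig: "integrable (lebesgue_on ?S) g"
    using i'(1) Bochner_Integration.integrable_cong[OF refl, of "lebesgue_on ?S" "\<lambda>x. \<Sum>i\<in>UNIV. \<Phi>' i x" g] g sp by blast
  have eg: "integral\<^sup>L (lebesgue_on ?S) g = 0"
    using i'(2) Bochner_Integration.integral_cong[OF refl, of "lebesgue_on ?S" "\<lambda>x. \<Sum>i\<in>UNIV. \<Phi>' i x" g] g sp by metis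
  have "integrable (lebesgue_on \<Omega>) g \<and> integral\<^sup>L (lebesgue_on \<Omega>) g = 0"
  proof (cases "0 \<in> \<Omega>")
    case True
    have "\<Omega> \<in> sets lebesgue" using S(1) by auto
    from lebesgue_on_remove_point[OF this True ig] eg show ?thesis by simp
  next
    case False
    then show ?thesis using ig eg by simp
  qed
  then show "integrable (lebesgue_on \<Omega>) g" "integral\<^sup>L (lebesgue_on \<Omega>) g = 0" by auto
qed

section \<open>Multiplier identities for smooth functions\<close>

text \<open>A function with two continuous derivatives and a radial weight supported away from the
  origin; \<open>K\<close> is a closed shell in all later uses.\<close>

locale smooth_radial =
  fixes \<alpha> :: real and \<Omega> K :: "('m::finite, 'k::finite) point set" and h :: "('m, 'k) point \<Rightarrow> real"
    and a a' :: "real \<Rightarrow> real"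
  assumes \<alpha>: "\<alpha> > 0" and \<Omega>: "open \<Omega>" and K: "compact K" "K \<subseteq> \<Omega> - {0}"
    and h: "C_k_on 2 h \<Omega>"
    and a: "\<And>s. (a has_real_derivative a' s) (at s)" and a': "continuous_on UNIV a'"
    and a0: "\<And>x. x \<in> \<Omega> - {0} - K \<Longrightarrow> a (lrho \<alpha> x) = 0"
begin

lemma differentiable_h: "x \<in> \<Omega> \<Longrightarrow> h differentiable (at x)"
  and C_1_pd: "C_k_on 1 (pd j h) \<Omega>"
  using h by (simp_all add: numeral_2_eq_2 pd_def[abs_def] del: split_paired_All)

lemma dderiv_h: "x \<in> \<Omega> \<Longrightarrow> dderiv (dir i) h (pd i h x) x"
  unfolding pd_def by (intro dderiv_frechet differentiable_h)

lemma dderiv_pd: "x \<in> \<Omega> \<Longrightarrow> dderiv (dir i) (pd j h) (pd i (pd j h) x) x"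
  unfolding pd_def[of i] using C_1_pd by (intro dderiv_frechet) (simp del: split_paired_All)

lemma pd_commute: "x \<in> \<Omega> \<Longrightarrow> pd i (pd j h) x = pd j (pd i h) x"
  unfolding pd_def[abs_def] by (rule frechet_derivative_symmetric[OF \<Omega> _ h])

lemma cont_h: "continuous_on (\<Omega> - {0}) h"
  and cont_pd: "continuous_on (\<Omega> - {0}) (pd j h)"
  and cont_pd2: "continuous_on (\<Omega> - {0}) (pd i (pd j h))"
proof -
  have 1: "C_k_on 1 (pd j h) \<Omega>" "C_k_on 0 (pd i (pd j h)) \<Omega>" for i j
    using C_1_pd[of j] by (simp_all add: pd_def[of i, abs_def] del: split_paired_All)
  show "continuous_on (\<Omega> - {0}) h" "continuous_on (\<Omega> - {0}) (pd j h)" "continuous_on (\<Omega> - {0}) (pd i (pd j h))"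
    using C_k_on_imp_continuous[OF \<Omega>] h 1 by (meson Diff_subset continuous_on_subset)+
qed

lemma cont_rad: "continuous_on (\<Omega> - {0}) (\<lambda>x. a (lrho \<alpha> x))"
  and cont_rad': "continuous_on (\<Omega> - {0}) (\<lambda>x. a' (lrho \<alpha> x))"
proof -
  have "continuous_on UNIV a" using a by (intro DERIV_continuous_on) auto
  then show "continuous_on (\<Omega> - {0}) (\<lambda>x. a (lrho \<alpha> x))" "continuous_on (\<Omega> - {0}) (\<lambda>x. a' (lrho \<alpha> x))"
    using a' by (auto intro!: continuous_on_compose2[OF _ continuous_on_lrho[OF \<alpha>]])
qed

lemma dil_eq: "dil \<alpha> f = (\<lambda>x. \<Sum>l\<in>UNIV. dilw \<alpha> l * ((x \<bullet> dir l) * pd l f x))"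
  by (simp add: dil_def[abs_def] mult.assoc)

lemma cont_dil: "continuous_on (\<Omega> - {0}) (dil \<alpha> h)"
  and cont_dil_pd: "continuous_on (\<Omega> - {0}) (dil \<alpha> (pd i h))"
  unfolding dil_eq by (intro continuous_intros cont_pd cont_pd2)+

lemma dderiv_dil:
  assumes "x \<in> \<Omega>"
  shows "dderiv (dir i) (dil \<alpha> h) (dilw \<alpha> i * pd i h x + dil \<alpha> (pd i h) x) x"
proof -
  have "dderiv (dir i) (dil \<alpha> h) (\<Sum>l\<in>UNIV. dilw \<alpha> l *
      ((if i = l then 1 else 0) * pd l h x + pd i (pd l h) x * (x \<bullet> dir l))) x"
    unfolding dil_eq by (intro dderiv_sum dderiv_cmult dderiv_mult dderiv_coord dderiv_pd assms)
  moreover have "(\<Sum>l\<in>UNIV. dilw \<alpha> l * ((if i = l then 1 else 0) * pd l h x + pd i (pd l h) x * (x \<bullet> dir l)))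
      = (\<Sum>l\<in>UNIV. (if i = l then dilw \<alpha> l * pd l h x else 0)) + dil \<alpha> (pd i h) x"
    unfolding dil_eq sum.distrib[symmetric]
    by (intro sum.cong refl) (simp add: pd_commute[OF assms, of i] algebra_simps)
  ultimately show ?thesis by simp
qed

lemma dderiv_rad: "x \<in> \<Omega> - {0} \<Longrightarrow> dderiv (dir i) (\<lambda>x. a (lrho \<alpha> x)) (a' (lrho \<alpha> x) * dlrho \<alpha> i x) x"
  by (rule dderiv_radial[OF \<alpha> _ a]) auto

lemmas conts = continuous_on_add continuous_on_diff continuous_on_mult continuous_on_const continuous_on_sum
  continuous_on_power continuous_on_inner continuous_on_id
  cont_h cont_pd cont_pd2 cont_rad cont_rad' cont_dil cont_dil_pd continuous_on_fldw[OF \<alpha>] continuous_on_cfld[OF \<alpha>]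
  continuous_on_dlrho[OF \<alpha>] continuous_on_radw[OF \<alpha>]

lemma sum_fldw_dlrho_pd:
  "(\<Sum>i\<in>UNIV. dlrho \<alpha> i x * (fldw \<alpha> i x * pd i h x)) = radw \<alpha> x * dil \<alpha> h x"
proof -
  have "(\<Sum>i\<in>UNIV. dlrho \<alpha> i x * (fldw \<alpha> i x * pd i h x)) = (\<Sum>i\<in>UNIV. radw \<alpha> x * (dilw \<alpha> i * (x \<bullet> dir i)) * pd i h x)"
    unfolding fldw_dlrho[OF \<alpha>, symmetric] by (intro sum.cong refl) (simp only: mult_ac)
  then show ?thesis by (simp add: dil_def sum_distrib_left mult.assoc)
qed

text \<open>This integrates the divergence of a (D h) X h minus half of a |X h|^2 times the dilation
  field. The second derivatives D (\<open>pd i h\<close>) cancel between the two, and of the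
  coefficient Q / 2 the commutator of X with D removes 1, which leaves (Q - 2) / 2.\<close>

lemma rellich_identity:
  defines "g \<equiv> \<lambda>x::('m, 'k) point. a (lrho \<alpha> x) * grushin \<alpha> h x * dil \<alpha> h x + a' (lrho \<alpha> x) * radw \<alpha> x * (dil \<alpha> h x)\<^sup>2
      - ((homdim \<alpha> TYPE('m) TYPE('k) - 2) / 2 * a (lrho \<alpha> x) + a' (lrho \<alpha> x) / 2) * gradsq \<alpha> h x"
  shows "integrable (lebesgue_on \<Omega>) g" "integral\<^sup>L (lebesgue_on \<Omega>) g = 0"
proof -
  define A A' where "A = (\<lambda>x::('m, 'k) point. a (lrho \<alpha> x))" and "A' = (\<lambda>x::('m, 'k) point. a' (lrho \<alpha> x))"
  define F where "F = (\<lambda>i (x::('m, 'k) point). A x * (fldw \<alpha> i x * (pd i h x * dil \<alpha> h x)))"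
  define F' where "F' = (\<lambda>i (x::('m, 'k) point). A' x * dlrho \<alpha> i x * (fldw \<alpha> i x * (pd i h x * dil \<alpha> h x))
     + A x * (fldw \<alpha> i x * (pd i (pd i h) x * dil \<alpha> h x + pd i h x * (dilw \<alpha> i * pd i h x + dil \<alpha> (pd i h) x))))"
  \<comment> \<open>The coordinate and \<open>fldw\<close> stay grouped, because only their product
    is differentiable in z across z = 0.\<close>
  define G where "G = (\<lambda>l (x::('m, 'k) point). \<Sum>i\<in>UNIV. dilw \<alpha> l / 2 * (A x * (((x \<bullet> dir l) * fldw \<alpha> i x) * (pd i h x)\<^sup>2)))"
  define G' where "G' = (\<lambda>l (x::('m, 'k) point). \<Sum>i\<in>UNIV. dilw \<alpha> l / 2 * (A' x * dlrho \<alpha> l x * (((x \<bullet> dir l) * fldw \<alpha> i x) * (pd i h x)\<^sup>2)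
     + A x * ((fldw \<alpha> i x + cfld \<alpha> l i x) * (pd i h x)\<^sup>2 + (x \<bullet> dir l) * fldw \<alpha> i x * (2 * pd i h x * pd l (pd i h) x))))"
  have dF: "dderiv (dir i) (F i) (F' i x) x" if "x \<in> \<Omega> - {0}" for i x
  proof -
    have x: "x \<in> \<Omega>" using that by auto
    have "dderiv (dir i) (F i) (A' x * dlrho \<alpha> i x * (fldw \<alpha> i x * (pd i h x * dil \<alpha> h x)) +
       (0 * (pd i h x * dil \<alpha> h x) + (pd i (pd i h) x * dil \<alpha> h x + (dilw \<alpha> i * pd i h x + dil \<alpha> (pd i h) x) * pd i h x) * fldw \<alpha> i x) * A x) x"
      unfolding F_def A_def A'_def
      by (intro dderiv_mult dderiv_rad dderiv_fldw_self dderiv_pd dderiv_dil that x)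
    then show ?thesis by (simp add: F'_def mult_ac)
  qed
  have dG: "dderiv (dir l) (G l) (G' l x) x" if "x \<in> \<Omega> - {0}" for l x
  proof -
    have x: "x \<in> \<Omega>" using that by auto
    have "dderiv (dir l) (G l) (\<Sum>i\<in>UNIV. dilw \<alpha> l / 2 * (A' x * dlrho \<alpha> l x * (((x \<bullet> dir l) * fldw \<alpha> i x) * (pd i h x)\<^sup>2)
       + ((fldw \<alpha> i x + cfld \<alpha> l i x) * (pd i h x)\<^sup>2 + (2 * pd i h x * pd l (pd i h) x) * ((x \<bullet> dir l) * fldw \<alpha> i x)) * A x)) x"
      unfolding G_def A_def A'_def
      by (intro dderiv_sum dderiv_cmult dderiv_mult dderiv_rad dderiv_coord_fldw dderiv_power2 dderiv_pd that x \<alpha>)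
    then show ?thesis by (simp add: G'_def mult_ac)
  qed
  have sF: "(\<Sum>i\<in>UNIV. F' i x) = A' x * radw \<alpha> x * (dil \<alpha> h x)\<^sup>2 + A x * grushin \<alpha> h x * dil \<alpha> h x
      + A x * (\<Sum>i\<in>UNIV. fldw \<alpha> i x * pd i h x * (dilw \<alpha> i * pd i h x + dil \<alpha> (pd i h) x))" for x
  proof -
    have "(\<Sum>i\<in>UNIV. F' i x) = (\<Sum>i\<in>UNIV. A' x * dil \<alpha> h x * (dlrho \<alpha> i x * (fldw \<alpha> i x * pd i h x)))
       + (\<Sum>i\<in>UNIV. A x * dil \<alpha> h x * (fldw \<alpha> i x * pd i (pd i h) x))
       + (\<Sum>i\<in>UNIV. A x * (fldw \<alpha> i x * pd i h x * (dilw \<alpha> i * pd i h x + dil \<alpha> (pd i h) x)))"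
      unfolding F'_def sum.distrib[symmetric] by (intro sum.cong refl) (simp add: algebra_simps)
    then show ?thesis
      by (simp add: sum_distrib_left[symmetric] sum_fldw_dlrho_pd grushin_def power2_eq_square mult_ac)
  qed
  have sG: "(\<Sum>l\<in>UNIV. G' l x) = (homdim \<alpha> TYPE('m) TYPE('k) / 2 * A x + A' x / 2) * gradsq \<alpha> h x
      + A x * (\<Sum>i\<in>UNIV. fldw \<alpha> i x * pd i h x * ((dilw \<alpha> i - 1) * pd i h x + dil \<alpha> (pd i h) x))"
    if "x \<in> \<Omega> - {0}" for x
  proof -
    have "(\<Sum>l\<in>UNIV. G' l x) = (\<Sum>i\<in>UNIV. (\<Sum>l\<in>UNIV.
        A' x / 2 * (fldw \<alpha> i x * (pd i h x)\<^sup>2) * (dilw \<alpha> l * (x \<bullet> dir l) * dlrho \<alpha> l x)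
        + A x / 2 * (fldw \<alpha> i x * (pd i h x)\<^sup>2) * dilw \<alpha> l
        + A x / 2 * (pd i h x)\<^sup>2 * (dilw \<alpha> l * cfld \<alpha> l i x)
        + A x * (fldw \<alpha> i x * pd i h x) * (dilw \<alpha> l * (x \<bullet> dir l) * pd l (pd i h) x)))"
      unfolding G'_def by (subst sum.swap) (intro sum.cong refl, simp add: field_simps)
    also have "\<dots> = (\<Sum>i\<in>UNIV. A' x / 2 * (fldw \<alpha> i x * (pd i h x)\<^sup>2) * 1
        + A x / 2 * (fldw \<alpha> i x * (pd i h x)\<^sup>2) * homdim \<alpha> TYPE('m) TYPE('k)
        + A x / 2 * (pd i h x)\<^sup>2 * ((2 * dilw \<alpha> i - 2) * fldw \<alpha> i x)
        + A x * (fldw \<alpha> i x * pd i h x) * dil \<alpha> (pd i h) x)"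
      using that by (simp only: sum.distrib sum_distrib_left[symmetric] sum_dilw sum_cfld[OF \<alpha>] dil_def[symmetric])
        (subst sum_dilw_dlrho[OF \<alpha>], auto)
    also have "\<dots> = (\<Sum>i\<in>UNIV. (homdim \<alpha> TYPE('m) TYPE('k) / 2 * A x + A' x / 2) * (fldw \<alpha> i x * (pd i h x)\<^sup>2))
        + (\<Sum>i\<in>UNIV. A x * (fldw \<alpha> i x * pd i h x * ((dilw \<alpha> i - 1) * pd i h x + dil \<alpha> (pd i h) x)))"
      unfolding sum.distrib[symmetric] by (intro sum.cong refl) (simp add: field_simps power2_eq_square)
    finally show ?thesis by (simp add: sum_distrib_left[symmetric] gradsq_def)
  qed
  have s: "(\<Sum>i\<in>UNIV. F' i x - G' i x) = g x" if "x \<in> \<Omega> - {0}" for x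
  proof -
    have "(\<Sum>i\<in>UNIV. fldw \<alpha> i x * pd i h x * (dilw \<alpha> i * pd i h x + dil \<alpha> (pd i h) x))
      = gradsq \<alpha> h x + (\<Sum>i\<in>UNIV. fldw \<alpha> i x * pd i h x * ((dilw \<alpha> i - 1) * pd i h x + dil \<alpha> (pd i h) x))"
      unfolding gradsq_def sum.distrib[symmetric] by (intro sum.cong refl) (simp add: algebra_simps power2_eq_square)
    then show ?thesis
      unfolding sum_subtractf sF sG[OF that] g_def by (simp only: A_def A'_def) (simp add: field_simps)
  qed
  have cF: "continuous_on (\<Omega> - {0}) (F i)" "continuous_on (\<Omega> - {0}) (F' i)"
     "continuous_on (\<Omega> - {0}) (G i)" "continuous_on (\<Omega> - {0}) (G' i)" for i
    unfolding F_def F'_def G_def G'_def A_def A'_def by (intro conts; simp)+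
  show "integrable (lebesgue_on \<Omega>) g" "integral\<^sup>L (lebesgue_on \<Omega>) g = 0"
    by (rule integral_divergence[OF \<Omega> K, of "\<lambda>i x. F i x - G i x" "\<lambda>i x. F' i x - G' i x"];
        (intro continuous_on_diff cF dderiv_diff dF dG s)?;
        simp add: F_def G_def A_def a0)+
qed

text \<open>The divergence of a h X h. Differentiating the weight contracts X (ln \<rho>) with X h,
  whence the factor W D h.\<close>

lemma energy_identity:
  defines "g \<equiv> \<lambda>x::('m, 'k) point. a (lrho \<alpha> x) * grushin \<alpha> h x * h x + a (lrho \<alpha> x) * gradsq \<alpha> h x
      + a' (lrho \<alpha> x) * radw \<alpha> x * h x * dil \<alpha> h x"
  shows "integrable (lebesgue_on \<Omega>) g" "integral\<^sup>L (lebesgue_on \<Omega>) g = 0"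
proof -
  define A A' where "A = (\<lambda>x::('m, 'k) point. a (lrho \<alpha> x))" and "A' = (\<lambda>x::('m, 'k) point. a' (lrho \<alpha> x))"
  define F where "F = (\<lambda>i (x::('m, 'k) point). A x * (fldw \<alpha> i x * (pd i h x * h x)))"
  define F' where "F' = (\<lambda>i (x::('m, 'k) point). A' x * dlrho \<alpha> i x * (fldw \<alpha> i x * (pd i h x * h x))
     + A x * (fldw \<alpha> i x * (pd i (pd i h) x * h x + pd i h x * pd i h x)))"
  have dF: "dderiv (dir i) (F i) (F' i x) x" if "x \<in> \<Omega> - {0}" for i x
  proof -
    have x: "x \<in> \<Omega>" using that by auto
    have "dderiv (dir i) (F i) (A' x * dlrho \<alpha> i x * (fldw \<alpha> i x * (pd i h x * h x)) +
       (0 * (pd i h x * h x) + (pd i (pd i h) x * h x + pd i h x * pd i h x) * fldw \<alpha> i x) * A x) x"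
      unfolding F_def A_def A'_def
      by (intro dderiv_mult dderiv_rad dderiv_fldw_self dderiv_pd dderiv_h that x)
    then show ?thesis by (simp add: F'_def mult_ac)
  qed
  have s: "(\<Sum>i\<in>UNIV. F' i x) = g x" for x
  proof -
    have "(\<Sum>i\<in>UNIV. F' i x) = (\<Sum>i\<in>UNIV. A' x * h x * (dlrho \<alpha> i x * (fldw \<alpha> i x * pd i h x)))
       + (\<Sum>i\<in>UNIV. A x * h x * (fldw \<alpha> i x * pd i (pd i h) x))
       + (\<Sum>i\<in>UNIV. A x * (fldw \<alpha> i x * (pd i h x)\<^sup>2))"
      unfolding F'_def sum.distrib[symmetric] by (intro sum.cong refl) (simp add: algebra_simps power2_eq_square)
    also have "\<dots> = A' x * h x * (radw \<alpha> x * dil \<alpha> h x) + A x * h x * grushin \<alpha> h x + A x * gradsq \<alpha> h x"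
      by (simp only: sum_distrib_left[symmetric] sum_fldw_dlrho_pd grushin_def gradsq_def)
    finally show ?thesis by (simp add: g_def A_def A'_def mult_ac)
  qed
  have cF: "continuous_on (\<Omega> - {0}) (F i)" "continuous_on (\<Omega> - {0}) (F' i)" for i
    unfolding F_def F'_def A_def A'_def by (intro conts; simp)+
  show "integrable (lebesgue_on \<Omega>) g" "integral\<^sup>L (lebesgue_on \<Omega>) g = 0"
    by (rule integral_divergence[OF \<Omega> K, of F F']; (intro cF dF s)?; simp add: F_def A_def a0)+
qed

text \<open>The divergence of a |z|^(2 \<alpha>) h^2 times the dilation field: Q comes from the
  field and 2 \<alpha> from the degree of the weight. The factor |z|^(2 \<alpha>) replaces W here;
  the radial denominator of W is put into \<open>a\<close> later.\<close>

lemma dilation_identity: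
  defines "P \<equiv> \<lambda>x::('m, 'k) point. norm (fst x) powr (2 * \<alpha>)"
  defines "g \<equiv> \<lambda>x::('m, 'k) point. P x * (2 * a (lrho \<alpha> x) * h x * dil \<alpha> h x
      + (a' (lrho \<alpha> x) + (homdim \<alpha> TYPE('m) TYPE('k) + 2 * \<alpha>) * a (lrho \<alpha> x)) * (h x)\<^sup>2)"
  shows "integrable (lebesgue_on \<Omega>) g" "integral\<^sup>L (lebesgue_on \<Omega>) g = 0"
proof -
  define A A' where "A = (\<lambda>x::('m, 'k) point. a (lrho \<alpha> x))" and "A' = (\<lambda>x::('m, 'k) point. a' (lrho \<alpha> x))"
  \<comment> \<open>For any t-index \<open>fldw\<close> is |z|^(2 \<alpha>), so the derivative rule
    for coordinate times \<open>fldw\<close> can be reused.\<close>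
  define i0 :: "'m + 'k" where "i0 = Inr undefined"
  define G where "G = (\<lambda>l (x::('m, 'k) point). dilw \<alpha> l * (A x * (((x \<bullet> dir l) * fldw \<alpha> i0 x) * (h x)\<^sup>2)))"
  define G' where "G' = (\<lambda>l (x::('m, 'k) point). dilw \<alpha> l * (A' x * dlrho \<alpha> l x * (((x \<bullet> dir l) * fldw \<alpha> i0 x) * (h x)\<^sup>2)
     + A x * ((fldw \<alpha> i0 x + cfld \<alpha> l i0 x) * (h x)\<^sup>2 + (x \<bullet> dir l) * fldw \<alpha> i0 x * (2 * h x * pd l h x))))"
  have dG: "dderiv (dir l) (G l) (G' l x) x" if "x \<in> \<Omega> - {0}" for l x
  proof -
    have x: "x \<in> \<Omega>" using that by auto
    have "dderiv (dir l) (G l) (dilw \<alpha> l * (A' x * dlrho \<alpha> l x * (((x \<bullet> dir l) * fldw \<alpha> i0 x) * (h x)\<^sup>2)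
       + ((fldw \<alpha> i0 x + cfld \<alpha> l i0 x) * (h x)\<^sup>2 + (2 * h x * pd l h x) * ((x \<bullet> dir l) * fldw \<alpha> i0 x)) * A x)) x"
      unfolding G_def A_def A'_def
      by (intro dderiv_cmult dderiv_mult dderiv_rad dderiv_coord_fldw dderiv_power2 dderiv_h that x \<alpha>)
    then show ?thesis by (simp add: G'_def mult_ac)
  qed
  have s: "(\<Sum>l\<in>UNIV. G' l x) = g x" if "x \<in> \<Omega> - {0}" for x
  proof -
    have "(\<Sum>l\<in>UNIV. G' l x) = (\<Sum>l\<in>UNIV.
        A' x * (fldw \<alpha> i0 x * (h x)\<^sup>2) * (dilw \<alpha> l * (x \<bullet> dir l) * dlrho \<alpha> l x)
        + A x * (fldw \<alpha> i0 x * (h x)\<^sup>2) * dilw \<alpha> l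
        + A x * (h x)\<^sup>2 * (dilw \<alpha> l * cfld \<alpha> l i0 x)
        + 2 * A x * (fldw \<alpha> i0 x * h x) * (dilw \<alpha> l * (x \<bullet> dir l) * pd l h x))"
      unfolding G'_def by (intro sum.cong refl) (simp add: field_simps)
    also have "\<dots> = A' x * (fldw \<alpha> i0 x * (h x)\<^sup>2) * 1
        + A x * (fldw \<alpha> i0 x * (h x)\<^sup>2) * homdim \<alpha> TYPE('m) TYPE('k)
        + A x * (h x)\<^sup>2 * ((2 * dilw \<alpha> i0 - 2) * fldw \<alpha> i0 x)
        + 2 * A x * (fldw \<alpha> i0 x * h x) * dil \<alpha> h x"
      using that by (simp only: sum.distrib sum_distrib_left[symmetric] sum_dilw sum_cfld[OF \<alpha>] dil_def[symmetric])
        (subst sum_dilw_dlrho[OF \<alpha>], auto)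
    finally show ?thesis by (simp add: g_def P_def i0_def A_def A'_def algebra_simps)
  qed
  have cG: "continuous_on (\<Omega> - {0}) (G i)" "continuous_on (\<Omega> - {0}) (G' i)" for i
    unfolding G_def G'_def A_def A'_def by (intro conts; simp)+
  show "integrable (lebesgue_on \<Omega>) g" "integral\<^sup>L (lebesgue_on \<Omega>) g = 0"
    by (rule integral_divergence[OF \<Omega> K, of G G']; (intro cG dG s)?; simp add: G_def A_def a0)+
qed

lemma integrable_compact_support:
  fixes f :: "('m, 'k) point \<Rightarrow> real"
  assumes "continuous_on (\<Omega> - {0}) f" "\<And>x. x \<in> \<Omega> - {0} - K \<Longrightarrow> f x = 0"
  shows "integrable (lebesgue_on \<Omega>) f"
proof -
  have "open (\<Omega> - {0})" using \<Omega> by auto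
  then have i: "integrable (lebesgue_on (\<Omega> - {0})) f"
    by (rule lebesgue_on_zero_extension(1)[OF _ K]) (use assms in auto)
  show ?thesis
  proof (cases "0 \<in> \<Omega>")
    case True
    have "\<Omega> \<in> sets lebesgue" using \<Omega> by auto
    from lebesgue_on_remove_point(1)[OF this True i] show ?thesis .
  qed (use i in simp)
qed

end

section \<open>The Hardy inequality in z\<close>

definition fw :: "real \<Rightarrow> 'm::finite + 'k::finite \<Rightarrow> ('m, 'k) point \<Rightarrow> real" where
  "fw \<alpha> i x = (case i of Inl _ \<Rightarrow> 1 | Inr _ \<Rightarrow> norm (fst x) powr \<alpha>)"

lemma fw_simps [simp]: "fw \<alpha> (Inl a) x = 1" "fw \<alpha> (Inr b) x = norm (fst x) powr \<alpha>"
  by (simp_all add: fw_def)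

lemma fw_sq: "(fw \<alpha> i x)\<^sup>2 = fldw \<alpha> i x"
  by (cases i) (auto simp: power2_eq_square powr_add[symmetric])

text \<open>The regularisation by \<tau> > 0 replaces the singular Hardy weight 1 / |z|^2 by a
  smooth bounded one; \<tau> is removed by monotone convergence after the limit in the Sobolev
  space.\<close>

lemma dderiv_resolvent_weight:
  fixes x :: "('m::finite, 'k::finite) point"
  assumes "\<tau> > 0"
  shows "dderiv (dir (Inl a)) (\<lambda>x. 1 / ((norm (fst x))\<^sup>2 + \<tau>)) (- 2 * (fst x $ a) * (1 / ((norm (fst x))\<^sup>2 + \<tau>))\<^sup>2) x"
proof -
  have p: "(norm (fst x))\<^sup>2 + \<tau> > 0" using assms by (simp add: add_nonneg_pos)
  have "((\<lambda>x::('m, 'k) point. (norm (fst x))\<^sup>2 + \<tau>) has_derivative (\<lambda>h. 2 * (fst x \<bullet> fst h))) (at x)"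
    unfolding power2_norm_eq_inner by (auto intro!: derivative_eq_intros simp: inner_commute)
  from dderiv_has_derivative[OF this, of "dir (Inl a)"]
  have 1: "dderiv (dir (Inl a)) (\<lambda>x::('m, 'k) point. (norm (fst x))\<^sup>2 + \<tau>) (2 * (fst x $ a)) x"
    by (simp add: inner_axis)
  have "((\<lambda>y. 1 / y) has_real_derivative - (1 / ((norm (fst x))\<^sup>2 + \<tau>))\<^sup>2) (at ((norm (fst x))\<^sup>2 + \<tau>))"
    using p by (auto intro!: derivative_eq_intros simp: power2_eq_square)
  from dderiv_chain[OF this 1] show ?thesis by (simp add: mult_ac)
qed

text \<open>\<open>hgrad \<alpha> i k' k a\<close> is the \<open>z\<^sub>a\<close>-derivative of \<open>fw \<alpha> i \<cdot> k\<close> off \<open>z = 0\<close>, where \<open>k'\<close> is the one of \<open>k\<close>.\<close>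

definition hgrad :: "real \<Rightarrow> 'm::finite + 'k::finite \<Rightarrow> ('m \<Rightarrow> ('m, 'k) point \<Rightarrow> real) \<Rightarrow> (('m, 'k) point \<Rightarrow> real) \<Rightarrow>
    'm \<Rightarrow> ('m, 'k) point \<Rightarrow> real" where
  "hgrad \<alpha> i k' k a x = fw \<alpha> i x * (k' a x + (dilw \<alpha> i - 1) * (fst x $ a) / (norm (fst x))\<^sup>2 * k x)"

lemma hgrad_Inl [simp]: "hgrad \<alpha> (Inl c) k' k a x = k' a x"
  by (simp add: hgrad_def)

context smooth_radial
begin

text \<open>The z-divergence of \<theta> a (\<open>fw \<alpha> j\<close> k)^2 z. The factor
  \<open>fw\<close> is included so that k = \<open>pd j h\<close> yields an identity for the field
  X_j h, while a z-index \<open>j\<close> gives one for \<open>k\<close> itself. The flux is written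
  with \<open>fldw\<close> and a coordinate, and is therefore differentiable across z = 0.\<close>

lemma hardy_identity:
  fixes k :: "('m, 'k) point \<Rightarrow> real" and k' :: "'m \<Rightarrow> ('m, 'k) point \<Rightarrow> real" and j :: "'m + 'k"
  assumes k: "\<And>x a. x \<in> \<Omega> - {0} \<Longrightarrow> dderiv (dir (Inl a)) k (k' a x) x"
    "continuous_on (\<Omega> - {0}) k" "\<And>a. continuous_on (\<Omega> - {0}) (k' a)" and \<tau>: "\<tau> > 0"
  defines "\<theta> \<equiv> \<lambda>x::('m, 'k) point. 1 / ((norm (fst x))\<^sup>2 + \<tau>)"
  defines "g \<equiv> \<lambda>x::('m, 'k) point. \<theta> x * a (lrho \<alpha> x) * (CARD('m) - 2 * (norm (fst x))\<^sup>2 * \<theta> x) * (fw \<alpha> j x * k x)\<^sup>2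
      + \<theta> x * (norm (fst x))\<^sup>2 * a' (lrho \<alpha> x) * radw \<alpha> x * (fw \<alpha> j x * k x)\<^sup>2
      + 2 * \<theta> x * a (lrho \<alpha> x) * (fw \<alpha> j x * k x) * (\<Sum>c\<in>UNIV. (fst x $ c) * hgrad \<alpha> j k' k c x)"
  shows "integrable (lebesgue_on \<Omega>) g" "integral\<^sup>L (lebesgue_on \<Omega>) g = 0"
proof -
  define A A' where "A = (\<lambda>x::('m, 'k) point. a (lrho \<alpha> x))" and "A' = (\<lambda>x::('m, 'k) point. a' (lrho \<alpha> x))"
  define F :: "'m + 'k \<Rightarrow> ('m, 'k) point \<Rightarrow> real" where
    "F = (\<lambda>i x. case i of Inr _ \<Rightarrow> 0 | Inl c \<Rightarrow>
       \<theta> x * (A x * (((x \<bullet> dir (Inl c :: 'm + 'k)) * fldw \<alpha> j x) * (k x)\<^sup>2)))"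
  define F' :: "'m + 'k \<Rightarrow> ('m, 'k) point \<Rightarrow> real" where
    "F' = (\<lambda>i x. case i of Inr _ \<Rightarrow> 0 | Inl c \<Rightarrow>
       (- 2 * (fst x $ c) * (\<theta> x)\<^sup>2) * (A x * (((fst x $ c) * fldw \<alpha> j x) * (k x)\<^sup>2))
       + \<theta> x * (A' x * dlrho \<alpha> (Inl c) x * (((fst x $ c) * fldw \<alpha> j x) * (k x)\<^sup>2)
         + A x * ((fldw \<alpha> j x + cfld \<alpha> (Inl c) j x) * (k x)\<^sup>2 + (fst x $ c) * fldw \<alpha> j x * (2 * k x * k' c x))))"
  have d: "dderiv (dir i) (F i) (F' i x) x" if "x \<in> \<Omega> - {0}" for i x
  proof (cases i)
    case (Inr b)
    then show ?thesis by (simp add: F_def F'_def dderiv_const)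
  next
    case (Inl c)
    have "dderiv (dir (Inl c)) (F (Inl c))
       ((- 2 * (fst x $ c) * (\<theta> x)\<^sup>2) * (A x * (((x \<bullet> dir (Inl c :: 'm + 'k)) * fldw \<alpha> j x) * (k x)\<^sup>2))
       + (A' x * dlrho \<alpha> (Inl c) x * (((x \<bullet> dir (Inl c :: 'm + 'k)) * fldw \<alpha> j x) * (k x)\<^sup>2)
         + ((fldw \<alpha> j x + cfld \<alpha> (Inl c) j x) * (k x)\<^sup>2 + (2 * k x * k' c x) * ((x \<bullet> dir (Inl c :: 'm + 'k)) * fldw \<alpha> j x)) * A x) * \<theta> x) x"
      unfolding F_def A_def A'_def \<theta>_def sum.case
      by (intro dderiv_mult dderiv_rad dderiv_coord_fldw dderiv_power2 dderiv_resolvent_weight k that \<alpha> \<tau>)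
    then show ?thesis using Inl by (simp add: F'_def mult_ac)
  qed
  have zc: "(\<Sum>c\<in>UNIV. (fst x $ c) * dlrho \<alpha> (Inl c) x) = (norm (fst x))\<^sup>2 * radw \<alpha> x" for x :: "('m, 'k) point"
  proof -
    have "(\<Sum>c\<in>UNIV. (fst x $ c) * dlrho \<alpha> (Inl c) x) = radw \<alpha> x * (\<Sum>c\<in>UNIV. (fst x $ c)\<^sup>2)"
      by (simp add: dlrho_def radw_def sum_distrib_left sum_divide_distrib power2_eq_square mult_ac)
    then show ?thesis by (simp add: sum_sq_vec mult.commute)
  qed
  have cs: "(\<Sum>c\<in>UNIV. cfld \<alpha> (Inl c) j x) = (2 * dilw \<alpha> j - 2) * fldw \<alpha> j x" for x
    unfolding sum_cfld[OF \<alpha>, symmetric] by (cases j) (simp_all add: sum_UNIV_Plus cfld_def)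
  have hg: "fw \<alpha> j x * k x * (\<Sum>c\<in>UNIV. (fst x $ c) * hgrad \<alpha> j k' k c x)
      = fldw \<alpha> j x * k x * (\<Sum>c\<in>UNIV. (fst x $ c) * k' c x) + (dilw \<alpha> j - 1) * fldw \<alpha> j x * (k x)\<^sup>2" for x
  proof -
    define R where "R = (\<Sum>c\<in>UNIV. (fst x $ c)\<^sup>2) / (norm (fst x))\<^sup>2"
    define B where "B = (\<Sum>c\<in>UNIV. (fst x $ c) * k' c x)"
    have "(\<Sum>c\<in>UNIV. (fst x $ c) * hgrad \<alpha> j k' k c x) = fw \<alpha> j x * (B + (dilw \<alpha> j - 1) * k x * R)"
      unfolding hgrad_def R_def B_def sum_divide_distrib sum_distrib_left sum.distrib[symmetric]
      by (intro sum.cong refl) (simp add: algebra_simps power2_eq_square)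
    \<comment> \<open>At z = 0 the quotient \<open>R\<close> is 0 instead of 1; the equation
      survives because then \<open>fldw\<close> vanishes for a t-index, and
      \<open>dilw \<alpha> j - 1\<close> vanishes for a z-index.\<close>
    moreover have "(dilw \<alpha> j - 1) * fldw \<alpha> j x * R = (dilw \<alpha> j - 1) * fldw \<alpha> j x"
      unfolding R_def by (cases "fst x = 0"; cases j) (auto simp: sum_sq_vec)
    ultimately show ?thesis
      unfolding fw_sq[symmetric] B_def[symmetric] by algebra
  qed
  have s: "(\<Sum>i\<in>UNIV. F' i x) = g x" for x
  proof -
    have "(\<Sum>i\<in>UNIV. F' i x) = (\<Sum>c\<in>UNIV. - 2 * (\<theta> x)\<^sup>2 * A x * fldw \<alpha> j x * (k x)\<^sup>2 * (fst x $ c)\<^sup>2)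
       + (\<Sum>c\<in>UNIV. \<theta> x * A' x * fldw \<alpha> j x * (k x)\<^sup>2 * ((fst x $ c) * dlrho \<alpha> (Inl c) x))
       + (\<Sum>c\<in>(UNIV::'m set). \<theta> x * A x * fldw \<alpha> j x * (k x)\<^sup>2)
       + (\<Sum>c\<in>UNIV. \<theta> x * A x * (k x)\<^sup>2 * cfld \<alpha> (Inl c) j x)
       + (\<Sum>c\<in>UNIV. 2 * \<theta> x * A x * fldw \<alpha> j x * k x * ((fst x $ c) * k' c x))"
      unfolding F'_def sum.distrib[symmetric] sum_UNIV_Plus sum.case
      by (simp del: sum_constant, intro sum.cong refl) (simp add: algebra_simps power2_eq_square)
    also have "\<dots> = - 2 * (\<theta> x)\<^sup>2 * A x * fldw \<alpha> j x * (k x)\<^sup>2 * (norm (fst x))\<^sup>2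
       + \<theta> x * A' x * fldw \<alpha> j x * (k x)\<^sup>2 * ((norm (fst x))\<^sup>2 * radw \<alpha> x)
       + CARD('m) * (\<theta> x * A x * fldw \<alpha> j x * (k x)\<^sup>2)
       + \<theta> x * A x * (k x)\<^sup>2 * ((2 * dilw \<alpha> j - 2) * fldw \<alpha> j x)
       + 2 * \<theta> x * A x * (fldw \<alpha> j x * k x * (\<Sum>c\<in>UNIV. (fst x $ c) * k' c x))"
      by (simp only: sum_distrib_left[symmetric] zc cs sum_sq_vec sum_constant) (simp add: mult.assoc)
    also have "fldw \<alpha> j x * k x * (\<Sum>c\<in>UNIV. (fst x $ c) * k' c x) =
        fw \<alpha> j x * k x * (\<Sum>c\<in>UNIV. (fst x $ c) * hgrad \<alpha> j k' k c x) - (dilw \<alpha> j - 1) * fldw \<alpha> j x * (k x)\<^sup>2"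
      using hg[of x] by simp
    finally show ?thesis
      unfolding g_def power_mult_distrib fw_sq by (simp add: A_def A'_def algebra_simps power2_eq_square)
  qed
  have c\<theta>: "continuous_on (\<Omega> - {0}) \<theta>"
  proof -
    have "(norm (fst x))\<^sup>2 + \<tau> \<noteq> 0" for x :: "('m, 'k) point" using \<tau>
      by (metis add_nonneg_pos less_irrefl zero_le_power2)
    then show ?thesis unfolding \<theta>_def by (intro continuous_intros) auto
  qed
  have cF: "continuous_on (\<Omega> - {0}) (F i)" "continuous_on (\<Omega> - {0}) (F' i)" for i
  proof -
    show "continuous_on (\<Omega> - {0}) (F i)"
      by (cases i; simp only: F_def A_def A'_def sum.case; (intro conts c\<theta> k; simp))
    show "continuous_on (\<Omega> - {0}) (F' i)"
      by (cases i; simp only: F'_def A_def A'_def sum.case; (intro conts continuous_on_minus continuous_on_component continuous_on_fst c\<theta> k; simp))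
  qed
  show "integrable (lebesgue_on \<Omega>) g" "integral\<^sup>L (lebesgue_on \<Omega>) g = 0"
    by (rule integral_divergence[OF \<Omega> K, of F F']; (intro cF d s)?; simp add: F_def A_def a0 split: sum.split)+
qed

text \<open>For m \<ge> 3 the leading coefficient m - 2 |z|^2 \<theta> is at least 1. Twice the
  identity is used: one half of its leading term absorbs the cross term by 4 |q S| \<le> q^2 + 4 S^2
  and S^2 \<le> |z|^2 T, the other half is the left-hand side.\<close>

lemma hardy_inequality:
  fixes k :: "('m, 'k) point \<Rightarrow> real" and k' :: "'m \<Rightarrow> ('m, 'k) point \<Rightarrow> real" and j :: "'m + 'k"
  assumes k: "\<And>x a. x \<in> \<Omega> - {0} \<Longrightarrow> dderiv (dir (Inl a)) k (k' a x) x"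
    "continuous_on (\<Omega> - {0}) k" "\<And>a. continuous_on (\<Omega> - {0}) (k' a)" and \<tau>: "\<tau> > 0"
    and m: "CARD('m) \<ge> 3" and a_nonneg: "\<And>s. 0 \<le> a s"
    and a'0: "\<And>x. x \<in> \<Omega> - {0} - K \<Longrightarrow> a' (lrho \<alpha> x) = 0"
    and int: "integrable (lebesgue_on \<Omega>) (\<lambda>x. a (lrho \<alpha> x) * (\<Sum>c\<in>UNIV. (hgrad \<alpha> j k' k c x)\<^sup>2))"
  shows "integral\<^sup>L (lebesgue_on \<Omega>) (\<lambda>x. a (lrho \<alpha> x) * (fw \<alpha> j x * k x)\<^sup>2 / ((norm (fst x))\<^sup>2 + \<tau>))
    \<le> 4 * integral\<^sup>L (lebesgue_on \<Omega>) (\<lambda>x. a (lrho \<alpha> x) * (\<Sum>c\<in>UNIV. (hgrad \<alpha> j k' k c x)\<^sup>2))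
      + 2 * integral\<^sup>L (lebesgue_on \<Omega>) (\<lambda>x. \<bar>a' (lrho \<alpha> x)\<bar> * radw \<alpha> x * (fw \<alpha> j x * k x)\<^sup>2)"
    (is "integral\<^sup>L ?M ?l \<le> 4 * integral\<^sup>L ?M ?r1 + 2 * integral\<^sup>L ?M ?r2")
proof -
  note id = hardy_identity[OF k \<tau>, of j]
  define \<theta> where "\<theta> = (\<lambda>x::('m, 'k) point. 1 / ((norm (fst x))\<^sup>2 + \<tau>))"
  define g where "g = (\<lambda>x::('m, 'k) point. \<theta> x * a (lrho \<alpha> x) * (CARD('m) - 2 * (norm (fst x))\<^sup>2 * \<theta> x) * (fw \<alpha> j x * k x)\<^sup>2
      + \<theta> x * (norm (fst x))\<^sup>2 * a' (lrho \<alpha> x) * radw \<alpha> x * (fw \<alpha> j x * k x)\<^sup>2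
      + 2 * \<theta> x * a (lrho \<alpha> x) * (fw \<alpha> j x * k x) * (\<Sum>c\<in>UNIV. (fst x $ c) * hgrad \<alpha> j k' k c x))"
  have g: "integrable ?M g" "integral\<^sup>L ?M g = 0"
    using id unfolding g_def \<theta>_def by auto
  have p: "(norm (fst x))\<^sup>2 + \<tau> > 0" for x :: "('m, 'k) point" using \<tau> by (simp add: add_nonneg_pos)
  have sq: "(fw \<alpha> j x * k x)\<^sup>2 = fldw \<alpha> j x * (k x)\<^sup>2" for x
    by (simp add: power_mult_distrib fw_sq)
  have il: "integrable ?M ?l"
  proof (rule integrable_compact_support)
    show "continuous_on (\<Omega> - {0}) ?l"
      unfolding sq by (intro continuous_on_divide conts k continuous_on_norm continuous_on_fst)
        (use p in \<open>auto simp: less_imp_neq[THEN not_sym]\<close>)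
  qed (simp add: a0)
  have ir: "integrable ?M ?r2"
  proof (rule integrable_compact_support)
    show "continuous_on (\<Omega> - {0}) ?r2"
      unfolding sq by (intro continuous_on_rabs conts k) auto
  qed (simp add: a'0)
  have pt: "?l x \<le> 2 * g x + (4 * ?r1 x + 2 * ?r2 x)" for x
  proof -
    define z2 A q S T where "z2 = (norm (fst x))\<^sup>2" and "A = a (lrho \<alpha> x)" and "q = fw \<alpha> j x * k x"
      and "S = (\<Sum>c\<in>UNIV. (fst x $ c) * hgrad \<alpha> j k' k c x)" and "T = (\<Sum>c\<in>UNIV. (hgrad \<alpha> j k' k c x)\<^sup>2)"
    have A: "A \<ge> 0" by (simp add: A_def a_nonneg)
    have t: "\<theta> x > 0" "z2 * \<theta> x \<le> 1" "z2 \<ge> 0" using p[of x] \<tau> by (auto simp: \<theta>_def z2_def field_simps)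
    have W: "radw \<alpha> x \<ge> 0" by (simp add: radw_def gaugeN_nonneg)
    have "S\<^sup>2 \<le> (\<Sum>c\<in>UNIV. (fst x $ c)\<^sup>2) * T"
      unfolding S_def T_def by (rule Cauchy_Schwarz_ineq_sum)
    then have S: "S\<^sup>2 \<le> z2 * T" by (simp add: sum_sq_vec z2_def)
    have T: "T \<ge> 0" by (simp add: T_def sum_nonneg)
    have "- (4 * q * S) \<le> q\<^sup>2 + 4 * S\<^sup>2" using zero_le_power2[of "q + 2 * S"] by (simp add: power2_sum)
    then have "- (4 * q * S) \<le> q\<^sup>2 + 4 * (z2 * T)" using S by linarith
    then have "\<theta> x * A * (- (4 * q * S)) \<le> \<theta> x * A * (q\<^sup>2 + 4 * (z2 * T))"
      using t A by (intro mult_left_mono) auto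
    moreover have "z2 * \<theta> x * (4 * (A * T)) \<le> 1 * (4 * (A * T))"
      using mult_right_mono[OF t(2), of "4 * (A * T)"] A T by simp
    moreover have "\<theta> x * A * (q\<^sup>2 + 4 * (z2 * T)) = \<theta> x * A * q\<^sup>2 + z2 * \<theta> x * (4 * (A * T))"
      by (simp add: algebra_simps)
    ultimately have 1: "\<theta> x * A * (- (4 * q * S)) \<le> \<theta> x * A * q\<^sup>2 + 4 * (A * T)" by linarith
    have "- a' (lrho \<alpha> x) * (\<theta> x * z2) \<le> \<bar>a' (lrho \<alpha> x)\<bar> * 1"
      using t by (intro mult_mono) (auto simp: mult.commute)
    from mult_right_mono[OF this, of "radw \<alpha> x * q\<^sup>2"]
    have 2: "- (\<theta> x * z2 * a' (lrho \<alpha> x) * radw \<alpha> x * q\<^sup>2) \<le> \<bar>a' (lrho \<alpha> x)\<bar> * radw \<alpha> x * q\<^sup>2"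
      using W by (simp add: mult_ac)
    have "1 \<le> real CARD('m) - 2 * z2 * \<theta> x" using m t(2) by linarith
    from mult_right_mono[OF this, of "\<theta> x * A * q\<^sup>2"]
    have 3: "\<theta> x * A * q\<^sup>2 \<le> \<theta> x * A * (CARD('m) - 2 * z2 * \<theta> x) * q\<^sup>2"
      using t A by (simp add: mult_ac)
    have "?l x = \<theta> x * A * q\<^sup>2" by (simp add: \<theta>_def A_def q_def)
    moreover have "g x = \<theta> x * A * (CARD('m) - 2 * z2 * \<theta> x) * q\<^sup>2 + \<theta> x * z2 * a' (lrho \<alpha> x) * radw \<alpha> x * q\<^sup>2 + 2 * \<theta> x * A * q * S"
      by (simp add: g_def z2_def A_def q_def S_def)
    moreover have "?r1 x = A * T" "?r2 x = \<bar>a' (lrho \<alpha> x)\<bar> * radw \<alpha> x * q\<^sup>2" by (simp_all add: A_def T_def q_def)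
    moreover have "\<theta> x * A * (- (4 * q * S)) = - 2 * (2 * \<theta> x * A * q * S)" by simp
    ultimately show ?thesis using 1 2 3 by linarith
  qed
  have "integral\<^sup>L ?M ?l \<le> integral\<^sup>L ?M (\<lambda>x. 2 * g x + (4 * ?r1 x + 2 * ?r2 x))"
    by (rule integral_mono[OF il _ pt]) (use g int ir in auto)
  also have "\<dots> = 4 * integral\<^sup>L ?M ?r1 + 2 * integral\<^sup>L ?M ?r2"
    using g int ir by simp
  finally show ?thesis .
qed

end

section \<open>Convergence in the space of square-integrable functions\<close>

definition L2 :: "'a measure \<Rightarrow> ('a \<Rightarrow> real) \<Rightarrow> bool" where
  "L2 M f \<longleftrightarrow> f \<in> borel_measurable M \<and> integrable M (\<lambda>x. (f x)\<^sup>2)"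

lemma L2_measurable [measurable_dest]: "L2 M f \<Longrightarrow> f \<in> borel_measurable M"
  by (simp add: L2_def)

lemma L2_sq_integrable: "L2 M f \<Longrightarrow> integrable M (\<lambda>x. (f x)\<^sup>2)"
  by (simp add: L2_def)

lemma L2_zero: "L2 M (\<lambda>_. 0)"
  by (simp add: L2_def)

lemma L2_mult_integrable:
  assumes f: "L2 M f" and g: "L2 M g"
  shows "integrable M (\<lambda>x. f x * g x)"
proof (rule Bochner_Integration.integrable_bound)
  show "integrable M (\<lambda>x. (f x)\<^sup>2 + (g x)\<^sup>2)" using f g by (auto simp: L2_def)
  show "(\<lambda>x. f x * g x) \<in> borel_measurable M"
    using f g unfolding L2_def by (intro borel_measurable_times) auto
  have "\<bar>a * b\<bar> \<le> a\<^sup>2 + b\<^sup>2" for a b :: real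
    using sum_squares_bound[of "\<bar>a\<bar>" "\<bar>b\<bar>"] mult_nonneg_nonneg[OF abs_ge_zero[of a] abs_ge_zero[of b]]
    unfolding abs_mult power2_abs by linarith
  then show "AE x in M. norm (f x * g x) \<le> norm ((f x)\<^sup>2 + (g x)\<^sup>2)" by simp
qed

lemma L2_add: "L2 M f \<Longrightarrow> L2 M g \<Longrightarrow> L2 M (\<lambda>x. f x + g x)"
  using L2_mult_integrable[of M f g] by (auto simp: L2_def power2_sum mult.assoc)

lemma L2_bounded_mult:
  assumes f: "L2 M f" and w: "w \<in> borel_measurable M" "\<And>x. x \<in> space M \<Longrightarrow> \<bar>w x\<bar> \<le> B"
  shows "L2 M (\<lambda>x. w x * f x)"
proof -
  have "integrable M (\<lambda>x. (w x * f x)\<^sup>2)"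
  proof (rule Bochner_Integration.integrable_bound)
    show "integrable M (\<lambda>x. B\<^sup>2 * (f x)\<^sup>2)" using f by (auto simp: L2_def)
    show "(\<lambda>x. (w x * f x)\<^sup>2) \<in> borel_measurable M"
      using f w(1) unfolding L2_def by (intro borel_measurable_power borel_measurable_times) auto
    have "(w x)\<^sup>2 \<le> B\<^sup>2" if "x \<in> space M" for x using power_mono[OF w(2)[OF that] abs_ge_zero, of 2] by simp
    then show "AE x in M. norm ((w x * f x)\<^sup>2) \<le> norm (B\<^sup>2 * (f x)\<^sup>2)"
      by (auto simp: power_mult_distrib mult_right_mono)
  qed
  with f w(1) show ?thesis unfolding L2_def by auto
qed

lemma L2_cmult: "L2 M f \<Longrightarrow> L2 M (\<lambda>x. c * f x)"
  by (rule L2_bounded_mult[where B = "\<bar>c\<bar>"]) auto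

lemma L2_diff: "L2 M f \<Longrightarrow> L2 M g \<Longrightarrow> L2 M (\<lambda>x. f x - g x)"
  using L2_add[of M f "\<lambda>x. (-1) * g x"] L2_cmult[of M g "-1"] by simp

lemma L2_cong_AE:
  assumes "L2 M f" "g \<in> borel_measurable M" "AE x in M. f x = g x"
  shows "L2 M g"
proof -
  have "integrable M (\<lambda>x. (g x)\<^sup>2)"
    by (rule integrable_cong_AE_imp[OF L2_sq_integrable[OF assms(1)]]) (use assms in auto)
  with assms(2) show ?thesis by (simp add: L2_def)
qed

lemma L2_Cauchy_Schwarz:
  assumes f: "L2 M f" and g: "L2 M g"
  shows "(integral\<^sup>L M (\<lambda>x. f x * g x))\<^sup>2 \<le> integral\<^sup>L M (\<lambda>x. (f x)\<^sup>2) * integral\<^sup>L M (\<lambda>x. (g x)\<^sup>2)"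
proof -
  define A B C where "A = integral\<^sup>L M (\<lambda>x. (f x)\<^sup>2)" and "B = integral\<^sup>L M (\<lambda>x. (g x)\<^sup>2)"
    and "C = integral\<^sup>L M (\<lambda>x. f x * g x)"
  note i = L2_sq_integrable[OF f] L2_sq_integrable[OF g] L2_mult_integrable[OF f g]
  have quad: "0 \<le> s\<^sup>2 * A + 2 * s * t * C + t\<^sup>2 * B" for s t
  proof -
    have "0 \<le> integral\<^sup>L M (\<lambda>x. (s * f x + t * g x)\<^sup>2)" by (intro integral_nonneg_AE) auto
    also have "(\<lambda>x. (s * f x + t * g x)\<^sup>2) = (\<lambda>x. s\<^sup>2 * (f x)\<^sup>2 + 2 * s * t * (f x * g x) + t\<^sup>2 * (g x)\<^sup>2)"
      by (simp add: power2_eq_square algebra_simps fun_eq_iff)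
    also have "integral\<^sup>L M \<dots> = s\<^sup>2 * A + 2 * s * t * C + t\<^sup>2 * B"
      using i by (simp add: A_def B_def C_def)
    finally show ?thesis .
  qed
  have A: "A \<ge> 0" unfolding A_def by (intro integral_nonneg_AE) auto
  show ?thesis
  proof (cases "A = 0")
    case True
    have "C = 0"
    proof (rule ccontr)
      assume "C \<noteq> 0"
      \<comment> \<open>With A = 0 the quadratic form is affine in \<open>s\<close>, and this choice
        of \<open>s\<close> gives it the value -1.\<close>
      have "0 \<le> 2 * (- (B + 1) / (2 * C)) * 1 * C + 1\<^sup>2 * B" using quad[of "- (B + 1) / (2 * C)" 1] True by simp
      then show False using \<open>C \<noteq> 0\<close> by (simp add: field_simps)
    qed
    then show ?thesis using True by (simp add: A_def B_def C_def)
  next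
    case False
    have "0 \<le> C\<^sup>2 * A - 2 * C * A * C + A\<^sup>2 * B" using quad[of "- C" A] by (simp add: mult.assoc)
    then have "0 \<le> A * (A * B - C\<^sup>2)" by (simp add: power2_eq_square algebra_simps)
    then have "0 \<le> A * B - C\<^sup>2" using A False by (simp add: zero_le_mult_iff)
    then show ?thesis by (simp add: A_def B_def C_def)
  qed
qed

definition L2lim :: "'a measure \<Rightarrow> (nat \<Rightarrow> 'a \<Rightarrow> real) \<Rightarrow> ('a \<Rightarrow> real) \<Rightarrow> bool" where
  "L2lim M F f \<longleftrightarrow> (\<forall>n. L2 M (F n)) \<and> L2 M f \<and> (\<lambda>n. integral\<^sup>L M (\<lambda>x. (F n x - f x)\<^sup>2)) \<longlonglongrightarrow> 0"

lemma L2limD: "L2lim M F f \<Longrightarrow> L2 M (F n)" "L2lim M F f \<Longrightarrow> L2 M f"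
  "L2lim M F f \<Longrightarrow> (\<lambda>n. integral\<^sup>L M (\<lambda>x. (F n x - f x)\<^sup>2)) \<longlonglongrightarrow> 0"
  by (auto simp: L2lim_def)

lemma L2limI_bound:
  assumes "\<And>n. L2 M (F n)" "L2 M f"
    and "\<And>n. integral\<^sup>L M (\<lambda>x. (F n x - f x)\<^sup>2) \<le> e n" "e \<longlonglongrightarrow> 0"
  shows "L2lim M F f"
proof -
  have "(\<lambda>n. integral\<^sup>L M (\<lambda>x. (F n x - f x)\<^sup>2)) \<longlonglongrightarrow> 0"
    by (rule tendsto_sandwich[OF _ _ tendsto_const assms(4)])
      (use assms(3) in \<open>auto intro!: always_eventually integral_nonneg_AE\<close>)
  with assms(1,2) show ?thesis by (simp add: L2lim_def)
qed

lemma L2lim_const: "L2 M f \<Longrightarrow> L2lim M (\<lambda>_. f) f"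
  by (simp add: L2lim_def)

lemma L2lim_bounded_mult:
  assumes F: "L2lim M F f" and w: "w \<in> borel_measurable M" "\<And>x. x \<in> space M \<Longrightarrow> \<bar>w x\<bar> \<le> B"
  shows "L2lim M (\<lambda>n x. w x * F n x) (\<lambda>x. w x * f x)"
proof (rule L2limI_bound)
  note L = L2limD[OF F]
  show "L2 M (\<lambda>x. w x * F n x)" "L2 M (\<lambda>x. w x * f x)" for n
    by (rule L2_bounded_mult[OF _ w]; use L in auto)+
  show "(\<lambda>n. B\<^sup>2 * integral\<^sup>L M (\<lambda>x. (F n x - f x)\<^sup>2)) \<longlonglongrightarrow> 0"
    using tendsto_mult[OF tendsto_const L(3)] by simp
  show "integral\<^sup>L M (\<lambda>x. (w x * F n x - w x * f x)\<^sup>2) \<le> B\<^sup>2 * integral\<^sup>L M (\<lambda>x. (F n x - f x)\<^sup>2)" for n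
  proof -
    have d: "L2 M (\<lambda>x. F n x - f x)" by (intro L2_diff L)
    have i: "integrable M (\<lambda>x. (F n x - f x)\<^sup>2)" "integrable M (\<lambda>x. (w x * (F n x - f x))\<^sup>2)"
      by (rule L2_sq_integrable[OF d], rule L2_sq_integrable[OF L2_bounded_mult[OF d w]])
    have "(w x)\<^sup>2 \<le> B\<^sup>2" if "x \<in> space M" for x using power_mono[OF w(2)[OF that] abs_ge_zero, of 2] by simp
    then have "integral\<^sup>L M (\<lambda>x. (w x * (F n x - f x))\<^sup>2) \<le> integral\<^sup>L M (\<lambda>x. B\<^sup>2 * (F n x - f x)\<^sup>2)"
      using i by (intro integral_mono) (auto simp: power_mult_distrib mult_right_mono)
    then show ?thesis by (simp add: right_diff_distrib)
  qed
qed

lemma L2lim_add: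
  assumes F: "L2lim M F f" and G: "L2lim M G g"
  shows "L2lim M (\<lambda>n x. F n x + G n x) (\<lambda>x. f x + g x)"
proof (rule L2limI_bound)
  note L = L2limD[OF F] L2limD[OF G]
  show "L2 M (\<lambda>x. F n x + G n x)" "L2 M (\<lambda>x. f x + g x)" for n
    by (intro L2_add L)+
  show "(\<lambda>n. 2 * integral\<^sup>L M (\<lambda>x. (F n x - f x)\<^sup>2) + 2 * integral\<^sup>L M (\<lambda>x. (G n x - g x)\<^sup>2)) \<longlonglongrightarrow> 0"
    using tendsto_add[OF tendsto_mult[OF tendsto_const L(3)] tendsto_mult[OF tendsto_const L(6)], of 2 2] by simp
  show "integral\<^sup>L M (\<lambda>x. (F n x + G n x - (f x + g x))\<^sup>2)
      \<le> 2 * integral\<^sup>L M (\<lambda>x. (F n x - f x)\<^sup>2) + 2 * integral\<^sup>L M (\<lambda>x. (G n x - g x)\<^sup>2)" for n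
  proof -
    have i: "integrable M (\<lambda>x. (F n x - f x)\<^sup>2)" "integrable M (\<lambda>x. (G n x - g x)\<^sup>2)"
       "integrable M (\<lambda>x. (F n x + G n x - (f x + g x))\<^sup>2)"
      by (intro L2_sq_integrable L2_diff L2_add L)+
    have "(a + b - (c + d))\<^sup>2 \<le> 2 * (a - c)\<^sup>2 + 2 * (b - d)\<^sup>2" for a b c d :: real
      using zero_le_power2[of "(a - c) - (b - d)"] by (simp add: power2_eq_square algebra_simps)
    then have "integral\<^sup>L M (\<lambda>x. (F n x + G n x - (f x + g x))\<^sup>2)
       \<le> integral\<^sup>L M (\<lambda>x. 2 * (F n x - f x)\<^sup>2 + 2 * (G n x - g x)\<^sup>2)"
      using i by (intro integral_mono) auto
    then show ?thesis using i by simp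
  qed
qed

lemma L2lim_cmult: "L2lim M F f \<Longrightarrow> L2lim M (\<lambda>n x. c * F n x) (\<lambda>x. c * f x)"
  by (rule L2lim_bounded_mult[where B = "\<bar>c\<bar>"]) auto

lemma L2lim_sum:
  "(\<And>i. i \<in> I \<Longrightarrow> L2lim M (F i) (f i)) \<Longrightarrow> L2lim M (\<lambda>n x. \<Sum>i\<in>I. F i n x) (\<lambda>x. \<Sum>i\<in>I. f i x)"
  by (induction I rule: infinite_finite_induct) (auto intro: L2lim_add L2lim_const L2_zero)

text \<open>Expanding (f + D) (g + E) leaves three remainders, each with a factor whose norm tends
  to 0.\<close>

lemma L2lim_inner:
  assumes F: "L2lim M F f" and G: "L2lim M G g"
  shows "(\<lambda>n. integral\<^sup>L M (\<lambda>x. F n x * G n x)) \<longlonglongrightarrow> integral\<^sup>L M (\<lambda>x. f x * g x)"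
proof -
  note L = L2limD[OF F] L2limD[OF G]
  define D where "D = (\<lambda>n x. F n x - f x)"
  define E where "E = (\<lambda>n x. G n x - g x)"
  have dD: "L2 M (D n)" and dE: "L2 M (E n)" for n unfolding D_def E_def by (intro L2_diff L)+
  have lim: "(\<lambda>n. integral\<^sup>L M (\<lambda>x. p n x * q n x)) \<longlonglongrightarrow> 0"
    if p: "\<And>n. L2 M (p n)" and q: "\<And>n. L2 M (q n)"
      and 0: "(\<lambda>n. integral\<^sup>L M (\<lambda>x. (p n x)\<^sup>2) * integral\<^sup>L M (\<lambda>x. (q n x)\<^sup>2)) \<longlonglongrightarrow> 0" for p q
  proof -
    have "(\<lambda>n. (integral\<^sup>L M (\<lambda>x. p n x * q n x))\<^sup>2) \<longlonglongrightarrow> 0"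
      by (rule tendsto_sandwich[OF _ _ tendsto_const 0])
        (use L2_Cauchy_Schwarz[OF p q] in \<open>auto intro!: always_eventually\<close>)
    from tendsto_real_sqrt[OF this] show ?thesis
      by (simp add: tendsto_rabs_zero_iff)
  qed
  have d0: "(\<lambda>n. integral\<^sup>L M (\<lambda>x. (D n x)\<^sup>2)) \<longlonglongrightarrow> 0" "(\<lambda>n. integral\<^sup>L M (\<lambda>x. (E n x)\<^sup>2)) \<longlonglongrightarrow> 0"
    using L(3,6) by (simp_all add: D_def E_def)
  have 1: "(\<lambda>n. integral\<^sup>L M (\<lambda>x. D n x * E n x)) \<longlonglongrightarrow> 0"
    using tendsto_mult[OF d0] by (intro lim dD dE) simp
  have 2: "(\<lambda>n. integral\<^sup>L M (\<lambda>x. f x * E n x)) \<longlonglongrightarrow> 0"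
    using tendsto_mult[OF tendsto_const d0(2)] by (intro lim L dE) simp
  have 3: "(\<lambda>n. integral\<^sup>L M (\<lambda>x. D n x * g x)) \<longlonglongrightarrow> 0"
    using tendsto_mult[OF d0(1) tendsto_const] by (intro lim L dD) simp
  have "integral\<^sup>L M (\<lambda>x. F n x * G n x) = integral\<^sup>L M (\<lambda>x. f x * g x) +
      (integral\<^sup>L M (\<lambda>x. D n x * E n x) + integral\<^sup>L M (\<lambda>x. f x * E n x) + integral\<^sup>L M (\<lambda>x. D n x * g x))" for n
  proof -
    have "(\<lambda>x. F n x * G n x) = (\<lambda>x. f x * g x + (D n x * E n x + f x * E n x + D n x * g x))"
      by (simp add: D_def E_def algebra_simps fun_eq_iff)
    then show ?thesis
      using L2_mult_integrable[OF L(2,5)] L2_mult_integrable[OF dD dE] L2_mult_integrable[OF L(2) dE]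
        L2_mult_integrable[OF dD L(5)] by simp
  qed
  then show ?thesis
    using tendsto_add[OF tendsto_const tendsto_add[OF tendsto_add[OF 1 2] 3], of "integral\<^sup>L M (\<lambda>x. f x * g x)"] by simp
qed

text \<open>The multiplier identities are quadratic in the function and its derivatives with bounded
  weights; this is how every one of them passes to the limit.\<close>

lemma L2lim_inner_weight:
  assumes F: "L2lim M F f" and G: "L2lim M G g"
    and w: "w \<in> borel_measurable M" "\<And>x. x \<in> space M \<Longrightarrow> \<bar>w x\<bar> \<le> B"
  shows "(\<lambda>n. integral\<^sup>L M (\<lambda>x. w x * (F n x * G n x))) \<longlonglongrightarrow> integral\<^sup>L M (\<lambda>x. w x * (f x * g x))"
  using L2lim_inner[OF L2lim_bounded_mult[OF F w] G] by (simp add: mult.assoc)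

lemma L2_inner_weight_integrable:
  assumes "L2 M f" "L2 M g" "w \<in> borel_measurable M" "\<And>x. x \<in> space M \<Longrightarrow> \<bar>w x\<bar> \<le> B"
  shows "integrable M (\<lambda>x. w x * (f x * g x))"
  using L2_mult_integrable[OF L2_bounded_mult[OF assms(1,3,4)] assms(2)] by (simp add: mult.assoc)

text \<open>Lebesgue measure is complete. This matters because \<open>X_beta\<close> is picked by a
  choice operator and is known only up to null sets, so its measurability has to be inherited from a
  square-integrable representative.\<close>

lemma measurable_lebesgue_on_cong_AE:
  fixes f g :: "'a::euclidean_space \<Rightarrow> real"
  assumes S: "S \<in> sets lebesgue" and f: "f \<in> borel_measurable (lebesgue_on S)"
    and ae: "AE x in lebesgue_on S. f x = g x"
  shows "g \<in> borel_measurable (lebesgue_on S)"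
proof -
  have S': "S \<inter> space lebesgue \<in> sets lebesgue" using S by simp
  have ae': "AE x in lebesgue. x \<in> S \<longrightarrow> f x = g x"
    using ae by (simp add: AE_restrict_space_iff[OF S'])
  have "g -` U \<inter> S \<in> sets lebesgue" if U: "U \<in> sets borel" for U
  proof (rule completion.in_sets_AE)
    show "AE x in lebesgue. (x \<in> f -` U \<inter> S) = (x \<in> g -` U \<inter> S)"
      using ae' by eventually_elim auto
    have "f -` U \<inter> S \<in> sets (lebesgue_on S)"
      using measurable_sets[OF f U] by simp
    then show "f -` U \<inter> S \<in> sets lebesgue"
      using sets_restrict_space_iff[OF S'] by blast
  qed auto
  then show ?thesis
    by (intro measurableI) (auto simp: sets_restrict_space_iff[OF S'])
qed

section \<open>Weak derivatives and smooth approximation\<close>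

lemma test_function_imp:
  assumes "test_function \<Omega> \<phi>"
  shows "continuous_on UNIV \<phi>" "\<phi> differentiable (at x)" "continuous_on UNIV (\<lambda>x. frechet_derivative \<phi> (at x) v)"
proof -
  have 1: "C_k_on 1 \<phi> UNIV" using assms unfolding test_function_def smooth_on_def by auto
  then show "\<phi> differentiable (at x)" "continuous_on UNIV (\<lambda>x. frechet_derivative \<phi> (at x) v)"
    by (simp_all del: split_paired_All)
  show "continuous_on UNIV \<phi>" using C_k_on_imp_continuous[OF open_UNIV 1] .
qed

lemma test_function_support:
  assumes "test_function \<Omega> \<phi>"
  shows "\<exists>K. compact K \<and> K \<subseteq> \<Omega> \<and> (\<forall>x. x \<notin> K \<longrightarrow> \<phi> x = 0) \<and> (\<forall>x v. x \<notin> K \<longrightarrow> frechet_derivative \<phi> (at x) v = 0)"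
proof -
  obtain K where K: "compact K" "K \<subseteq> \<Omega>" "\<And>x. x \<notin> K \<Longrightarrow> \<phi> x = 0"
    using assms unfolding test_function_def by blast
  have "frechet_derivative \<phi> (at x) v = 0" if "x \<notin> K" for x v
    by (rule dderiv_zero_off[of UNIV K x \<phi> v])
      (use K that compact_imp_closed dderiv_frechet[OF test_function_imp(2)[OF assms]] in auto)
  with K show ?thesis by blast
qed

lemma X_classical_eq: "X_classical \<alpha> i \<phi> x = fw \<alpha> i x * pd i \<phi> x"
  by (cases x; cases i) (auto simp: pd_def)

lemma locally_integrable_mult_compact_support:
  fixes f :: "'a::euclidean_space \<Rightarrow> real"
  assumes \<Omega>: "open \<Omega>" and f: "locally_integrable_on f \<Omega>" and \<phi>: "continuous_on UNIV \<phi>"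
    and K: "compact K" "K \<subseteq> \<Omega>" "\<And>x. x \<notin> K \<Longrightarrow> \<phi> x = 0"
  shows "integrable (lebesgue_on \<Omega>) (\<lambda>x. f x * \<phi> x)"
proof -
  obtain B where B: "B \<ge> 0" "\<And>x. \<bar>\<phi> x\<bar> \<le> B"
    by (rule compact_support_bounded[of K UNIV \<phi>]) (use K \<phi> in auto)
  have i: "integrable lebesgue (\<lambda>x. indicator K x *\<^sub>R f x)"
    using f K unfolding locally_integrable_on_def set_integrable_def by auto
  have "integrable lebesgue (\<lambda>x. (indicator K x *\<^sub>R f x) * \<phi> x)"
  proof (rule Bochner_Integration.integrable_bound)
    show "integrable lebesgue (\<lambda>x. B * (indicator K x *\<^sub>R f x))" using i by simp
    have "\<phi> \<in> borel_measurable lborel" using \<phi> by (simp add: borel_measurable_continuous_onI)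
    then show "(\<lambda>x. (indicator K x *\<^sub>R f x) * \<phi> x) \<in> borel_measurable lebesgue"
      by (intro borel_measurable_times[OF borel_measurable_integrable[OF i] measurable_completion])
    show "AE x in lebesgue. norm ((indicator K x *\<^sub>R f x) * \<phi> x) \<le> norm (B * (indicator K x *\<^sub>R f x))"
    proof (rule AE_I2)
      fix x
      have "\<bar>indicator K x * f x\<bar> * \<bar>\<phi> x\<bar> \<le> \<bar>indicator K x * f x\<bar> * \<bar>B\<bar>"
        using B(2)[of x] by (intro mult_left_mono) auto
      then show "norm ((indicator K x *\<^sub>R f x) * \<phi> x) \<le> norm (B * (indicator K x *\<^sub>R f x))"
        by (simp add: abs_mult mult_ac)
    qed
  qed
  moreover have "(\<lambda>x. (indicator K x *\<^sub>R f x) * \<phi> x) = (\<lambda>x. indicator \<Omega> x *\<^sub>R (f x * \<phi> x))"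
    using K(2,3) by (auto simp: indicator_def fun_eq_iff)
  ultimately show ?thesis using \<Omega> by (subst integrable_restrict_space) auto
qed

lemma locally_integrable_diff:
  "locally_integrable_on f \<Omega> \<Longrightarrow> locally_integrable_on g \<Omega> \<Longrightarrow> locally_integrable_on (\<lambda>x. f x - g x) \<Omega>"
  unfolding locally_integrable_on_def by (auto intro: set_integral_diff)

lemma locally_integrable_continuous:
  assumes "open \<Omega>" "continuous_on \<Omega> f"
  shows "locally_integrable_on f \<Omega>"
  unfolding locally_integrable_on_def set_integrable_def
proof (intro allI impI)
  fix K assume K: "compact K" "K \<subseteq> \<Omega>"
  have c: "continuous_on K f" using assms K continuous_on_subset by blast
  have "integrable lborel (\<lambda>x. indicator K x *\<^sub>R f x)"
    using borel_integrable_compact[OF K(1) c] .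
  then show "integrable lebesgue (\<lambda>x. indicator K x *\<^sub>R f x)"
    by (subst integrable_completion) auto
qed

lemma continuous_on_fw: "\<alpha> > 0 \<Longrightarrow> continuous_on S (fw \<alpha> i)"
  by (cases i) (auto simp: fw_def[abs_def] intro!: continuous_on_norm_fst_powr)

lemma X_classical_test:
  fixes \<phi> :: "('m::finite, 'k::finite) point \<Rightarrow> real"
  assumes "\<alpha> > 0" "test_function \<Omega> \<phi>"
  shows "continuous_on UNIV (X_classical \<alpha> i \<phi>)"
    and "\<exists>K. compact K \<and> K \<subseteq> \<Omega> \<and> (\<forall>x. x \<notin> K \<longrightarrow> X_classical \<alpha> i \<phi> x = 0)"
proof -
  have "X_classical \<alpha> i \<phi> = (\<lambda>x. fw \<alpha> i x * frechet_derivative \<phi> (at x) (dir i))"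
    unfolding X_classical_eq[abs_def] pd_def ..
  then show "continuous_on UNIV (X_classical \<alpha> i \<phi>)"
    using test_function_imp(3)[OF assms(2), of "dir i"] continuous_on_fw[OF assms(1)]
    by (auto intro!: continuous_on_mult)
  obtain K where "compact K" "K \<subseteq> \<Omega>" "\<And>x. x \<notin> K \<Longrightarrow> \<phi> x = 0"
      "\<And>x v. x \<notin> K \<Longrightarrow> frechet_derivative \<phi> (at x) v = 0"
    using test_function_support[OF assms(2)] by blast
  then show "\<exists>K. compact K \<and> K \<subseteq> \<Omega> \<and> (\<forall>x. x \<notin> K \<longrightarrow> X_classical \<alpha> i \<phi> x = 0)"
    by (intro exI[of _ K]) (auto simp: X_classical_eq pd_def)
qed

lemma weak_X_integrable:
  fixes f :: "('m::finite, 'k::finite) point \<Rightarrow> real"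
  assumes "\<alpha> > 0" "open \<Omega>" "locally_integrable_on f \<Omega>" "test_function \<Omega> \<phi>"
  shows "integrable (lebesgue_on \<Omega>) (\<lambda>x. f x * X_classical \<alpha> i \<phi> x)" "integrable (lebesgue_on \<Omega>) (\<lambda>x. f x * \<phi> x)"
proof -
  obtain K where "compact K" "K \<subseteq> \<Omega>" "\<And>x. x \<notin> K \<Longrightarrow> X_classical \<alpha> i \<phi> x = 0"
    using X_classical_test(2)[OF assms(1,4), of i] by blast
  then show "integrable (lebesgue_on \<Omega>) (\<lambda>x. f x * X_classical \<alpha> i \<phi> x)"
    by (rule locally_integrable_mult_compact_support[OF assms(2,3) X_classical_test(1)[OF assms(1,4)]])
  obtain K where "compact K" "K \<subseteq> \<Omega>" "\<And>x. x \<notin> K \<Longrightarrow> \<phi> x = 0"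
    using test_function_support[OF assms(4)] by blast
  then show "integrable (lebesgue_on \<Omega>) (\<lambda>x. f x * \<phi> x)"
    by (rule locally_integrable_mult_compact_support[OF assms(2,3) test_function_imp(1)[OF assms(4)]])
qed

lemma weak_X_diff:
  fixes f :: "('m::finite, 'k::finite) point \<Rightarrow> real"
  assumes "\<alpha> > 0" "open \<Omega>" "weak_X \<alpha> \<Omega> i f g" "weak_X \<alpha> \<Omega> i f' g'"
  shows "weak_X \<alpha> \<Omega> i (\<lambda>x. f x - f' x) (\<lambda>x. g x - g' x)"
  unfolding weak_X_def
proof (intro conjI allI impI)
  show "locally_integrable_on (\<lambda>x. f x - f' x) \<Omega>" "locally_integrable_on (\<lambda>x. g x - g' x) \<Omega>"
    using assms(3,4) by (auto simp: weak_X_def intro: locally_integrable_diff)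
  fix \<phi> :: "('m, 'k) point \<Rightarrow> real" assume t: "test_function \<Omega> \<phi>"
  have l: "locally_integrable_on f \<Omega>" "locally_integrable_on f' \<Omega>" "locally_integrable_on g \<Omega>" "locally_integrable_on g' \<Omega>"
    using assms(3,4) by (auto simp: weak_X_def)
  have eq: "(LINT x|lebesgue_on \<Omega>. f x * X_classical \<alpha> i \<phi> x) = - (LINT x|lebesgue_on \<Omega>. g x * \<phi> x)"
      "(LINT x|lebesgue_on \<Omega>. f' x * X_classical \<alpha> i \<phi> x) = - (LINT x|lebesgue_on \<Omega>. g' x * \<phi> x)"
    using assms(3,4) t by (auto simp: weak_X_def)
  show "(LINT x|lebesgue_on \<Omega>. (f x - f' x) * X_classical \<alpha> i \<phi> x) = - (LINT x|lebesgue_on \<Omega>. (g x - g' x) * \<phi> x)"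
    unfolding left_diff_distrib
    using weak_X_integrable(1)[OF assms(1,2) l(1) t, of i] weak_X_integrable(1)[OF assms(1,2) l(2) t, of i]
      weak_X_integrable(2)[OF assms(1,2) l(3) t] weak_X_integrable(2)[OF assms(1,2) l(4) t] eq
    by (simp only: Bochner_Integration.integral_diff)
qed

lemma weak_X_restrict:
  fixes f :: "('m::finite, 'k::finite) point \<Rightarrow> real"
  assumes "\<alpha> > 0" "open \<Omega>" "open \<Omega>'" "\<Omega>' \<subseteq> \<Omega>" "weak_X \<alpha> \<Omega> i f g"
  shows "weak_X \<alpha> \<Omega>' i f g"
  unfolding weak_X_def
proof (intro conjI allI impI)
  show "locally_integrable_on f \<Omega>'" "locally_integrable_on g \<Omega>'"
    using assms(4,5) by (auto simp: weak_X_def locally_integrable_on_def)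
  fix \<phi> :: "('m, 'k) point \<Rightarrow> real" assume t: "test_function \<Omega>' \<phi>"
  then have t': "test_function \<Omega> \<phi>" using assms(4) unfolding test_function_def by blast
  have eq: "(LINT x|lebesgue_on \<Omega>. f x * p x) = (LINT x|lebesgue_on \<Omega>'. f x * p x)"
    if "\<And>x. x \<notin> \<Omega>' \<Longrightarrow> p x = 0" for f p :: "('m, 'k) point \<Rightarrow> real"
  proof -
    have "(\<lambda>x. indicator \<Omega> x *\<^sub>R (f x * p x)) = (\<lambda>x. indicator \<Omega>' x *\<^sub>R (f x * p x))"
      using that assms(4) by (auto simp: indicator_def fun_eq_iff)
    then show ?thesis using assms(2,3) by (simp add: integral_restrict_space)
  qed
  have "X_classical \<alpha> i \<phi> x = 0" "\<phi> x = 0" if "x \<notin> \<Omega>'" for x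
  proof -
    show "X_classical \<alpha> i \<phi> x = 0" using X_classical_test(2)[OF assms(1) t, of i] that by blast
    obtain K where "K \<subseteq> \<Omega>'" "\<And>x. x \<notin> K \<Longrightarrow> \<phi> x = 0" using test_function_support[OF t] by blast
    then show "\<phi> x = 0" using that by blast
  qed
  then show "(LINT x|lebesgue_on \<Omega>'. f x * X_classical \<alpha> i \<phi> x) = - (LINT x|lebesgue_on \<Omega>'. g x * \<phi> x)"
    using assms(5) t' eq[of "X_classical \<alpha> i \<phi>" f] eq[of \<phi> g] unfolding weak_X_def by auto
qed

text \<open>The fundamental lemma applied to the difference. Agreement of \<open>f\<close> and
  \<open>f'\<close> up to a null set is all that is available when the lemma is iterated along a
  word.\<close>

lemma weak_X_unique:
  fixes f :: "('m::finite, 'k::finite) point \<Rightarrow> real"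
  assumes "\<alpha> > 0" "open \<Omega>" "weak_X \<alpha> \<Omega> i f g" "weak_X \<alpha> \<Omega> i f' g'" "AE x in lebesgue_on \<Omega>. f x = f' x"
  shows "AE x in lebesgue_on \<Omega>. g x = g' x"
proof -
  have w: "weak_X \<alpha> \<Omega> i (\<lambda>x. f x - f' x) (\<lambda>x. g x - g' x)" by (rule weak_X_diff[OF assms(1-4)])
  have "AE x in lebesgue_on \<Omega>. g x - g' x = 0"
  proof (rule AE_zero_if_test_integrals_zero[OF assms(2)])
    show "locally_integrable_on (\<lambda>x. g x - g' x) \<Omega>" using w by (simp add: weak_X_def)
    fix \<phi> :: "('m, 'k) point \<Rightarrow> real" assume t: "test_function \<Omega> \<phi>"
    have "(LINT x|lebesgue_on \<Omega>. (f x - f' x) * X_classical \<alpha> i \<phi> x) = 0"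
      by (rule integral_eq_zero_AE) (use assms(5) in eventually_elim, simp)
    then show "(LINT x|lebesgue_on \<Omega>. (g x - g' x) * \<phi> x) = 0"
      using w t by (simp add: weak_X_def)
  qed
  then show ?thesis by eventually_elim simp
qed

lemma dderiv_fw_self: "dderiv (dir i) (fw \<alpha> i) 0 x"
  by (cases i) (auto simp: fw_def[abs_def] dderiv_def)

text \<open>The coefficient \<open>fw \<alpha> i\<close> is constant in the direction
  \<open>dir i\<close>, so integrating the derivative of \<open>fw\<close> f \<phi> in this one
  direction gives the claim.\<close>

lemma weak_X_classical:
  fixes f :: "('m::finite, 'k::finite) point \<Rightarrow> real"
  assumes "\<alpha> > 0" "open \<Omega>" "continuous_on \<Omega> f" "continuous_on \<Omega> f'"
    and d: "\<And>x. x \<in> \<Omega> \<Longrightarrow> dderiv (dir i) f (f' x) x"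
  shows "weak_X \<alpha> \<Omega> i f (\<lambda>x. fw \<alpha> i x * f' x)"
  unfolding weak_X_def
proof (intro conjI allI impI)
  note cfw = continuous_on_fw[OF assms(1)]
  show l: "locally_integrable_on f \<Omega>" "locally_integrable_on (\<lambda>x. fw \<alpha> i x * f' x) \<Omega>"
    by (intro locally_integrable_continuous continuous_on_mult cfw assms)+
  fix \<phi> :: "('m, 'k) point \<Rightarrow> real" assume t: "test_function \<Omega> \<phi>"
  obtain K where K: "compact K" "K \<subseteq> \<Omega>" "\<And>x. x \<notin> K \<Longrightarrow> \<phi> x = 0"
    using test_function_support[OF t] by blast
  have c: "continuous_on \<Omega> \<phi>" "continuous_on \<Omega> (pd i \<phi>)"
    using test_function_imp(1)[OF t] test_function_imp(3)[OF t, of "dir i"]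
    by (auto simp: pd_def[abs_def] intro: continuous_on_subset)
  have "(LINT x|lebesgue_on \<Omega>. f x * X_classical \<alpha> i \<phi> x + (fw \<alpha> i x * f' x) * \<phi> x) = 0"
  proof (rule integral_dderiv(1)[OF assms(2) K(1,2), where F = "\<lambda>x. fw \<alpha> i x * (f x * \<phi> x)" and e = "dir i"])
    show "continuous_on \<Omega> (\<lambda>x. fw \<alpha> i x * (f x * \<phi> x))"
      "continuous_on \<Omega> (\<lambda>x. f x * X_classical \<alpha> i \<phi> x + fw \<alpha> i x * f' x * \<phi> x)"
      unfolding X_classical_eq by (intro continuous_on_mult continuous_on_add cfw c assms)+
    fix x assume x: "x \<in> \<Omega>"
    have "dderiv (dir i) \<phi> (pd i \<phi> x) x"
      unfolding pd_def by (rule dderiv_frechet[OF test_function_imp(2)[OF t]])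
    from dderiv_mult[OF dderiv_fw_self dderiv_mult[OF d[OF x] this]]
    show "dderiv (dir i) (\<lambda>x. fw \<alpha> i x * (f x * \<phi> x)) (f x * X_classical \<alpha> i \<phi> x + fw \<alpha> i x * f' x * \<phi> x) x"
      by (simp add: X_classical_eq algebra_simps)
  qed (use K in auto)
  then show "(LINT x|lebesgue_on \<Omega>. f x * X_classical \<alpha> i \<phi> x) = - (LINT x|lebesgue_on \<Omega>. fw \<alpha> i x * f' x * \<phi> x)"
    using weak_X_integrable(1)[OF assms(1,2) l(1) t, of i] weak_X_integrable(2)[OF assms(1,2) l(2) t]
    by (subst (asm) Bochner_Integration.integral_add) (auto simp: mult.assoc)
qed

section \<open>Words of vector fields\<close>

lemma weak_Xs_diff:
  fixes f :: "('m::finite, 'k::finite) point \<Rightarrow> real"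
  assumes "\<alpha> > 0" "open \<Omega>" "weak_Xs \<alpha> \<Omega> w f g" "weak_Xs \<alpha> \<Omega> w f' g'"
  shows "weak_Xs \<alpha> \<Omega> w (\<lambda>x. f x - f' x) (\<lambda>x. g x - g' x)"
  using assms(3,4)
proof (induction w arbitrary: g g')
  case (Cons i w)
  then show ?case using weak_X_diff[OF assms(1,2)] by (auto; metis)
qed simp

lemma concat_replicate_zero:
  "(\<And>j. j \<in> set xs \<Longrightarrow> \<beta> j = 0) \<Longrightarrow> concat (map (\<lambda>i. replicate (\<beta> i) i) xs) = []"
  by (induction xs) auto

lemma concat_replicate_single:
  "distinct xs \<Longrightarrow> i \<in> set xs \<Longrightarrow> (\<And>j. j \<in> set xs \<Longrightarrow> j \<noteq> i \<Longrightarrow> \<beta> j = 0) \<Longrightarrow>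
    concat (map (\<lambda>i. replicate (\<beta> i) i) xs) = replicate (\<beta> i) i"
proof (induction xs)
  case (Cons x xs)
  show ?case
  proof (cases "x = i")
    case True
    then have "concat (map (\<lambda>i. replicate (\<beta> i) i) xs) = []"
      using Cons.prems by (intro concat_replicate_zero) auto
    with True show ?thesis by simp
  next
    case False
    then show ?thesis using Cons by auto
  qed
qed simp

lemma field_list_props:
  "distinct (map Inl (sorted_list_of_set UNIV) :: ('m::{finite,linorder} + 'k::{finite,linorder}) list)"
  "distinct (map Inr (sorted_list_of_set UNIV) :: ('m::{finite,linorder} + 'k::{finite,linorder}) list)"
  "set (map Inl (sorted_list_of_set UNIV) :: ('m + 'k) list) = range Inl"
  "set (map Inr (sorted_list_of_set UNIV) :: ('m + 'k) list) = range Inr"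
  "distinct (field_list :: ('m + 'k) list)" "set (field_list :: ('m + 'k) list) = UNIV"
  by (auto simp: distinct_map field_list_def UNIV_sum)

lemma multi_word_single: "multi_word (\<lambda>j. if j = i then n else 0) = replicate n i"
  unfolding multi_word_def
  using concat_replicate_single[OF field_list_props(5), of i "\<lambda>j. if j = i then n else 0"] field_list_props(6) by auto

text \<open>The z-fields come first in \<open>field_list\<close>, so the z-derivative is applied
  last. This is the order that the Hardy inequality for the t-components of X u requires.\<close>

lemma multi_word_mixed:
  "multi_word (\<lambda>j. if j = Inl a \<or> j = Inr b then 1 else 0) =
    [Inl (a :: 'm::{finite,linorder}), Inr (b :: 'k::{finite,linorder})]"
proof -
  let ?\<beta> = "\<lambda>j. if j = Inl a \<or> j = Inr b then 1 else (0::nat)"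
  have "concat (map (\<lambda>i. replicate (?\<beta> i) i) (map Inl (sorted_list_of_set UNIV) :: ('m + 'k) list)) = replicate (?\<beta> (Inl a)) (Inl a)"
    by (rule concat_replicate_single[OF field_list_props(1)]) (auto simp: field_list_props)
  moreover have "concat (map (\<lambda>i. replicate (?\<beta> i) i) (map Inr (sorted_list_of_set UNIV) :: ('m + 'k) list)) = replicate (?\<beta> (Inr b)) (Inr b)"
    by (rule concat_replicate_single[OF field_list_props(2)]) (auto simp: field_list_props)
  ultimately show ?thesis unfolding multi_word_def field_list_def map_append concat_append by simp
qed

lemma weak_Xs_restrict:
  fixes f :: "('m::finite, 'k::finite) point \<Rightarrow> real"
  assumes "\<alpha> > 0" "open \<Omega>" "open \<Omega>'" "\<Omega>' \<subseteq> \<Omega>" "weak_Xs \<alpha> \<Omega> w f g"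
  shows "weak_Xs \<alpha> \<Omega>' w f g"
  using assms(5)
proof (induction w arbitrary: g)
  case (Cons i w)
  then show ?case using weak_X_restrict[OF assms(1-4)] by (auto, blast)
qed simp

lemma weak_Xs_unique:
  fixes f :: "('m::finite, 'k::finite) point \<Rightarrow> real"
  assumes "\<alpha> > 0" "open \<Omega>" "weak_Xs \<alpha> \<Omega> w f g" "weak_Xs \<alpha> \<Omega> w f g'"
  shows "AE x in lebesgue_on \<Omega>. g x = g' x"
  using assms(3,4)
proof (induction w arbitrary: g g')
  case (Cons i w)
  obtain h h' where "weak_Xs \<alpha> \<Omega> w f h" "weak_X \<alpha> \<Omega> i h g" "weak_Xs \<alpha> \<Omega> w f h'" "weak_X \<alpha> \<Omega> i h' g'"
    using Cons.prems by auto
  then show ?case using weak_X_unique[OF assms(1,2)] Cons.IH by blast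
qed simp

text \<open>A z-derivative of a t-field differentiates |z|^\<alpha>, which may fail to be
  differentiable at z = 0. Classical and weak derivatives of smooth functions are therefore compared
  off this null set.\<close>

definition off_axis :: "('m::finite, 'k::finite) point set \<Rightarrow> ('m, 'k) point set" where
  "off_axis \<Omega> = {x \<in> \<Omega>. fst x \<noteq> 0}"

lemma open_off_axis: "open \<Omega> \<Longrightarrow> open (off_axis \<Omega>)"
proof -
  assume "open \<Omega>"
  moreover have "open {x :: ('m::finite, 'k::finite) point. fst x \<noteq> 0}"
    by (intro open_Collect_neq continuous_intros)
  ultimately have "open (\<Omega> \<inter> {x. fst x \<noteq> 0})" by (rule open_Int)
  moreover have "off_axis \<Omega> = \<Omega> \<inter> {x. fst x \<noteq> 0}" by (auto simp: off_axis_def)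
  ultimately show ?thesis by simp
qed

lemma off_axis_subset: "off_axis \<Omega> \<subseteq> \<Omega>"
  by (auto simp: off_axis_def)

lemma AE_fst_nonzero: "AE x in lebesgue. fst (x :: ('m::finite, 'k::finite) point) \<noteq> 0"
proof -
  let ?e = "(axis undefined 1, 0) :: ('m, 'k) point"
  have "?e \<in> Basis" by (auto simp: Basis_prod_def)
  then have "negligible {x. x \<bullet> ?e = 0}" by (rule negligible_standard_hyperplane)
  then have "AE x in lebesgue. x \<notin> {x. x \<bullet> ?e = 0}"
    by (intro AE_not_in) (simp add: negligible_iff_null_sets)
  then show ?thesis by eventually_elim auto
qed

lemma AE_off_axis:
  fixes \<Omega> :: "('m::finite, 'k::finite) point set"
  assumes "open \<Omega>" "AE x in lebesgue_on (off_axis \<Omega>). P x"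
  shows "AE x in lebesgue_on \<Omega>. P x"
proof -
  have "off_axis \<Omega> \<inter> space lebesgue \<in> sets lebesgue" "\<Omega> \<inter> space lebesgue \<in> sets lebesgue"
    using assms(1) open_off_axis[OF assms(1)] by auto
  note [simp] = AE_restrict_space_iff[OF this(1)] AE_restrict_space_iff[OF this(2)]
  show ?thesis using assms(2) AE_fst_nonzero
    by (simp, elim eventually_elim2) (auto simp: off_axis_def)
qed

section \<open>Approximation by smooth functions in the Sobolev norm\<close>

lemma in_Lp_2_iff: "in_Lp \<Omega> 2 f \<longleftrightarrow> L2 (lebesgue_on \<Omega>) f"
  by (simp add: in_Lp_def L2_def)

lemma norm_Lp_2_less_imp:
  assumes "norm_Lp \<Omega> 2 f < e"
  shows "integral\<^sup>L (lebesgue_on \<Omega>) (\<lambda>x. (f x)\<^sup>2) \<le> e\<^sup>2"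
proof -
  define I where "I = integral\<^sup>L (lebesgue_on \<Omega>) (\<lambda>x. (f x)\<^sup>2)"
  have I: "I \<ge> 0" unfolding I_def by (intro integral_nonneg_AE) auto
  have "norm_Lp \<Omega> 2 f = sqrt I"
    using I by (simp add: norm_Lp_def I_def powr_half_sqrt)
  with assms have "sqrt I < e" by simp
  then have "(sqrt I)\<^sup>2 \<le> e\<^sup>2" by (intro power_mono) (use I in auto)
  then show ?thesis using I by (simp add: I_def)
qed

lemma norm_Lp_le_W_norm:
  assumes "\<beta> \<in> multi_indices l"
  shows "norm_Lp \<Omega> p (X_beta \<alpha> \<Omega> \<beta> f) \<le> W_norm \<alpha> l p \<Omega> f"
proof -
  have "norm_Lp \<Omega> p (X_beta \<alpha> \<Omega> \<beta> f) \<le> (\<Sum>\<beta>\<in>multi_indices l. norm_Lp \<Omega> p (X_beta \<alpha> \<Omega> \<beta> f))"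
    using assms by (intro member_le_sum finite_multi_indices) (auto simp: norm_Lp_def)
  then show ?thesis by (simp add: W_norm_def norm_Lp_def add_increasing)
qed

text \<open>Here \<open>c\<close> is the explicit formula for the derivative of the smooth
  \<open>h\<close>, known to be correct only off the axis. Uniqueness identifies
  \<open>X_beta\<close> of u - h with the difference of \<open>X_beta\<close> of u and
  \<open>c\<close> almost everywhere, so the Sobolev norm controls the distance between the
  two.\<close>

lemma approximation_step:
  fixes u h c :: "('m::{finite,linorder}, 'k::{finite,linorder}) point \<Rightarrow> real"
  assumes \<alpha>: "\<alpha> > 0" and \<Omega>: "open \<Omega>" and u: "u \<in> W_space \<alpha> l 2 \<Omega>" and h: "h \<in> W_space \<alpha> l 2 \<Omega>"
    and \<beta>: "\<beta> \<in> multi_indices l" and e: "W_norm \<alpha> l 2 \<Omega> (\<lambda>x. u x - h x) < e"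
    and c: "weak_Xs \<alpha> (off_axis \<Omega>) (multi_word \<beta>) h c"
  shows "L2 (lebesgue_on \<Omega>) (X_beta \<alpha> \<Omega> \<beta> u)" "L2 (lebesgue_on \<Omega>) c"
    "integral\<^sup>L (lebesgue_on \<Omega>) (\<lambda>x. (c x - X_beta \<alpha> \<Omega> \<beta> u x)\<^sup>2) \<le> e\<^sup>2"
proof -
  let ?M = "lebesgue_on \<Omega>" and ?w = "multi_word \<beta>"
  have S: "\<Omega> \<in> sets lebesgue" using \<Omega> by auto
  obtain g1 where g1: "weak_Xs \<alpha> \<Omega> ?w u g1" "L2 ?M g1"
    using u \<beta> by (auto simp: W_space_def has_X_beta_def in_Lp_2_iff)
  obtain g2 where g2: "weak_Xs \<alpha> \<Omega> ?w h g2" "L2 ?M g2"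
    using h \<beta> by (auto simp: W_space_def has_X_beta_def in_Lp_2_iff)
  have d: "weak_Xs \<alpha> \<Omega> ?w (\<lambda>x. u x - h x) (\<lambda>x. g1 x - g2 x)"
    by (rule weak_Xs_diff[OF \<alpha> \<Omega> g1(1) g2(1)])
  define U where "U = X_beta \<alpha> \<Omega> \<beta> u"
  define D where "D = X_beta \<alpha> \<Omega> \<beta> (\<lambda>x. u x - h x)"
  have U: "weak_Xs \<alpha> \<Omega> ?w u U"
    unfolding U_def X_beta_def has_X_beta_def by (rule someI[of _ g1]) (rule g1)
  have D: "weak_Xs \<alpha> \<Omega> ?w (\<lambda>x. u x - h x) D"
    unfolding D_def X_beta_def has_X_beta_def by (rule someI[where P = "weak_Xs \<alpha> \<Omega> ?w (\<lambda>x. u x - h x)"]) (rule d)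
  have L2_of_AE: "L2 ?M q" if "L2 ?M p" "AE x in ?M. p x = q x" for p q
    by (rule L2_cong_AE[OF that(1) measurable_lebesgue_on_cong_AE[OF S _ that(2)] that(2)])
      (use that(1) in \<open>simp add: L2_def\<close>)
  have LU: "L2 ?M U" by (rule L2_of_AE[OF g1(2) weak_Xs_unique[OF \<alpha> \<Omega> g1(1) U]])
  have LD: "L2 ?M D" by (rule L2_of_AE[OF L2_diff[OF g1(2) g2(2)] weak_Xs_unique[OF \<alpha> \<Omega> d D]])
  note o = open_off_axis[OF \<Omega>]
  note r = weak_Xs_restrict[OF \<alpha> \<Omega> o off_axis_subset]
  \<comment> \<open>Both sides are weak derivatives of u - h along the same word, although
    \<open>U\<close> and \<open>D\<close> were chosen independently of each other.\<close>
  have "AE x in lebesgue_on (off_axis \<Omega>). U x - c x = D x"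
    by (rule weak_Xs_unique[OF \<alpha> o weak_Xs_diff[OF \<alpha> o r[OF U] c] r[OF D]])
  then have ae: "AE x in ?M. U x - c x = D x" by (rule AE_off_axis[OF \<Omega>])
  have aec: "AE x in ?M. U x - D x = c x" using ae by eventually_elim simp
  have Lc: "L2 ?M c" by (rule L2_of_AE[OF L2_diff[OF LU LD] aec])
  have "integral\<^sup>L ?M (\<lambda>x. (c x - U x)\<^sup>2) = integral\<^sup>L ?M (\<lambda>x. (D x)\<^sup>2)"
  proof (rule integral_cong_AE)
    show "AE x in ?M. (c x - U x)\<^sup>2 = (D x)\<^sup>2"
      using ae by eventually_elim (metis power2_commute)
  qed (use LU LD Lc in \<open>auto intro!: borel_measurable_power borel_measurable_diff simp: L2_def\<close>)
  also have "\<dots> \<le> e\<^sup>2"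
  proof (rule norm_Lp_2_less_imp)
    show "norm_Lp \<Omega> 2 D < e"
      using norm_Lp_le_W_norm[OF \<beta>, of \<Omega> 2 \<alpha> "\<lambda>x. u x - h x"] e unfolding D_def by linarith
  qed
  finally show "integral\<^sup>L ?M (\<lambda>x. (c x - X_beta \<alpha> \<Omega> \<beta> u x)\<^sup>2) \<le> e\<^sup>2" by (simp add: U_def)
  show "L2 ?M (X_beta \<alpha> \<Omega> \<beta> u)" "L2 ?M c" using LU Lc by (simp_all add: U_def)
qed

lemma dderiv_fw_off_axis:
  fixes x :: "('m::finite, 'k::finite) point"
  assumes "fst x \<noteq> 0"
  shows "dderiv (dir (Inl a)) (fw \<alpha> j) ((dilw \<alpha> j - 1) * (fst x $ a) / (norm (fst x))\<^sup>2 * fw \<alpha> j x) x"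
proof (cases j)
  case (Inl c)
  then show ?thesis by (simp add: fw_def[abs_def] dderiv_const)
next
  case (Inr b)
  have "norm (fst x) powr (\<alpha> - 2) = norm (fst x) powr \<alpha> / (norm (fst x))\<^sup>2"
    using assms by (simp add: powr_diff)
  then show ?thesis
    using dderiv_norm_fst_powr[of \<alpha> x "dir (Inl a)"] assms Inr
    by (simp add: fw_def[abs_def] inner_axis mult_ac)
qed

context
  fixes \<alpha> :: real and \<Omega> :: "('m::finite, 'k::finite) point set" and h :: "('m, 'k) point \<Rightarrow> real"
  assumes \<alpha>: "\<alpha> > 0" and \<Omega>: "open \<Omega>" and h: "C_k_on 2 h \<Omega>"
begin

lemma C_2_facts:
  assumes "x \<in> \<Omega>"
  shows "dderiv (dir i) h (pd i h x) x" "dderiv (dir i) (pd j h) (pd i (pd j h) x) x"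
  using assms h unfolding pd_def[of i]
  by (auto intro!: dderiv_frechet simp: numeral_2_eq_2 pd_def[abs_def] simp del: split_paired_All)

lemma C_2_continuous:
  "S \<subseteq> \<Omega> \<Longrightarrow> continuous_on S h" "S \<subseteq> \<Omega> \<Longrightarrow> continuous_on S (pd j h)" "S \<subseteq> \<Omega> \<Longrightarrow> continuous_on S (pd i (pd j h))"
proof -
  have 1: "C_k_on 1 (pd j h) \<Omega>"
    using h by (simp add: pd_def[abs_def] numeral_2_eq_2 del: split_paired_All)
  then have 2: "C_k_on 0 (pd i (pd j h)) \<Omega>"
    by (simp add: pd_def[of i, abs_def] del: split_paired_All)
  show "S \<subseteq> \<Omega> \<Longrightarrow> continuous_on S h" "S \<subseteq> \<Omega> \<Longrightarrow> continuous_on S (pd j h)" "S \<subseteq> \<Omega> \<Longrightarrow> continuous_on S (pd i (pd j h))"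
    using C_k_on_imp_continuous[OF \<Omega> h] C_k_on_imp_continuous[OF \<Omega> 1] C_k_on_imp_continuous[OF \<Omega> 2]
    by (auto intro: continuous_on_subset)
qed

text \<open>In the second word the coefficient passes through the outer field, which does not
  differentiate it. The third word is where the coefficient is differentiated and
  \<open>hgrad\<close> arises.\<close>

lemma classical_words:
  "weak_Xs \<alpha> (off_axis \<Omega>) [i] h (\<lambda>x. fw \<alpha> i x * pd i h x)"
  "weak_Xs \<alpha> (off_axis \<Omega>) [i, i] h (\<lambda>x. fw \<alpha> i x * (fw \<alpha> i x * pd i (pd i h) x))"
  "weak_Xs \<alpha> (off_axis \<Omega>) [Inl a, j] h (hgrad \<alpha> j (\<lambda>c. pd (Inl c) (pd j h)) (pd j h) a)"
proof -
  note o = open_off_axis[OF \<Omega>]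
  note cs = C_2_continuous[OF off_axis_subset]
  have w: "weak_X \<alpha> (off_axis \<Omega>) i h (\<lambda>x. fw \<alpha> i x * pd i h x)" for i
    by (rule weak_X_classical[OF \<alpha> o cs(1,2)]) (auto simp: off_axis_def intro: C_2_facts)
  have "weak_X \<alpha> (off_axis \<Omega>) i (\<lambda>x. fw \<alpha> i x * pd i h x) (\<lambda>x. fw \<alpha> i x * (fw \<alpha> i x * pd i (pd i h) x))"
  proof (rule weak_X_classical[OF \<alpha> o])
    fix x assume "x \<in> off_axis \<Omega>"
    then have "dderiv (dir i) (pd i h) (pd i (pd i h) x) x" by (intro C_2_facts) (simp add: off_axis_def)
    from dderiv_mult[OF dderiv_fw_self[of i \<alpha> x] this]
    show "dderiv (dir i) (\<lambda>x. fw \<alpha> i x * pd i h x) (fw \<alpha> i x * pd i (pd i h) x) x"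
      by (simp add: mult.commute)
  qed (intro continuous_on_mult continuous_on_fw \<alpha> cs)+
  moreover have "weak_X \<alpha> (off_axis \<Omega>) (Inl a) (\<lambda>x. fw \<alpha> j x * pd j h x)
      (\<lambda>x. fw \<alpha> (Inl a) x * hgrad \<alpha> j (\<lambda>c. pd (Inl c) (pd j h)) (pd j h) a x)"
  proof (rule weak_X_classical[OF \<alpha> o])
    have "(norm (fst x))\<^sup>2 \<noteq> 0" if "x \<in> off_axis \<Omega>" for x using that by (simp add: off_axis_def)
    then show "continuous_on (off_axis \<Omega>) (hgrad \<alpha> j (\<lambda>c. pd (Inl c) (pd j h)) (pd j h) a)"
      unfolding hgrad_def[abs_def] by (intro continuous_on_mult continuous_on_add continuous_on_divide
        continuous_on_const continuous_on_power continuous_on_norm continuous_on_component continuous_on_fst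
        continuous_on_id continuous_on_fw \<alpha> cs) auto
    show "continuous_on (off_axis \<Omega>) (\<lambda>x. fw \<alpha> j x * pd j h x)"
      by (intro continuous_on_mult continuous_on_fw \<alpha> cs)
    fix x assume "x \<in> off_axis \<Omega>"
    then have x: "x \<in> \<Omega>" "fst x \<noteq> 0" by (auto simp: off_axis_def)
    from dderiv_mult[OF dderiv_fw_off_axis[OF x(2), of a \<alpha> j] C_2_facts(2)[OF x(1), of "Inl a" j]]
    show "dderiv (dir (Inl a)) (\<lambda>x. fw \<alpha> j x * pd j h x) (hgrad \<alpha> j (\<lambda>c. pd (Inl c) (pd j h)) (pd j h) a x) x"
      by (simp add: hgrad_def algebra_simps)
  qed
  ultimately show "weak_Xs \<alpha> (off_axis \<Omega>) [i] h (\<lambda>x. fw \<alpha> i x * pd i h x)"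
    "weak_Xs \<alpha> (off_axis \<Omega>) [i, i] h (\<lambda>x. fw \<alpha> i x * (fw \<alpha> i x * pd i (pd i h) x))"
    "weak_Xs \<alpha> (off_axis \<Omega>) [Inl a, j] h (hgrad \<alpha> j (\<lambda>c. pd (Inl c) (pd j h)) (pd j h) a)"
    using w by (auto simp del: split_paired_Ex)
qed

end

lemma multi_indices_small:
  "(\<lambda>_. 0) \<in> multi_indices 2" "(\<lambda>j. if j = i then 1 else 0) \<in> multi_indices 2"
  "(\<lambda>j. if j = i then 2 else 0) \<in> multi_indices 2"
  "(\<lambda>j. if j = Inl a \<or> j = Inr b then 1 else 0) \<in> (multi_indices 2 :: ('m::finite + 'k::finite \<Rightarrow> nat) set)"
proof -
  have "(\<Sum>j\<in>UNIV. if j = Inl a \<or> j = Inr b then 1 else 0) = (\<Sum>j\<in>{Inl a, Inr b :: 'm + 'k}. 1::nat)"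
    by (rule sum.mono_neutral_cong_right) auto
  then show "(\<lambda>j. if j = Inl a \<or> j = Inr b then 1 else 0) \<in> (multi_indices 2 :: ('m::finite + 'k::finite \<Rightarrow> nat) set)"
    by (simp add: multi_indices_def)
qed (simp_all add: multi_indices_def)

text \<open>Only the words needed later are kept: the single fields, their squares (summed to the
  operator) and the mixed words with a z-field outside a t-field. The mixed ones serve the Hardy
  control of the t-derivatives.\<close>

lemma S_space_approximation:
  fixes u :: "('m::{finite,linorder}, 'k::{finite,linorder}) point \<Rightarrow> real"
  assumes \<alpha>: "\<alpha> > 0" and \<Omega>: "open \<Omega>" and u: "u \<in> S_space \<alpha> 2 2 \<Omega>"
  obtains h P Q where "\<And>n. C_k_on 2 (h n) \<Omega>" "L2lim (lebesgue_on \<Omega>) h u"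
    "\<And>i. L2lim (lebesgue_on \<Omega>) (\<lambda>n x. fw \<alpha> i x * pd i (h n) x) (P i)"
    "L2lim (lebesgue_on \<Omega>) (\<lambda>n. grushin \<alpha> (h n)) (baouendi \<alpha> \<Omega> u)"
    "\<And>a b. L2lim (lebesgue_on \<Omega>) (\<lambda>n. hgrad \<alpha> (Inr b) (\<lambda>c. pd (Inl c) (pd (Inr b) (h n))) (pd (Inr b) (h n)) a) (Q a b)"
proof -
  let ?M = "lebesgue_on \<Omega>"
  have uW: "u \<in> W_space \<alpha> 2 2 \<Omega>" using u by (simp add: S_space_def)
  have "\<exists>h \<in> W_space \<alpha> 2 2 \<Omega>. smooth_on h \<Omega> \<and> W_norm \<alpha> 2 2 \<Omega> (\<lambda>x. u x - h x) < inverse (real (Suc n))" for n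
    using u unfolding S_space_def by simp
  then obtain h where h: "\<And>n. h n \<in> W_space \<alpha> 2 2 \<Omega>" "\<And>n. smooth_on (h n) \<Omega>"
    "\<And>n. W_norm \<alpha> 2 2 \<Omega> (\<lambda>x. u x - h n x) < inverse (real (Suc n))" by metis
  have C2: "C_k_on 2 (h n) \<Omega>" for n using h(2) by (auto simp: smooth_on_def)
  have e: "(\<lambda>n. (inverse (real (Suc n)))\<^sup>2) \<longlonglongrightarrow> 0"
    using tendsto_power[OF LIMSEQ_inverse_real_of_nat, of 2] by simp
  have lim: "L2lim ?M c (X_beta \<alpha> \<Omega> \<beta> u)"
    if "\<beta> \<in> multi_indices 2" "\<And>n. weak_Xs \<alpha> (off_axis \<Omega>) (multi_word \<beta>) (h n) (c n)" for \<beta> c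
    by (rule L2limI_bound[OF _ _ _ e]; rule approximation_step[OF \<alpha> \<Omega> uW h(1) that(1) h(3) that(2)])
  note cw = classical_words[OF \<alpha> \<Omega> C2]
  have 0: "L2lim ?M h u"
  proof -
    have w: "multi_word (\<lambda>_. 0) = ([] :: ('m + 'k) list)"
      unfolding multi_word_def by (simp add: concat_replicate_zero)
    have "X_beta \<alpha> \<Omega> (\<lambda>_. 0) u = u"
    proof -
      have "weak_Xs \<alpha> \<Omega> [] u = (\<lambda>g. g = u)" by auto
      then show ?thesis unfolding X_beta_def has_X_beta_def w by simp
    qed
    with lim[OF multi_indices_small(1), of h] show ?thesis by (simp add: w)
  qed
  have 1: "L2lim ?M (\<lambda>n x. fw \<alpha> i x * pd i (h n) x) (X_beta \<alpha> \<Omega> (\<lambda>j. if j = i then 1 else 0) u)" for i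
    by (rule lim[OF multi_indices_small(2)]) (simp only: multi_word_single replicate.simps One_nat_def cw)
  have 2: "L2lim ?M (\<lambda>n x. fw \<alpha> i x * (fw \<alpha> i x * pd i (pd i (h n)) x)) (X_beta \<alpha> \<Omega> (\<lambda>j. if j = i then 2 else 0) u)" for i
    by (rule lim[OF multi_indices_small(3)]) (simp only: multi_word_single replicate.simps numeral_2_eq_2 cw)
  have 3: "L2lim ?M (\<lambda>n. hgrad \<alpha> (Inr b) (\<lambda>c. pd (Inl c) (pd (Inr b) (h n))) (pd (Inr b) (h n)) a)
      (X_beta \<alpha> \<Omega> (\<lambda>j. if j = Inl a \<or> j = Inr b then 1 else 0) u)" for a b
    by (rule lim[OF multi_indices_small(4)]) (simp only: multi_word_mixed cw)
  have 4: "L2lim ?M (\<lambda>n. grushin \<alpha> (h n)) (baouendi \<alpha> \<Omega> u)"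
  proof -
    have "(\<lambda>n. grushin \<alpha> (h n)) = (\<lambda>n x. \<Sum>i\<in>UNIV. fw \<alpha> i x * (fw \<alpha> i x * pd i (pd i (h n)) x))"
      by (simp add: grushin_def[abs_def] fw_sq[symmetric] power2_eq_square mult.assoc)
    then show ?thesis unfolding baouendi_def[abs_def] by (simp only:) (intro L2lim_sum 2)
  qed
  show ?thesis
    by (rule that[OF C2 0 1 4 3])
qed

section \<open>Cutoffs and shells\<close>

definition clamp01 :: "real \<Rightarrow> real" where "clamp01 x = max 0 (min 1 x)"

lemma clamp01_simps: "x \<le> 0 \<Longrightarrow> clamp01 x = 0" "x \<ge> 1 \<Longrightarrow> clamp01 x = 1" "0 \<le> x \<Longrightarrow> x \<le> 1 \<Longrightarrow> clamp01 x = x"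
  by (auto simp: clamp01_def)

lemma clamp01_bounds: "0 \<le> clamp01 x" "clamp01 x \<le> 1"
  by (auto simp: clamp01_def)

text \<open>The clamped argument has corners at 0 and 1, but \<open>q'\<close> vanishes there; near
  a corner the composite either follows \<open>q\<close> or stays constant.\<close>

lemma DERIV_clamp01:
  fixes q q' :: "real \<Rightarrow> real"
  assumes q: "\<And>x. (q has_real_derivative q' x) (at x)" and 0: "q' 0 = 0" "q' 1 = 0"
  shows "((\<lambda>x. q (clamp01 x)) has_real_derivative q' (clamp01 x)) (at x)"
proof -
  have edge: "((\<lambda>x. q (clamp01 x)) has_real_derivative 0) (at c)"
    if c: "c = 0 \<or> c = 1" for c
  proof -
    have "(q has_real_derivative 0) (at c)" using q[of c] 0 c by auto
    then have lim: "((\<lambda>h. \<bar>(q (c + h) - q c) / h\<bar>) \<longlongrightarrow> 0) (at 0)"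
      unfolding DERIV_def by (rule tendsto_rabs_zero)
    have "((\<lambda>h. (q (clamp01 (c + h)) - q (clamp01 c)) / h) \<longlongrightarrow> 0) (at 0)"
    proof (rule Lim_null_comparison[OF _ lim])
      have "\<forall>\<^sub>F h in at 0. \<bar>h\<bar> < (1::real)"
        using eventually_at_ball[of 1 "0::real" UNIV] by (simp add: dist_real_def)
      then show "\<forall>\<^sub>F h in at 0. norm ((q (clamp01 (c + h)) - q (clamp01 c)) / h) \<le> \<bar>(q (c + h) - q c) / h\<bar>"
      proof eventually_elim
        case (elim h)
        then have "clamp01 (c + h) = c + h \<or> clamp01 (c + h) = c" "clamp01 c = c"
          using c by (auto simp: clamp01_def)
        then show ?case by auto
      qed
    qed
    then show ?thesis unfolding DERIV_def .
  qed
  consider "x < 0" | "x > 1" | "x = 0" | "x = 1" | "0 < x" "x < 1" by linarith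
  then show ?thesis
  proof cases
    case 1
    have "((\<lambda>x. q 0) has_real_derivative q' (clamp01 x)) (at x)" using 1 0 by (simp add: clamp01_simps)
    then show ?thesis
      by (rule has_field_derivative_transform_within_open[where S = "{..<0}"]) (use 1 in \<open>auto simp: clamp01_simps\<close>)
  next
    case 2
    have "((\<lambda>x. q 1) has_real_derivative q' (clamp01 x)) (at x)" using 2 0 by (simp add: clamp01_simps)
    then show ?thesis
      by (rule has_field_derivative_transform_within_open[where S = "{1<..}"]) (use 2 in \<open>auto simp: clamp01_simps\<close>)
  next
    case 5
    have "(q has_real_derivative q' (clamp01 x)) (at x)" using q[of x] 5 by (simp add: clamp01_simps)
    then show ?thesis
      by (rule has_field_derivative_transform_within_open[where S = "{0<..<1}"]) (use 5 in \<open>auto simp: clamp01_simps\<close>)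
  qed (use edge 0 in \<open>auto simp: clamp01_simps\<close>)
qed

text \<open>The smoothstep of degree 7, whose derivative is \<open>140 y\<^sup>3 (1 - y)\<^sup>3\<close>, together with its derivatives of order \<open>k \<le> 3\<close>.\<close>

definition step :: "nat \<Rightarrow> real \<Rightarrow> real" where
  "step k x = (let y = clamp01 x in
    if k = 0 then 35 * y ^ 4 - 84 * y ^ 5 + 70 * y ^ 6 - 20 * y ^ 7
    else if k = 1 then 140 * (y ^ 3 - 3 * y ^ 4 + 3 * y ^ 5 - y ^ 6)
    else if k = 2 then 420 * (y ^ 2 - 4 * y ^ 3 + 5 * y ^ 4 - 2 * y ^ 5)
    else 840 * (y - 6 * y ^ 2 + 10 * y ^ 3 - 5 * y ^ 4))"

lemma DERIV_step: "k < 3 \<Longrightarrow> (step k has_real_derivative step (Suc k) x) (at x)"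
proof -
  assume "k < 3"
  then consider "k = 0" | "k = 1" | "k = 2" by linarith
  then show ?thesis
  proof cases
    case 1
    have "((\<lambda>x. (\<lambda>y. 35 * y ^ 4 - 84 * y ^ 5 + 70 * y ^ 6 - 20 * y ^ 7) (clamp01 x)) has_real_derivative
      (\<lambda>y. 140 * (y ^ 3 - 3 * y ^ 4 + 3 * y ^ 5 - y ^ 6)) (clamp01 x)) (at x)"
      by (rule DERIV_clamp01) (auto intro!: derivative_eq_intros simp: algebra_simps)
    then show ?thesis using 1 by (simp add: step_def[abs_def] Let_def)
  next
    case 2
    have "((\<lambda>x. (\<lambda>y. 140 * (y ^ 3 - 3 * y ^ 4 + 3 * y ^ 5 - y ^ 6)) (clamp01 x)) has_real_derivative
      (\<lambda>y. 420 * (y ^ 2 - 4 * y ^ 3 + 5 * y ^ 4 - 2 * y ^ 5)) (clamp01 x)) (at x)"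
      by (rule DERIV_clamp01) (auto intro!: derivative_eq_intros simp: algebra_simps)
    then show ?thesis using 2 by (simp add: step_def[abs_def] Let_def)
  next
    case 3
    have "((\<lambda>x. (\<lambda>y. 420 * (y ^ 2 - 4 * y ^ 3 + 5 * y ^ 4 - 2 * y ^ 5)) (clamp01 x)) has_real_derivative
      (\<lambda>y. 840 * (y - 6 * y ^ 2 + 10 * y ^ 3 - 5 * y ^ 4)) (clamp01 x)) (at x)"
      by (rule DERIV_clamp01) (auto intro!: derivative_eq_intros simp: algebra_simps)
    then show ?thesis using 3 by (simp add: step_def[abs_def] Let_def numeral_2_eq_2 numeral_3_eq_3)
  qed
qed

lemma continuous_on_step: "continuous_on S (step k)"
proof -
  have c: "continuous_on UNIV clamp01" unfolding clamp01_def[abs_def] by (intro continuous_intros)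
  show ?thesis
    unfolding step_def[abs_def] Let_def
    by (rule continuous_on_subset[of UNIV]; cases "k = 0"; cases "k = 1"; cases "k = 2"; simp; intro continuous_intros c)
qed

lemma step_le_0: "x \<le> 0 \<Longrightarrow> step k x = 0"
  by (simp add: step_def clamp01_simps)

lemma step_ge_1: "x \<ge> 1 \<Longrightarrow> step k x = (if k = 0 then 1 else 0)"
  by (simp add: step_def clamp01_simps)

lemma step_0_bounds: "0 \<le> step 0 x" "step 0 x \<le> 1"
proof -
  have "step 1 y \<ge> 0" for y
  proof -
    have "step 1 y = 140 * (clamp01 y * (1 - clamp01 y)) ^ 3"
      by (simp add: step_def Let_def power_mult_distrib) (simp add: algebra_simps power_numeral_reduce)
    then show ?thesis using clamp01_bounds[of y] by simp
  qed
  then have mono: "step 0 a \<le> step 0 b" if "a \<le> b" for a b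
    by (intro DERIV_nonneg_imp_nondecreasing[OF that]) (use DERIV_step[of 0] in auto)
  show "0 \<le> step 0 x" using mono[of "min x 0" x] step_le_0[of "min x 0" 0] by simp
  show "step 0 x \<le> 1" using mono[of x "max x 1"] step_ge_1[of "max x 1" 0] by simp
qed

lemma continuous_on_if_const:
  "(b \<Longrightarrow> continuous_on S f) \<Longrightarrow> (\<not> b \<Longrightarrow> continuous_on S g) \<Longrightarrow> continuous_on S (\<lambda>x. if b then f x else g x)"
  by (cases b) auto

text \<open>The coefficients of the third derivative have absolute values adding up to 18480, and
  those of the lower derivatives to less.\<close>

lemma step_bound: "\<bar>step k x\<bar> \<le> 20000"
proof -
  let ?y = "clamp01 x"
  have y: "0 \<le> ?y ^ n" "?y ^ n \<le> 1" for n using clamp01_bounds[of x] by (auto intro: power_le_one)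
  note b = y[of 1, unfolded power_one_right] y[of 2] y[of 3] y[of 4] y[of 5] y[of 6] y[of 7]
  have "step k x = 35 * ?y ^ 4 - 84 * ?y ^ 5 + 70 * ?y ^ 6 - 20 * ?y ^ 7 \<or>
    step k x = 140 * ?y ^ 3 - 420 * ?y ^ 4 + 420 * ?y ^ 5 - 140 * ?y ^ 6 \<or>
    step k x = 420 * ?y ^ 2 - 1680 * ?y ^ 3 + 2100 * ?y ^ 4 - 840 * ?y ^ 5 \<or>
    step k x = 840 * ?y - 5040 * ?y ^ 2 + 8400 * ?y ^ 3 - 4200 * ?y ^ 4"
    by (simp add: step_def Let_def algebra_simps)
  then show ?thesis
    using b unfolding abs_le_iff by - (elim disjE; intro conjI; linarith)
qed

text \<open>\<open>cut k\<close> is the \<open>k\<close>-th derivative of the cutoff that rises on \<open>[s0, s0 + 1]\<close> and falls on \<open>[s1, s2]\<close>.\<close>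

definition cut :: "nat \<Rightarrow> real \<Rightarrow> real \<Rightarrow> real \<Rightarrow> real \<Rightarrow> real" where
  "cut k s0 s1 s2 s = (let d = 1 / (s2 - s1); A = (\<lambda>i. step i (s - s0)); B = (\<lambda>i. (- d) ^ i * step i ((s2 - s) * d)) in
     if k = 0 then A 0 * B 0
     else if k = 1 then A 1 * B 0 + A 0 * B 1
     else if k = 2 then A 2 * B 0 + 2 * (A 1 * B 1) + A 0 * B 2
     else A 3 * B 0 + 3 * (A 2 * B 1) + 3 * (A 1 * B 2) + A 0 * B 3)"

lemma DERIV_cut: "k < 3 \<Longrightarrow> (cut k s0 s1 s2 has_real_derivative cut (Suc k) s0 s1 s2 s) (at s)"
proof -
  assume k: "k < 3"
  define d where "d = 1 / (s2 - s1)"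
  have A: "((\<lambda>s. step i (s - s0)) has_real_derivative step (Suc i) (s - s0)) (at s)" if "i < 3" for i
  proof -
    have "((\<lambda>s. s - s0) has_real_derivative 1) (at s)" by (auto intro!: derivative_eq_intros)
    from DERIV_chain2[OF DERIV_step[OF that] this] show ?thesis by simp
  qed
  have B: "((\<lambda>s. (- d) ^ i * step i ((s2 - s) * d)) has_real_derivative (- d) ^ Suc i * step (Suc i) ((s2 - s) * d)) (at s)" if "i < 3" for i
  proof -
    have "((\<lambda>s. (s2 - s) * d) has_real_derivative (- d)) (at s)" by (auto intro!: derivative_eq_intros)
    from DERIV_cmult[OF DERIV_chain2[OF DERIV_step[OF that] this], of "(- d) ^ i"]
    show ?thesis by (simp add: mult_ac)
  qed
  consider "k = 0" | "k = 1" | "k = 2" using k by linarith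
  then show ?thesis
  proof cases
    case 1
    show ?thesis using DERIV_mult[OF A[of 0] B[of 0]] 1
      unfolding cut_def[abs_def] Let_def d_def[symmetric] by (simp add: algebra_simps)
  next
    case 2
    show ?thesis using DERIV_add[OF DERIV_mult[OF A[of 1] B[of 0]] DERIV_mult[OF A[of 0] B[of 1]]] 2
      unfolding cut_def[abs_def] Let_def d_def[symmetric] by (simp add: numeral_2_eq_2 algebra_simps)
  next
    case 3
    show ?thesis using DERIV_add[OF DERIV_add[OF DERIV_mult[OF A[of 2] B[of 0]] DERIV_cmult[OF DERIV_mult[OF A[of 1] B[of 1]], of 2]] DERIV_mult[OF A[of 0] B[of 2]]] 3
      unfolding cut_def[abs_def] Let_def d_def[symmetric] by (simp add: numeral_2_eq_2 numeral_3_eq_3 algebra_simps)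
  qed
qed

lemma continuous_on_cut: "continuous_on UNIV (cut k s0 s1 s2)"
proof -
  have A: "continuous_on UNIV (\<lambda>s. step i (s - s0))" "continuous_on UNIV (\<lambda>s. step i ((s2 - s) * c))" for i c
  proof -
    show "continuous_on UNIV (\<lambda>s. step i (s - s0))"
      by (rule continuous_on_compose2[OF continuous_on_step[of UNIV]]) (intro continuous_intros, simp)
    show "continuous_on UNIV (\<lambda>s. step i ((s2 - s) * c))"
      by (rule continuous_on_compose2[OF continuous_on_step[of UNIV]]) (intro continuous_intros, simp)
  qed
  show ?thesis
    unfolding cut_def[abs_def] Let_def
    by (intro continuous_on_if_const continuous_on_mult continuous_on_add continuous_on_const A)
qed

lemma cut_outside: "s1 < s2 \<Longrightarrow> s \<le> s0 \<or> s2 \<le> s \<Longrightarrow> cut k s0 s1 s2 s = 0"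
  by (auto simp: cut_def Let_def step_le_0 divide_le_0_iff)

lemma cut_inside: "s1 < s2 \<Longrightarrow> s0 + 1 \<le> s \<Longrightarrow> s \<le> s1 \<Longrightarrow> cut k s0 s1 s2 s = (if k = 0 then 1 else 0)"
  by (auto simp: cut_def Let_def step_ge_1 le_divide_eq)

lemma cut_0_bounds: "0 \<le> cut 0 s0 s1 s2 s" "cut 0 s0 s1 s2 s \<le> 1"
  by (auto simp: cut_def Let_def step_0_bounds intro!: mult_nonneg_nonneg mult_le_one)

text \<open>The inner transition has length 1 in the logarithmic variable wherever it starts, so
  \<open>C\<close> can be chosen independent of \<open>s0\<close>. This uniformity allows the inner
  cutoff to be sent to the origin.\<close>

lemma cut_bound:
  obtains C where "C \<ge> 1" "\<And>k s0 s. \<bar>cut k s0 s1 s2 s\<bar> \<le> C"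
proof -
  define d where "d = \<bar>1 / (s2 - s1)\<bar> + 1"
  define L where "L = (20000::real)"
  have d: "d \<ge> 1" by (simp add: d_def)
  have A: "\<bar>step i x\<bar> \<le> L" for i x using step_bound by (simp add: L_def)
  have B: "\<bar>(- (1 / (s2 - s1))) ^ i * step j x\<bar> \<le> d ^ 3 * L" if "i \<le> 3" for i j x
  proof -
    have "\<bar>- (1 / (s2 - s1))\<bar> ^ i \<le> d ^ i" by (intro power_mono) (auto simp: d_def)
    also have "\<dots> \<le> d ^ 3" using d that by (intro power_increasing) auto
    finally show ?thesis using A[of j x] using d unfolding abs_mult power_abs by (intro mult_mono) auto
  qed
  have AB: "\<bar>step k y * ((- (1 / (s2 - s1))) ^ i * step j x)\<bar> \<le> L * (d ^ 3 * L)" if "i \<le> 3" for k y i j x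
    using A[of k y] B[OF that, of j x] unfolding abs_mult[of "step k y"] by (intro mult_mono) (auto simp: L_def)
  define T where "T = L * (d ^ 3 * L)"
  have T: "T \<ge> 1"
  proof -
    have "1 * (1 * 1) \<le> L * (d ^ 3 * L)" using d by (intro mult_mono) (auto simp: L_def)
    then show ?thesis by (simp add: T_def)
  qed
  \<comment> \<open>8 = 1 + 3 + 3 + 1 is the sum of the coefficients in Leibniz' rule for the third
    derivative.\<close>
  have "\<bar>cut k s0 s1 s2 s\<bar> \<le> 8 * T" for k s0 s
  proof -
    define p where "p = (\<lambda>k i. step k (s - s0) * ((- (1 / (s2 - s1))) ^ i * step i ((s2 - s) * (1 / (s2 - s1)))))"
    have p: "\<bar>p k i\<bar> \<le> T" if "i \<le> 3" for k i unfolding p_def T_def by (rule AB[OF that])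
    have "cut k s0 s1 s2 s = (if k = 0 then p 0 0 else if k = 1 then p 1 0 + p 0 1
       else if k = 2 then p 2 0 + 2 * p 1 1 + p 0 2 else p 3 0 + 3 * p 2 1 + 3 * p 1 2 + p 0 3)"
      by (simp add: cut_def Let_def p_def)
    then show ?thesis using p[of 0 0] p[of 0 1] p[of 1 0] p[of 0 2] p[of 1 1] p[of 2 0] p[of 0 3] p[of 1 2] p[of 2 1] p[of 3 0] T
      by (auto simp: abs_le_iff)
  qed
  then show ?thesis using T by (intro that[of "8 * T"]) auto
qed

section \<open>Gauge balls and shells\<close>

lemma gauge_rho_eq:
  fixes x :: "('m::finite, 'k::finite) point"
  assumes "\<alpha> > 0"
  shows "gauge_rho \<alpha> x = (if x = 0 then 0 else exp (lrho \<alpha> x))"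
proof -
  have "gauge_rho \<alpha> x = gaugeN \<alpha> x powr (1 / (2 * (\<alpha> + 1)))"
    by (cases x) (simp add: gauge_rho_def gaugeN_def)
  moreover have "gaugeN \<alpha> 0 = 0" by (simp add: gaugeN_def)
  ultimately show ?thesis using gaugeN_pos[OF assms, of x] by (cases "x = 0") (simp_all add: powr_def lrho_def)
qed

lemma gauge_ball_iff:
  assumes "\<alpha> > 0" "R > 0"
  shows "x \<in> gauge_ball \<alpha> R \<longleftrightarrow> x = 0 \<or> lrho \<alpha> x < ln R"
  using assms by (auto simp: gauge_ball_def gauge_rho_eq ln_less_cancel_iff[symmetric] simp del: ln_less_cancel_iff)

lemma gaugeN_eq_exp: "\<alpha> > 0 \<Longrightarrow> x \<noteq> 0 \<Longrightarrow> gaugeN \<alpha> x = exp (2 * (\<alpha> + 1) * lrho \<alpha> x)"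
  using gaugeN_pos[of \<alpha> x] by (simp add: lrho_def)

lemma open_gauge_ball:
  fixes \<alpha> R :: real
  assumes "\<alpha> > 0" "R > 0"
  shows "open (gauge_ball \<alpha> R :: ('m::finite, 'k::finite) point set)"
proof -
  have "gauge_ball \<alpha> R = {x :: ('m, 'k) point. gaugeN \<alpha> x < exp (2 * (\<alpha> + 1) * ln R)}"
  proof (intro set_eqI)
    fix x :: "('m, 'k) point"
    show "x \<in> gauge_ball \<alpha> R \<longleftrightarrow> x \<in> {x. gaugeN \<alpha> x < exp (2 * (\<alpha> + 1) * ln R)}"
      using gaugeN_eq_exp[of \<alpha> x] assms
      by (cases "x = 0") (auto simp: gauge_ball_iff gaugeN_def mult_less_cancel_left_pos)
  qed
  moreover have "open {x :: ('m, 'k) point. gaugeN \<alpha> x < exp (2 * (\<alpha> + 1) * ln R)}"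
    using continuous_on_gaugeN[OF assms(1), of UNIV] by (intro open_Collect_less) auto
  ultimately show ?thesis by simp
qed

definition shell :: "real \<Rightarrow> real \<Rightarrow> real \<Rightarrow> ('m::finite, 'k::finite) point set" where
  "shell \<alpha> s1 s2 = {x. x \<noteq> 0 \<and> s1 \<le> lrho \<alpha> x \<and> lrho \<alpha> x \<le> s2}"

lemma norm_fst_le_exp_lrho:
  fixes x :: "('m::finite, 'k::finite) point"
  assumes "\<alpha> > 0" "x \<noteq> 0"
  shows "norm (fst x) \<le> exp (lrho \<alpha> x)"
proof (cases "fst x = 0")
  case False
  have "norm (fst x) powr (2 * (\<alpha> + 1)) \<le> gaugeN \<alpha> x" by (simp add: gaugeN_def)
  then have "(norm (fst x) powr (2 * (\<alpha> + 1))) powr (1 / (2 * (\<alpha> + 1))) \<le> gaugeN \<alpha> x powr (1 / (2 * (\<alpha> + 1)))"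
    using assms by (intro powr_mono2) auto
  moreover have "gaugeN \<alpha> x powr (1 / (2 * (\<alpha> + 1))) = exp (lrho \<alpha> x)"
    using gaugeN_pos[OF assms] by (simp add: powr_def lrho_def)
  ultimately show ?thesis using assms False by (simp add: powr_powr)
qed simp

lemma shell_props:
  assumes "\<alpha> > 0"
  shows "compact (shell \<alpha> s1 s2 :: ('m::finite, 'k::finite) point set)"
    and "R > 0 \<Longrightarrow> s2 < ln R \<Longrightarrow> (shell \<alpha> s1 s2 :: ('m::finite, 'k::finite) point set) \<subseteq> gauge_ball \<alpha> R - {0}"
proof -
  let ?n = "2 * (\<alpha> + 1)"
  \<comment> \<open>\<open>gaugeN\<close> is continuous on the whole space, whereas
    \<open>lrho\<close> is singular at the origin; in this form the shell is visibly closed.\<close>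
  have eq: "shell \<alpha> s1 s2 = {x :: ('m, 'k) point. exp (?n * s1) \<le> gaugeN \<alpha> x} \<inter> {x. gaugeN \<alpha> x \<le> exp (?n * s2)}"
  proof (intro set_eqI)
    fix x :: "('m, 'k) point"
    have "gaugeN \<alpha> (0 :: ('m, 'k) point) = 0" by (simp add: gaugeN_def)
    then show "x \<in> shell \<alpha> s1 s2 \<longleftrightarrow> x \<in> {x. exp (?n * s1) \<le> gaugeN \<alpha> x} \<inter> {x. gaugeN \<alpha> x \<le> exp (?n * s2)}"
      using gaugeN_eq_exp[OF assms, of x] assms
      by (cases "x = 0") (auto simp: shell_def not_le)
  qed
  have "closed (shell \<alpha> s1 s2 :: ('m, 'k) point set)"
    unfolding eq using continuous_on_gaugeN[OF assms, of UNIV]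
    by (intro closed_Int closed_Collect_le) auto
  moreover have "bounded (shell \<alpha> s1 s2 :: ('m, 'k) point set)"
    unfolding bounded_iff
  proof (intro exI ballI)
    fix x :: "('m, 'k) point" assume x: "x \<in> shell \<alpha> s1 s2"
    have 1: "norm (fst x) \<le> exp s2"
      using norm_fst_le_exp_lrho[OF assms, of x] x by (auto simp: shell_def intro: order_trans)
    have "(norm (snd x))\<^sup>2 \<le> (\<alpha> + 1)\<^sup>2 * (norm (snd x))\<^sup>2"
      using assms by (simp add: mult_le_cancel_right1 one_le_power)
    also have "\<dots> \<le> gaugeN \<alpha> x" by (simp add: gaugeN_def)
    also have "\<dots> \<le> exp (?n * s2)" using x unfolding eq by simp
    also have "\<dots> = (exp ((\<alpha> + 1) * s2))\<^sup>2" by (simp add: exp_double[symmetric] mult.assoc)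
    finally have "norm (snd x) \<le> exp ((\<alpha> + 1) * s2)" by (rule power2_le_imp_le) simp
    with 1 show "norm x \<le> exp s2 + exp ((\<alpha> + 1) * s2)"
      using norm_Pair_le[of "fst x" "snd x"] by simp
  qed
  ultimately show "compact (shell \<alpha> s1 s2 :: ('m, 'k) point set)"
    by (simp add: compact_eq_bounded_closed)
  show "(shell \<alpha> s1 s2 :: ('m::finite, 'k::finite) point set) \<subseteq> gauge_ball \<alpha> R - {0}" if "R > 0" "s2 < ln R"
  proof
    fix x :: "('m, 'k) point" assume "x \<in> shell \<alpha> s1 s2"
    then show "x \<in> gauge_ball \<alpha> R - {0}"
      using gauge_ball_iff[OF assms that(1), of x] that(2) by (simp add: shell_def)
  qed
qed

text \<open>Monotone convergence along \<tau> = 1 / (n + 1). Integrability of the limit is a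
  conclusion: nothing is known about f / \<zeta> beforehand.\<close>

lemma integral_resolvent_limit:
  fixes f \<zeta> :: "'a \<Rightarrow> real"
  assumes f: "\<And>x. 0 \<le> f x" and \<zeta>: "\<And>x. 0 \<le> \<zeta> x" "AE x in M. 0 < \<zeta> x"
    and m: "f \<in> borel_measurable M" "\<zeta> \<in> borel_measurable M"
    and i: "\<And>\<tau>. \<tau> > 0 \<Longrightarrow> integrable M (\<lambda>x. f x / (\<zeta> x + \<tau>))"
    and E: "\<And>\<tau>. \<tau> > 0 \<Longrightarrow> integral\<^sup>L M (\<lambda>x. f x / (\<zeta> x + \<tau>)) \<le> E"
  shows "integrable M (\<lambda>x. f x / \<zeta> x)" "integral\<^sup>L M (\<lambda>x. f x / \<zeta> x) \<le> E"
proof -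
  define F where "F = (\<lambda>n x. f x / (\<zeta> x + inverse (real (Suc n))))"
  have p: "\<zeta> x + inverse (real (Suc n)) > 0" for x n using \<zeta>(1)[of x] by (simp add: add_nonneg_pos)
  have iF: "integrable M (F n)" "integral\<^sup>L M (F n) \<le> E" for n
    unfolding F_def by (rule i, simp, rule E, simp)
  have mono: "F n x \<le> F n' x" if "n \<le> n'" for n n' x
    unfolding F_def using that p[of x n'] f[of x]
    by (intro divide_left_mono mult_pos_pos p add_left_mono le_imp_inverse_le) auto
  have "incseq (\<lambda>n. integral\<^sup>L M (F n))"
    by (intro incseq_SucI integral_mono iF mono) auto
  then obtain L where L: "(\<lambda>n. integral\<^sup>L M (F n)) \<longlonglongrightarrow> L" "\<And>n. integral\<^sup>L M (F n) \<le> L"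
    using incseq_convergent[of _ E] iF(2) by metis
  have LE: "L \<le> E" by (rule LIMSEQ_le_const2[OF L(1)]) (use iF(2) in auto)
  have lim: "AE x in M. (\<lambda>n. F n x) \<longlonglongrightarrow> f x / \<zeta> x"
    using \<zeta>(2)
  proof eventually_elim
    case (elim x)
    have "(\<lambda>n. f x / (\<zeta> x + inverse (real (Suc n)))) \<longlonglongrightarrow> f x / (\<zeta> x + 0)"
      by (intro tendsto_intros LIMSEQ_inverse_real_of_nat) (use elim in auto)
    then show ?case by (simp add: F_def)
  qed
  have mon: "AE x in M. mono (\<lambda>n. F n x)" using mono by (intro AE_I2 monoI)
  have u: "(\<lambda>x. f x / \<zeta> x) \<in> borel_measurable M" using m by measurable
  show "integrable M (\<lambda>x. f x / \<zeta> x)"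
    by (rule integrable_monotone_convergence[OF iF(1) mon lim L(1) u])
  show "integral\<^sup>L M (\<lambda>x. f x / \<zeta> x) \<le> E"
    using integral_monotone_convergence[OF iF(1) mon lim L(1) u] LE by simp
qed

lemma dlrho_sum_sq:
  fixes x :: "('m::finite, 'k::finite) point"
  assumes "\<alpha> > 0" "x \<noteq> 0"
  shows "(\<Sum>i\<in>UNIV. fldw \<alpha> i x * (dlrho \<alpha> i x)\<^sup>2) = radw \<alpha> x"
proof -
  have "(\<Sum>i\<in>UNIV. fldw \<alpha> i x * (dlrho \<alpha> i x)\<^sup>2) = (\<Sum>i\<in>UNIV. radw \<alpha> x * (dilw \<alpha> i * (x \<bullet> dir i) * dlrho \<alpha> i x))"
    by (intro sum.cong refl) (simp add: power2_eq_square mult.assoc[symmetric] fldw_dlrho[OF assms(1)])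
  then show ?thesis by (simp add: sum_distrib_left[symmetric] sum_dilw_dlrho[OF assms])
qed

lemma borel_measurable_geometry:
  assumes "\<alpha> > 0"
  shows "lrho \<alpha> \<in> borel_measurable borel" "radw \<alpha> \<in> borel_measurable borel" "fw \<alpha> i \<in> borel_measurable borel"
proof -
  have 1: "gaugeN \<alpha> \<in> borel_measurable borel" by (intro borel_measurable_continuous_onI continuous_on_gaugeN assms)
  have 2: "(\<lambda>x. norm (fst x) powr (2 * \<alpha>)) \<in> borel_measurable borel"
    using assms by (intro borel_measurable_continuous_onI continuous_on_norm_fst_powr) auto
  show "lrho \<alpha> \<in> borel_measurable borel" using 1 unfolding lrho_def[abs_def] by measurable
  show "radw \<alpha> \<in> borel_measurable borel" using 1 2 unfolding radw_def[abs_def] by measurable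
  show "fw \<alpha> i \<in> borel_measurable borel" by (intro borel_measurable_continuous_onI continuous_on_fw assms)
qed

lemma borel_measurable_lebesgue_onI: "f \<in> borel_measurable borel \<Longrightarrow> f \<in> borel_measurable (lebesgue_on S)"
  by (intro measurable_restrict_space1 measurable_completion) simp

text \<open>With L = ln R such a radial weight is supported in a compact shell inside the ball and
  away from its centre, so it is bounded, also after multiplication by W.\<close>

definition admissible :: "real \<Rightarrow> (real \<Rightarrow> real) \<Rightarrow> bool" where
  "admissible L a \<longleftrightarrow> continuous_on UNIV a \<and> (\<exists>s1 s2. s2 < L \<and> (\<forall>s. s < s1 \<or> s2 < s \<longrightarrow> a s = 0))"

lemma admissible_mult:
  assumes "continuous_on UNIV b" "admissible L a"
  shows "admissible L (\<lambda>s. b s * a s)" "admissible L (\<lambda>s. a s * b s)"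
proof -
  obtain s1 s2 where "s2 < L" "\<forall>s. s < s1 \<or> s2 < s \<longrightarrow> a s = 0" using assms(2) by (auto simp: admissible_def)
  then have "\<exists>s1 s2. s2 < L \<and> (\<forall>s. s < s1 \<or> s2 < s \<longrightarrow> b s * a s = 0)" by (intro exI[of _ s1] exI[of _ s2]) auto
  then show "admissible L (\<lambda>s. b s * a s)" "admissible L (\<lambda>s. a s * b s)" using assms
    by (auto simp: admissible_def mult.commute intro: continuous_on_mult)
qed

lemma admissible_abs: "admissible L a \<Longrightarrow> admissible L (\<lambda>s. \<bar>a s\<bar>)"
  by (auto simp: admissible_def intro!: continuous_on_rabs)

lemma admissible_add: "admissible L a \<Longrightarrow> admissible L b \<Longrightarrow> admissible L (\<lambda>s. a s + b s)"
proof -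
  assume a: "admissible L a" and b: "admissible L b"
  obtain s1 s2 where 1: "s2 < L" "\<forall>s. s < s1 \<or> s2 < s \<longrightarrow> a s = 0" using a by (auto simp: admissible_def)
  obtain t1 t2 where 2: "t2 < L" "\<forall>s. s < t1 \<or> t2 < s \<longrightarrow> b s = 0" using b by (auto simp: admissible_def)
  have "\<exists>s1 s2. s2 < L \<and> (\<forall>s. s < s1 \<or> s2 < s \<longrightarrow> a s + b s = 0)"
    using 1 2 by (intro exI[of _ "min s1 t1"] exI[of _ "max s2 t2"]) auto
  with a b show ?thesis by (auto simp: admissible_def intro: continuous_on_add)
qed

lemma admissible_cmult: "admissible L a \<Longrightarrow> admissible L (\<lambda>s. c * a s)"
  by (rule admissible_mult(1)) (rule continuous_on_const)

lemma bounded_of_admissible: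
  assumes "admissible L a" obtains B where "\<And>s. \<bar>a s\<bar> \<le> B"
proof -
  obtain s1 s2 where s: "continuous_on UNIV a" "\<forall>s. s < s1 \<or> s2 < s \<longrightarrow> a s = 0"
    using assms by (auto simp: admissible_def)
  obtain B where "\<And>x. x \<in> UNIV \<Longrightarrow> \<bar>a x\<bar> \<le> B"
    by (rule compact_support_bounded[of "{s1..s2}" UNIV a]) (use s in \<open>auto simp: not_le\<close>)
  then show ?thesis using that by auto
qed

section \<open>Multiplier identities in the Sobolev space\<close>

text \<open>\<open>P i\<close>, \<open>Q a b\<close> and \<open>Bu\<close> stand for \<open>X\<^sub>i u\<close>, \<open>X\<^sub>a X\<^sub>m\<^sub>+\<^sub>b u\<close> and \<open>\<B>\<^sub>\<alpha> u\<close>.\<close>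

locale limit_solution =
  fixes \<alpha> R \<kappa> :: real and u Bu :: "('m::finite, 'k::finite) point \<Rightarrow> real"
    and h :: "nat \<Rightarrow> ('m, 'k) point \<Rightarrow> real" and P :: "'m + 'k \<Rightarrow> ('m, 'k) point \<Rightarrow> real"
    and Q :: "'m \<Rightarrow> 'k \<Rightarrow> ('m, 'k) point \<Rightarrow> real"
  assumes \<alpha>: "0 < \<alpha>" "\<alpha> \<le> 1" and R: "R > 0" and \<kappa>: "\<kappa> = (homdim \<alpha> TYPE('m) TYPE('k) - 2) / 2" and m: "CARD('m) \<ge> 3"
    and h: "\<And>n. C_k_on 2 (h n) (gauge_ball \<alpha> R)"
    and lim_u: "L2lim (lebesgue_on (gauge_ball \<alpha> R)) h u"
    and lim_P: "\<And>i. L2lim (lebesgue_on (gauge_ball \<alpha> R)) (\<lambda>n x. fw \<alpha> i x * pd i (h n) x) (P i)"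
    and lim_B: "L2lim (lebesgue_on (gauge_ball \<alpha> R)) (\<lambda>n. grushin \<alpha> (h n)) Bu"
    and lim_Q: "\<And>a b. L2lim (lebesgue_on (gauge_ball \<alpha> R))
      (\<lambda>n. hgrad \<alpha> (Inr b) (\<lambda>c. pd (Inl c) (pd (Inr b) (h n))) (pd (Inr b) (h n)) a) (Q a b)"
begin

abbreviation "\<Omega> \<equiv> gauge_ball \<alpha> R :: ('m, 'k) point set"
abbreviation "M \<equiv> lebesgue_on (gauge_ball \<alpha> R :: ('m, 'k) point set)"

text \<open>\<open>P i x / fw \<alpha> i x\<close> recovers the plain partial derivative off z = 0;
  on the null set z = 0 the value is irrelevant. Square-integrability on shells is established
  below, not assumed.\<close>

definition Du :: "('m, 'k) point \<Rightarrow> real" where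
  "Du x = (\<Sum>i\<in>UNIV. dilw \<alpha> i * (x \<bullet> dir i) * (P i x / fw \<alpha> i x))"

definition Gu :: "('m, 'k) point \<Rightarrow> real" where
  "Gu x = (\<Sum>i\<in>UNIV. (P i x)\<^sup>2)"

lemma open_\<Omega>: "open \<Omega>"
  by (rule open_gauge_ball[OF \<alpha>(1) R])

lemma AE_M_nonzero: "AE x in M. fst x \<noteq> 0"
proof -
  have "\<Omega> \<inter> space lebesgue \<in> sets lebesgue" using open_\<Omega> by auto
  show ?thesis
    unfolding AE_restrict_space_iff[OF \<open>\<Omega> \<inter> space lebesgue \<in> sets lebesgue\<close>]
    by (rule eventually_mono[OF AE_fst_nonzero]) simp
qed

lemma measurable_radial: "continuous_on UNIV a \<Longrightarrow> (\<lambda>x. a (lrho \<alpha> x)) \<in> borel_measurable M"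
  by (intro borel_measurable_lebesgue_onI measurable_compose[OF borel_measurable_geometry(1)[OF \<alpha>(1)]]
      borel_measurable_continuous_onI)

lemma measurable_radial_radw: "continuous_on UNIV a \<Longrightarrow> (\<lambda>x. a (lrho \<alpha> x) * radw \<alpha> x) \<in> borel_measurable M"
  by (intro borel_measurable_times measurable_radial borel_measurable_lebesgue_onI borel_measurable_geometry \<alpha>)

lemma radw_nonneg: "0 \<le> radw \<alpha> x"
  by (simp add: radw_def gaugeN_nonneg)

lemma radial_radw_bounded:
  assumes "admissible (ln R) a"
  obtains B where "\<And>x. x \<in> space M \<Longrightarrow> \<bar>a (lrho \<alpha> x) * radw \<alpha> x\<bar> \<le> B"
proof -
  obtain s1 s2 where s: "continuous_on UNIV a" "s2 < ln R" "\<forall>s. s < s1 \<or> s2 < s \<longrightarrow> a s = 0"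
    using assms by (auto simp: admissible_def)
  have c: "continuous_on (\<Omega> - {0}) (\<lambda>x. a (lrho \<alpha> x) * radw \<alpha> x)"
    by (intro continuous_on_mult continuous_on_compose2[OF s(1) continuous_on_lrho[OF \<alpha>(1)]] continuous_on_radw \<alpha>) auto
  obtain B where B: "B \<ge> 0" "\<And>x. x \<in> \<Omega> - {0} \<Longrightarrow> \<bar>a (lrho \<alpha> x) * radw \<alpha> x\<bar> \<le> B"
    by (rule compact_support_bounded[OF shell_props(1)[OF \<alpha>(1)] shell_props(2)[OF \<alpha>(1) R s(2), of s1] c])
      (use s(3) in \<open>auto simp: shell_def not_le\<close>)
  have "\<bar>a (lrho \<alpha> x) * radw \<alpha> x\<bar> \<le> B" if "x \<in> space M" for x
  proof (cases "x = 0")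
    case True
    then show ?thesis using B(1) by (simp add: radw_def)
  next
    case False
    have "x \<in> \<Omega>" using that by simp
    then show ?thesis using False B(2)[of x] by blast
  qed
  then show ?thesis using that by blast
qed

lemma smooth_radialI:
  assumes "\<And>s. (a has_real_derivative a' s) (at s)" "continuous_on UNIV a'"
    and "s2 < ln R" "\<And>s. s < s1 \<or> s2 < s \<Longrightarrow> a s = 0"
  shows "smooth_radial \<alpha> \<Omega> (shell \<alpha> s1 s2) (h n) a a'"
proof
  show "shell \<alpha> s1 s2 \<subseteq> \<Omega> - {0}" by (rule shell_props(2)[OF \<alpha>(1) R assms(3)])
  show "a (lrho \<alpha> x) = 0" if "x \<in> \<Omega> - {0} - shell \<alpha> s1 s2" for x
    using that assms(4) by (auto simp: shell_def not_le)
qed (use \<alpha> open_\<Omega> shell_props(1)[OF \<alpha>(1)] h assms in auto)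

lemma DERIV_zero_outside:
  assumes "\<And>s. (a has_real_derivative a' s) (at s)" "\<And>s. s < s1 \<or> s2 < s \<Longrightarrow> a s = 0" "s < s1 \<or> s2 < s"
  shows "a' s = (0::real)"
proof -
  have "(a has_real_derivative 0) (at s)"
    by (rule has_field_derivative_transform_within_open[OF DERIV_const, of "{..<s1} \<union> {s2<..}"])
      (use assms in auto)
  with assms(1) show ?thesis using DERIV_unique by blast
qed

section \<open>Convergence of the t-derivatives and of D\<close>

lemma L2_indicator_continuous:
  assumes "continuous_on \<Omega> f" "compact K" "K \<subseteq> \<Omega>"
  shows "L2 M (\<lambda>x. indicator K x * f x)"
proof -
  have c: "continuous_on K f" using assms continuous_on_subset by blast
  have i: "integrable lborel (\<lambda>x. indicator K x *\<^sub>R f x)" by (rule borel_integrable_compact[OF assms(2) c])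
  have "integrable lborel (\<lambda>x. indicator K x *\<^sub>R (f x)\<^sup>2)"
    by (rule borel_integrable_compact[OF assms(2)]) (intro continuous_intros c)
  then have "integrable lebesgue (\<lambda>x. indicator K x *\<^sub>R (f x)\<^sup>2)"
    by (subst integrable_completion) auto
  moreover have "(\<lambda>x. indicator K x *\<^sub>R (f x)\<^sup>2) = (\<lambda>x. indicator \<Omega> x *\<^sub>R (indicator K x * f x)\<^sup>2)"
    using assms(3) by (auto simp: indicator_def fun_eq_iff)
  ultimately have "integrable M (\<lambda>x. (indicator K x * f x)\<^sup>2)"
    using open_\<Omega> by (subst integrable_restrict_space) auto
  moreover have "(\<lambda>x. indicator K x * f x) \<in> borel_measurable M"
    using borel_measurable_integrable[OF i] by (intro borel_measurable_lebesgue_onI) simp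
  ultimately show ?thesis by (simp add: L2_def)
qed

lemma L2lim_diff: "L2lim M' F f \<Longrightarrow> L2lim M' G g \<Longrightarrow> L2lim M' (\<lambda>n x. F n x - G n x) (\<lambda>x. f x - g x)"
  using L2lim_add[of M' F f "\<lambda>n x. (-1) * G n x" "\<lambda>x. (-1) * g x"] L2lim_cmult[of M' G g "-1"] by simp

lemma hgrad_diff: "hgrad \<alpha> j k' k c x - hgrad \<alpha> j l' l c x = hgrad \<alpha> j (\<lambda>c x. k' c x - l' c x) (\<lambda>x. k x - l x) c x"
proof -
  define t where "t = (dilw \<alpha> j - 1) * (fst x $ c) / (norm (fst x))\<^sup>2"
  show ?thesis unfolding hgrad_def t_def[symmetric] by (simp add: algebra_simps)
qed

text \<open>In the ball |z| \<le> \<rho> < R, and \<alpha> \<le> 1 leaves a nonnegative power 2 - 2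
  \<alpha> of |z| to be bounded. It compares the singular factor in a t-derivative with the Hardy
  weight.\<close>

lemma norm_fst_powr_bound:
  assumes "x \<in> \<Omega>" "fst x \<noteq> 0"
  shows "(1 / norm (fst x) powr \<alpha>)\<^sup>2 \<le> R powr (2 - 2 * \<alpha>) / (norm (fst x))\<^sup>2"
proof -
  have x: "x \<noteq> 0" using assms(2) by auto
  have "lrho \<alpha> x < ln R" using assms(1) x gauge_ball_iff[OF \<alpha>(1) R] by blast
  then have "exp (lrho \<alpha> x) < R" using R by (metis exp_less_cancel_iff exp_ln)
  then have le: "norm (fst x) \<le> R" using norm_fst_le_exp_lrho[OF \<alpha>(1) x] by linarith
  have "norm (fst x) powr (2 - 2 * \<alpha>) \<le> R powr (2 - 2 * \<alpha>)"
    using le \<alpha>(2) by (intro powr_mono2) auto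
  moreover have "norm (fst x) powr (2 - 2 * \<alpha>) = (norm (fst x))\<^sup>2 * (1 / norm (fst x) powr \<alpha>)\<^sup>2"
  proof -
    have "norm (fst x) powr (2 - 2 * \<alpha>) = norm (fst x) powr 2 / (norm (fst x) powr \<alpha> * norm (fst x) powr \<alpha>)"
      by (simp add: powr_diff powr_add[symmetric])
    then show ?thesis using assms(2) by (simp add: power2_eq_square powr_numeral)
  qed
  ultimately show ?thesis using assms(2) by (simp add: pos_le_divide_eq mult.commute)
qed

lemma measurable_norm_fst: "(\<lambda>x. (norm (fst x))\<^sup>2) \<in> borel_measurable M"
  by (intro borel_measurable_lebesgue_onI borel_measurable_continuous_onI continuous_intros)

text \<open>A t-derivative is |z|^(-\<alpha>) times a field, and convergence of the field alone does
  not give convergence of the quotient. The Hardy inequality for the field applied to h_n - h_m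
  does: its z-gradient consists of mixed words, which converge as well.\<close>

lemma L2lim_pd_Inr:
  assumes s: "s2 < ln R"
  shows "L2lim M (\<lambda>n x. indicator (shell \<alpha> s1 s2) x * pd (Inr b) (h n) x)
    (\<lambda>x. indicator (shell \<alpha> s1 s2) x * (P (Inr b) x / fw \<alpha> (Inr b) x))"
proof -
  define s3 where "s3 = (s2 + ln R) / 2"
  \<comment> \<open>The weight is 1 on the shell, rises on the unit interval before it and falls on
    [s2, s3], still inside the ball.\<close>
  define a a' where "a = cut 0 (s1 - 1) s2 s3" and "a' = cut 1 (s1 - 1) s2 s3"
  have s3: "s2 < s3" "s3 < ln R" using s by (auto simp: s3_def)
  have da: "(a has_real_derivative a' s) (at s)" for s unfolding a_def a'_def using DERIV_cut[of 0] by simp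
  have ca: "continuous_on UNIV a" "continuous_on UNIV a'" unfolding a_def a'_def by (rule continuous_on_cut)+
  have z: "a s = 0" "a' s = 0" if "s < s1 - 1 \<or> s3 < s" for s
    using that s3 by (auto simp: a_def a'_def intro: cut_outside)
  have a1: "a s = 1" if "s1 \<le> s" "s \<le> s2" for s using that s3 by (simp add: a_def cut_inside)
  have a0: "0 \<le> a s" for s by (simp add: a_def cut_0_bounds)
  have adm: "admissible (ln R) a" "admissible (ln R) a'"
    using ca z s3 unfolding admissible_def by blast+
  define A W where "A = (\<lambda>x::('m, 'k) point. a (lrho \<alpha> x))" and "W = (\<lambda>x::('m, 'k) point. \<bar>a' (lrho \<alpha> x)\<bar> * radw \<alpha> x)"
  have A0: "0 \<le> A x" for x by (simp add: A_def a0)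
  have mA: "A \<in> borel_measurable M" unfolding A_def by (rule measurable_radial[OF ca(1)])
  have mW: "W \<in> borel_measurable M" unfolding W_def
    by (rule measurable_radial_radw) (intro continuous_on_rabs ca)
  obtain BA where BA: "\<And>x. \<bar>A x\<bar> \<le> BA" using bounded_of_admissible[OF adm(1)] unfolding A_def by metis
  obtain BW where BW: "\<And>x. x \<in> space M \<Longrightarrow> \<bar>W x\<bar> \<le> BW"
    using radial_radw_bounded[OF admissible_abs[OF adm(2)]] unfolding W_def by metis
  define j :: "'m + 'k" where "j = Inr b"
  define q where "q = (\<lambda>n x. fw \<alpha> j x * pd j (h n) x)"
  define g where "g = (\<lambda>c n. hgrad \<alpha> j (\<lambda>c. pd (Inl c) (pd j (h n))) (pd j (h n)) c)"
  have lq: "L2lim M q (P j)" unfolding q_def by (rule lim_P)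
  have lg: "L2lim M (g c) (Q c b)" for c unfolding g_def j_def by (rule lim_Q)
  have Lq: "L2 M (\<lambda>x. q n x - P j x)" for n by (intro L2_diff L2limD[OF lq])
  define E where "E = (\<lambda>n. 4 * (\<Sum>c\<in>UNIV. integral\<^sup>L M (\<lambda>x. A x * ((g c n x - Q c b x) * (g c n x - Q c b x))))
      + 2 * integral\<^sup>L M (\<lambda>x. W x * ((q n x - P j x) * (q n x - P j x))))"
  have E0: "E \<longlonglongrightarrow> 0"
  proof -
    have 1: "L2lim M (\<lambda>n x. g c n x - Q c b x) (\<lambda>x. 0)" for c
      using L2lim_diff[OF lg[of c] L2lim_const[OF L2limD(2)[OF lg[of c]]]] by simp
    have 2: "L2lim M (\<lambda>n x. q n x - P j x) (\<lambda>x. 0)"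
      using L2lim_diff[OF lq L2lim_const[OF L2limD(2)[OF lq]]] by simp
    have "(\<lambda>n. integral\<^sup>L M (\<lambda>x. A x * ((g c n x - Q c b x) * (g c n x - Q c b x)))) \<longlonglongrightarrow> 0" for c
      using L2lim_inner_weight[OF 1 1 mA BA, of c c] by simp
    moreover have "(\<lambda>n. integral\<^sup>L M (\<lambda>x. W x * ((q n x - P j x) * (q n x - P j x)))) \<longlonglongrightarrow> 0"
      using L2lim_inner_weight[OF 2 2 mW BW] by simp
    ultimately have "E \<longlonglongrightarrow> 4 * (\<Sum>c\<in>(UNIV::'m set). 0) + 2 * 0"
      unfolding E_def by (intro tendsto_intros)
    then show ?thesis by simp
  qed
  \<comment> \<open>For fixed \<tau> the weight is bounded by \<open>BA / \<tau>\<close>, so the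
    Hardy inequality for h_n - h_m survives the limit in m. Only afterwards does \<tau> tend to
    0.\<close>
  have res: "integral\<^sup>L M (\<lambda>x. A x * (q n x - P j x)\<^sup>2 / ((norm (fst x))\<^sup>2 + \<tau>)) \<le> E n"
    and ires: "integrable M (\<lambda>x. A x * (q n x - P j x)\<^sup>2 / ((norm (fst x))\<^sup>2 + \<tau>))" if \<tau>: "\<tau> > 0" for n \<tau>
  proof -
    define w where "w = (\<lambda>x::('m, 'k) point. A x / ((norm (fst x))\<^sup>2 + \<tau>))"
    have mw: "w \<in> borel_measurable M" unfolding w_def using mA measurable_norm_fst by measurable
    have bw: "\<bar>w x\<bar> \<le> BA / \<tau>" for x
    proof -
      have "\<bar>A x\<bar> / ((norm (fst x))\<^sup>2 + \<tau>) \<le> BA / \<tau>"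
        using \<tau> BA[of x] by (intro frac_le) auto
      then show ?thesis using \<tau> by (simp add: w_def abs_of_nonneg A0)
    qed
    have dq: "L2lim M (\<lambda>m x. q n x - q m x) (\<lambda>x. q n x - P j x)"
      by (intro L2lim_diff lq L2lim_const L2limD(1)[OF lq])
    have dg: "L2lim M (\<lambda>m x. g c n x - g c m x) (\<lambda>x. g c n x - Q c b x)" for c
      by (intro L2lim_diff lg L2lim_const L2limD(1)[OF lg])
    have "integral\<^sup>L M (\<lambda>x. w x * ((q n x - q m x) * (q n x - q m x)))
        \<le> 4 * (\<Sum>c\<in>UNIV. integral\<^sup>L M (\<lambda>x. A x * ((g c n x - g c m x) * (g c n x - g c m x))))
          + 2 * integral\<^sup>L M (\<lambda>x. W x * ((q n x - q m x) * (q n x - q m x)))" for m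
    proof -
      interpret sr: smooth_radial \<alpha> \<Omega> "shell \<alpha> (s1 - 1) s3" "h n" a a'
        by (rule smooth_radialI[OF da ca(2) s3(2) z(1)])
      interpret sm: smooth_radial \<alpha> \<Omega> "shell \<alpha> (s1 - 1) s3" "h m" a a'
        by (rule smooth_radialI[OF da ca(2) s3(2) z(1)])
      let ?k = "\<lambda>x. pd j (h n) x - pd j (h m) x" and ?k' = "\<lambda>c x. pd (Inl c) (pd j (h n)) x - pd (Inl c) (pd j (h m)) x"
      have hg: "hgrad \<alpha> j ?k' ?k c x = g c n x - g c m x" for c x unfolding g_def by (rule hgrad_diff[symmetric])
      have fk: "fw \<alpha> j x * ?k x = q n x - q m x" for x by (simp add: q_def algebra_simps)
      have ig: "integrable M (\<lambda>x. A x * ((g c n x - g c m x) * (g c n x - g c m x)))" for c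
        by (rule L2_inner_weight_integrable[OF L2limD(1)[OF dg] L2limD(1)[OF dg] mA BA])
      have "integrable M (\<lambda>x. a (lrho \<alpha> x) * (\<Sum>c\<in>UNIV. (hgrad \<alpha> j ?k' ?k c x)\<^sup>2))"
        using ig by (simp add: hg A_def sum_distrib_left power2_eq_square)
      note int = this
      have dk: "dderiv (dir (Inl c)) ?k (?k' c x) x" if "x \<in> \<Omega> - {0}" for x c
        using that by (intro dderiv_diff sr.dderiv_pd sm.dderiv_pd) auto
      have ck: "continuous_on (\<Omega> - {0}) ?k" "continuous_on (\<Omega> - {0}) (?k' c)" for c
        by (intro continuous_on_diff sr.cont_pd sm.cont_pd sr.cont_pd2 sm.cont_pd2)+
      have z': "a' (lrho \<alpha> x) = 0" if "x \<in> \<Omega> - {0} - shell \<alpha> (s1 - 1) s3" for x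
        by (rule z(2)) (use that in \<open>auto simp: shell_def not_le\<close>)
      have "integral\<^sup>L M (\<lambda>x. a (lrho \<alpha> x) * (fw \<alpha> j x * ?k x)\<^sup>2 / ((norm (fst x))\<^sup>2 + \<tau>))
        \<le> 4 * integral\<^sup>L M (\<lambda>x. a (lrho \<alpha> x) * (\<Sum>c\<in>UNIV. (hgrad \<alpha> j ?k' ?k c x)\<^sup>2))
          + 2 * integral\<^sup>L M (\<lambda>x. \<bar>a' (lrho \<alpha> x)\<bar> * radw \<alpha> x * (fw \<alpha> j x * ?k x)\<^sup>2)"
        by (rule sr.hardy_inequality[of ?k ?k' \<tau> j, OF dk ck \<tau> m a0 z' int])
      moreover have "integral\<^sup>L M (\<lambda>x. a (lrho \<alpha> x) * (\<Sum>c\<in>UNIV. (hgrad \<alpha> j ?k' ?k c x)\<^sup>2))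
        = (\<Sum>c\<in>UNIV. integral\<^sup>L M (\<lambda>x. A x * ((g c n x - g c m x) * (g c n x - g c m x))))"
        using ig by (simp add: hg A_def sum_distrib_left power2_eq_square)
      ultimately show ?thesis by (simp add: fk w_def A_def W_def power2_eq_square)
    qed
    then have "integral\<^sup>L M (\<lambda>x. w x * ((q n x - P j x) * (q n x - P j x))) \<le> E n"
      unfolding E_def
      by (intro LIMSEQ_le[OF L2lim_inner_weight[OF dq dq mw bw]
            tendsto_add[OF tendsto_mult[OF tendsto_const tendsto_sum[OF L2lim_inner_weight[OF dg dg mA BA]]]
              tendsto_mult[OF tendsto_const L2lim_inner_weight[OF dq dq mW BW]]]]) auto
    then show "integral\<^sup>L M (\<lambda>x. A x * (q n x - P j x)\<^sup>2 / ((norm (fst x))\<^sup>2 + \<tau>)) \<le> E n"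
      by (simp add: w_def power2_eq_square)
    show "integrable M (\<lambda>x. A x * (q n x - P j x)\<^sup>2 / ((norm (fst x))\<^sup>2 + \<tau>))"
      using L2_inner_weight_integrable[OF Lq Lq mw bw, of n n] by (simp add: w_def power2_eq_square)
  qed
  have inv: "integrable M (\<lambda>x. A x * (q n x - P j x)\<^sup>2 / (norm (fst x))\<^sup>2)"
      "integral\<^sup>L M (\<lambda>x. A x * (q n x - P j x)\<^sup>2 / (norm (fst x))\<^sup>2) \<le> E n" for n
  proof -
    have mq: "(\<lambda>x. A x * (q n x - P j x)\<^sup>2) \<in> borel_measurable M"
      using mA L2_measurable[OF Lq[of n]] by measurable
    have pos: "AE x in M. 0 < (norm (fst x))\<^sup>2" using AE_M_nonzero by eventually_elim simp
    note r = integral_resolvent_limit[OF _ _ pos mq measurable_norm_fst ires res]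
    show "integrable M (\<lambda>x. A x * (q n x - P j x)\<^sup>2 / (norm (fst x))\<^sup>2)"
      "integral\<^sup>L M (\<lambda>x. A x * (q n x - P j x)\<^sup>2 / (norm (fst x))\<^sup>2) \<le> E n"
      by (rule r; simp add: A0)+
  qed
  define I where "I = (indicator (shell \<alpha> s1 s2) :: ('m, 'k) point \<Rightarrow> real)"
  define C where "C = R powr (2 - 2 * \<alpha>)"
  have C: "C \<ge> 0" by (simp add: C_def)
  define d where "d = (\<lambda>n x. I x * pd j (h n) x - I x * (P j x / fw \<alpha> j x))"
  have mI: "I \<in> borel_measurable M" unfolding I_def
    by (intro borel_measurable_lebesgue_onI borel_measurable_indicator borel_compact shell_props(1) \<alpha>)
  have LI: "L2 M (\<lambda>x. I x * pd j (h n) x)" for n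
    unfolding I_def
  proof (rule L2_indicator_continuous)
    show "continuous_on \<Omega> (pd j (h n))" by (rule C_2_continuous(2)[OF \<alpha>(1) open_\<Omega> h]) simp
    show "shell \<alpha> s1 s2 \<subseteq> \<Omega>" using shell_props(2)[OF \<alpha>(1) R s, of s1] by blast
  qed (rule shell_props(1)[OF \<alpha>(1)])
  have md: "d n \<in> borel_measurable M" for n
    unfolding d_def
    by (intro borel_measurable_diff borel_measurable_times[OF mI] borel_measurable_divide
        L2_measurable[OF LI] L2_measurable[OF L2limD(2)[OF lq]] borel_measurable_lebesgue_onI borel_measurable_geometry \<alpha>)
  have bd: "AE x in M. (d n x)\<^sup>2 \<le> C * (A x * (q n x - P j x)\<^sup>2 / (norm (fst x))\<^sup>2)" for n
    using AE_M_nonzero AE_space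
  proof eventually_elim
    case (elim x)
    show ?case
    proof (cases "x \<in> shell \<alpha> s1 s2")
      case False
      then show ?thesis using C A0[of x] by (simp add: d_def I_def)
    next
      case True
      then have A1: "A x = 1" by (simp add: A_def shell_def a1)
      have "d n x = (1 / norm (fst x) powr \<alpha>) * (q n x - P j x)"
        using True elim(1) by (simp add: d_def I_def q_def j_def field_simps)
      then have "(d n x)\<^sup>2 = (1 / norm (fst x) powr \<alpha>)\<^sup>2 * (q n x - P j x)\<^sup>2" by (simp only: power_mult_distrib)
      also have "\<dots> \<le> C / (norm (fst x))\<^sup>2 * (q n x - P j x)\<^sup>2"
        unfolding C_def using norm_fst_powr_bound[of x] elim by (intro mult_right_mono) auto
      finally show ?thesis by (simp add: A1)
    qed
  qed
  have id: "integrable M (\<lambda>x. (d n x)\<^sup>2)" for n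
  proof (rule Bochner_Integration.integrable_bound)
    show "integrable M (\<lambda>x. C * (A x * (q n x - P j x)\<^sup>2 / (norm (fst x))\<^sup>2))"
      by (intro integrable_mult_right inv(1))
    show "(\<lambda>x. (d n x)\<^sup>2) \<in> borel_measurable M" using md by measurable
    show "AE x in M. norm ((d n x)\<^sup>2) \<le> norm (C * (A x * (q n x - P j x)\<^sup>2 / (norm (fst x))\<^sup>2))"
      using bd[of n]
    proof eventually_elim
      case (elim x)
      then show ?case using abs_ge_self[of "C * (A x * (q n x - P j x)\<^sup>2 / (norm (fst x))\<^sup>2)"]
        unfolding real_norm_def abs_power2 by linarith
    qed
  qed
  have Ld: "L2 M (d n)" for n using md id by (simp add: L2_def)
  show ?thesis
    unfolding j_def[symmetric] I_def[symmetric]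
  proof (rule L2limI_bound[OF LI])
    show "L2 M (\<lambda>x. I x * (P j x / fw \<alpha> j x))"
      using L2_diff[OF LI[of 0] Ld[of 0]] by (simp add: d_def)
    show "(\<lambda>n. C * E n) \<longlonglongrightarrow> 0" using tendsto_mult[OF tendsto_const E0, of C] by simp
    show "integral\<^sup>L M (\<lambda>x. (I x * pd j (h n) x - I x * (P j x / fw \<alpha> j x))\<^sup>2) \<le> C * E n" for n
    proof -
      have "integral\<^sup>L M (\<lambda>x. (d n x)\<^sup>2) \<le> integral\<^sup>L M (\<lambda>x. C * (A x * (q n x - P j x)\<^sup>2 / (norm (fst x))\<^sup>2))"
        by (rule integral_mono_AE[OF id _ bd]) (intro integrable_mult_right inv(1))
      also have "\<dots> = C * integral\<^sup>L M (\<lambda>x. A x * (q n x - P j x)\<^sup>2 / (norm (fst x))\<^sup>2)"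
        by (rule integral_mult_right_zero)
      also have "\<dots> \<le> C * E n" by (rule mult_left_mono[OF inv(2) C])
      finally show ?thesis by (simp add: d_def)
    qed
  qed
qed

lemma measurable_indicator_shell: "indicator (shell \<alpha> s1 s2) \<in> borel_measurable M"
  by (intro borel_measurable_lebesgue_onI borel_measurable_indicator borel_compact shell_props(1) \<alpha>)

text \<open>Coordinates are bounded on the shell, so convergence of the plain derivatives suffices.
  The z-derivatives are themselves fields; the t-derivatives were treated by the Hardy
  inequality.\<close>

lemma L2lim_dil:
  assumes s: "s2 < ln R"
  shows "L2lim M (\<lambda>n x. indicator (shell \<alpha> s1 s2) x * dil \<alpha> (h n) x) (\<lambda>x. indicator (shell \<alpha> s1 s2) x * Du x)"
proof -
  define I where "I = (indicator (shell \<alpha> s1 s2) :: ('m, 'k) point \<Rightarrow> real)"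
  have mI: "I \<in> borel_measurable M" unfolding I_def by (rule measurable_indicator_shell)
  have "bounded (shell \<alpha> s1 s2 :: ('m, 'k) point set)" by (rule compact_imp_bounded[OF shell_props(1)[OF \<alpha>(1)]])
  then obtain B where B: "\<And>x. x \<in> shell \<alpha> s1 s2 \<Longrightarrow> norm (x :: ('m, 'k) point) \<le> B"
    unfolding bounded_iff by blast
  have 1: "L2lim M (\<lambda>n x. I x * pd i (h n) x) (\<lambda>x. I x * (P i x / fw \<alpha> i x))" for i
  proof (cases i)
    case (Inl a)
    have "L2lim M (\<lambda>n x. I x * (fw \<alpha> i x * pd i (h n) x)) (\<lambda>x. I x * P i x)"
      by (rule L2lim_bounded_mult[OF lim_P mI, of 1]) (auto simp: I_def indicator_def)
    then show ?thesis using Inl by simp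
  next
    case (Inr b)
    then show ?thesis unfolding I_def using L2lim_pd_Inr[OF s] by simp
  qed
  have 2: "L2lim M (\<lambda>n x. (I x * (dilw \<alpha> i * (x \<bullet> dir i))) * (I x * pd i (h n) x))
      (\<lambda>x. (I x * (dilw \<alpha> i * (x \<bullet> dir i))) * (I x * (P i x / fw \<alpha> i x)))" for i
  proof (rule L2lim_bounded_mult[OF 1])
    have "(\<lambda>x. x \<bullet> dir i) \<in> borel_measurable M"
      by (intro borel_measurable_lebesgue_onI borel_measurable_continuous_onI continuous_intros)
    then show "(\<lambda>x. I x * (dilw \<alpha> i * (x \<bullet> dir i))) \<in> borel_measurable M" using mI by measurable
    fix x assume "x \<in> space M"
    show "\<bar>I x * (dilw \<alpha> i * (x \<bullet> dir i))\<bar> \<le> (\<alpha> + 1) * \<bar>B\<bar>"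
    proof (cases "x \<in> shell \<alpha> s1 s2")
      case True
      have "norm (dir i :: ('m, 'k) point) = 1" by (cases i) (auto simp: norm_Pair)
      then have "\<bar>x \<bullet> dir i\<bar> \<le> \<bar>B\<bar>"
        using Cauchy_Schwarz_ineq2[of x "dir i"] B[OF True] by simp
      moreover have "\<bar>dilw \<alpha> i\<bar> \<le> \<alpha> + 1" using \<alpha> by (cases i) auto
      ultimately show ?thesis using True \<alpha> by (simp add: I_def abs_mult mult_mono)
    qed (use \<alpha> in \<open>simp add: I_def\<close>)
  qed
  \<comment> \<open>The indicator is idempotent: one copy bounds the coordinate, the other makes the
    derivative square-integrable.\<close>
  have 3: "(I x * (dilw \<alpha> i * (x \<bullet> dir i))) * (I x * y) = I x * (dilw \<alpha> i * (x \<bullet> dir i) * y)" for x i y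
    by (cases "x \<in> shell \<alpha> s1 s2") (auto simp: I_def)
  have "L2lim M (\<lambda>n x. \<Sum>i\<in>UNIV. I x * (dilw \<alpha> i * (x \<bullet> dir i) * pd i (h n) x))
      (\<lambda>x. \<Sum>i\<in>UNIV. I x * (dilw \<alpha> i * (x \<bullet> dir i) * (P i x / fw \<alpha> i x)))"
    using 2 unfolding 3 by (rule L2lim_sum)
  then show ?thesis unfolding I_def[symmetric] Du_def dil_def sum_distrib_left .
qed

section \<open>The multiplier identities in the limit\<close>

lemmas L2_u = L2limD(2)[OF lim_u] and L2_B = L2limD(2)[OF lim_B] and L2_P = L2limD(2)[OF lim_P]

lemma bounded_radial:
  assumes "admissible (ln R) a" obtains B where "\<And>x. \<bar>a (lrho \<alpha> x)\<bar> \<le> B"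
  using bounded_of_admissible[OF assms] by metis

lemma Du_zero: "Du 0 = 0"
  by (simp add: Du_def)

text \<open>The shell excludes the origin, where \<open>lrho\<close> is meaningless and the weight
  need not vanish; \<open>f 0 = 0\<close> covers this point.\<close>

lemma truncated_Du:
  assumes "\<And>s. s < s1 \<or> s2 < s \<Longrightarrow> a s = (0::real)" and f0: "f 0 = 0"
  shows "a (lrho \<alpha> x) * f x = a (lrho \<alpha> x) * (indicator (shell \<alpha> s1 s2) x * f x)"
proof (cases "x \<in> shell \<alpha> s1 s2")
  case False
  then have "x = 0 \<or> a (lrho \<alpha> x) = 0" using assms(1)[of "lrho \<alpha> x"] by (auto simp: shell_def not_le)
  with False f0 show ?thesis by auto
qed simp

lemma rellich_limit:
  assumes da: "\<And>s. (a has_real_derivative a' s) (at s)" and ca': "continuous_on UNIV a'"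
    and s2: "s2 < ln R" and z: "\<And>s. s < s1 \<or> s2 < s \<Longrightarrow> a s = 0"
  shows "has_bochner_integral M (\<lambda>x. a (lrho \<alpha> x) * Bu x * Du x + a' (lrho \<alpha> x) * radw \<alpha> x * (Du x)\<^sup>2
    - (\<kappa> * a (lrho \<alpha> x) + a' (lrho \<alpha> x) / 2) * Gu x) 0"
proof -
  have z': "a' s = 0" if "s < s1 \<or> s2 < s" for s by (rule DERIV_zero_outside[OF da z that])
  have ca: "continuous_on UNIV a" using da by (intro DERIV_continuous_on) auto
  have adm: "admissible (ln R) a" "admissible (ln R) a'" using ca ca' z z' s2 unfolding admissible_def by blast+
  define I where "I = (indicator (shell \<alpha> s1 s2) :: ('m, 'k) point \<Rightarrow> real)"
  define A W C where "A = (\<lambda>x::('m, 'k) point. a (lrho \<alpha> x))" and "W = (\<lambda>x::('m, 'k) point. a' (lrho \<alpha> x) * radw \<alpha> x)"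
    and "C = (\<lambda>x::('m, 'k) point. \<kappa> * a (lrho \<alpha> x) + a' (lrho \<alpha> x) / 2)"
  have mA: "A \<in> borel_measurable M" unfolding A_def by (rule measurable_radial[OF ca])
  have mW: "W \<in> borel_measurable M" unfolding W_def by (rule measurable_radial_radw[OF ca'])
  have admC: "admissible (ln R) (\<lambda>s. \<kappa> * a s + a' s / 2)"
    using admissible_add[OF admissible_cmult[OF adm(1), of \<kappa>] admissible_cmult[OF adm(2), of "1/2"]] by simp
  have mC: "C \<in> borel_measurable M" unfolding C_def
    by (rule measurable_radial) (use admC in \<open>simp add: admissible_def\<close>)
  obtain BA where BA: "\<And>x. \<bar>A x\<bar> \<le> BA" using bounded_radial[OF adm(1)] unfolding A_def by blast
  obtain BW where BW: "\<And>x. x \<in> space M \<Longrightarrow> \<bar>W x\<bar> \<le> BW"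
    using radial_radw_bounded[OF adm(2)] unfolding W_def by blast
  obtain BC where BC: "\<And>x. \<bar>C x\<bar> \<le> BC" using bounded_radial[OF admC] unfolding C_def by blast
  note lD = L2lim_dil[OF s2, of s1, folded I_def]
  \<comment> \<open>One functional serves the approximants and the limit: it vanishes on the former
    by the smooth identity and is continuous under \<open>L2lim\<close>.\<close>
  define J where "J = (\<lambda>(b :: ('m, 'k) point \<Rightarrow> real) (d :: ('m, 'k) point \<Rightarrow> real) p.
      integral\<^sup>L M (\<lambda>x. A x * (b x * (I x * d x))) + integral\<^sup>L M (\<lambda>x. W x * ((I x * d x) * (I x * d x)))
      - (\<Sum>i\<in>(UNIV :: ('m + 'k) set). integral\<^sup>L M (\<lambda>x. C x * (p i x * p i x))))"
  have eq: "has_bochner_integral M (\<lambda>x. a (lrho \<alpha> x) * b x * d x + a' (lrho \<alpha> x) * radw \<alpha> x * (d x)\<^sup>2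
    - (\<kappa> * a (lrho \<alpha> x) + a' (lrho \<alpha> x) / 2) * (\<Sum>i\<in>UNIV. (p i x)\<^sup>2)) (J b d p)"
    if L: "L2 M b" "L2 M (\<lambda>x. I x * d x)" "\<And>i. L2 M (p i)" and d0: "d 0 = 0" for b d p
  proof -
    have i: "integrable M (\<lambda>x. A x * (b x * (I x * d x)))" "integrable M (\<lambda>x. W x * ((I x * d x) * (I x * d x)))"
      "integrable M (\<lambda>x. C x * (p i x * p i x))" for i
      using L2_inner_weight_integrable[OF L(1) L(2) mA BA] L2_inner_weight_integrable[OF L(2) L(2) mW BW]
        L2_inner_weight_integrable[OF L(3) L(3) mC BC] by blast+
    have "has_bochner_integral M (\<lambda>x. A x * (b x * (I x * d x)) + W x * ((I x * d x) * (I x * d x))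
        - (\<Sum>i\<in>UNIV. C x * (p i x * p i x))) (J b d p)"
      unfolding J_def
      by (intro has_bochner_integral_diff has_bochner_integral_add has_bochner_integral_sum has_bochner_integral_integrable i)
    moreover have "A x * (b x * (I x * d x)) + W x * ((I x * d x) * (I x * d x)) - (\<Sum>i\<in>UNIV. C x * (p i x * p i x))
      = a (lrho \<alpha> x) * b x * d x + a' (lrho \<alpha> x) * radw \<alpha> x * (d x)\<^sup>2
        - (\<kappa> * a (lrho \<alpha> x) + a' (lrho \<alpha> x) / 2) * (\<Sum>i\<in>UNIV. (p i x)\<^sup>2)" for x
    proof -
      have "A x * d x = A x * (I x * d x)" unfolding A_def I_def by (rule truncated_Du[where a = a and f = d, OF z d0])
      from arg_cong[OF this, of "\<lambda>t. b x * t"]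
      have 1: "A x * b x * d x = A x * (b x * (I x * d x))" by (simp only: mult_ac)
      have "a' (lrho \<alpha> x) * (d x)\<^sup>2 = a' (lrho \<alpha> x) * (I x * (d x)\<^sup>2)"
        unfolding I_def by (rule truncated_Du[where a = a' and f = "\<lambda>x. (d x)\<^sup>2"]) (simp_all add: d0 z')
      moreover have "I x * (d x)\<^sup>2 = (I x * d x) * (I x * d x)" by (simp add: I_def indicator_def power2_eq_square)
      ultimately have "a' (lrho \<alpha> x) * (d x)\<^sup>2 = a' (lrho \<alpha> x) * ((I x * d x) * (I x * d x))" by simp
      from arg_cong[OF this, of "\<lambda>t. radw \<alpha> x * t"]
      have 2: "a' (lrho \<alpha> x) * radw \<alpha> x * (d x)\<^sup>2 = W x * ((I x * d x) * (I x * d x))"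
        unfolding W_def by (simp only: mult_ac)
      show ?thesis unfolding 1[symmetric] 2[symmetric]
        by (simp add: A_def C_def sum_distrib_left power2_eq_square)
    qed
    ultimately show ?thesis by simp
  qed
  have "(\<lambda>n. J (grushin \<alpha> (h n)) (dil \<alpha> (h n)) (\<lambda>i x. fw \<alpha> i x * pd i (h n) x)) \<longlonglongrightarrow> J Bu Du P"
    unfolding J_def
    by (intro tendsto_diff tendsto_add tendsto_sum L2lim_inner_weight[OF lim_B lD mA BA] L2lim_inner_weight[OF lD lD mW BW]
        L2lim_inner_weight[OF lim_P lim_P mC BC])
  moreover have "J (grushin \<alpha> (h n)) (dil \<alpha> (h n)) (\<lambda>i x. fw \<alpha> i x * pd i (h n) x) = 0" for n
  proof -
    interpret sr: smooth_radial \<alpha> \<Omega> "shell \<alpha> s1 s2" "h n" a a'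
      by (rule smooth_radialI[OF da ca' s2 z])
    have d0: "dil \<alpha> (h n) 0 = 0" by (simp add: dil_def)
    have "(\<Sum>i\<in>UNIV. (fw \<alpha> i x * pd i (h n) x)\<^sup>2) = gradsq \<alpha> (h n) x" for x
      by (simp add: gradsq_def power_mult_distrib fw_sq)
    with eq[where p = "\<lambda>i x. fw \<alpha> i x * pd i (h n) x", OF L2limD(1)[OF lim_B, where n = n] L2limD(1)[OF lD, where n = n] L2limD(1)[OF lim_P, where n = n] d0] sr.rellich_identity(2)
    show ?thesis by (simp add: \<kappa>[symmetric] has_bochner_integral_iff)
  qed
  ultimately have "J Bu Du P = 0" by (simp add: LIMSEQ_const_iff)
  with eq[where p = P, OF L2_B L2limD(2)[OF lD] L2_P Du_zero] show ?thesis by (simp add: Gu_def)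
qed

lemma energy_limit:
  assumes da: "\<And>s. (a has_real_derivative a' s) (at s)" and ca': "continuous_on UNIV a'"
    and s2: "s2 < ln R" and z: "\<And>s. s < s1 \<or> s2 < s \<Longrightarrow> a s = 0"
  shows "has_bochner_integral M (\<lambda>x. a (lrho \<alpha> x) * Bu x * u x + a (lrho \<alpha> x) * Gu x
    + a' (lrho \<alpha> x) * radw \<alpha> x * u x * Du x) 0"
proof -
  have z': "a' s = 0" if "s < s1 \<or> s2 < s" for s by (rule DERIV_zero_outside[OF da z that])
  have ca: "continuous_on UNIV a" using da by (intro DERIV_continuous_on) auto
  have adm: "admissible (ln R) a" "admissible (ln R) a'" using ca ca' z z' s2 unfolding admissible_def by blast+
  define I where "I = (indicator (shell \<alpha> s1 s2) :: ('m, 'k) point \<Rightarrow> real)"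
  define A W where "A = (\<lambda>x::('m, 'k) point. a (lrho \<alpha> x))" and "W = (\<lambda>x::('m, 'k) point. a' (lrho \<alpha> x) * radw \<alpha> x)"
  have mA: "A \<in> borel_measurable M" unfolding A_def by (rule measurable_radial[OF ca])
  have mW: "W \<in> borel_measurable M" unfolding W_def by (rule measurable_radial_radw[OF ca'])
  obtain BA where BA: "\<And>x. \<bar>A x\<bar> \<le> BA" using bounded_radial[OF adm(1)] unfolding A_def by blast
  obtain BW where BW: "\<And>x. x \<in> space M \<Longrightarrow> \<bar>W x\<bar> \<le> BW"
    using radial_radw_bounded[OF adm(2)] unfolding W_def by blast
  note lD = L2lim_dil[OF s2, of s1, folded I_def]
  define J where "J = (\<lambda>(b :: ('m, 'k) point \<Rightarrow> real) v (d :: ('m, 'k) point \<Rightarrow> real) p.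
      integral\<^sup>L M (\<lambda>x. A x * (b x * v x)) + (\<Sum>i\<in>(UNIV :: ('m + 'k) set). integral\<^sup>L M (\<lambda>x. A x * (p i x * p i x)))
      + integral\<^sup>L M (\<lambda>x. W x * (v x * (I x * d x))))"
  have eq: "has_bochner_integral M (\<lambda>x. a (lrho \<alpha> x) * b x * v x + a (lrho \<alpha> x) * (\<Sum>i\<in>UNIV. (p i x)\<^sup>2)
      + a' (lrho \<alpha> x) * radw \<alpha> x * v x * d x) (J b v d p)"
    if L: "L2 M b" "L2 M v" "L2 M (\<lambda>x. I x * d x)" "\<And>i. L2 M (p i)" and d0: "d 0 = 0" for b v d p
  proof -
    have i: "integrable M (\<lambda>x. A x * (b x * v x))" "integrable M (\<lambda>x. W x * (v x * (I x * d x)))"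
      "integrable M (\<lambda>x. A x * (p i x * p i x))" for i
      using L2_inner_weight_integrable[OF L(1) L(2) mA BA] L2_inner_weight_integrable[OF L(2) L(3) mW BW]
        L2_inner_weight_integrable[OF L(4) L(4) mA BA] by blast+
    have "has_bochner_integral M (\<lambda>x. A x * (b x * v x) + (\<Sum>i\<in>UNIV. A x * (p i x * p i x))
        + W x * (v x * (I x * d x))) (J b v d p)"
      unfolding J_def
      by (intro has_bochner_integral_add has_bochner_integral_sum has_bochner_integral_integrable i)
    moreover have "A x * (b x * v x) + (\<Sum>i\<in>UNIV. A x * (p i x * p i x)) + W x * (v x * (I x * d x))
      = a (lrho \<alpha> x) * b x * v x + a (lrho \<alpha> x) * (\<Sum>i\<in>UNIV. (p i x)\<^sup>2) + a' (lrho \<alpha> x) * radw \<alpha> x * v x * d x" for x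
    proof -
      have "a' (lrho \<alpha> x) * d x = a' (lrho \<alpha> x) * (I x * d x)" unfolding I_def by (rule truncated_Du[where a = a' and f = d, OF z' d0])
      from arg_cong[OF this, of "\<lambda>t. radw \<alpha> x * v x * t"]
      have 2: "a' (lrho \<alpha> x) * radw \<alpha> x * v x * d x = W x * (v x * (I x * d x))"
        unfolding W_def by (simp only: mult_ac)
      show ?thesis unfolding 2[symmetric] by (simp add: A_def sum_distrib_left power2_eq_square)
    qed
    ultimately show ?thesis by simp
  qed
  have "(\<lambda>n. J (grushin \<alpha> (h n)) (h n) (dil \<alpha> (h n)) (\<lambda>i x. fw \<alpha> i x * pd i (h n) x)) \<longlonglongrightarrow> J Bu u Du P"
    unfolding J_def
    by (intro tendsto_add tendsto_sum L2lim_inner_weight[OF lim_B lim_u mA BA] L2lim_inner_weight[OF lim_u lD mW BW]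
        L2lim_inner_weight[OF lim_P lim_P mA BA])
  moreover have "J (grushin \<alpha> (h n)) (h n) (dil \<alpha> (h n)) (\<lambda>i x. fw \<alpha> i x * pd i (h n) x) = 0" for n
  proof -
    interpret sr: smooth_radial \<alpha> \<Omega> "shell \<alpha> s1 s2" "h n" a a'
      by (rule smooth_radialI[OF da ca' s2 z])
    have d0: "dil \<alpha> (h n) 0 = 0" by (simp add: dil_def)
    have "(\<Sum>i\<in>UNIV. (fw \<alpha> i x * pd i (h n) x)\<^sup>2) = gradsq \<alpha> (h n) x" for x
      by (simp add: gradsq_def power_mult_distrib fw_sq)
    with eq[where p = "\<lambda>i x. fw \<alpha> i x * pd i (h n) x", OF L2limD(1)[OF lim_B, where n = n] L2limD(1)[OF lim_u, where n = n] L2limD(1)[OF lD, where n = n] L2limD(1)[OF lim_P, where n = n] d0] sr.energy_identity(2)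
    show ?thesis by (simp add: has_bochner_integral_iff)
  qed
  ultimately have "J Bu u Du P = 0" by (simp add: LIMSEQ_const_iff)
  with eq[where p = P, OF L2_B L2_u L2limD(2)[OF lD] L2_P Du_zero] show ?thesis by (simp add: Gu_def)
qed

lemma dilation_limit:
  assumes da: "\<And>s. (a has_real_derivative a' s) (at s)" and ca': "continuous_on UNIV a'"
    and s2: "s2 < ln R" and z: "\<And>s. s < s1 \<or> s2 < s \<Longrightarrow> a s = 0"
  shows "has_bochner_integral M (\<lambda>x. radw \<alpha> x * (2 * a (lrho \<alpha> x) * u x * Du x
    + (a' (lrho \<alpha> x) + 2 * \<kappa> * a (lrho \<alpha> x)) * (u x)\<^sup>2)) 0"
proof -
  have z': "a' s = 0" if "s < s1 \<or> s2 < s" for s by (rule DERIV_zero_outside[OF da z that])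
  have ca: "continuous_on UNIV a" using da by (intro DERIV_continuous_on) auto
  have adm: "admissible (ln R) a" "admissible (ln R) a'" using ca ca' z z' s2 unfolding admissible_def by blast+
  \<comment> \<open>The exponential is the reciprocal of \<open>gaugeN\<close> and turns |z|^(2
    \<alpha>) into W. Its derivative contributes -2 (\<alpha> + 1), which together with Q + 2
    \<alpha> gives Q - 2 = 2 \<kappa>.\<close>
  define b b' where "b = (\<lambda>s. a s * exp (- 2 * (\<alpha> + 1) * s))"
    and "b' = (\<lambda>s. (a' s - 2 * (\<alpha> + 1) * a s) * exp (- 2 * (\<alpha> + 1) * s))"
  have db: "(b has_real_derivative b' s) (at s)" for s
    unfolding b_def b'_def by (auto intro!: derivative_eq_intros da simp: algebra_simps)
  have cb': "continuous_on UNIV b'" unfolding b'_def by (intro continuous_intros ca ca')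
  define I where "I = (indicator (shell \<alpha> s1 s2) :: ('m, 'k) point \<Rightarrow> real)"
  define A C where "A = (\<lambda>x::('m, 'k) point. (2 * a (lrho \<alpha> x)) * radw \<alpha> x)"
    and "C = (\<lambda>x::('m, 'k) point. (a' (lrho \<alpha> x) + 2 * \<kappa> * a (lrho \<alpha> x)) * radw \<alpha> x)"
  have admC: "admissible (ln R) (\<lambda>s. a' s + 2 * \<kappa> * a s)" "admissible (ln R) (\<lambda>s. 2 * a s)"
    by (intro admissible_add admissible_cmult adm)+
  have mA: "A \<in> borel_measurable M" unfolding A_def
    by (rule measurable_radial_radw[where a = "\<lambda>s. 2 * a s"]) (use admC in \<open>simp add: admissible_def\<close>)
  have mC: "C \<in> borel_measurable M" unfolding C_def
    by (rule measurable_radial_radw[where a = "\<lambda>s. a' s + 2 * \<kappa> * a s"]) (use admC in \<open>simp add: admissible_def\<close>)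
  obtain BA where BA: "\<And>x. x \<in> space M \<Longrightarrow> \<bar>A x\<bar> \<le> BA"
    using radial_radw_bounded[OF admC(2)] unfolding A_def by blast
  obtain BC where BC: "\<And>x. x \<in> space M \<Longrightarrow> \<bar>C x\<bar> \<le> BC"
    using radial_radw_bounded[OF admC(1)] unfolding C_def by blast
  note lD = L2lim_dil[OF s2, of s1, folded I_def]
  define J where "J = (\<lambda>v (d :: ('m, 'k) point \<Rightarrow> real).
      integral\<^sup>L M (\<lambda>x. A x * (v x * (I x * d x))) + integral\<^sup>L M (\<lambda>x. C x * (v x * v x)))"
  have eq: "has_bochner_integral M (\<lambda>x. radw \<alpha> x * (2 * a (lrho \<alpha> x) * v x * d x
    + (a' (lrho \<alpha> x) + 2 * \<kappa> * a (lrho \<alpha> x)) * (v x)\<^sup>2)) (J v d)"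
    if L: "L2 M v" "L2 M (\<lambda>x. I x * d x)" and d0: "d 0 = 0" for v d
  proof -
    have i: "integrable M (\<lambda>x. A x * (v x * (I x * d x)))" "integrable M (\<lambda>x. C x * (v x * v x))"
      using L2_inner_weight_integrable[OF L(1) L(2) mA BA] L2_inner_weight_integrable[OF L(1) L(1) mC BC] by blast+
    have "has_bochner_integral M (\<lambda>x. A x * (v x * (I x * d x)) + C x * (v x * v x)) (J v d)"
      unfolding J_def by (intro has_bochner_integral_add has_bochner_integral_integrable i)
    moreover have "A x * (v x * (I x * d x)) + C x * (v x * v x) = radw \<alpha> x * (2 * a (lrho \<alpha> x) * v x * d x
      + (a' (lrho \<alpha> x) + 2 * \<kappa> * a (lrho \<alpha> x)) * (v x)\<^sup>2)" for x
    proof -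
      have "a (lrho \<alpha> x) * d x = a (lrho \<alpha> x) * (I x * d x)" unfolding I_def by (rule truncated_Du[where a = a and f = d, OF z d0])
      then have "2 * radw \<alpha> x * v x * (a (lrho \<alpha> x) * d x) = 2 * radw \<alpha> x * v x * (a (lrho \<alpha> x) * (I x * d x))" by simp
      then show ?thesis by (simp add: A_def C_def power2_eq_square algebra_simps)
    qed
    ultimately show ?thesis by simp
  qed
  have "(\<lambda>n. J (h n) (dil \<alpha> (h n))) \<longlonglongrightarrow> J u Du"
    unfolding J_def
    by (intro tendsto_add L2lim_inner_weight[OF lim_u lD mA BA] L2lim_inner_weight[OF lim_u lim_u mC BC])
  moreover have "J (h n) (dil \<alpha> (h n)) = 0" for n
  proof -
    interpret sr: smooth_radial \<alpha> \<Omega> "shell \<alpha> s1 s2" "h n" b b'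
      by (rule smooth_radialI[OF db cb' s2]) (simp add: b_def z)
    have d0: "dil \<alpha> (h n) 0 = 0" by (simp add: dil_def)
    have pt: "norm (fst x) powr (2 * \<alpha>) * (2 * b (lrho \<alpha> x) * h n x * dil \<alpha> (h n) x
       + (b' (lrho \<alpha> x) + (homdim \<alpha> TYPE('m) TYPE('k) + 2 * \<alpha>) * b (lrho \<alpha> x)) * (h n x)\<^sup>2)
       = radw \<alpha> x * (2 * a (lrho \<alpha> x) * h n x * dil \<alpha> (h n) x
       + (a' (lrho \<alpha> x) + 2 * \<kappa> * a (lrho \<alpha> x)) * (h n x)\<^sup>2)" for x
    proof (cases "x = 0")
      case True
      then show ?thesis by (simp add: radw_def)
    next
      case False
      have "radw \<alpha> x = norm (fst x) powr (2 * \<alpha>) * exp (- 2 * (\<alpha> + 1) * lrho \<alpha> x)"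
        unfolding radw_def gaugeN_eq_exp[OF \<alpha>(1) False] mult_minus_left exp_minus divide_inverse ..
      moreover have "homdim \<alpha> TYPE('m) TYPE('k) = 2 * \<kappa> + 2" by (simp add: \<kappa> field_simps)
      moreover obtain e where "exp (- 2 * (\<alpha> + 1) * lrho \<alpha> x) = e" by blast
      ultimately show ?thesis unfolding b_def b'_def by (simp only:) (simp add: algebra_simps)
    qed
    show ?thesis
      using eq[OF L2limD(1)[OF lim_u, where n = n] L2limD(1)[OF lD, where n = n] d0] sr.dilation_identity(2)
      unfolding pt by (simp add: has_bochner_integral_iff)
  qed
  ultimately have "J u Du = 0" by (simp add: LIMSEQ_const_iff)
  with eq[OF L2_u L2limD(2)[OF lD] Du_zero] show ?thesis by simp
qed

lemma hardy_limit:
  assumes da: "\<And>s. (a has_real_derivative a' s) (at s)" and ca': "continuous_on UNIV a'"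
    and s2: "s2 < ln R" and z: "\<And>s. s < s1 \<or> s2 < s \<Longrightarrow> a s = 0" and a0: "\<And>s. 0 \<le> a s"
  shows "integrable M (\<lambda>x. a (lrho \<alpha> x) * (u x)\<^sup>2 / (norm (fst x))\<^sup>2)"
    and "integral\<^sup>L M (\<lambda>x. a (lrho \<alpha> x) * (u x)\<^sup>2 / (norm (fst x))\<^sup>2)
      \<le> 4 * integral\<^sup>L M (\<lambda>x. a (lrho \<alpha> x) * Gu x) + 2 * integral\<^sup>L M (\<lambda>x. \<bar>a' (lrho \<alpha> x)\<bar> * radw \<alpha> x * (u x)\<^sup>2)"
proof -
  have z': "a' s = 0" if "s < s1 \<or> s2 < s" for s by (rule DERIV_zero_outside[OF da z that])
  have ca: "continuous_on UNIV a" using da by (intro DERIV_continuous_on) auto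
  have adm: "admissible (ln R) a" "admissible (ln R) a'" using ca ca' z z' s2 unfolding admissible_def by blast+
  define A W where "A = (\<lambda>x::('m, 'k) point. a (lrho \<alpha> x))" and "W = (\<lambda>x::('m, 'k) point. \<bar>a' (lrho \<alpha> x)\<bar> * radw \<alpha> x)"
  have A0: "0 \<le> A x" for x by (simp add: A_def a0)
  have mA: "A \<in> borel_measurable M" unfolding A_def by (rule measurable_radial[OF ca])
  have mW: "W \<in> borel_measurable M" unfolding W_def
    by (rule measurable_radial_radw[where a = "\<lambda>s. \<bar>a' s\<bar>"]) (intro continuous_on_rabs ca')
  obtain BA where BA: "\<And>x. \<bar>A x\<bar> \<le> BA" using bounded_radial[OF adm(1)] unfolding A_def by blast
  obtain BW where BW: "\<And>x. x \<in> space M \<Longrightarrow> \<bar>W x\<bar> \<le> BW"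
    using radial_radw_bounded[OF admissible_abs[OF adm(2)]] unfolding W_def by blast
  \<comment> \<open>A z-index has \<open>fw\<close> equal to 1, so the inequality is obtained for
    the functions themselves and not for a t-field.\<close>
  define j :: "'m + 'k" where "j = Inl undefined"
  define E where "E = 4 * (\<Sum>c\<in>UNIV. integral\<^sup>L M (\<lambda>x. A x * (P (Inl c) x * P (Inl c) x))) + 2 * integral\<^sup>L M (\<lambda>x. W x * (u x * u x))"
  have iP: "integrable M (\<lambda>x. A x * (P i x * P i x))" for i
    by (rule L2_inner_weight_integrable[OF L2_P L2_P mA BA])
  have res: "integral\<^sup>L M (\<lambda>x. A x * (u x)\<^sup>2 / ((norm (fst x))\<^sup>2 + \<tau>)) \<le> E"
    and ires: "integrable M (\<lambda>x. A x * (u x)\<^sup>2 / ((norm (fst x))\<^sup>2 + \<tau>))" if \<tau>: "\<tau> > 0" for \<tau>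
  proof -
    define w where "w = (\<lambda>x::('m, 'k) point. A x / ((norm (fst x))\<^sup>2 + \<tau>))"
    have mw: "w \<in> borel_measurable M" unfolding w_def using mA measurable_norm_fst by measurable
    have bw: "\<bar>w x\<bar> \<le> BA / \<tau>" for x
    proof -
      have "\<bar>A x\<bar> / ((norm (fst x))\<^sup>2 + \<tau>) \<le> BA / \<tau>" using \<tau> BA[of x] by (intro frac_le) auto
      then show ?thesis using \<tau> by (simp add: w_def abs_of_nonneg A0)
    qed
    have lP: "L2lim M (\<lambda>n. pd (Inl c) (h n)) (P (Inl c))" for c using lim_P[of "Inl c"] by simp
    have "integral\<^sup>L M (\<lambda>x. w x * (h n x * h n x))
        \<le> 4 * (\<Sum>c\<in>UNIV. integral\<^sup>L M (\<lambda>x. A x * (pd (Inl c) (h n) x * pd (Inl c) (h n) x)))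
          + 2 * integral\<^sup>L M (\<lambda>x. W x * (h n x * h n x))" for n
    proof -
      interpret sr: smooth_radial \<alpha> \<Omega> "shell \<alpha> s1 s2" "h n" a a'
        by (rule smooth_radialI[OF da ca' s2 z])
      let ?k' = "\<lambda>c. pd (Inl c) (h n)"
      have hg: "hgrad \<alpha> j ?k' (h n) c x = pd (Inl c) (h n) x" for c x by (simp add: j_def)
      have ig: "integrable M (\<lambda>x. A x * (pd (Inl c) (h n) x * pd (Inl c) (h n) x))" for c
        by (rule L2_inner_weight_integrable[OF L2limD(1)[OF lP] L2limD(1)[OF lP] mA BA])
      have int: "integrable M (\<lambda>x. a (lrho \<alpha> x) * (\<Sum>c\<in>UNIV. (hgrad \<alpha> j ?k' (h n) c x)\<^sup>2))"
        using ig by (simp add: hg A_def sum_distrib_left power2_eq_square)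
      have dk: "dderiv (dir (Inl c)) (h n) (?k' c x) x" if "x \<in> \<Omega> - {0}" for x c
        using that by (intro sr.dderiv_h) auto
      have zz: "a' (lrho \<alpha> x) = 0" if "x \<in> \<Omega> - {0} - shell \<alpha> s1 s2" for x
        by (rule z') (use that in \<open>auto simp: shell_def not_le\<close>)
      have "integral\<^sup>L M (\<lambda>x. a (lrho \<alpha> x) * (fw \<alpha> j x * h n x)\<^sup>2 / ((norm (fst x))\<^sup>2 + \<tau>))
        \<le> 4 * integral\<^sup>L M (\<lambda>x. a (lrho \<alpha> x) * (\<Sum>c\<in>UNIV. (hgrad \<alpha> j ?k' (h n) c x)\<^sup>2))
          + 2 * integral\<^sup>L M (\<lambda>x. \<bar>a' (lrho \<alpha> x)\<bar> * radw \<alpha> x * (fw \<alpha> j x * h n x)\<^sup>2)"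
        by (rule sr.hardy_inequality[of "h n" ?k' \<tau> j, OF dk sr.cont_h sr.cont_pd \<tau> m a0 zz int])
      moreover have "integral\<^sup>L M (\<lambda>x. a (lrho \<alpha> x) * (\<Sum>c\<in>UNIV. (hgrad \<alpha> j ?k' (h n) c x)\<^sup>2))
        = (\<Sum>c\<in>UNIV. integral\<^sup>L M (\<lambda>x. A x * (pd (Inl c) (h n) x * pd (Inl c) (h n) x)))"
        using ig by (simp add: hg A_def sum_distrib_left power2_eq_square)
      moreover have "fw \<alpha> j x = 1" for x by (simp add: j_def)
      ultimately show ?thesis by (simp add: w_def A_def W_def power2_eq_square)
    qed
    then have "integral\<^sup>L M (\<lambda>x. w x * (u x * u x)) \<le> E"
      unfolding E_def
      by (intro LIMSEQ_le[OF L2lim_inner_weight[OF lim_u lim_u mw bw]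
            tendsto_add[OF tendsto_mult[OF tendsto_const tendsto_sum[OF L2lim_inner_weight[OF lP lP mA BA]]]
              tendsto_mult[OF tendsto_const L2lim_inner_weight[OF lim_u lim_u mW BW]]]]) auto
    then show "integral\<^sup>L M (\<lambda>x. A x * (u x)\<^sup>2 / ((norm (fst x))\<^sup>2 + \<tau>)) \<le> E"
      by (simp add: w_def power2_eq_square)
    show "integrable M (\<lambda>x. A x * (u x)\<^sup>2 / ((norm (fst x))\<^sup>2 + \<tau>))"
      using L2_inner_weight_integrable[OF L2_u L2_u mw bw] by (simp add: w_def power2_eq_square)
  qed
  have mq: "(\<lambda>x. A x * (u x)\<^sup>2) \<in> borel_measurable M"
    using mA L2_measurable[OF L2_u] by measurable
  have pos: "AE x in M. 0 < (norm (fst x))\<^sup>2" using AE_M_nonzero by eventually_elim simp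
  note r = integral_resolvent_limit[OF _ _ pos mq measurable_norm_fst ires res]
  have r1: "integrable M (\<lambda>x. A x * (u x)\<^sup>2 / (norm (fst x))\<^sup>2)"
    and r2: "integral\<^sup>L M (\<lambda>x. A x * (u x)\<^sup>2 / (norm (fst x))\<^sup>2) \<le> E"
    by (rule r; simp add: A0)+
  show "integrable M (\<lambda>x. a (lrho \<alpha> x) * (u x)\<^sup>2 / (norm (fst x))\<^sup>2)" using r1 by (simp add: A_def)
  have "(\<Sum>c\<in>UNIV. integral\<^sup>L M (\<lambda>x. A x * (P (Inl c) x * P (Inl c) x))) = integral\<^sup>L M (\<lambda>x. \<Sum>c\<in>UNIV. A x * (P (Inl c) x * P (Inl c) x))"
    using iP by simp
  \<comment> \<open>The z-components are part of |X u|^2; the nonnegative t-components are added to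
    reach \<open>Gu\<close>.\<close>
  also have "\<dots> \<le> integral\<^sup>L M (\<lambda>x. \<Sum>i\<in>UNIV. A x * (P i x * P i x))"
    using iP A0 by (intro integral_mono) (auto simp: sum_UNIV_Plus intro!: sum_nonneg)
  also have "(\<lambda>x. \<Sum>i\<in>UNIV. A x * (P i x * P i x)) = (\<lambda>x. a (lrho \<alpha> x) * Gu x)"
    by (simp add: A_def Gu_def sum_distrib_left power2_eq_square)
  finally have "E \<le> 4 * integral\<^sup>L M (\<lambda>x. a (lrho \<alpha> x) * Gu x) + 2 * integral\<^sup>L M (\<lambda>x. \<bar>a' (lrho \<alpha> x)\<bar> * radw \<alpha> x * (u x)\<^sup>2)"
    by (simp add: E_def W_def power2_eq_square)
  with r2 show "integral\<^sup>L M (\<lambda>x. a (lrho \<alpha> x) * (u x)\<^sup>2 / (norm (fst x))\<^sup>2)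
      \<le> 4 * integral\<^sup>L M (\<lambda>x. a (lrho \<alpha> x) * Gu x) + 2 * integral\<^sup>L M (\<lambda>x. \<bar>a' (lrho \<alpha> x)\<bar> * radw \<alpha> x * (u x)\<^sup>2)"
    by (simp add: A_def)
qed

section \<open>Weighted integrals and pointwise bounds\<close>

lemma integrable_weighted:
  assumes w: "admissible (ln R) w"
  shows "integrable M (\<lambda>x. w (lrho \<alpha> x) * (u x)\<^sup>2)" "integrable M (\<lambda>x. w (lrho \<alpha> x) * (radw \<alpha> x * (u x)\<^sup>2))"
    "integrable M (\<lambda>x. w (lrho \<alpha> x) * Gu x)" "integrable M (\<lambda>x. w (lrho \<alpha> x) * \<bar>Bu x * u x\<bar>)"
proof -
  have c: "continuous_on UNIV w" using w by (simp add: admissible_def)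
  have mA: "(\<lambda>x. w (lrho \<alpha> x)) \<in> borel_measurable M" by (rule measurable_radial[OF c])
  have mW: "(\<lambda>x. w (lrho \<alpha> x) * radw \<alpha> x) \<in> borel_measurable M" by (rule measurable_radial_radw[OF c])
  obtain BA where BA: "\<And>x :: ('m, 'k) point. \<bar>w (lrho \<alpha> x)\<bar> \<le> BA" using bounded_radial[OF w] by blast
  obtain BW where BW: "\<And>x. x \<in> space M \<Longrightarrow> \<bar>w (lrho \<alpha> x) * radw \<alpha> x\<bar> \<le> BW"
    using radial_radw_bounded[OF w] by blast
  show "integrable M (\<lambda>x. w (lrho \<alpha> x) * (u x)\<^sup>2)"
    using L2_inner_weight_integrable[OF L2_u L2_u mA BA] by (simp add: power2_eq_square)
  show "integrable M (\<lambda>x. w (lrho \<alpha> x) * (radw \<alpha> x * (u x)\<^sup>2))"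
    using L2_inner_weight_integrable[OF L2_u L2_u mW BW] by (simp add: power2_eq_square mult.assoc)
  have "integrable M (\<lambda>x. w (lrho \<alpha> x) * (P i x * P i x))" for i
    by (rule L2_inner_weight_integrable[OF L2_P L2_P mA BA])
  then show "integrable M (\<lambda>x. w (lrho \<alpha> x) * Gu x)"
    by (simp add: Gu_def sum_distrib_left power2_eq_square)
  have abs: "L2 M (\<lambda>x. \<bar>f x\<bar>)" if "L2 M f" for f using that by (auto simp: L2_def intro: borel_measurable_abs)
  show "integrable M (\<lambda>x. w (lrho \<alpha> x) * \<bar>Bu x * u x\<bar>)"
    using L2_inner_weight_integrable[OF abs[OF L2_B] abs[OF L2_u] mA BA] by (simp add: abs_mult)
qed

lemma Gu_nonneg: "0 \<le> Gu x"
  by (simp add: Gu_def sum_nonneg)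

text \<open>W D u is the contraction of X (ln \<rho>) with X u, and |X (ln \<rho>)|^2 = W;
  Cauchy-Schwarz and division by W finish the argument.\<close>

lemma radw_Du_sq_le:
  assumes "fst x \<noteq> 0"
  shows "radw \<alpha> x * (Du x)\<^sup>2 \<le> Gu x"
proof -
  have x: "x \<noteq> 0" using assms by auto
  have fw0: "fw \<alpha> i x \<noteq> 0" for i using assms by (cases i) auto
  have W: "radw \<alpha> x > 0" using assms gaugeN_pos[OF \<alpha>(1) x] by (simp add: radw_def)
  have "radw \<alpha> x * Du x = (\<Sum>i\<in>UNIV. (fw \<alpha> i x * dlrho \<alpha> i x) * P i x)"
  proof -
    have "radw \<alpha> x * (dilw \<alpha> i * (x \<bullet> dir i) * (P i x / fw \<alpha> i x)) = fw \<alpha> i x * dlrho \<alpha> i x * P i x" for i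
    proof -
      have "radw \<alpha> x * (dilw \<alpha> i * (x \<bullet> dir i)) = (fw \<alpha> i x)\<^sup>2 * dlrho \<alpha> i x"
        by (simp add: fw_sq fldw_dlrho[OF \<alpha>(1)])
      then have "radw \<alpha> x * (dilw \<alpha> i * (x \<bullet> dir i)) * (P i x / fw \<alpha> i x) = (fw \<alpha> i x)\<^sup>2 * dlrho \<alpha> i x * (P i x / fw \<alpha> i x)"
        by simp
      then show ?thesis using fw0[of i] by (simp add: power2_eq_square mult.assoc)
    qed
    then show ?thesis by (simp add: Du_def sum_distrib_left)
  qed
  then have "(radw \<alpha> x * Du x)\<^sup>2 \<le> (\<Sum>i\<in>UNIV. (fw \<alpha> i x * dlrho \<alpha> i x)\<^sup>2) * Gu x"
    unfolding Gu_def by (simp only: Cauchy_Schwarz_ineq_sum)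
  also have "(\<Sum>i\<in>UNIV. (fw \<alpha> i x * dlrho \<alpha> i x)\<^sup>2) = radw \<alpha> x"
    using dlrho_sum_sq[OF \<alpha>(1) x] by (simp add: power_mult_distrib fw_sq)
  finally have "radw \<alpha> x * (radw \<alpha> x * (Du x)\<^sup>2) \<le> radw \<alpha> x * Gu x"
    by (simp add: power2_eq_square mult_ac)
  then show ?thesis using W by simp
qed

text \<open>This is |z| \<le> \<rho> inserted into the numerator of W.\<close>

lemma radw_le: "x \<noteq> 0 \<Longrightarrow> radw \<alpha> x \<le> exp (- 2 * lrho \<alpha> x)"
proof -
  assume x: "x \<noteq> 0"
  have "norm (fst x) powr (2 * \<alpha>) \<le> exp (lrho \<alpha> x) powr (2 * \<alpha>)"
    using norm_fst_le_exp_lrho[OF \<alpha>(1) x] \<alpha> by (intro powr_mono2) auto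
  also have "\<dots> = exp (2 * \<alpha> * lrho \<alpha> x)" by (simp add: exp_powr_real mult.commute)
  finally have "radw \<alpha> x \<le> exp (2 * \<alpha> * lrho \<alpha> x) / exp (2 * (\<alpha> + 1) * lrho \<alpha> x)"
    unfolding radw_def gaugeN_eq_exp[OF \<alpha>(1) x] by (intro divide_right_mono) auto
  also have "\<dots> = exp (- 2 * lrho \<alpha> x)" by (simp add: exp_diff[symmetric] algebra_simps)
  finally show ?thesis .
qed

text \<open>The cross term with u D u is removed by half of the dilation identity with weight
  \<open>b1\<close>, which leaves squares only.\<close>

lemma energy_identity_squared:
  assumes db: "\<And>s. (b has_real_derivative b1 s) (at s)" "\<And>s. (b1 has_real_derivative b2 s) (at s)"
    and cb: "continuous_on UNIV b2" and s2: "s2 < ln R" and z: "\<And>s. s < s1 \<or> s2 < s \<Longrightarrow> b s = 0"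
  shows "has_bochner_integral M (\<lambda>x. b (lrho \<alpha> x) * Bu x * u x + b (lrho \<alpha> x) * Gu x
    - (b2 (lrho \<alpha> x) / 2 + \<kappa> * b1 (lrho \<alpha> x)) * (radw \<alpha> x * (u x)\<^sup>2)) 0"
proof -
  have cb1: "continuous_on UNIV b1" using db(2) by (intro DERIV_continuous_on) auto
  have z1: "b1 s = 0" if "s < s1 \<or> s2 < s" for s by (rule DERIV_zero_outside[OF db(1) z that])
  note e = energy_limit[OF db(1) cb1 s2 z]
  have d: "has_bochner_integral M (\<lambda>x. 1 / 2 * (radw \<alpha> x * (2 * b1 (lrho \<alpha> x) * u x * Du x
      + (b2 (lrho \<alpha> x) + 2 * \<kappa> * b1 (lrho \<alpha> x)) * (u x)\<^sup>2))) (1 / 2 * 0)"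
    by (rule has_bochner_integral_mult_right) (rule dilation_limit[OF db(2) cb s2 z1])
  have "has_bochner_integral M (\<lambda>x. (b (lrho \<alpha> x) * Bu x * u x + b (lrho \<alpha> x) * Gu x + b1 (lrho \<alpha> x) * radw \<alpha> x * u x * Du x)
     - 1 / 2 * (radw \<alpha> x * (2 * b1 (lrho \<alpha> x) * u x * Du x + (b2 (lrho \<alpha> x) + 2 * \<kappa> * b1 (lrho \<alpha> x)) * (u x)\<^sup>2))) (0 - 1 / 2 * 0)"
    by (rule has_bochner_integral_diff[OF e d])
  moreover have "(b (lrho \<alpha> x) * Bu x * u x + b (lrho \<alpha> x) * Gu x + b1 (lrho \<alpha> x) * radw \<alpha> x * u x * Du x)
     - 1 / 2 * (radw \<alpha> x * (2 * b1 (lrho \<alpha> x) * u x * Du x + (b2 (lrho \<alpha> x) + 2 * \<kappa> * b1 (lrho \<alpha> x)) * (u x)\<^sup>2))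
    = b (lrho \<alpha> x) * Bu x * u x + b (lrho \<alpha> x) * Gu x
    - (b2 (lrho \<alpha> x) / 2 + \<kappa> * b1 (lrho \<alpha> x)) * (radw \<alpha> x * (u x)\<^sup>2)" for x
    by (simp add: field_simps)
  ultimately show ?thesis by (simp only: mult_zero_right diff_self)
qed

end

section \<open>The Carleman estimate\<close>

text \<open>With s the logarithm of the gauge and L that of R, this is the power with exponent
  \<open>\<epsilon>\<close> of the gauge divided by R.\<close>

definition ceta :: "real \<Rightarrow> real \<Rightarrow> real \<Rightarrow> real" where
  "ceta \<epsilon> L s = exp (\<epsilon> * (s - L))"

text \<open>The Carleman weight \<open>E = exp (- 2 \<phi>)\<close>; below, \<open>\<phi>' = t (2 - \<eta>)\<close> with \<open>\<eta> = ceta \<epsilon> L\<close>, so that \<open>\<phi>\<close> is concave.\<close>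

definition cwt :: "real \<Rightarrow> real \<Rightarrow> real \<Rightarrow> real \<Rightarrow> real" where
  "cwt \<epsilon> L t s = exp (- 2 * (t * (2 * s - ceta \<epsilon> L s / \<epsilon>)))"

lemma DERIV_ceta: "(ceta \<epsilon> L has_real_derivative \<epsilon> * ceta \<epsilon> L s) (at s)"
  unfolding ceta_def[abs_def] by (auto intro!: derivative_eq_intros)

lemma DERIV_cwt:
  assumes "\<epsilon> > 0"
  shows "(cwt \<epsilon> L t has_real_derivative - 2 * (t * (2 - ceta \<epsilon> L s)) * cwt \<epsilon> L t s) (at s)"
  unfolding cwt_def[abs_def] using assms by (auto intro!: derivative_eq_intros DERIV_ceta)

lemma ceta_pos: "0 < ceta \<epsilon> L s" and cwt_pos: "0 < cwt \<epsilon> L t s"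
  by (simp_all add: ceta_def cwt_def)

lemma ceta_le_1: "\<epsilon> > 0 \<Longrightarrow> s \<le> L \<Longrightarrow> ceta \<epsilon> L s \<le> 1"
  by (simp add: ceta_def mult_le_0_iff)

lemma continuous_on_ceta: "continuous_on UNIV (ceta \<epsilon> L)"
  unfolding ceta_def[abs_def] by (intro continuous_intros)

lemma continuous_on_cwt: "\<epsilon> > 0 \<Longrightarrow> continuous_on UNIV (cwt \<epsilon> L t)"
  using DERIV_cwt by (intro DERIV_continuous_on) auto

text \<open>Up to L the function \<open>ceta\<close> is at most 1, so the slope of the exponent is
  at least t and the weight decays at least like exp (-2 t s).\<close>

lemma cwt_ratio:
  assumes "\<epsilon> > 0" "t \<ge> 0" "a \<le> b" "b \<le> L"
  shows "cwt \<epsilon> L t b \<le> exp (- 2 * t * (b - a)) * cwt \<epsilon> L t a"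
proof -
  have m: "(\<lambda>s. s - ceta \<epsilon> L s / \<epsilon>) a \<le> (\<lambda>s. s - ceta \<epsilon> L s / \<epsilon>) b"
  proof (rule DERIV_nonneg_imp_nondecreasing[OF assms(3)])
    fix s assume "a \<le> s" "s \<le> b"
    then have "ceta \<epsilon> L s \<le> 1" using assms by (intro ceta_le_1) auto
    moreover have "((\<lambda>s. s - ceta \<epsilon> L s / \<epsilon>) has_real_derivative 1 - ceta \<epsilon> L s) (at s)"
      using assms(1) by (auto intro!: derivative_eq_intros DERIV_ceta)
    ultimately show "\<exists>y. ((\<lambda>s. s - ceta \<epsilon> L s / \<epsilon>) has_real_derivative y) (at s) \<and> 0 \<le> y" by auto
  qed
  define p where "p = (\<lambda>s. 2 * s - ceta \<epsilon> L s / \<epsilon>)"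
  have "p b - p a \<ge> b - a" using m by (simp add: p_def)
  then have "t * (b - a) \<le> t * (p b - p a)" using assms(2) by (rule mult_left_mono)
  then have "- 2 * (t * p b) \<le> - 2 * t * (b - a) + - 2 * (t * p a)" by (simp add: algebra_simps)
  then have "exp (- 2 * (t * p b)) \<le> exp (- 2 * t * (b - a)) * exp (- 2 * (t * p a))"
    by (simp only: exp_add[symmetric] exp_le_cancel_iff)
  then show ?thesis by (simp add: cwt_def p_def)
qed

lemma DERIV_cwt_mult:
  assumes "\<epsilon> > 0" "(f has_real_derivative f') (at s)"
  shows "((\<lambda>s. cwt \<epsilon> L t s * f s) has_real_derivative cwt \<epsilon> L t s * (f' - 2 * (t * (2 - ceta \<epsilon> L s)) * f s)) (at s)"
  using DERIV_mult[OF DERIV_cwt[OF assms(1), of L t s] assms(2)] by (simp add: algebra_simps)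

text \<open>Completing the square; \<open>K\<close> is an upper bound for B^2 / W.\<close>

lemma young_weighted:
  fixes B Y W K f :: real
  assumes "W > 0" "f > 0" "B\<^sup>2 \<le> W * K"
  shows "B * Y \<le> f * W * Y\<^sup>2 + K / (4 * f)"
proof -
  have "0 \<le> (2 * f * W * Y - B)\<^sup>2" by simp
  then have "4 * f * W * (B * Y) \<le> 4 * f * W * (f * W * Y\<^sup>2) + B\<^sup>2"
    by (simp add: power2_eq_square algebra_simps)
  also have "\<dots> \<le> 4 * f * W * (f * W * Y\<^sup>2) + W * K" using assms by simp
  also have "\<dots> = 4 * f * W * (f * W * Y\<^sup>2 + K / (4 * f))" using assms by (simp add: field_simps)
  finally show ?thesis using assms by (simp add: mult_le_cancel_left_pos)
qed

text \<open>Here f1 lies in [0, 2 t] and |f2| \<le> 4 t; t \<ge> 1 puts everything on the scale of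
  t^2. The summand 10 is 6 from f2, 3 from f1 and 1 from the last term.\<close>

lemma theta_remainder_bound:
  fixes k t \<eta> \<epsilon> c1 c2 c3 C :: real
  assumes "t \<ge> 1" "0 \<le> \<eta>" "\<eta> \<le> 1" "0 < \<epsilon>" "\<epsilon> \<le> 4" "\<bar>c1\<bar> \<le> C" "\<bar>c2\<bar> \<le> C" "\<bar>c3\<bar> \<le> C"
  defines "f1 \<equiv> t * (2 - \<eta>)" and "f2 \<equiv> - (t * \<epsilon> * \<eta>)"
  shows "\<bar>((k - f1)\<^sup>2 - 3 / 2 * f2) * c1 + (k - 3 / 2 * f1) * c2 + c3 / 4\<bar> \<le> ((\<bar>k\<bar> + 2)\<^sup>2 + \<bar>k\<bar> + 10) * t\<^sup>2 * C"
proof -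
  have C: "C \<ge> 0" using assms by linarith
  have f1: "0 \<le> f1" "f1 \<le> 2 * t" using assms by (auto simp: f1_def mult.commute[of t])
  have "\<epsilon> * \<eta> \<le> 4 * 1" using assms by (intro mult_mono) auto
  then have f2: "\<bar>f2\<bar> \<le> 4 * t" using assms by (simp add: f2_def abs_mult mult.assoc mult.commute[of t])
  have tt: "t \<le> t\<^sup>2" "1 \<le> t\<^sup>2" using assms by (auto simp: power2_eq_square mult_le_cancel_left1 intro: one_le_power[of t 2, unfolded power2_eq_square])
  have kt: "\<bar>k\<bar> \<le> \<bar>k\<bar> * t" using assms by (simp add: mult_le_cancel_left1)
  have "\<bar>k - f1\<bar> \<le> (\<bar>k\<bar> + 2) * t" using f1 kt by (simp add: algebra_simps)
  then have "\<bar>k - f1\<bar>\<^sup>2 \<le> ((\<bar>k\<bar> + 2) * t)\<^sup>2" by (intro power_mono) auto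
  then have 1: "(k - f1)\<^sup>2 \<le> (\<bar>k\<bar> + 2)\<^sup>2 * t\<^sup>2" by (simp add: power_mult_distrib)
  have "\<bar>(k - f1)\<^sup>2 - 3 / 2 * f2\<bar> \<le> (\<bar>k\<bar> + 2)\<^sup>2 * t\<^sup>2 + 6 * t\<^sup>2" using 1 f2 tt zero_le_power2[of "k - f1"] by linarith
  then have a: "\<bar>((k - f1)\<^sup>2 - 3 / 2 * f2) * c1\<bar> \<le> ((\<bar>k\<bar> + 2)\<^sup>2 * t\<^sup>2 + 6 * t\<^sup>2) * C"
    unfolding abs_mult using assms by (intro mult_mono) auto
  have "\<bar>k\<bar> \<le> \<bar>k\<bar> * t\<^sup>2" using tt by (simp add: mult_le_cancel_left1)
  then have "\<bar>k - 3 / 2 * f1\<bar> \<le> \<bar>k\<bar> * t\<^sup>2 + 3 * t\<^sup>2" using f1 tt by linarith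
  then have b: "\<bar>(k - 3 / 2 * f1) * c2\<bar> \<le> (\<bar>k\<bar> * t\<^sup>2 + 3 * t\<^sup>2) * C"
    unfolding abs_mult using assms by (intro mult_mono) auto
  have "C \<le> t\<^sup>2 * C" using mult_right_mono[OF tt(2) C] by simp
  then have c: "\<bar>c3 / 4\<bar> \<le> t\<^sup>2 * C" using assms by simp
  have "((\<bar>k\<bar> + 2)\<^sup>2 + \<bar>k\<bar> + 10) * t\<^sup>2 * C = ((\<bar>k\<bar> + 2)\<^sup>2 * t\<^sup>2 + 6 * t\<^sup>2) * C + (\<bar>k\<bar> * t\<^sup>2 + 3 * t\<^sup>2) * C + t\<^sup>2 * C"
    by (simp add: algebra_simps)
  with a b c show ?thesis by linarith
qed

text \<open>The term-by-term bounds are 8 + 16 + 4 + 8 = 36, and 4 + 4 = 8 for the terms with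
  \<open>k\<close>. The coefficient of \<open>c0\<close> keeps \<open>c0\<close> itself, because the
  cutoff is not small; only its derivatives go into the error.\<close>

lemma energy_coefficient_bound:
  fixes k t \<eta> \<epsilon> c0 c1 c2 C :: real
  assumes "t \<ge> 1" "0 \<le> \<eta>" "\<eta> \<le> 1" "0 < \<epsilon>" "\<epsilon> \<le> 4" "0 \<le> c0" "\<bar>c1\<bar> \<le> C" "\<bar>c2\<bar> \<le> C"
  defines "f1 \<equiv> t * (2 - \<eta>)" and "f2 \<equiv> - (t * \<epsilon> * \<eta>)"
  shows "\<bar>(\<epsilon>\<^sup>2 / 2 - 2 * f1 * \<epsilon> - f2 + 2 * f1\<^sup>2 + k * \<epsilon> - 2 * k * f1) * c0 + (\<epsilon> - 2 * f1 + k) * c1 + c2 / 2\<bar>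
    \<le> (36 + 8 * \<bar>k\<bar>) * t\<^sup>2 * c0 + (9 + \<bar>k\<bar>) * t\<^sup>2 * C"
proof -
  have C: "C \<ge> 0" using assms by linarith
  have f1: "0 \<le> f1" "f1 \<le> 2 * t" using assms by (auto simp: f1_def mult.commute[of t])
  have "\<epsilon> * \<eta> \<le> 4 * 1" using assms by (intro mult_mono) auto
  then have f2: "\<bar>f2\<bar> \<le> 4 * t" using assms by (simp add: f2_def abs_mult mult.assoc mult.commute[of t])
  have tt: "t \<le> t\<^sup>2" "1 \<le> t\<^sup>2" using assms by (auto simp: power2_eq_square mult_le_cancel_left1 intro: one_le_power[of t 2, unfolded power2_eq_square])
  have e: "\<epsilon>\<^sup>2 \<le> 16" using power_mono[of \<epsilon> 4 2] assms by simp
  have fe: "0 \<le> f1 * \<epsilon>" using f1 assms(4) by simp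
  have fe': "f1 * \<epsilon> \<le> (2 * t) * 4" by (rule mult_mono[OF f1(2) assms(5)]) (use assms in auto)
  have ff: "f1\<^sup>2 \<le> 4 * t\<^sup>2" using power_mono[OF f1(2) f1(1), of 2] by (simp add: power_mult_distrib)
  have ke: "\<bar>k * \<epsilon>\<bar> \<le> \<bar>k\<bar> * 4" unfolding abs_mult using assms by (intro mult_left_mono) auto
  have kf: "\<bar>k * f1\<bar> \<le> \<bar>k\<bar> * (2 * t)" unfolding abs_mult using f1 by (intro mult_left_mono) auto
  have kt: "\<bar>k\<bar> \<le> \<bar>k\<bar> * t\<^sup>2" "\<bar>k\<bar> * t \<le> \<bar>k\<bar> * t\<^sup>2" using tt by (auto simp: mult_le_cancel_left1 intro: mult_left_mono)
  define p where "p = \<epsilon>\<^sup>2 / 2 - 2 * f1 * \<epsilon> - f2 + 2 * f1\<^sup>2 + k * \<epsilon> - 2 * k * f1"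
  have "\<bar>p\<bar> \<le> \<epsilon>\<^sup>2 / 2 + 2 * (f1 * \<epsilon>) + \<bar>f2\<bar> + 2 * f1\<^sup>2 + \<bar>k * \<epsilon>\<bar> + 2 * \<bar>k * f1\<bar>"
    using fe zero_le_power2[of \<epsilon>] zero_le_power2[of f1] unfolding p_def by (simp only: mult.assoc)
  also have "\<dots> \<le> 36 * t\<^sup>2 + 8 * (\<bar>k\<bar> * t\<^sup>2)" using e fe fe' f2 ff ke kf kt tt by linarith
  finally have "\<bar>p\<bar> \<le> (36 + 8 * \<bar>k\<bar>) * t\<^sup>2" by (simp add: algebra_simps)
  then have a: "\<bar>p * c0\<bar> \<le> (36 + 8 * \<bar>k\<bar>) * t\<^sup>2 * c0"
    unfolding abs_mult using assms by (intro mult_mono) auto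
  have "\<bar>\<epsilon> - 2 * f1 + k\<bar> \<le> 8 * t\<^sup>2 + \<bar>k\<bar> * t\<^sup>2" using f1 tt kt assms by linarith
  then have b: "\<bar>(\<epsilon> - 2 * f1 + k) * c1\<bar> \<le> (8 * t\<^sup>2 + \<bar>k\<bar> * t\<^sup>2) * C"
    unfolding abs_mult using assms by (intro mult_mono) auto
  have "C \<le> t\<^sup>2 * C" using mult_right_mono[OF tt(2) C] by simp
  then have c: "\<bar>c2 / 2\<bar> \<le> t\<^sup>2 * C" using assms by simp
  have "(9 + \<bar>k\<bar>) * t\<^sup>2 * C = (8 * t\<^sup>2 + \<bar>k\<bar> * t\<^sup>2) * C + t\<^sup>2 * C" by (simp add: algebra_simps)
  with a b c show ?thesis unfolding p_def[symmetric] by linarith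
qed

text \<open>A trapezoid that dominates the derivatives of the cutoff on a transition zone. It is
  never differentiated, so a piecewise linear shape suffices.\<close>

definition bump :: "real \<Rightarrow> real \<Rightarrow> real \<Rightarrow> real \<Rightarrow> real \<Rightarrow> real" where
  "bump p0 p1 p2 p3 s = clamp01 ((s - p0) / (p1 - p0)) * clamp01 ((p3 - s) / (p3 - p2))"

lemma bump_props:
  assumes "p0 < p1" "p2 < p3"
  shows "continuous_on UNIV (bump p0 p1 p2 p3)" "0 \<le> bump p0 p1 p2 p3 s" "bump p0 p1 p2 p3 s \<le> 1"
    "p1 \<le> s \<Longrightarrow> s \<le> p2 \<Longrightarrow> bump p0 p1 p2 p3 s = 1" "s \<le> p0 \<or> p3 \<le> s \<Longrightarrow> bump p0 p1 p2 p3 s = 0"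
proof -
  show "continuous_on UNIV (bump p0 p1 p2 p3)"
    unfolding bump_def[abs_def] clamp01_def using assms by (intro continuous_intros) auto
  show "0 \<le> bump p0 p1 p2 p3 s" "bump p0 p1 p2 p3 s \<le> 1"
    by (auto simp: bump_def clamp01_bounds intro!: mult_nonneg_nonneg mult_le_one)
  show "p1 \<le> s \<Longrightarrow> s \<le> p2 \<Longrightarrow> bump p0 p1 p2 p3 s = 1" "s \<le> p0 \<or> p3 \<le> s \<Longrightarrow> bump p0 p1 p2 p3 s = 0"
    using assms by (auto simp: bump_def clamp01_def divide_le_0_iff le_divide_eq min_def max_def)
qed

lemma admissible_bump:
  assumes "p0 < p1" "p2 < p3" "p3 < L"
  shows "admissible L (bump p0 p1 p2 p3)"
  unfolding admissible_def using bump_props[OF assms(1,2)] assms(3) by (intro conjI exI[of _ p0] exI[of _ p3]) auto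

lemma admissible_cut:
  assumes "s1 < s2" "s2 < L"
  shows "admissible L (cut k s0 s1 s2)"
  unfolding admissible_def using continuous_on_cut cut_outside[OF assms(1)] assms(2)
  by (intro conjI exI[of _ s0] exI[of _ s2]) auto

text \<open>Of the equation only the differential inequality for \<open>Bu\<close> is retained; the
  potential itself no longer occurs.\<close>

locale carleman = limit_solution +
  fixes C0 \<delta> :: real
  assumes C0: "C0 > 0" and \<delta>: "0 < \<delta>" "\<delta> \<le> 2"
    and V: "AE x in lebesgue_on (gauge_ball \<alpha> R). \<bar>Bu x\<bar> \<le> C0 * exp ((\<delta> - 2) * lrho \<alpha> x) * \<bar>u x\<bar>"
begin

abbreviation "\<epsilon> \<equiv> 2 * \<delta>"
abbreviation "L \<equiv> ln R"
abbreviation "\<eta> \<equiv> ceta (2 * \<delta>) (ln R)"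
abbreviation "E \<equiv> cwt (2 * \<delta>) (ln R)"
text \<open>Normalised such that the square of C0 \<rho>^\<delta> is C1^2 \<eta>.\<close>

definition "C1 = C0 * R powr \<delta>"

abbreviation "f1 \<equiv> \<lambda>t s. t * (2 - \<eta> s)"
abbreviation "f2 \<equiv> \<lambda>t s. - (t * \<epsilon> * \<eta> s)"

text \<open>The last bound is the pointwise heart of the estimate: |V|^2 / W is compared with \<eta>
  / |z|^2, a Hardy weight that keeps the factor \<eta> of the Carleman gain.\<close>

lemma pointwise_facts:
  "AE x in M. x \<noteq> 0 \<and> fst x \<noteq> 0 \<and> lrho \<alpha> x < L \<and> 0 < radw \<alpha> x \<and> radw \<alpha> x * (Du x)\<^sup>2 \<le> Gu x \<and>
     (Bu x)\<^sup>2 \<le> radw \<alpha> x * (C1\<^sup>2 * \<eta> (lrho \<alpha> x) * ((u x)\<^sup>2 / (norm (fst x))\<^sup>2))"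
  using AE_M_nonzero AE_space V
proof eventually_elim
  case (elim x)
  then have x: "x \<noteq> 0" and z: "norm (fst x) > 0" by auto
  define s where "s = lrho \<alpha> x"
  have x\<Omega>: "x \<in> \<Omega>" using elim(2) by simp
  have s: "s < L" using x\<Omega> x gauge_ball_iff[OF \<alpha>(1) R, of x] unfolding s_def by blast
  have W: "radw \<alpha> x = norm (fst x) powr (2 * \<alpha>) * exp (- (2 * (\<alpha> + 1) * s))"
    unfolding radw_def gaugeN_eq_exp[OF \<alpha>(1) x] s_def[symmetric] by (simp add: exp_minus divide_inverse)
  have "(Bu x)\<^sup>2 \<le> (C0 * exp ((\<delta> - 2) * s) * \<bar>u x\<bar>)\<^sup>2"
    using power_mono[OF elim(3) abs_ge_zero, of 2] by (simp add: s_def)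
  also have "\<dots> = C0\<^sup>2 * exp (2 * \<delta> * s) * exp (- (4 * s)) * (u x)\<^sup>2"
    by (simp add: power_mult_distrib exp_double[symmetric] exp_add[symmetric] algebra_simps)
  also have "C0\<^sup>2 * exp (2 * \<delta> * s) = C1\<^sup>2 * \<eta> s"
    using R by (simp add: C1_def ceta_def power_mult_distrib powr_def exp_double[symmetric] exp_add[symmetric] algebra_simps)
  also have "C1\<^sup>2 * \<eta> s * exp (- (4 * s)) * (u x)\<^sup>2 \<le> C1\<^sup>2 * \<eta> s * (radw \<alpha> x / (norm (fst x))\<^sup>2) * (u x)\<^sup>2"
  proof -
    \<comment> \<open>The bound of \<rho>^(-4) by W / |z|^2 amounts to |z|^(2 - 2 \<alpha>) \<le>
      \<rho>^(2 - 2 \<alpha>), which needs \<alpha> \<le> 1.\<close>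
    have "norm (fst x) powr (2 - 2 * \<alpha>) \<le> exp s powr (2 - 2 * \<alpha>)"
      using norm_fst_le_exp_lrho[OF \<alpha>(1) x] \<alpha>(2) by (intro powr_mono2) (auto simp: s_def)
    then have "norm (fst x) powr (2 - 2 * \<alpha>) * norm (fst x) powr (2 * \<alpha>) \<le> exp ((2 - 2 * \<alpha>) * s) * norm (fst x) powr (2 * \<alpha>)"
      by (intro mult_right_mono) (auto simp: exp_powr_real mult.commute)
    moreover have "norm (fst x) powr (2 - 2 * \<alpha>) * norm (fst x) powr (2 * \<alpha>) = (norm (fst x))\<^sup>2"
      using z by (simp add: powr_add[symmetric] powr_numeral)
    ultimately have "exp (- (4 * s)) * (norm (fst x))\<^sup>2 \<le> exp (- (4 * s)) * (exp ((2 - 2 * \<alpha>) * s) * norm (fst x) powr (2 * \<alpha>))"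
      by (intro mult_left_mono) auto
    also have "\<dots> = radw \<alpha> x"
      unfolding W by (simp add: mult.assoc[symmetric] exp_add[symmetric]) (simp add: algebra_simps)
    finally have "exp (- (4 * s)) \<le> radw \<alpha> x / (norm (fst x))\<^sup>2" using z by (simp add: pos_le_divide_eq)
    then show ?thesis by (intro mult_right_mono mult_left_mono) (auto simp: ceta_pos less_imp_le)
  qed
  finally have "(Bu x)\<^sup>2 \<le> radw \<alpha> x * (C1\<^sup>2 * \<eta> s * ((u x)\<^sup>2 / (norm (fst x))\<^sup>2))" by (simp add: mult_ac)
  then show ?case using x z s W radw_Du_sq_le[of x] by (auto simp: s_def)
qed

lemma DERIV_f1: "((\<lambda>s. t * (2 - \<eta> s)) has_real_derivative - (t * \<epsilon> * \<eta> s)) (at s)"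
  by (auto intro!: derivative_eq_intros DERIV_ceta)

lemma DERIV_f2: "((\<lambda>s. - (t * \<epsilon> * \<eta> s)) has_real_derivative - (t * \<epsilon>\<^sup>2 * \<eta> s)) (at s)"
  by (auto intro!: derivative_eq_intros DERIV_ceta simp: power2_eq_square)

text \<open>The Rellich identity with weight \<open>a = E \<omega>\<close> and the energy identity with weight \<open>\<kappa> a + a' / 2\<close>, so that
  the terms \<open>|X u|\<^sup>2\<close> cancel; the square in \<open>D u\<close> is completed to one in \<open>Y\<close>.\<close>

lemma carleman_identity:
  fixes t s0 s1 s2 :: real
  assumes s: "s1 < s2" "s2 < L"
  defines "\<omega> \<equiv> \<lambda>k. cut k s0 s1 s2"
  defines "Y \<equiv> \<lambda>x. Du x + (\<kappa> - f1 t (lrho \<alpha> x)) * u x"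
  defines "\<Theta> \<equiv> \<lambda>s. (t * \<epsilon>\<^sup>2 * \<eta> s / 2 - f1 t s * f2 t s) * \<omega> 0 s
    + (((\<kappa> - f1 t s)\<^sup>2 - 3 / 2 * f2 t s) * \<omega> 1 s + (\<kappa> - 3 / 2 * f1 t s) * \<omega> 2 s + \<omega> 3 s / 4)"
  shows "has_bochner_integral M (\<lambda>x. E t (lrho \<alpha> x) * (\<omega> 0 (lrho \<alpha> x) * (Bu x * Y x) + \<omega> 1 (lrho \<alpha> x) / 2 * (Bu x * u x)
    - \<omega> 0 (lrho \<alpha> x) * (2 * f1 t (lrho \<alpha> x) * radw \<alpha> x * (Y x)\<^sup>2) + \<omega> 1 (lrho \<alpha> x) * (radw \<alpha> x * (Du x)\<^sup>2)
    - \<Theta> (lrho \<alpha> x) * (radw \<alpha> x * (u x)\<^sup>2))) 0"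
proof -
  have e: "\<epsilon> > 0" using \<delta> by simp
  note DE = DERIV_cwt_mult[OF e]
  have d\<omega>: "(\<omega> 0 has_real_derivative \<omega> 1 s) (at s)" "(\<omega> 1 has_real_derivative \<omega> 2 s) (at s)" "(\<omega> 2 has_real_derivative \<omega> 3 s) (at s)" for s
    using DERIV_cut[of 0] DERIV_cut[of 1] DERIV_cut[of 2] by (simp_all add: \<omega>_def numeral_2_eq_2 numeral_3_eq_3)
  have z\<omega>: "\<omega> k s = 0" if "s < s0 \<or> s2 < s" for k s unfolding \<omega>_def using that s(1) by (intro cut_outside) auto
  have c\<omega>: "continuous_on UNIV (\<omega> k)" for k unfolding \<omega>_def by (rule continuous_on_cut)
  have cE: "continuous_on UNIV (E t)" by (rule continuous_on_cwt[OF e])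
  note c\<eta> = continuous_on_ceta
  note conts = continuous_on_add continuous_on_diff continuous_on_mult continuous_on_const continuous_on_divide
    continuous_on_minus continuous_on_power c\<omega> cE c\<eta>
  \<comment> \<open>\<open>E\<close> times \<open>\<beta>\<close> is \<kappa> a + a' / 2 for a =
    \<open>E\<close> times \<open>\<omega> 0\<close>; \<open>\<beta>1\<close> and
    \<open>\<beta>2\<close> are its successive derivatives before the factor
    \<open>E\<close>.\<close>
  define \<beta> \<beta>1 \<beta>2 where "\<beta> = (\<lambda>s. (\<kappa> - f1 t s) * \<omega> 0 s + \<omega> 1 s / 2)"
    and "\<beta>1 = (\<lambda>s. (\<kappa> - f1 t s) * \<omega> 1 s - f2 t s * \<omega> 0 s + \<omega> 2 s / 2)"
    and "\<beta>2 = (\<lambda>s. (\<kappa> - f1 t s) * \<omega> 2 s - 2 * f2 t s * \<omega> 1 s + t * \<epsilon>\<^sup>2 * \<eta> s * \<omega> 0 s + \<omega> 3 s / 2)"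
  have d\<beta>: "(\<beta> has_real_derivative \<beta>1 s) (at s)" "(\<beta>1 has_real_derivative \<beta>2 s) (at s)" for s
    unfolding \<beta>_def \<beta>1_def \<beta>2_def
    by (auto intro!: derivative_eq_intros d\<omega> d\<omega>(2)[unfolded One_nat_def] DERIV_f1 DERIV_f2 DERIV_ceta simp: field_simps power2_eq_square)
  \<comment> \<open>Twice \<open>g\<close> is the cross coefficient of u D u in 2 f1
    \<open>\<omega> 0\<close> Y^2. Subtracting the dilation identity with this weight completes the
    square.\<close>
  define g g1 where "g = (\<lambda>s. 2 * f1 t s * (\<kappa> - f1 t s) * \<omega> 0 s)"
    and "g1 = (\<lambda>s. 2 * f2 t s * (\<kappa> - 2 * f1 t s) * \<omega> 0 s + 2 * f1 t s * (\<kappa> - f1 t s) * \<omega> 1 s)"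
  have dg: "(g has_real_derivative g1 s) (at s)" for s
    unfolding g_def g1_def by (auto intro!: derivative_eq_intros d\<omega> d\<omega>(2)[unfolded One_nat_def] DERIV_f1 DERIV_ceta simp: algebra_simps)
  \<comment> \<open>\<open>E\<close> times \<open>\<gamma>\<close> is the derivative of
    \<open>E\<close> times \<open>\<beta>\<close>; half of the dilation identity with this weight
    cancels the cross term of the energy identity.\<close>
  define \<gamma> \<gamma>1 where "\<gamma> = (\<lambda>s. \<beta>1 s - 2 * f1 t s * \<beta> s)" and "\<gamma>1 = (\<lambda>s. \<beta>2 s - 2 * (f2 t s * \<beta> s + f1 t s * \<beta>1 s))"
  have d\<gamma>: "(\<gamma> has_real_derivative \<gamma>1 s) (at s)" for s
    unfolding \<gamma>_def \<gamma>1_def by (auto intro!: derivative_eq_intros d\<beta> DERIV_f1 DERIV_ceta simp: algebra_simps)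
  have z: "\<beta> s = 0" "\<gamma> s = 0" "g s = 0" if "s < s0 \<or> s2 < s" for s
    using z\<omega>[OF that] by (simp_all add: \<beta>_def \<gamma>_def \<beta>1_def g_def)
  have c: "continuous_on UNIV \<beta>" "continuous_on UNIV \<beta>1" "continuous_on UNIV \<beta>2" "continuous_on UNIV g" "continuous_on UNIV g1"
    unfolding \<beta>_def \<beta>1_def \<beta>2_def g_def g1_def by (intro conts; simp)+
  have c': "continuous_on UNIV \<gamma>" "continuous_on UNIV \<gamma>1"
    unfolding \<gamma>_def \<gamma>1_def by (intro conts c; simp)+
  have R: "has_bochner_integral M (\<lambda>x. E t (lrho \<alpha> x) * \<omega> 0 (lrho \<alpha> x) * Bu x * Du x
      + E t (lrho \<alpha> x) * (\<omega> 1 (lrho \<alpha> x) - 2 * (t * (2 - \<eta> (lrho \<alpha> x))) * \<omega> 0 (lrho \<alpha> x)) * radw \<alpha> x * (Du x)\<^sup>2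
      - (\<kappa> * (E t (lrho \<alpha> x) * \<omega> 0 (lrho \<alpha> x)) + E t (lrho \<alpha> x) * (\<omega> 1 (lrho \<alpha> x) - 2 * (t * (2 - \<eta> (lrho \<alpha> x))) * \<omega> 0 (lrho \<alpha> x)) / 2) * Gu x) 0"
    by (rule rellich_limit[where a = "\<lambda>s. E t s * \<omega> 0 s" and a' = "\<lambda>s. E t s * (\<omega> 1 s - 2 * (t * (2 - \<eta> s)) * \<omega> 0 s)" and ?s1.0 = s0 and ?s2.0 = s2, OF DE[OF d\<omega>(1)] _ s(2)]) (auto intro!: conts simp: z\<omega>)
  have N: "has_bochner_integral M (\<lambda>x. E t (lrho \<alpha> x) * \<beta> (lrho \<alpha> x) * Bu x * u x + E t (lrho \<alpha> x) * \<beta> (lrho \<alpha> x) * Gu x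
      + E t (lrho \<alpha> x) * (\<beta>1 (lrho \<alpha> x) - 2 * (t * (2 - \<eta> (lrho \<alpha> x))) * \<beta> (lrho \<alpha> x)) * radw \<alpha> x * u x * Du x) 0"
    by (rule energy_limit[where a = "\<lambda>s. E t s * \<beta> s" and a' = "\<lambda>s. E t s * (\<beta>1 s - 2 * (t * (2 - \<eta> s)) * \<beta> s)" and ?s1.0 = s0 and ?s2.0 = s2, OF DE[OF d\<beta>(1)] _ s(2)]) (auto intro!: conts c simp: z)
  have D1: "has_bochner_integral M (\<lambda>x. radw \<alpha> x * (2 * (E t (lrho \<alpha> x) * \<gamma> (lrho \<alpha> x)) * u x * Du x
      + (E t (lrho \<alpha> x) * (\<gamma>1 (lrho \<alpha> x) - 2 * (t * (2 - \<eta> (lrho \<alpha> x))) * \<gamma> (lrho \<alpha> x)) + 2 * \<kappa> * (E t (lrho \<alpha> x) * \<gamma> (lrho \<alpha> x))) * (u x)\<^sup>2)) 0"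
    by (rule dilation_limit[where a = "\<lambda>s. E t s * \<gamma> s" and a' = "\<lambda>s. E t s * (\<gamma>1 s - 2 * (t * (2 - \<eta> s)) * \<gamma> s)" and ?s1.0 = s0 and ?s2.0 = s2, OF DE[OF d\<gamma>] _ s(2)]) (auto intro!: conts c' simp: z)
  have D2: "has_bochner_integral M (\<lambda>x. radw \<alpha> x * (2 * (E t (lrho \<alpha> x) * g (lrho \<alpha> x)) * u x * Du x
      + (E t (lrho \<alpha> x) * (g1 (lrho \<alpha> x) - 2 * (t * (2 - \<eta> (lrho \<alpha> x))) * g (lrho \<alpha> x)) + 2 * \<kappa> * (E t (lrho \<alpha> x) * g (lrho \<alpha> x))) * (u x)\<^sup>2)) 0"
    by (rule dilation_limit[where a = "\<lambda>s. E t s * g s" and a' = "\<lambda>s. E t s * (g1 s - 2 * (t * (2 - \<eta> s)) * g s)" and ?s1.0 = s0 and ?s2.0 = s2, OF DE[OF dg] _ s(2)]) (auto intro!: conts c simp: z)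
  note T = has_bochner_integral_diff[OF has_bochner_integral_diff[OF has_bochner_integral_add[OF R N]
      has_bochner_integral_mult_right[where c = "1/2", OF D1]] D2]
  show ?thesis
  proof (rule has_bochner_integral_cong[OF refl _ _, THEN iffD1, OF _ _ T])
    fix x
    define W B v D G Es x0 x1 x2 x3 p q where defs: "W = radw \<alpha> x" "B = Bu x" "v = u x" "D = Du x" "G = Gu x"
      "Es = E t (lrho \<alpha> x)" "x0 = \<omega> 0 (lrho \<alpha> x)" "x1 = \<omega> 1 (lrho \<alpha> x)" "x2 = \<omega> 2 (lrho \<alpha> x)" "x3 = \<omega> 3 (lrho \<alpha> x)"
      "p = t * (2 - \<eta> (lrho \<alpha> x))" "q = t * \<epsilon> * \<eta> (lrho \<alpha> x)"
    obtain r where r: "t * \<epsilon>\<^sup>2 * \<eta> (lrho \<alpha> x) = r" by blast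
    show "E t (lrho \<alpha> x) * \<omega> 0 (lrho \<alpha> x) * Bu x * Du x
      + E t (lrho \<alpha> x) * (\<omega> 1 (lrho \<alpha> x) - 2 * (t * (2 - \<eta> (lrho \<alpha> x))) * \<omega> 0 (lrho \<alpha> x)) * radw \<alpha> x * (Du x)\<^sup>2
      - (\<kappa> * (E t (lrho \<alpha> x) * \<omega> 0 (lrho \<alpha> x)) + E t (lrho \<alpha> x) * (\<omega> 1 (lrho \<alpha> x) - 2 * (t * (2 - \<eta> (lrho \<alpha> x))) * \<omega> 0 (lrho \<alpha> x)) / 2) * Gu x
      + (E t (lrho \<alpha> x) * \<beta> (lrho \<alpha> x) * Bu x * u x + E t (lrho \<alpha> x) * \<beta> (lrho \<alpha> x) * Gu x
      + E t (lrho \<alpha> x) * (\<beta>1 (lrho \<alpha> x) - 2 * (t * (2 - \<eta> (lrho \<alpha> x))) * \<beta> (lrho \<alpha> x)) * radw \<alpha> x * u x * Du x)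
      - 1 / 2 * (radw \<alpha> x * (2 * (E t (lrho \<alpha> x) * \<gamma> (lrho \<alpha> x)) * u x * Du x
      + (E t (lrho \<alpha> x) * (\<gamma>1 (lrho \<alpha> x) - 2 * (t * (2 - \<eta> (lrho \<alpha> x))) * \<gamma> (lrho \<alpha> x)) + 2 * \<kappa> * (E t (lrho \<alpha> x) * \<gamma> (lrho \<alpha> x))) * (u x)\<^sup>2))
      - radw \<alpha> x * (2 * (E t (lrho \<alpha> x) * g (lrho \<alpha> x)) * u x * Du x
      + (E t (lrho \<alpha> x) * (g1 (lrho \<alpha> x) - 2 * (t * (2 - \<eta> (lrho \<alpha> x))) * g (lrho \<alpha> x)) + 2 * \<kappa> * (E t (lrho \<alpha> x) * g (lrho \<alpha> x))) * (u x)\<^sup>2)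
      = E t (lrho \<alpha> x) * (\<omega> 0 (lrho \<alpha> x) * (Bu x * Y x) + \<omega> 1 (lrho \<alpha> x) / 2 * (Bu x * u x)
      - \<omega> 0 (lrho \<alpha> x) * (2 * f1 t (lrho \<alpha> x) * radw \<alpha> x * (Y x)\<^sup>2) + \<omega> 1 (lrho \<alpha> x) * (radw \<alpha> x * (Du x)\<^sup>2)
      - \<Theta> (lrho \<alpha> x) * (radw \<alpha> x * (u x)\<^sup>2))"
      unfolding Y_def \<Theta>_def \<gamma>_def \<gamma>1_def \<beta>_def \<beta>1_def \<beta>2_def g_def g1_def r
      unfolding defs(1-12)[symmetric]
      by (simp add: field_simps power2_eq_square)
  qed simp
qed

text \<open>The extra factor \<eta> in \<open>b\<close> matches the weight of the Hardy integral,
  whose Hardy bound is a gradient integral with the same weight. \<open>\<Psi>\<close> is b'' / 2 +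
  \<kappa> b' divided by \<open>E\<close> \<eta>. The last three parts are what the Hardy inequality
  asks of its weight.\<close>

lemma weighted_energy_identity:
  fixes t s0 s1 s2 :: real
  assumes s: "s1 < s2" "s2 < L"
  defines "\<omega> \<equiv> \<lambda>k. cut k s0 s1 s2"
  defines "b \<equiv> \<lambda>s. E t s * (\<eta> s * \<omega> 0 s)"
  defines "b1 \<equiv> \<lambda>s. E t s * (\<eta> s * (\<epsilon> * \<omega> 0 s + \<omega> 1 s) - 2 * f1 t s * (\<eta> s * \<omega> 0 s))"
  defines "\<Psi> \<equiv> \<lambda>s. (\<epsilon>\<^sup>2 / 2 - 2 * f1 t s * \<epsilon> - f2 t s + 2 * (f1 t s)\<^sup>2 + \<kappa> * \<epsilon> - 2 * \<kappa> * f1 t s) * \<omega> 0 s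
    + (\<epsilon> - 2 * f1 t s + \<kappa>) * \<omega> 1 s + \<omega> 2 s / 2"
  shows "has_bochner_integral M (\<lambda>x. b (lrho \<alpha> x) * Bu x * u x + b (lrho \<alpha> x) * Gu x
      - E t (lrho \<alpha> x) * \<eta> (lrho \<alpha> x) * \<Psi> (lrho \<alpha> x) * (radw \<alpha> x * (u x)\<^sup>2)) 0"
    and "(b has_real_derivative b1 s) (at s)" and "continuous_on UNIV b1"
    and "r < s0 \<or> s2 < r \<Longrightarrow> b r = 0"
proof -
  have e: "\<epsilon> > 0" using \<delta> by simp
  note DE = DERIV_cwt_mult[OF e]
  have d\<omega>: "(\<omega> 0 has_real_derivative \<omega> 1 s) (at s)" "(\<omega> 1 has_real_derivative \<omega> 2 s) (at s)" for s
    using DERIV_cut[of 0] DERIV_cut[of 1] by (simp_all add: \<omega>_def numeral_2_eq_2)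
  have z\<omega>: "\<omega> k s = 0" if "s < s0 \<or> s2 < s" for k s unfolding \<omega>_def using that s(1) by (intro cut_outside) auto
  have c\<omega>: "continuous_on UNIV (\<omega> k)" for k unfolding \<omega>_def by (rule continuous_on_cut)
  have cE: "continuous_on UNIV (E t)" by (rule continuous_on_cwt[OF e])
  note conts = continuous_on_add continuous_on_diff continuous_on_mult continuous_on_const continuous_on_divide
    continuous_on_minus continuous_on_power c\<omega> cE continuous_on_ceta
  define \<beta>1 \<beta>2 where "\<beta>1 = (\<lambda>s. \<eta> s * (\<epsilon> * \<omega> 0 s + \<omega> 1 s))"
    and "\<beta>2 = (\<lambda>s. \<eta> s * (\<epsilon>\<^sup>2 * \<omega> 0 s + 2 * \<epsilon> * \<omega> 1 s + \<omega> 2 s))"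
  have d\<beta>0: "((\<lambda>s. \<eta> s * \<omega> 0 s) has_real_derivative \<beta>1 s) (at s)" for s
    unfolding \<beta>1_def by (rule DERIV_cong[OF DERIV_mult[OF DERIV_ceta d\<omega>(1)]]) (simp add: algebra_simps)
  have d\<beta>1: "(\<beta>1 has_real_derivative \<beta>2 s) (at s)" for s
    unfolding \<beta>1_def \<beta>2_def
    by (rule DERIV_cong[OF DERIV_mult[OF DERIV_ceta DERIV_add[OF DERIV_cmult[OF d\<omega>(1)] d\<omega>(2)]]])
      (simp add: algebra_simps power2_eq_square)
  define \<gamma> \<gamma>1 where "\<gamma> = (\<lambda>s. \<beta>1 s - 2 * f1 t s * (\<eta> s * \<omega> 0 s))"
    and "\<gamma>1 = (\<lambda>s. \<beta>2 s - 2 * (f2 t s * (\<eta> s * \<omega> 0 s) + f1 t s * \<beta>1 s))"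
  have d\<gamma>: "(\<gamma> has_real_derivative \<gamma>1 s) (at s)" for s
    unfolding \<gamma>_def \<gamma>1_def
    by (rule DERIV_cong[OF DERIV_diff[OF d\<beta>1 DERIV_mult[OF DERIV_cmult[OF DERIV_f1, of 2] d\<beta>0]]])
      (simp add: algebra_simps)
  have cs: "continuous_on UNIV \<beta>1" "continuous_on UNIV \<beta>2" "continuous_on UNIV \<gamma>" "continuous_on UNIV \<gamma>1"
    unfolding \<gamma>_def \<gamma>1_def \<beta>1_def \<beta>2_def by (intro conts; simp)+
  have b1: "b1 = (\<lambda>s. E t s * \<gamma> s)" by (simp add: b1_def \<gamma>_def \<beta>1_def)
  show db: "(b has_real_derivative b1 s) (at s)" for s
    unfolding b_def b1 \<gamma>_def by (rule DE[OF d\<beta>0])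
  show cb1: "continuous_on UNIV b1" unfolding b1 by (intro conts cs)
  show zb: "b r = 0" if "r < s0 \<or> s2 < r" for r using z\<omega>[OF that] by (simp add: b_def)
  define b2 where "b2 = (\<lambda>s. E t s * (\<gamma>1 s - 2 * (t * (2 - \<eta> s)) * \<gamma> s))"
  have db1: "(b1 has_real_derivative b2 s) (at s)" for s unfolding b1 b2_def by (rule DE[OF d\<gamma>])
  have cb2: "continuous_on UNIV b2" unfolding b2_def by (intro conts cs)
  have "b2 r / 2 + \<kappa> * b1 r = E t r * \<eta> r * \<Psi> r" for r
    unfolding b2_def b1 \<gamma>1_def \<gamma>_def \<beta>1_def \<beta>2_def \<Psi>_def by (simp add: field_simps power2_eq_square)
  then show "has_bochner_integral M (\<lambda>x. b (lrho \<alpha> x) * Bu x * u x + b (lrho \<alpha> x) * Gu x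
      - E t (lrho \<alpha> x) * \<eta> (lrho \<alpha> x) * \<Psi> (lrho \<alpha> x) * (radw \<alpha> x * (u x)\<^sup>2)) 0"
    using energy_identity_squared[OF db db1 cb2 s(2) zb] by simp
qed

text \<open>The three bounds between \<open>H\<close>, \<open>U\<close> and \<open>G\<close> come
  from the Carleman identity, the energy identity and the Hardy inequality in turn. Everything on
  the transition zones, where C \<tau> dominates the derivatives of the cutoff, goes into
  \<open>Er\<close>.\<close>

lemma carleman_absorption:
  fixes t s0 s1 s2 C :: real
  assumes s: "s1 < s2" "s2 < L" and t: "t \<ge> 1" and C: "C \<ge> 1"
    and \<tau>: "admissible L \<tau>" "\<And>s. 0 \<le> \<tau> s"
    and bnd: "\<And>k s. k \<in> {1, 2, 3} \<Longrightarrow> \<bar>cut k s0 s1 s2 s\<bar> \<le> C * \<tau> s"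
  defines "w \<equiv> \<lambda>x. E t (lrho \<alpha> x) * \<eta> (lrho \<alpha> x) * cut 0 s0 s1 s2 (lrho \<alpha> x)"
  defines "H \<equiv> integral\<^sup>L M (\<lambda>x. w x * ((u x)\<^sup>2 / (norm (fst x))\<^sup>2))"
    and "U \<equiv> integral\<^sup>L M (\<lambda>x. w x * (radw \<alpha> x * (u x)\<^sup>2))"
    and "G \<equiv> integral\<^sup>L M (\<lambda>x. w x * Gu x)"
    and "Er \<equiv> integral\<^sup>L M (\<lambda>x. E t (lrho \<alpha> x) * \<tau> (lrho \<alpha> x) * (radw \<alpha> x * (u x)\<^sup>2 + Gu x + \<bar>Bu x * u x\<bar>))"
  shows "integrable M (\<lambda>x. w x * ((u x)\<^sup>2 / (norm (fst x))\<^sup>2))"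
    and "t\<^sup>2 * \<epsilon> * U \<le> C1\<^sup>2 / (8 * t) * H + ((\<bar>\<kappa>\<bar> + 2)\<^sup>2 + \<bar>\<kappa>\<bar> + 10) * t\<^sup>2 * C * Er"
    and "G \<le> C1\<^sup>2 / (2 * t\<^sup>2) * H + (37 + 8 * \<bar>\<kappa>\<bar>) * t\<^sup>2 * U + (9 + \<bar>\<kappa>\<bar>) * t\<^sup>2 * C * Er"
    and "H \<le> 4 * G + 16 * t\<^sup>2 * U + 2 * t\<^sup>2 * C * Er"
proof -
  have e: "\<epsilon> > 0" "\<epsilon> \<le> 4" using \<delta> by auto
  define \<omega> where "\<omega> = (\<lambda>k. cut k s0 s1 s2)"
  have cE: "continuous_on UNIV (E t)" by (rule continuous_on_cwt[OF e(1)])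
  have adm\<omega>: "admissible L (\<omega> k)" for k unfolding \<omega>_def by (rule admissible_cut[OF s])
  have admw: "admissible L (\<lambda>s. E t s * \<eta> s * \<omega> 0 s)"
    by (rule admissible_mult(1)[OF _ adm\<omega>]) (intro continuous_on_mult cE continuous_on_ceta)
  have adme: "admissible L (\<lambda>s. E t s * \<tau> s)" by (rule admissible_mult(1)[OF cE \<tau>(1)])
  note iw = integrable_weighted[OF admw] and ie = integrable_weighted[OF adme]
  have w: "w x = E t (lrho \<alpha> x) * \<eta> (lrho \<alpha> x) * \<omega> 0 (lrho \<alpha> x)" for x by (simp add: w_def \<omega>_def)
  have w0: "0 \<le> w x" for x
    by (simp add: w_def cut_0_bounds ceta_pos cwt_pos less_imp_le)
  define er where "er = (\<lambda>x. E t (lrho \<alpha> x) * \<tau> (lrho \<alpha> x) * (radw \<alpha> x * (u x)\<^sup>2 + Gu x + \<bar>Bu x * u x\<bar>))"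
  have ier: "integrable M er" unfolding er_def distrib_left
    using ie(2-4) by (intro Bochner_Integration.integrable_add)
  have Er: "Er = integral\<^sup>L M er" by (simp add: Er_def er_def)
  have iU: "integrable M (\<lambda>x. w x * (radw \<alpha> x * (u x)\<^sup>2))" and iG: "integrable M (\<lambda>x. w x * Gu x)"
    using iw(2,3) by (simp_all add: w)
  define b b1 where "b = (\<lambda>s. E t s * (\<eta> s * \<omega> 0 s))"
    and "b1 = (\<lambda>s. E t s * (\<eta> s * (\<epsilon> * \<omega> 0 s + \<omega> 1 s) - 2 * f1 t s * (\<eta> s * \<omega> 0 s)))"
  have db: "(b has_real_derivative b1 s) (at s)" and cb1: "continuous_on UNIV b1" and zb: "r < s0 \<or> s2 < r \<Longrightarrow> b r = 0" for s r
    unfolding b_def b1_def \<omega>_def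
    by (rule weighted_energy_identity(2)[OF s], rule weighted_energy_identity(3)[OF s], erule weighted_energy_identity(4)[OF s])
  have b: "b (lrho \<alpha> x) = w x" for x by (simp add: b_def w)
  have b0: "0 \<le> b r" for r by (simp add: b_def \<omega>_def cut_0_bounds ceta_pos cwt_pos less_imp_le)
  note hl = hardy_limit[where ?s1.0 = s0, OF db cb1 s(2) zb b0, unfolded b]
  show iH: "integrable M (\<lambda>x. w x * ((u x)\<^sup>2 / (norm (fst x))\<^sup>2))" using hl(1) by simp
  have adm1: "admissible L b1"
    unfolding admissible_def using cb1 DERIV_zero_outside[OF db zb] s(2) by blast
  have ib1: "integrable M (\<lambda>x. \<bar>b1 (lrho \<alpha> x)\<bar> * (radw \<alpha> x * (u x)\<^sup>2))"
    by (rule integrable_weighted(2)[OF admissible_abs[OF adm1]])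
  define A where "A = (\<bar>\<kappa>\<bar> + 2)\<^sup>2 + \<bar>\<kappa>\<bar> + 10"
  have A1: "A \<ge> 1" by (simp add: A_def add_increasing)
  have tt: "1 \<le> t\<^sup>2" "t \<le> t\<^sup>2" using t by (auto simp: power2_eq_square mult_le_cancel_left1 intro: one_le_power[of t 2, unfolded power2_eq_square])
  have bn: "\<bar>\<omega> 1 r\<bar> \<le> C * \<tau> r" "\<bar>\<omega> 2 r\<bar> \<le> C * \<tau> r" "\<bar>\<omega> 3 r\<bar> \<le> C * \<tau> r" for r using bnd by (auto simp: \<omega>_def)
  have \<omega>0: "0 \<le> \<omega> 0 r" for r by (simp add: \<omega>_def cut_0_bounds)
  show "t\<^sup>2 * \<epsilon> * U \<le> C1\<^sup>2 / (8 * t) * H + ((\<bar>\<kappa>\<bar> + 2)\<^sup>2 + \<bar>\<kappa>\<bar> + 10) * t\<^sup>2 * C * Er"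
  proof -
    define Y where "Y = (\<lambda>x. Du x + (\<kappa> - f1 t (lrho \<alpha> x)) * u x)"
    define Rm where "Rm = (\<lambda>s. ((\<kappa> - f1 t s)\<^sup>2 - 3 / 2 * f2 t s) * \<omega> 1 s + (\<kappa> - 3 / 2 * f1 t s) * \<omega> 2 s + \<omega> 3 s / 4)"
    define T where "T = (\<lambda>x. E t (lrho \<alpha> x) * (\<omega> 0 (lrho \<alpha> x) * (Bu x * Y x) + \<omega> 1 (lrho \<alpha> x) / 2 * (Bu x * u x)
      - \<omega> 0 (lrho \<alpha> x) * (2 * f1 t (lrho \<alpha> x) * radw \<alpha> x * (Y x)\<^sup>2) + \<omega> 1 (lrho \<alpha> x) * (radw \<alpha> x * (Du x)\<^sup>2)
      - ((t * \<epsilon>\<^sup>2 * \<eta> (lrho \<alpha> x) / 2 - f1 t (lrho \<alpha> x) * f2 t (lrho \<alpha> x)) * \<omega> 0 (lrho \<alpha> x) + Rm (lrho \<alpha> x)) * (radw \<alpha> x * (u x)\<^sup>2)))"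
    have T: "has_bochner_integral M T 0"
      using carleman_identity[OF s, of t s0] unfolding T_def Y_def Rm_def \<omega>_def .
    have pt: "AE x in M. T x + t\<^sup>2 * \<epsilon> * (w x * (radw \<alpha> x * (u x)\<^sup>2))
        \<le> C1\<^sup>2 / (8 * t) * (w x * ((u x)\<^sup>2 / (norm (fst x))\<^sup>2)) + A * t\<^sup>2 * C * er x"
      using pointwise_facts
    proof eventually_elim
      case (elim x)
      define r where "r = lrho \<alpha> x"
      have \<eta>: "0 < \<eta> r" "\<eta> r \<le> 1" using elim e by (auto simp: r_def ceta_pos intro!: ceta_le_1)
      have Ep: "0 < E t r" by (rule cwt_pos)
      have f1: "t \<le> f1 t r" using t \<eta> by (simp add: mult_le_cancel_left1)
      define W where "W = radw \<alpha> x"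
      have W: "W > 0" using elim by (simp add: W_def)
      define q where "q = (u x)\<^sup>2 / (norm (fst x))\<^sup>2"
      have q: "q \<ge> 0" by (simp add: q_def)
      define K where "K = C1\<^sup>2 * \<eta> r * q"
      have K: "K \<ge> 0" "(Bu x)\<^sup>2 \<le> W * K" using \<eta> q elim by (simp_all add: K_def W_def r_def q_def)
      \<comment> \<open>Young's inequality with f = 2 f1 spends the whole negative term in Y^2;
        since f1 \<ge> t the price is at most K / (8 t).\<close>
      have "Bu x * Y x \<le> 2 * f1 t r * W * (Y x)\<^sup>2 + K / (4 * (2 * f1 t r))"
        by (rule young_weighted[OF W _ K(2)]) (use f1 t in auto)
      moreover have "K / (4 * (2 * f1 t r)) \<le> K / (8 * t)"
        using K(1) f1 t by (intro divide_left_mono) auto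
      ultimately have "Bu x * Y x - 2 * f1 t r * W * (Y x)\<^sup>2 \<le> K / (8 * t)" by linarith
      from mult_left_mono[OF this \<omega>0[of r]]
      have 1: "\<omega> 0 r * (Bu x * Y x) - \<omega> 0 r * (2 * f1 t r * W * (Y x)\<^sup>2) \<le> \<omega> 0 r * (K / (8 * t))"
        by (simp only: right_diff_distrib)
      define c where "c = C * \<tau> r"
      have c: "c \<ge> 0" using C \<tau>(2)[of r] by (simp add: c_def)
      have "A * t\<^sup>2 \<ge> 1 * 1" using A1 tt by (intro mult_mono) auto
      from mult_right_mono[OF this c] have cA: "c \<le> A * t\<^sup>2 * c" by simp
      have "\<omega> 1 r / 2 * (Bu x * u x) \<le> \<bar>\<omega> 1 r\<bar> * \<bar>Bu x * u x\<bar>"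
      proof -
        have "\<omega> 1 r * (Bu x * u x) \<le> \<bar>\<omega> 1 r\<bar> * \<bar>Bu x * u x\<bar>" unfolding abs_mult[symmetric] by (rule abs_ge_self)
        moreover have "0 \<le> \<bar>\<omega> 1 r\<bar> * \<bar>Bu x * u x\<bar>" by simp
        ultimately show ?thesis by linarith
      qed
      also have "\<dots> \<le> A * t\<^sup>2 * c * \<bar>Bu x * u x\<bar>"
        using bn(1)[of r] cA by (intro mult_right_mono) (auto simp: c_def)
      finally have 2: "\<omega> 1 r / 2 * (Bu x * u x) \<le> A * t\<^sup>2 * c * \<bar>Bu x * u x\<bar>" .
      have "\<omega> 1 r * (W * (Du x)\<^sup>2) \<le> \<bar>\<omega> 1 r\<bar> * (W * (Du x)\<^sup>2)" using W by (intro mult_right_mono) auto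
      also have "\<dots> \<le> A * t\<^sup>2 * c * Gu x"
        using bn(1)[of r] cA elim W by (intro mult_mono) (auto simp: c_def W_def)
      finally have 3: "\<omega> 1 r * (W * (Du x)\<^sup>2) \<le> A * t\<^sup>2 * c * Gu x" .
      have "\<bar>Rm r\<bar> \<le> A * t\<^sup>2 * c"
        unfolding Rm_def A_def c_def using \<eta> by (intro theta_remainder_bound t e bn) auto
      then have "- Rm r * (W * (u x)\<^sup>2) \<le> A * t\<^sup>2 * c * (W * (u x)\<^sup>2)"
        using W by (intro mult_right_mono) auto
      \<comment> \<open>This is the gain: concavity gives -f2 = t \<epsilon> \<eta>, and it is
        multiplied by f1 \<ge> t. The third-order term in \<eta> is nonnegative and is
        dropped.\<close>
      moreover have "t\<^sup>2 * \<epsilon> * \<eta> r * \<omega> 0 r \<le> (t * \<epsilon>\<^sup>2 * \<eta> r / 2 - f1 t r * f2 t r) * \<omega> 0 r"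
      proof (rule mult_right_mono[OF _ \<omega>0])
        have "t * (t * \<epsilon> * \<eta> r) \<le> f1 t r * (t * \<epsilon> * \<eta> r)" using f1 t e \<eta> by (intro mult_right_mono) auto
        moreover have "0 \<le> t * \<epsilon>\<^sup>2 * \<eta> r / 2" using t \<eta> by simp
        ultimately have "t * (t * \<epsilon> * \<eta> r) \<le> t * \<epsilon>\<^sup>2 * \<eta> r / 2 + f1 t r * (t * \<epsilon> * \<eta> r)" by linarith
        then show "t\<^sup>2 * \<epsilon> * \<eta> r \<le> t * \<epsilon>\<^sup>2 * \<eta> r / 2 - f1 t r * f2 t r"
          by (simp only: power2_eq_square mult.assoc mult_minus_right diff_minus_eq_add)
      qed
      then have "t\<^sup>2 * \<epsilon> * \<eta> r * \<omega> 0 r * (W * (u x)\<^sup>2) \<le> (t * \<epsilon>\<^sup>2 * \<eta> r / 2 - f1 t r * f2 t r) * \<omega> 0 r * (W * (u x)\<^sup>2)"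
        by (rule mult_right_mono) (use W in simp)
      ultimately have 4: "- (((t * \<epsilon>\<^sup>2 * \<eta> r / 2 - f1 t r * f2 t r) * \<omega> 0 r + Rm r) * (W * (u x)\<^sup>2))
          + t\<^sup>2 * \<epsilon> * \<eta> r * \<omega> 0 r * (W * (u x)\<^sup>2) \<le> A * t\<^sup>2 * c * (W * (u x)\<^sup>2)"
        by (simp only: distrib_right minus_mult_left[symmetric])
      have "T x + t\<^sup>2 * \<epsilon> * (w x * (W * (u x)\<^sup>2)) = E t r * (
          (\<omega> 0 r * (Bu x * Y x) - \<omega> 0 r * (2 * f1 t r * W * (Y x)\<^sup>2)) + \<omega> 1 r / 2 * (Bu x * u x) + \<omega> 1 r * (W * (Du x)\<^sup>2)
          + (- (((t * \<epsilon>\<^sup>2 * \<eta> r / 2 - f1 t r * f2 t r) * \<omega> 0 r + Rm r) * (W * (u x)\<^sup>2))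
          + t\<^sup>2 * \<epsilon> * \<eta> r * \<omega> 0 r * (W * (u x)\<^sup>2)))"
        unfolding T_def w r_def[symmetric] W_def[symmetric] by (simp add: algebra_simps)
      also have "\<dots> \<le> E t r * (\<omega> 0 r * (K / (8 * t)) + A * t\<^sup>2 * c * \<bar>Bu x * u x\<bar> + A * t\<^sup>2 * c * Gu x + A * t\<^sup>2 * c * (W * (u x)\<^sup>2))"
        using Ep 1 2 3 4 by (intro mult_left_mono add_mono) auto
      also have "\<dots> = C1\<^sup>2 / (8 * t) * (w x * q) + A * t\<^sup>2 * C * er x"
        unfolding w er_def r_def[symmetric] W_def[symmetric] K_def c_def by (simp add: algebra_simps)
      finally show ?case by (simp only: q_def W_def)
    qed
    have "integral\<^sup>L M (\<lambda>x. T x + t\<^sup>2 * \<epsilon> * (w x * (radw \<alpha> x * (u x)\<^sup>2)))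
      \<le> integral\<^sup>L M (\<lambda>x. C1\<^sup>2 / (8 * t) * (w x * ((u x)\<^sup>2 / (norm (fst x))\<^sup>2)) + A * t\<^sup>2 * C * er x)"
      by (rule integral_mono_AE[OF _ _ pt])
        (intro Bochner_Integration.integrable_add integrable_mult_right iU iH ier has_bochner_integral_integrable
          integrable.intros[OF T])+
    also have "\<dots> = C1\<^sup>2 / (8 * t) * H + A * t\<^sup>2 * C * Er"
      unfolding H_def Er
      by (intro has_bochner_integral_integral_eq has_bochner_integral_add has_bochner_integral_mult_right
          has_bochner_integral_integrable iH ier)
    also have "integral\<^sup>L M (\<lambda>x. T x + t\<^sup>2 * \<epsilon> * (w x * (radw \<alpha> x * (u x)\<^sup>2))) = 0 + t\<^sup>2 * \<epsilon> * U"
      unfolding U_def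
      by (intro has_bochner_integral_integral_eq has_bochner_integral_add has_bochner_integral_mult_right
          has_bochner_integral_integrable T iU)
    finally show ?thesis by (simp add: A_def)
  qed
  show "G \<le> C1\<^sup>2 / (2 * t\<^sup>2) * H + (37 + 8 * \<bar>\<kappa>\<bar>) * t\<^sup>2 * U + (9 + \<bar>\<kappa>\<bar>) * t\<^sup>2 * C * Er"
  proof -
    define \<Psi> where "\<Psi> = (\<lambda>s. (\<epsilon>\<^sup>2 / 2 - 2 * f1 t s * \<epsilon> - f2 t s + 2 * (f1 t s)\<^sup>2 + \<kappa> * \<epsilon> - 2 * \<kappa> * f1 t s) * \<omega> 0 s
      + (\<epsilon> - 2 * f1 t s + \<kappa>) * \<omega> 1 s + \<omega> 2 s / 2)"
    define T where "T = (\<lambda>x. w x * Bu x * u x + w x * Gu x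
      - E t (lrho \<alpha> x) * \<eta> (lrho \<alpha> x) * \<Psi> (lrho \<alpha> x) * (radw \<alpha> x * (u x)\<^sup>2))"
    have T: "has_bochner_integral M T 0"
      using weighted_energy_identity(1)[OF s, where t = t and ?s0.0 = s0]
      unfolding T_def \<Psi>_def w \<omega>_def by (simp only: mult.assoc)
    have pt: "AE x in M. w x * Gu x \<le> T x + (C1\<^sup>2 / (2 * t\<^sup>2) * (w x * ((u x)\<^sup>2 / (norm (fst x))\<^sup>2))
        + (37 + 8 * \<bar>\<kappa>\<bar>) * t\<^sup>2 * (w x * (radw \<alpha> x * (u x)\<^sup>2)) + (9 + \<bar>\<kappa>\<bar>) * t\<^sup>2 * C * er x)"
      using pointwise_facts
    proof eventually_elim
      case (elim x)
      define r where "r = lrho \<alpha> x"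
      have \<eta>: "0 < \<eta> r" "\<eta> r \<le> 1" using elim e by (auto simp: r_def ceta_pos intro!: ceta_le_1)
      have Ep: "0 < E t r" by (rule cwt_pos)
      define W where "W = radw \<alpha> x"
      have W: "W > 0" using elim by (simp add: W_def)
      define q where "q = (u x)\<^sup>2 / (norm (fst x))\<^sup>2"
      have q: "q \<ge> 0" by (simp add: q_def)
      define K where "K = C1\<^sup>2 * \<eta> r * q"
      have K: "(- Bu x)\<^sup>2 \<le> W * K" using \<eta> q elim by (simp_all add: K_def W_def r_def q_def)
      \<comment> \<open>The parameter t^2 / 2 leaves only 1 / (2 t^2) in front of the Hardy term and
        raises the constant 36 of \<open>U\<close> to at most 37.\<close>
      have "- Bu x * u x \<le> t\<^sup>2 / 2 * W * (u x)\<^sup>2 + K / (4 * (t\<^sup>2 / 2))"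
        by (rule young_weighted[OF W _ K]) (use t in auto)
      moreover have "K / (4 * (t\<^sup>2 / 2)) \<le> C1\<^sup>2 / (2 * t\<^sup>2) * q"
      proof -
        have "\<eta> r * (C1\<^sup>2 * q) \<le> 1 * (C1\<^sup>2 * q)" using \<eta> q by (intro mult_right_mono) auto
        then have "K \<le> C1\<^sup>2 * q" by (simp add: K_def mult_ac)
        then show ?thesis using t by (simp add: divide_right_mono)
      qed
      ultimately have "- Bu x * u x \<le> t\<^sup>2 / 2 * W * (u x)\<^sup>2 + C1\<^sup>2 / (2 * t\<^sup>2) * q" by linarith
      from mult_left_mono[OF this w0[of x]]
      have 1: "- (w x * Bu x * u x) \<le> t\<^sup>2 / 2 * (w x * (W * (u x)\<^sup>2)) + C1\<^sup>2 / (2 * t\<^sup>2) * (w x * q)"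
        by (simp add: algebra_simps)
      define c where "c = C * \<tau> r"
      have c: "c \<ge> 0" using C \<tau>(2)[of r] by (simp add: c_def)
      have "\<bar>\<Psi> r\<bar> \<le> (36 + 8 * \<bar>\<kappa>\<bar>) * t\<^sup>2 * \<omega> 0 r + (9 + \<bar>\<kappa>\<bar>) * t\<^sup>2 * c"
        unfolding \<Psi>_def c_def using \<eta> by (intro energy_coefficient_bound t e bn \<omega>0) auto
      then have "\<Psi> r * (E t r * \<eta> r * (W * (u x)\<^sup>2)) \<le> ((36 + 8 * \<bar>\<kappa>\<bar>) * t\<^sup>2 * \<omega> 0 r + (9 + \<bar>\<kappa>\<bar>) * t\<^sup>2 * c) * (E t r * \<eta> r * (W * (u x)\<^sup>2))"
        using W \<eta> Ep by (intro mult_right_mono) auto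
      also have "\<dots> = (36 + 8 * \<bar>\<kappa>\<bar>) * t\<^sup>2 * (w x * (W * (u x)\<^sup>2)) + \<eta> r * ((9 + \<bar>\<kappa>\<bar>) * t\<^sup>2 * c * (E t r * (W * (u x)\<^sup>2)))"
        unfolding w r_def[symmetric] by (simp add: algebra_simps)
      finally have 21: "\<Psi> r * (E t r * \<eta> r * (W * (u x)\<^sup>2)) \<le> (36 + 8 * \<bar>\<kappa>\<bar>) * t\<^sup>2 * (w x * (W * (u x)\<^sup>2))
          + \<eta> r * ((9 + \<bar>\<kappa>\<bar>) * t\<^sup>2 * c * (E t r * (W * (u x)\<^sup>2)))" .
      have "\<eta> r * ((9 + \<bar>\<kappa>\<bar>) * t\<^sup>2 * c * (E t r * (W * (u x)\<^sup>2))) \<le> 1 * ((9 + \<bar>\<kappa>\<bar>) * t\<^sup>2 * c * (E t r * (W * (u x)\<^sup>2)))"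
        using \<eta> c Ep W by (intro mult_right_mono) auto
      also have "\<dots> \<le> 1 * ((9 + \<bar>\<kappa>\<bar>) * t\<^sup>2 * c * (E t r * (W * (u x)\<^sup>2 + Gu x + \<bar>Bu x * u x\<bar>)))"
        using Ep Gu_nonneg[of x] c by (intro mult_left_mono) auto
      also have "\<dots> = (9 + \<bar>\<kappa>\<bar>) * t\<^sup>2 * C * er x"
        by (simp add: c_def er_def r_def W_def mult_ac)
      finally have 22: "\<eta> r * ((9 + \<bar>\<kappa>\<bar>) * t\<^sup>2 * c * (E t r * (W * (u x)\<^sup>2))) \<le> (9 + \<bar>\<kappa>\<bar>) * t\<^sup>2 * C * er x" .
      have "E t r * \<eta> r * \<Psi> r * (W * (u x)\<^sup>2) = \<Psi> r * (E t r * \<eta> r * (W * (u x)\<^sup>2))" by (simp add: mult_ac)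
      then have 2: "E t r * \<eta> r * \<Psi> r * (W * (u x)\<^sup>2) \<le> (36 + 8 * \<bar>\<kappa>\<bar>) * t\<^sup>2 * (w x * (W * (u x)\<^sup>2)) + (9 + \<bar>\<kappa>\<bar>) * t\<^sup>2 * C * er x"
        using order_trans[OF 21 add_left_mono[OF 22]] by (simp only:)
      have "0 \<le> w x * (W * (u x)\<^sup>2)" using w0[of x] W by simp
      then have "(t\<^sup>2 / 2 + (36 + 8 * \<bar>\<kappa>\<bar>) * t\<^sup>2) * (w x * (W * (u x)\<^sup>2)) \<le> ((37 + 8 * \<bar>\<kappa>\<bar>) * t\<^sup>2) * (w x * (W * (u x)\<^sup>2))"
        by (intro mult_right_mono) (simp_all add: distrib_right)
      then have 3: "t\<^sup>2 / 2 * (w x * (W * (u x)\<^sup>2)) + (36 + 8 * \<bar>\<kappa>\<bar>) * t\<^sup>2 * (w x * (W * (u x)\<^sup>2)) \<le> (37 + 8 * \<bar>\<kappa>\<bar>) * t\<^sup>2 * (w x * (W * (u x)\<^sup>2))"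
        by (simp only: distrib_right)
      have "T x = w x * Bu x * u x + w x * Gu x - E t r * \<eta> r * \<Psi> r * (W * (u x)\<^sup>2)"
        by (simp add: T_def r_def W_def)
      then show ?case using 1 2 3 unfolding W_def[symmetric] q_def[symmetric] by linarith
    qed
    have "G \<le> integral\<^sup>L M (\<lambda>x. T x + (C1\<^sup>2 / (2 * t\<^sup>2) * (w x * ((u x)\<^sup>2 / (norm (fst x))\<^sup>2))
        + (37 + 8 * \<bar>\<kappa>\<bar>) * t\<^sup>2 * (w x * (radw \<alpha> x * (u x)\<^sup>2)) + (9 + \<bar>\<kappa>\<bar>) * t\<^sup>2 * C * er x))"
      unfolding G_def
      by (rule integral_mono_AE[OF iG _ pt])
        (intro Bochner_Integration.integrable_add integrable_mult_right iU iH ier integrable.intros[OF T])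
    also have "\<dots> = 0 + (C1\<^sup>2 / (2 * t\<^sup>2) * H + (37 + 8 * \<bar>\<kappa>\<bar>) * t\<^sup>2 * U + (9 + \<bar>\<kappa>\<bar>) * t\<^sup>2 * C * Er)"
      unfolding H_def U_def Er
      by (intro has_bochner_integral_integral_eq has_bochner_integral_add has_bochner_integral_mult_right
          has_bochner_integral_integrable T iH iU ier)
    finally show ?thesis by simp
  qed
  show "H \<le> 4 * G + 16 * t\<^sup>2 * U + 2 * t\<^sup>2 * C * Er"
  proof -
    \<comment> \<open>Apart from cutoff terms the derivative of \<open>b\<close> is of size t times
      \<open>b\<close>; with t \<le> t^2 it fits the scale of the bound for t^2 U.\<close>
    have pt: "AE x in M. \<bar>b1 (lrho \<alpha> x)\<bar> * (radw \<alpha> x * (u x)\<^sup>2) \<le> 8 * t\<^sup>2 * (w x * (radw \<alpha> x * (u x)\<^sup>2)) + t\<^sup>2 * C * er x"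
      using pointwise_facts
    proof eventually_elim
      case (elim x)
      define r where "r = lrho \<alpha> x"
      have \<eta>: "0 < \<eta> r" "\<eta> r \<le> 1" using elim e by (auto simp: r_def ceta_pos intro!: ceta_le_1)
      have Ep: "0 < E t r" by (rule cwt_pos)
      have W: "0 < radw \<alpha> x" using elim by simp
      have f1: "0 \<le> f1 t r" "f1 t r \<le> 2 * t" using t \<eta> by (auto simp: mult.commute[of t])
      have "b1 r = E t r * \<eta> r * ((\<epsilon> - 2 * f1 t r) * \<omega> 0 r + \<omega> 1 r)" by (simp add: b1_def algebra_simps)
      then have "\<bar>b1 r\<bar> = E t r * \<eta> r * \<bar>(\<epsilon> - 2 * f1 t r) * \<omega> 0 r + \<omega> 1 r\<bar>"
        using Ep \<eta> by (simp add: abs_mult)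
      also have "\<dots> \<le> E t r * \<eta> r * (8 * t\<^sup>2 * \<omega> 0 r + C * \<tau> r)"
      proof (rule mult_left_mono)
        have "\<bar>\<epsilon> - 2 * f1 t r\<bar> \<le> 8 * t\<^sup>2" using f1 e tt by linarith
        then have "\<bar>(\<epsilon> - 2 * f1 t r) * \<omega> 0 r\<bar> \<le> 8 * t\<^sup>2 * \<omega> 0 r"
          unfolding abs_mult using \<omega>0[of r] by (intro mult_mono) auto
        then show "\<bar>(\<epsilon> - 2 * f1 t r) * \<omega> 0 r + \<omega> 1 r\<bar> \<le> 8 * t\<^sup>2 * \<omega> 0 r + C * \<tau> r"
          using bn(1)[of r] by linarith
      qed (use Ep \<eta> in simp)
      also have "\<dots> = 8 * t\<^sup>2 * w x + \<eta> r * (C * (E t r * \<tau> r))" unfolding w r_def[symmetric] by (simp add: algebra_simps)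
      also have "\<dots> \<le> 8 * t\<^sup>2 * w x + t\<^sup>2 * (C * (E t r * \<tau> r))"
        using \<eta> tt C Ep \<tau>(2)[of r] by (intro add_left_mono mult_right_mono) auto
      finally have "\<bar>b1 r\<bar> * (radw \<alpha> x * (u x)\<^sup>2) \<le> (8 * t\<^sup>2 * w x + t\<^sup>2 * (C * (E t r * \<tau> r))) * (radw \<alpha> x * (u x)\<^sup>2)"
        using W by (intro mult_right_mono) auto
      also have "\<dots> = 8 * t\<^sup>2 * (w x * (radw \<alpha> x * (u x)\<^sup>2)) + t\<^sup>2 * C * (E t r * \<tau> r * (radw \<alpha> x * (u x)\<^sup>2))"
        by (simp add: algebra_simps)
      also have "\<dots> \<le> 8 * t\<^sup>2 * (w x * (radw \<alpha> x * (u x)\<^sup>2)) + t\<^sup>2 * C * er x"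
        unfolding er_def r_def[symmetric] using C Ep \<tau>(2)[of r] Gu_nonneg[of x]
        by (intro add_left_mono mult_left_mono) auto
      finally show ?case by (simp add: r_def)
    qed
    have "integral\<^sup>L M (\<lambda>x. \<bar>b1 (lrho \<alpha> x)\<bar> * (radw \<alpha> x * (u x)\<^sup>2))
      \<le> integral\<^sup>L M (\<lambda>x. 8 * t\<^sup>2 * (w x * (radw \<alpha> x * (u x)\<^sup>2)) + t\<^sup>2 * C * er x)"
      by (rule integral_mono_AE[OF ib1 _ pt]) (intro Bochner_Integration.integrable_add integrable_mult_right iU ier)
    also have "\<dots> = 8 * t\<^sup>2 * U + t\<^sup>2 * C * Er"
      unfolding U_def Er
      by (intro has_bochner_integral_integral_eq has_bochner_integral_add has_bochner_integral_mult_right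
          has_bochner_integral_integrable iU ier)
    finally show ?thesis using hl(2) by (simp add: H_def G_def mult.assoc)
  qed
qed

text \<open>Inserting the bounds of the preceding lemma into each other gives H \<le> (Z / t) H plus
  errors, and large t absorbs the first term. \<open>t0\<close> and \<open>D\<close> depend neither
  on the cutoff nor on t, which permits the two limits taken at the end.\<close>

lemma carleman_estimate:
  obtains t0 D where "t0 \<ge> 1" "D \<ge> 0"
    "\<And>t s0 s1 s2 C \<tau>. t \<ge> t0 \<Longrightarrow> s1 < s2 \<Longrightarrow> s2 < L \<Longrightarrow> C \<ge> 1 \<Longrightarrow> admissible L \<tau> \<Longrightarrow> (\<And>s. 0 \<le> \<tau> s) \<Longrightarrow>
      (\<And>k s. k \<in> {1, 2, 3} \<Longrightarrow> \<bar>cut k s0 s1 s2 s\<bar> \<le> C * \<tau> s) \<Longrightarrow>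
      integral\<^sup>L M (\<lambda>x. E t (lrho \<alpha> x) * \<eta> (lrho \<alpha> x) * cut 0 s0 s1 s2 (lrho \<alpha> x) * ((u x)\<^sup>2 / (norm (fst x))\<^sup>2))
      \<le> D * C * t\<^sup>2 * integral\<^sup>L M (\<lambda>x. E t (lrho \<alpha> x) * \<tau> (lrho \<alpha> x) * (radw \<alpha> x * (u x)\<^sup>2 + Gu x + \<bar>Bu x * u x\<bar>))"
proof -
  \<comment> \<open>164 + 32 |\<kappa>| = 4 (37 + 8 |\<kappa>|) + 16 collects the coefficients of
    t^2 U after the bound for \<open>G\<close> is put into the one for \<open>H\<close>;
    \<open>A\<close> is the error constant of the Carleman identity.\<close>
  define A B where "A = (\<bar>\<kappa>\<bar> + 2)\<^sup>2 + \<bar>\<kappa>\<bar> + 10" and "B = 164 + 32 * \<bar>\<kappa>\<bar>"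
  have A: "A \<ge> 0" and B: "B \<ge> 0" by (simp_all add: A_def B_def)
  have e: "\<epsilon> > 0" using \<delta> by simp
  \<comment> \<open>\<open>Z / t\<close> dominates the coefficient of \<open>H\<close> on the right;
    t \<ge> 1 + 2 Z brings it down to 1/2.\<close>
  define Z where "Z = 2 * C1\<^sup>2 + B * (C1\<^sup>2 / (8 * \<epsilon>))"
  have Z: "Z \<ge> 0" using B e by (simp add: Z_def)
  define t0 where "t0 = 1 + 2 * Z"
  \<comment> \<open>38 + 4 |\<kappa>| = 4 (9 + |\<kappa>|) + 2, and the outer factor 2 comes from
    moving H / 2 to the left.\<close>
  define D where "D = 2 * (B * (A / \<epsilon>) + 38 + 4 * \<bar>\<kappa>\<bar>)"
  show ?thesis
  proof (rule that[of t0 D])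
    show "t0 \<ge> 1" using Z by (simp add: t0_def)
    show "D \<ge> 0" using A B e by (simp add: D_def)
    fix t s0 s1 s2 C \<tau>
    assume t: "t \<ge> t0" and s: "s1 < s2" "s2 < L" and C: "C \<ge> 1" and \<tau>: "admissible L \<tau>" "\<And>s. 0 \<le> \<tau> s"
      and bnd: "\<And>k s. k \<in> {1, 2, 3} \<Longrightarrow> \<bar>cut k s0 s1 s2 s\<bar> \<le> C * \<tau> s"
    have t1: "t \<ge> 1" using t Z by (simp add: t0_def)
    note abs = carleman_absorption[OF s t1 C \<tau> bnd]
    define H where "H = integral\<^sup>L M (\<lambda>x. E t (lrho \<alpha> x) * \<eta> (lrho \<alpha> x) * cut 0 s0 s1 s2 (lrho \<alpha> x) * ((u x)\<^sup>2 / (norm (fst x))\<^sup>2))"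
    define U where "U = integral\<^sup>L M (\<lambda>x. E t (lrho \<alpha> x) * \<eta> (lrho \<alpha> x) * cut 0 s0 s1 s2 (lrho \<alpha> x) * (radw \<alpha> x * (u x)\<^sup>2))"
    define G where "G = integral\<^sup>L M (\<lambda>x. E t (lrho \<alpha> x) * \<eta> (lrho \<alpha> x) * cut 0 s0 s1 s2 (lrho \<alpha> x) * Gu x)"
    define Er where "Er = integral\<^sup>L M (\<lambda>x. E t (lrho \<alpha> x) * \<tau> (lrho \<alpha> x) * (radw \<alpha> x * (u x)\<^sup>2 + Gu x + \<bar>Bu x * u x\<bar>))"
    have 1: "t\<^sup>2 * \<epsilon> * U \<le> C1\<^sup>2 / (8 * t) * H + A * t\<^sup>2 * C * Er"
      and 2: "G \<le> C1\<^sup>2 / (2 * t\<^sup>2) * H + (37 + 8 * \<bar>\<kappa>\<bar>) * t\<^sup>2 * U + (9 + \<bar>\<kappa>\<bar>) * t\<^sup>2 * C * Er"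
      and 3: "H \<le> 4 * G + 16 * t\<^sup>2 * U + 2 * t\<^sup>2 * C * Er"
      using abs(2-4) unfolding H_def U_def G_def Er_def A_def by simp_all
    have H: "H \<ge> 0" unfolding H_def
      by (intro integral_nonneg_AE AE_I2 mult_nonneg_nonneg) (auto simp: cut_0_bounds ceta_pos cwt_pos less_imp_le)
    have 4: "t\<^sup>2 * U \<le> (C1\<^sup>2 / (8 * t) * H + A * t\<^sup>2 * C * Er) / \<epsilon>"
      using 1 e by (simp add: pos_le_divide_eq mult_ac)
    have "H \<le> 4 * (C1\<^sup>2 / (2 * t\<^sup>2) * H + (37 + 8 * \<bar>\<kappa>\<bar>) * t\<^sup>2 * U + (9 + \<bar>\<kappa>\<bar>) * t\<^sup>2 * C * Er) + 16 * t\<^sup>2 * U + 2 * t\<^sup>2 * C * Er"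
      by (rule order_trans[OF 3 add_right_mono[OF add_right_mono[OF mult_left_mono[OF 2]]]]) simp
    also have "\<dots> = 2 * C1\<^sup>2 / t\<^sup>2 * H + B * (t\<^sup>2 * U) + (38 + 4 * \<bar>\<kappa>\<bar>) * (t\<^sup>2 * C * Er)"
      by (simp add: B_def field_simps)
    also have "\<dots> \<le> 2 * C1\<^sup>2 / t\<^sup>2 * H + B * ((C1\<^sup>2 / (8 * t) * H + A * t\<^sup>2 * C * Er) / \<epsilon>) + (38 + 4 * \<bar>\<kappa>\<bar>) * (t\<^sup>2 * C * Er)"
      using mult_left_mono[OF 4 B] by simp
    also have "\<dots> = (2 * C1\<^sup>2 / t\<^sup>2 + B * (C1\<^sup>2 / (8 * \<epsilon>)) / t) * H + D / 2 * (t\<^sup>2 * C * Er)"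
    proof -
      have "D / 2 = B * (A / \<epsilon>) + (38 + 4 * \<bar>\<kappa>\<bar>)" by (simp add: D_def)
      then show ?thesis by (simp only: distrib_left distrib_right add_divide_distrib times_divide_eq_left times_divide_eq_right divide_divide_eq_left mult_ac add_ac)
    qed
    also have "\<dots> \<le> (Z / t) * H + D / 2 * (t\<^sup>2 * C * Er)"
    proof -
      have "2 * C1\<^sup>2 / t\<^sup>2 \<le> 2 * C1\<^sup>2 / t" using t1 by (intro divide_left_mono) (auto simp: power2_eq_square mult_le_cancel_left1)
      then show ?thesis using H by (intro add_right_mono mult_right_mono) (auto simp: Z_def add_divide_distrib)
    qed
    also have "(Z / t) * H \<le> (1 / 2) * H" using t t1 Z H by (intro mult_right_mono) (auto simp: t0_def field_simps)
    finally have "H \<le> D * C * t\<^sup>2 * Er" by (simp add: algebra_simps)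
    then show "integral\<^sup>L M (\<lambda>x. E t (lrho \<alpha> x) * \<eta> (lrho \<alpha> x) * cut 0 s0 s1 s2 (lrho \<alpha> x) * ((u x)\<^sup>2 / (norm (fst x))\<^sup>2))
      \<le> D * C * t\<^sup>2 * integral\<^sup>L M (\<lambda>x. E t (lrho \<alpha> x) * \<tau> (lrho \<alpha> x) * (radw \<alpha> x * (u x)\<^sup>2 + Gu x + \<bar>Bu x * u x\<bar>))"
      by (simp add: H_def Er_def)
  qed
qed

end

section \<open>Unique continuation\<close>

lemma vanishing_order_bound:
  assumes "vanishes_to_infinite_order \<alpha> u" "l > 0"
  obtains B r0 where "B \<ge> 0" "r0 > 0"
    "\<And>r. 0 < r \<Longrightarrow> r < r0 \<Longrightarrow> integral\<^sup>L (lebesgue_on (gauge_ball \<alpha> r)) (\<lambda>x. (u x)\<^sup>2) \<le> B * r powr l"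
proof -
  have "(\<lambda>r. integral\<^sup>L (lebesgue_on (gauge_ball \<alpha> r)) (\<lambda>x. (u x)\<^sup>2)) \<in> O[at_right 0](\<lambda>r. r powr l)"
    using assms by (simp add: vanishes_to_infinite_order_def)
  then obtain B where B: "B > 0"
      "eventually (\<lambda>r. norm (integral\<^sup>L (lebesgue_on (gauge_ball \<alpha> r)) (\<lambda>x. (u x)\<^sup>2)) \<le> B * norm (r powr l)) (at_right 0)"
    by (rule landau_o.bigE)
  then obtain r0 where r0: "r0 > 0"
      "\<And>r. 0 < r \<Longrightarrow> r < r0 \<Longrightarrow> norm (integral\<^sup>L (lebesgue_on (gauge_ball \<alpha> r)) (\<lambda>x. (u x)\<^sup>2)) \<le> B * norm (r powr l)"
    unfolding eventually_at_right_field by blast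
  show ?thesis
  proof (rule that[of B r0])
    fix r :: real assume "0 < r" "r < r0"
    from r0(2)[OF this] show "integral\<^sup>L (lebesgue_on (gauge_ball \<alpha> r)) (\<lambda>x. (u x)\<^sup>2) \<le> B * r powr l" by simp
  qed (use B r0 in auto)
qed

text \<open>A cutoff that moves with s inherits the derivative bounds of a fixed one.\<close>

lemma cut_translate: "cut k (s + a) (s + b) (s + c) r = cut k a b c (r - s)"
proof -
  have "s + c - (s + b) = c - b" "r - (s + a) = r - s - a" "s + c - r = c - (r - s)" by simp_all
  then show ?thesis by (simp only: cut_def)
qed

context carleman
begin

text \<open>A cruder form of the pointwise bounds with the radial singularity \<rho>^(-2) in place
  of the Hardy weight; it is enough on shells of bounded logarithmic width.\<close>

lemma V_radial: "AE x in M. x \<noteq> 0 \<and> lrho \<alpha> x < L \<and> 0 \<le> radw \<alpha> x \<and> radw \<alpha> x \<le> exp (- 2 * lrho \<alpha> x) \<and>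
    \<bar>Bu x * u x\<bar> \<le> C1 * exp (- 2 * lrho \<alpha> x) * (u x)\<^sup>2"
  using pointwise_facts V
proof eventually_elim
  case (elim x)
  then have x: "x \<noteq> 0" and s: "lrho \<alpha> x \<le> L" by auto
  have "exp ((\<delta> - 2) * lrho \<alpha> x) = exp (\<delta> * lrho \<alpha> x) * exp (- 2 * lrho \<alpha> x)"
    by (simp add: exp_add[symmetric] algebra_simps)
  also have "\<dots> \<le> exp (\<delta> * L) * exp (- 2 * lrho \<alpha> x)"
    using s \<delta> by (intro mult_right_mono) auto
  also have "exp (\<delta> * L) = R powr \<delta>" using R by (simp add: powr_def)
  finally have "C0 * exp ((\<delta> - 2) * lrho \<alpha> x) \<le> C1 * exp (- 2 * lrho \<alpha> x)"
    using C0 unfolding C1_def mult.assoc by (intro mult_left_mono) auto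
  then have "C0 * exp ((\<delta> - 2) * lrho \<alpha> x) * \<bar>u x\<bar> \<le> C1 * exp (- 2 * lrho \<alpha> x) * \<bar>u x\<bar>" by (rule mult_right_mono) simp
  with elim(2) have "\<bar>Bu x\<bar> \<le> C1 * exp (- 2 * lrho \<alpha> x) * \<bar>u x\<bar>" by linarith
  then have "\<bar>Bu x\<bar> * \<bar>u x\<bar> \<le> C1 * exp (- 2 * lrho \<alpha> x) * \<bar>u x\<bar> * \<bar>u x\<bar>" by (rule mult_right_mono) simp
  then have "\<bar>Bu x * u x\<bar> \<le> C1 * exp (- 2 * lrho \<alpha> x) * (u x)\<^sup>2"
    by (simp add: abs_mult power2_eq_square mult.assoc)
  then show ?case using elim(1) radw_le[OF x] by auto
qed

text \<open>The error contains |X u|^2, on which vanishing to infinite order says nothing. The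
  energy identity with a wider cutoff bounds it by u^2 on a slightly larger ball, at the price of
  exp (-2 s) from W, \<open>Bu\<close> and the logarithmic scale.\<close>

lemma caccioppoli:
  obtains K where "K \<ge> 0"
    "\<And>s. s + 3 < L \<Longrightarrow> integral\<^sup>L M (\<lambda>x. bump (s - 1) s (s + 1) (s + 2) (lrho \<alpha> x) * (radw \<alpha> x * (u x)\<^sup>2 + Gu x + \<bar>Bu x * u x\<bar>))
      \<le> K * exp (- 2 * s) * integral\<^sup>L (lebesgue_on (gauge_ball \<alpha> (exp (s + 3)))) (\<lambda>x. (u x)\<^sup>2)"
proof -
  obtain C where C: "C \<ge> 1" "\<And>k s0 s. \<bar>cut k s0 2 3 s\<bar> \<le> C" using cut_bound[of 2 3] by blast
  have C1: "C1 \<ge> 0" using C0 R by (simp add: C1_def)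
  \<comment> \<open>The 1 is for W u^2 and the 2 for |Bu u|, which enters once from the error and
    once through the energy identity; the last summand bounds the derivatives of the cutoff. The
    factor exp 4 arises since exp (-2 r) \<le> exp 4 exp (-2 s) for r \<ge> s - 2.\<close>
  define K where "K = (1 + 2 * C1 + (1 / 2 + \<bar>\<kappa>\<bar>) * C) * exp 4"
  have K: "K \<ge> 0" using C C1 by (simp add: K_def)
  show ?thesis
  proof (rule that[OF K])
    fix s :: real assume s: "s + 3 < L"
    \<comment> \<open>This cutoff is 1 on [s - 1, s + 2], the support of \<open>\<tau>\<close>, so
      it dominates \<open>\<tau>\<close>.\<close>
    define \<omega> where "\<omega> = (\<lambda>k. cut k (s + (-2)) (s + 2) (s + 3))"
    define \<tau> where "\<tau> = bump (s - 1) s (s + 1) (s + 2)"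
    define B where "B = gauge_ball \<alpha> (exp (s + 3)) \<inter> \<Omega>"
    have B: "B = gauge_ball \<alpha> (exp (s + 3))"
      unfolding B_def using s by (auto simp: gauge_ball_iff[OF \<alpha>(1)] R)
    have lt: "s + 2 < s + 3" "s - 1 < s" "s + 1 < s + 2" "s + 2 < L" using s by auto
    have \<omega>C: "\<bar>\<omega> k r\<bar> \<le> C" for k r unfolding \<omega>_def cut_translate by (rule C)
    have d\<omega>: "(\<omega> 0 has_real_derivative \<omega> 1 r) (at r)" "(\<omega> 1 has_real_derivative \<omega> 2 r) (at r)" for r
      using DERIV_cut[of 0] DERIV_cut[of 1] by (simp_all add: \<omega>_def numeral_2_eq_2)
    have z\<omega>: "\<omega> k r = 0" if "r < s - 2 \<or> s + 3 < r" for k r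
      unfolding \<omega>_def by (rule cut_outside[OF lt(1)]) (use that in auto)
    define T where "T = (\<lambda>x. \<omega> 0 (lrho \<alpha> x) * Bu x * u x + \<omega> 0 (lrho \<alpha> x) * Gu x
      - (\<omega> 2 (lrho \<alpha> x) / 2 + \<kappa> * \<omega> 1 (lrho \<alpha> x)) * (radw \<alpha> x * (u x)\<^sup>2))"
    have T: "has_bochner_integral M T 0"
      unfolding T_def
    proof (rule energy_identity_squared[where ?s1.0 = "s - 2" and ?s2.0 = "s + 3"])
      show "continuous_on UNIV (\<omega> 2)" unfolding \<omega>_def by (rule continuous_on_cut)
    qed (use d\<omega> z\<omega> s in blast)+
    have B\<Omega>: "B \<subseteq> \<Omega>"
      by (simp add: B_def)
    have oB: "open B" unfolding B by (rule open_gauge_ball[OF \<alpha>(1)]) simp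
    define g where "g = (\<lambda>x. indicator B x * (u x)\<^sup>2)"
    have iu: "integrable M (\<lambda>x. (u x)\<^sup>2)" using L2_u by (simp add: L2_def)
    have setB: "B \<in> sets M" using B\<Omega> oB open_\<Omega> by (simp add: sets_restrict_space_iff)
    have ig: "integrable M g"
      unfolding g_def using integrable_mult_indicator[OF setB iu] by simp
    have Ig: "integral\<^sup>L M g = integral\<^sup>L (lebesgue_on B) (\<lambda>x. (u x)\<^sup>2)"
      unfolding g_def using B\<Omega> oB open_\<Omega>
      by (simp add: integral_restrict_space indicator_inter_arith[symmetric] mult.assoc[symmetric] Int_absorb1 Int_absorb2)
    define er where "er = (\<lambda>x. \<tau> (lrho \<alpha> x) * (radw \<alpha> x * (u x)\<^sup>2 + Gu x + \<bar>Bu x * u x\<bar>))"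
    have "admissible L \<tau>" unfolding \<tau>_def by (rule admissible_bump[OF lt(2-4)])
    note ie = integrable_weighted[OF this]
    have ier: "integrable M er" unfolding er_def distrib_left
      using ie(2-4) by (intro Bochner_Integration.integrable_add)
    have pt: "AE x in M. er x \<le> T x + K * exp (- 2 * s) * g x"
      using V_radial
    proof eventually_elim
      case (elim x)
      define r where "r = lrho \<alpha> x"
      define W where "W = radw \<alpha> x"
      define b where "b = \<bar>Bu x * u x\<bar>"
      have W: "0 \<le> W" "W \<le> exp (- 2 * r)" and b: "b \<le> C1 * exp (- 2 * r) * (u x)\<^sup>2" "0 \<le> b"
        using elim by (auto simp: W_def r_def b_def)
      have G: "0 \<le> Gu x" by (rule Gu_nonneg)
      have \<omega>0: "0 \<le> \<omega> 0 r" "\<omega> 0 r \<le> 1" by (simp_all add: \<omega>_def cut_0_bounds)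
      have \<tau>0: "0 \<le> \<tau> r" "\<tau> r \<le> 1" unfolding \<tau>_def by (rule bump_props(2,3)[OF lt(2,3)])+
      show ?case
      proof (cases "s - 2 \<le> r \<and> r < s + 3")
        case False
        then have 0: "r < s - 2 \<or> s + 3 \<le> r" by auto
        then have "\<omega> k r = 0" for k unfolding \<omega>_def by (intro cut_outside[OF lt(1)]) auto
        moreover have "\<tau> r = 0" unfolding \<tau>_def using 0 by (intro bump_props(5)[OF lt(2,3)]) auto
        moreover have "0 \<le> K * exp (- 2 * s) * g x" using K by (simp add: g_def)
        ultimately show ?thesis unfolding er_def T_def r_def[symmetric] by simp
      next
        case True
        have "x \<in> B" unfolding B using True by (simp add: gauge_ball_iff[OF \<alpha>(1)] r_def)
        then have g: "g x = (u x)\<^sup>2" by (simp add: g_def)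
        define e where "e = exp 4 * exp (- 2 * s)"
        have re: "exp (- 2 * r) \<le> e" using True by (simp add: e_def exp_add[symmetric])
        have W': "W * (u x)\<^sup>2 \<le> e * (u x)\<^sup>2" using W re by (intro mult_right_mono) auto
        have "exp (- 2 * r) * (u x)\<^sup>2 \<le> e * (u x)\<^sup>2" using re by (rule mult_right_mono) simp
        from order_trans[OF b(1)[unfolded mult.assoc] mult_left_mono[OF this[unfolded mult.assoc] C1]]
        have b': "b \<le> C1 * (e * (u x)\<^sup>2)" .
        have \<tau>\<omega>: "\<tau> r * Gu x \<le> \<omega> 0 r * Gu x"
        proof (rule mult_right_mono[OF _ G], cases "s - 1 \<le> r \<and> r \<le> s + 2")
          case True
          then have "\<omega> 0 r = 1" unfolding \<omega>_def by (subst cut_inside[OF lt(1)]) auto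
          then show "\<tau> r \<le> \<omega> 0 r" using \<tau>0 by simp
        next
          case False
          then have "\<tau> r = 0" unfolding \<tau>_def by (intro bump_props(5)[OF lt(2,3)]) auto
          then show "\<tau> r \<le> \<omega> 0 r" using \<omega>0 by simp
        qed
        have "\<tau> r * (W * (u x)\<^sup>2 + b) \<le> 1 * (W * (u x)\<^sup>2 + b)"
          using \<tau>0 W b by (intro mult_right_mono) auto
        then have 1: "er x \<le> \<omega> 0 r * Gu x + W * (u x)\<^sup>2 + b"
          using \<tau>\<omega> unfolding er_def r_def[symmetric] W_def[symmetric] b_def[symmetric] distrib_left by linarith
        have "- (\<omega> 0 r * (Bu x * u x)) \<le> \<bar>\<omega> 0 r * (Bu x * u x)\<bar>" by (rule abs_ge_minus_self)
        also have "\<dots> = \<omega> 0 r * b" using \<omega>0 by (simp add: abs_mult b_def)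
        also have "\<dots> \<le> 1 * b" by (rule mult_right_mono[OF \<omega>0(2) b(2)])
        finally have 2: "- (\<omega> 0 r * (Bu x * u x)) \<le> b" by simp
        have "\<bar>\<omega> 2 r / 2 + \<kappa> * \<omega> 1 r\<bar> \<le> (1 / 2 + \<bar>\<kappa>\<bar>) * C"
        proof -
          have "\<bar>\<kappa> * \<omega> 1 r\<bar> \<le> \<bar>\<kappa>\<bar> * C" unfolding abs_mult using \<omega>C by (rule mult_left_mono) simp
          then show ?thesis using \<omega>C[of 2 r] unfolding distrib_right by linarith
        qed
        then have "(\<omega> 2 r / 2 + \<kappa> * \<omega> 1 r) * (W * (u x)\<^sup>2) \<le> ((1 / 2 + \<bar>\<kappa>\<bar>) * C) * (W * (u x)\<^sup>2)"
          by (intro mult_right_mono) (use W in auto)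
        also have "\<dots> \<le> ((1 / 2 + \<bar>\<kappa>\<bar>) * C) * (e * (u x)\<^sup>2)"
          using W' C by (intro mult_left_mono) auto
        finally have 3: "(\<omega> 2 r / 2 + \<kappa> * \<omega> 1 r) * (W * (u x)\<^sup>2) \<le> ((1 / 2 + \<bar>\<kappa>\<bar>) * C) * (e * (u x)\<^sup>2)" .
        have T: "T x = \<omega> 0 r * (Bu x * u x) + \<omega> 0 r * Gu x - (\<omega> 2 r / 2 + \<kappa> * \<omega> 1 r) * (W * (u x)\<^sup>2)"
          by (simp add: T_def r_def W_def)
        have "K * exp (- 2 * s) * g x = e * (u x)\<^sup>2 + 2 * (C1 * (e * (u x)\<^sup>2)) + ((1 / 2 + \<bar>\<kappa>\<bar>) * C) * (e * (u x)\<^sup>2)"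
          unfolding K_def g e_def by (simp only: distrib_right distrib_left mult_ac mult_1_left mult_1_right)
        with 1 2 3 T W' b' show ?thesis by linarith
      qed
    qed
    have "integral\<^sup>L M er \<le> integral\<^sup>L M (\<lambda>x. T x + K * exp (- 2 * s) * g x)"
      by (rule integral_mono_AE[OF ier _ pt])
        (intro Bochner_Integration.integrable_add integrable_mult_right ig integrable.intros[OF T])
    also have "\<dots> = 0 + K * exp (- 2 * s) * integral\<^sup>L M g"
      by (intro has_bochner_integral_integral_eq has_bochner_integral_add has_bochner_integral_mult_right
          has_bochner_integral_integrable T ig)
    finally show "integral\<^sup>L M (\<lambda>x. bump (s - 1) s (s + 1) (s + 2) (lrho \<alpha> x) * (radw \<alpha> x * (u x)\<^sup>2 + Gu x + \<bar>Bu x * u x\<bar>))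
      \<le> K * exp (- 2 * s) * integral\<^sup>L (lebesgue_on (gauge_ball \<alpha> (exp (s + 3)))) (\<lambda>x. (u x)\<^sup>2)"
      unfolding er_def \<tau>_def Ig B by simp
  qed
qed

text \<open>For fixed t the Carleman weight grows only like a fixed negative power of the gauge near
  the origin, which vanishing of sufficiently high order overcomes.\<close>

lemma inner_error_tendsto_0:
  assumes van: "vanishes_to_infinite_order \<alpha> u" and t: "t \<ge> 0"
  shows "((\<lambda>s. integral\<^sup>L M (\<lambda>x. E t (lrho \<alpha> x) * bump (s - 1) s (s + 1) (s + 2) (lrho \<alpha> x)
    * (radw \<alpha> x * (u x)\<^sup>2 + Gu x + \<bar>Bu x * u x\<bar>))) \<longlongrightarrow> 0) at_bot"
proof -
  have e: "\<epsilon> > 0" using \<delta> by simp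
  obtain K where K: "K \<ge> 0"
    "\<And>s. s + 3 < L \<Longrightarrow> integral\<^sup>L M (\<lambda>x. bump (s - 1) s (s + 1) (s + 2) (lrho \<alpha> x) * (radw \<alpha> x * (u x)\<^sup>2 + Gu x + \<bar>Bu x * u x\<bar>))
      \<le> K * exp (- 2 * s) * integral\<^sup>L (lebesgue_on (gauge_ball \<alpha> (exp (s + 3)))) (\<lambda>x. (u x)\<^sup>2)"
    using caccioppoli by blast
  \<comment> \<open>The exponent pays 4 t for the Carleman weight and 2 for the Caccioppoli factor;
    the remaining 1 yields the decay exp s.\<close>
  have "4 * t + 3 > 0" using t by simp
  then obtain B r0 where B: "B \<ge> 0" "r0 > 0"
    "\<And>r. 0 < r \<Longrightarrow> r < r0 \<Longrightarrow> integral\<^sup>L (lebesgue_on (gauge_ball \<alpha> r)) (\<lambda>x. (u x)\<^sup>2) \<le> B * r powr (4 * t + 3)"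
    using vanishing_order_bound[OF van] by blast
  \<comment> \<open>On the support of the bump the variable is at least s - 1 and \<eta> \<le> 1, so
    the Carleman weight is at most A exp (-4 t s).\<close>
  define A where "A = exp (4 * t + 2 * t / \<epsilon>)"
  define c where "c = A * (K * (B * exp (3 * (4 * t + 3))))"
  define F where "F = (\<lambda>s. integral\<^sup>L M (\<lambda>x. E t (lrho \<alpha> x) * bump (s - 1) s (s + 1) (s + 2) (lrho \<alpha> x)
    * (radw \<alpha> x * (u x)\<^sup>2 + Gu x + \<bar>Bu x * u x\<bar>)))"
  have F0: "0 \<le> F s" for s
    unfolding F_def
    by (intro integral_nonneg_AE AE_I2 mult_nonneg_nonneg add_nonneg_nonneg)
      (auto simp: cwt_pos less_imp_le Gu_nonneg radw_nonneg bump_props(2))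
  have bound: "F s \<le> c * exp s" if s: "s < L - 3" "s < ln r0 - 3" for s
  proof -
    have lt: "s - 1 < s" "s + 1 < s + 2" "s + 2 < L" using s by auto
    define er where "er = (\<lambda>x. bump (s - 1) s (s + 1) (s + 2) (lrho \<alpha> x) * (radw \<alpha> x * (u x)\<^sup>2 + Gu x + \<bar>Bu x * u x\<bar>))"
    have adm: "admissible L (bump (s - 1) s (s + 1) (s + 2))" by (rule admissible_bump[OF lt])
    note ie = integrable_weighted[OF adm] and iE = integrable_weighted[OF admissible_mult(1)[OF continuous_on_cwt[OF e, of L t] adm]]
    have ier: "integrable M er" unfolding er_def distrib_left
      using ie(2-4) by (intro Bochner_Integration.integrable_add)
    have iEr: "integrable M (\<lambda>x. E t (lrho \<alpha> x) * bump (s - 1) s (s + 1) (s + 2) (lrho \<alpha> x)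
        * (radw \<alpha> x * (u x)\<^sup>2 + Gu x + \<bar>Bu x * u x\<bar>))"
      unfolding distrib_left using iE(2-4) by (intro Bochner_Integration.integrable_add)
    have "F s \<le> integral\<^sup>L M (\<lambda>x. (A * exp (- 4 * t * s)) * er x)"
      unfolding F_def
    proof (rule integral_mono_AE[OF iEr integrable_mult_right[OF ier]])
      show "AE x in M. E t (lrho \<alpha> x) * bump (s - 1) s (s + 1) (s + 2) (lrho \<alpha> x) * (radw \<alpha> x * (u x)\<^sup>2 + Gu x + \<bar>Bu x * u x\<bar>)
          \<le> (A * exp (- 4 * t * s)) * er x"
        using V_radial
      proof eventually_elim
        case (elim x)
        define r where "r = lrho \<alpha> x"
        have er0: "0 \<le> er x"
          unfolding er_def by (intro mult_nonneg_nonneg add_nonneg_nonneg bump_props(2)[OF lt(1,2)] Gu_nonneg radw_nonneg) auto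
        show ?case
        proof (cases "r \<le> s - 1")
          case True
          then have "bump (s - 1) s (s + 1) (s + 2) (lrho \<alpha> x) = 0" by (intro bump_props(5)[OF lt(1,2)]) (simp add: r_def)
          then show ?thesis using er0 by (simp add: A_def)
        next
          case False
          have "\<eta> r \<le> 1" by (rule ceta_le_1[OF e]) (use elim in \<open>auto simp: r_def\<close>)
          then have "\<eta> r / \<epsilon> \<le> 1 / \<epsilon>" using e by (intro divide_right_mono) auto
          then have "2 * (s - 1) - 1 / \<epsilon> \<le> 2 * r - \<eta> r / \<epsilon>" using False by (intro diff_mono) auto
          from mult_left_mono[OF this t] have "E t r \<le> exp (- 2 * (t * (2 * (s - 1) - 1 / \<epsilon>)))" by (simp add: cwt_def)
          also have "\<dots> = A * exp (- 4 * t * s)" by (simp add: A_def exp_add[symmetric] algebra_simps)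
          finally have "E t r * er x \<le> A * exp (- 4 * t * s) * er x" by (rule mult_right_mono[OF _ er0])
          then show ?thesis unfolding er_def r_def by (simp only: mult.assoc)
        qed
      qed
    qed
    also have "\<dots> = A * exp (- 4 * t * s) * integral\<^sup>L M er" by (rule integral_mult_right_zero)
    also have "\<dots> \<le> A * exp (- 4 * t * s) * (K * exp (- 2 * s) * (B * exp (s + 3) powr (4 * t + 3)))"
    proof (rule mult_left_mono)
      have "exp (s + 3) < exp (ln r0)" using s by simp
      then have "exp (s + 3) < r0" using B(2) by simp
      from B(3)[OF exp_gt_zero this]
      have "K * exp (- 2 * s) * integral\<^sup>L (lebesgue_on (gauge_ball \<alpha> (exp (s + 3)))) (\<lambda>x. (u x)\<^sup>2)
          \<le> K * exp (- 2 * s) * (B * exp (s + 3) powr (4 * t + 3))"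
        by (rule mult_left_mono) (use K in simp)
      moreover have "integral\<^sup>L M er \<le> K * exp (- 2 * s) * integral\<^sup>L (lebesgue_on (gauge_ball \<alpha> (exp (s + 3)))) (\<lambda>x. (u x)\<^sup>2)"
        unfolding er_def by (rule K(2)) (use s in simp)
      ultimately show "integral\<^sup>L M er \<le> K * exp (- 2 * s) * (B * exp (s + 3) powr (4 * t + 3))" by linarith
    qed (simp add: A_def)
    also have "exp (s + 3) powr (4 * t + 3) = exp (3 * (4 * t + 3)) * (exp (4 * t * s) * exp (2 * s) * exp s)"
      by (simp add: powr_def exp_add[symmetric] algebra_simps)
    also have "A * exp (- 4 * t * s) * (K * exp (- 2 * s) * (B * (exp (3 * (4 * t + 3)) * (exp (4 * t * s) * exp (2 * s) * exp s))))
        = c * exp s * (exp (- 4 * t * s) * exp (4 * t * s)) * (exp (- 2 * s) * exp (2 * s))"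
      by (simp only: c_def mult_ac)
    also have "\<dots> = c * exp s" by (simp add: exp_add[symmetric])
    finally show ?thesis .
  qed
  have lim: "((\<lambda>s. c * exp s) \<longlongrightarrow> 0) at_bot" using tendsto_mult_right_zero[OF exp_at_bot] by simp
  have "eventually (\<lambda>s. s < min (L - 3) (ln r0 - 3)) at_bot" by (rule eventually_gt_at_bot)
  then have "eventually (\<lambda>s. F s \<le> c * exp s) at_bot" by eventually_elim (auto intro: bound)
  then have "(F \<longlongrightarrow> 0) at_bot"
    by (intro tendsto_sandwich[OF _ _ tendsto_const lim]) (simp_all add: F0)
  then show ?thesis unfolding F_def .
qed

text \<open>The order of the limits matters: for fixed t the inner cutoff first moves to the origin,
  which uses an order of vanishing that grows with t, and only then t tends to infinity.\<close>

lemma vanishes_on_shell: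
  assumes van: "vanishes_to_infinite_order \<alpha> u" and ac: "c < L"
  shows "AE x in M. x \<in> shell \<alpha> a c \<longrightarrow> u x = 0"
proof -
  have e: "\<epsilon> > 0" using \<delta> by simp
  \<comment> \<open>Successive midpoints towards L: the cutoff falls on [s1, s2], its error lives on
    [p, s3], and the gap between c and p provides the exponential gain.\<close>
  define p s1 s2 s3 where "p = (c + L) / 2" and "s1 = (p + L) / 2" and "s2 = (s1 + L) / 2" and "s3 = (s2 + L) / 2"
  have lt: "c < p" "p < s1" "s1 < s2" "s2 < s3" "s3 < L" "s2 < L" using ac by (simp_all add: p_def s1_def s2_def s3_def)
  obtain C where C: "C \<ge> 1" "\<And>k s0 s. \<bar>cut k s0 s1 s2 s\<bar> \<le> C" using cut_bound[of s1 s2] by blast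
  obtain t0 D where D: "t0 \<ge> 1" "D \<ge> 0" and ce: "\<And>t s0 s1 s2 C \<tau>. t \<ge> t0 \<Longrightarrow> s1 < s2 \<Longrightarrow> s2 < L \<Longrightarrow> C \<ge> 1 \<Longrightarrow> admissible L \<tau> \<Longrightarrow> (\<And>s. 0 \<le> \<tau> s) \<Longrightarrow>
      (\<And>k s. k \<in> {1, 2, 3} \<Longrightarrow> \<bar>cut k s0 s1 s2 s\<bar> \<le> C * \<tau> s) \<Longrightarrow>
      integral\<^sup>L M (\<lambda>x. E t (lrho \<alpha> x) * \<eta> (lrho \<alpha> x) * cut 0 s0 s1 s2 (lrho \<alpha> x) * ((u x)\<^sup>2 / (norm (fst x))\<^sup>2))
      \<le> D * C * t\<^sup>2 * integral\<^sup>L M (\<lambda>x. E t (lrho \<alpha> x) * \<tau> (lrho \<alpha> x) * (radw \<alpha> x * (u x)\<^sup>2 + Gu x + \<bar>Bu x * u x\<bar>))"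
    using carleman_estimate by blast
  define ef where "ef = (\<lambda>x. radw \<alpha> x * (u x)\<^sup>2 + Gu x + \<bar>Bu x * u x\<bar>)"
  have ef0: "0 \<le> ef x" for x unfolding ef_def by (intro add_nonneg_nonneg mult_nonneg_nonneg Gu_nonneg radw_nonneg) auto
  have ief: "integrable M (\<lambda>x. \<tau> (lrho \<alpha> x) * ef x)" if "admissible L \<tau>" for \<tau>
    unfolding ef_def distrib_left using integrable_weighted(2-4)[OF that] by (intro Bochner_Integration.integrable_add)
  have cE: "continuous_on UNIV (E t)" for t by (rule continuous_on_cwt[OF e])
  define \<tau>1 where "\<tau>1 = bump p s1 s2 s3"
  define K where "K = integral\<^sup>L M (\<lambda>x. \<tau>1 (lrho \<alpha> x) * ef x)"
  have adm1: "admissible L \<tau>1" unfolding \<tau>1_def by (rule admissible_bump) (use lt in auto)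
  have \<tau>1: "0 \<le> \<tau>1 s" for s unfolding \<tau>1_def by (rule bump_props(2)) (use lt in auto)
  have K: "0 \<le> K" unfolding K_def by (intro integral_nonneg_AE AE_I2 mult_nonneg_nonneg \<tau>1 ef0)
  \<comment> \<open>Neither t nor \<open>s0\<close> occurs here, so the single number
    \<open>F\<close> is compared with the Carleman left-hand side for all of them.\<close>
  define g where "g = (\<lambda>x. indicator (shell \<alpha> a c) x * (\<eta> (lrho \<alpha> x) * ((u x)\<^sup>2 / (norm (fst x))\<^sup>2)))"
  define F where "F = integral\<^sup>L M g"
  have g0: "0 \<le> g x" for x by (simp add: g_def ceta_pos less_imp_le)
  define H where "H = (\<lambda>t s0 x. E t (lrho \<alpha> x) * \<eta> (lrho \<alpha> x) * cut 0 s0 s1 s2 (lrho \<alpha> x) * ((u x)\<^sup>2 / (norm (fst x))\<^sup>2))"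
  have H0: "0 \<le> H t s0 x" for t s0 x by (simp add: H_def ceta_pos cwt_pos less_imp_le cut_0_bounds)
  have gH: "E t c * g x \<le> H t s0 x" if "t \<ge> 0" "s0 \<le> a - 1" for t s0 x
  proof (cases "x \<in> shell \<alpha> a c")
    case True
    then have r: "a \<le> lrho \<alpha> x" "lrho \<alpha> x \<le> c" by (auto simp: shell_def)
    have "cut 0 s0 s1 s2 (lrho \<alpha> x) = 1" using r that lt by (subst cut_inside) auto
    moreover have "E t c \<le> exp (- 2 * t * (c - lrho \<alpha> x)) * E t (lrho \<alpha> x)"
      by (rule cwt_ratio[OF e that(1) r(2)]) (use ac in simp)
    moreover have "exp (- 2 * t * (c - lrho \<alpha> x)) * E t (lrho \<alpha> x) \<le> 1 * E t (lrho \<alpha> x)"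
      using that(1) r by (intro mult_right_mono) (auto simp: cwt_pos less_imp_le)
    ultimately have "E t c * (\<eta> (lrho \<alpha> x) * ((u x)\<^sup>2 / (norm (fst x))\<^sup>2)) \<le> E t (lrho \<alpha> x) * (\<eta> (lrho \<alpha> x) * ((u x)\<^sup>2 / (norm (fst x))\<^sup>2))"
      by (intro mult_right_mono) (auto simp: ceta_pos less_imp_le)
    with True \<open>cut 0 s0 s1 s2 (lrho \<alpha> x) = 1\<close> show ?thesis by (simp add: H_def g_def mult.assoc)
  next
    case False
    then show ?thesis using H0[of t s0 x] by (simp add: g_def)
  qed
  have iH: "integrable M (H t s0)" for t s0
  proof -
    note we = weighted_energy_identity[OF lt(3,6), where t = t and ?s0.0 = s0]
    have "integrable M (\<lambda>x. E t (lrho \<alpha> x) * (\<eta> (lrho \<alpha> x) * cut 0 s0 s1 s2 (lrho \<alpha> x)) * (u x)\<^sup>2 / (norm (fst x))\<^sup>2)"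
      by (rule hardy_limit(1)[where a = "\<lambda>s. E t s * (\<eta> s * cut 0 s0 s1 s2 s)" and ?s1.0 = s0, OF we(2,3) lt(6)])
        (auto simp: cut_outside[OF lt(3)] cwt_pos ceta_pos cut_0_bounds less_imp_le)
    then show ?thesis by (simp add: H_def mult.assoc)
  qed
  have mg: "g \<in> borel_measurable M"
  proof -
    have "shell \<alpha> a c \<in> sets M"
      using shell_props(2)[OF \<alpha>(1) R ac, of a] fmeasurableD[OF lmeasurable_compact[OF shell_props(1)[OF \<alpha>(1), of a c]]] open_\<Omega>
      by (subst sets_restrict_space_iff) auto
    moreover have "(\<lambda>x. \<eta> (lrho \<alpha> x)) \<in> borel_measurable M" by (rule measurable_radial[OF continuous_on_ceta])
    moreover have "(\<lambda>x. norm (fst x)) \<in> borel_measurable M"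
      by (intro borel_measurable_lebesgue_onI borel_measurable_continuous_onI continuous_intros)
    moreover have "u \<in> borel_measurable M" using L2_u by (rule L2_measurable)
    ultimately show ?thesis
      unfolding g_def by (intro borel_measurable_times borel_measurable_indicator borel_measurable_divide borel_measurable_power)
  qed
  \<comment> \<open>Domination by one Carleman integrand, for t0 and a cutoff rising before a; the
    Hardy inequality made that one integrable.\<close>
  have ig: "integrable M g"
  proof (rule Bochner_Integration.integrable_bound[OF integrable_mult_right[OF iH[of t0 "a - 1"], of "1 / E t0 c"] mg AE_I2])
    fix x show "norm (g x) \<le> norm (1 / E t0 c * H t0 (a - 1) x)"
      using gH[of t0 "a - 1" x] g0[of x] H0[of t0 "a - 1" x] D cwt_pos[of \<epsilon> L t0 c]
      by (simp add: pos_le_divide_eq mult.commute)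
  qed
  have Ft: "F \<le> D * C * K * (t\<^sup>2 * exp (- 2 * t * (p - c)))" if t: "t \<ge> t0" for t
  proof -
    have t1: "t \<ge> 0" using t D by simp
    define I where "I = (\<lambda>s. integral\<^sup>L M (\<lambda>x. E t (lrho \<alpha> x) * bump (s - 1) s (s + 1) (s + 2) (lrho \<alpha> x) * ef x))"
    have I: "(I \<longlongrightarrow> 0) at_bot" unfolding I_def ef_def by (rule inner_error_tendsto_0[OF van t1])
    have step: "E t c * F \<le> D * C * t\<^sup>2 * (I s + E t p * K)" if s: "s < a - 1" "s < L - 2" for s
    proof -
      define \<tau>0 where "\<tau>0 = bump (s - 1) s (s + 1) (s + 2)"
      have adm0: "admissible L \<tau>0" unfolding \<tau>0_def by (rule admissible_bump) (use s in auto)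
      have \<tau>0: "0 \<le> \<tau>0 r" for r unfolding \<tau>0_def by (rule bump_props(2)) auto
      \<comment> \<open>The derivatives live on the two transition zones, where one of the
        trapezoids equals 1, and vanish on the plateau because k \<ge> 1.\<close>
      have bnd: "\<bar>cut k s s1 s2 r\<bar> \<le> C * (\<tau>0 r + \<tau>1 r)" if k: "k \<in> {1, 2, 3}" for k r
      proof -
        have nn: "0 \<le> C * \<tau>0 r" "0 \<le> C * \<tau>1 r" using C \<tau>0[of r] \<tau>1[of r] by auto
        consider "s \<le> r \<and> r \<le> s + 1" | "s1 \<le> r \<and> r \<le> s2" | "r \<le> s \<or> s2 \<le> r" | "s + 1 \<le> r \<and> r \<le> s1" by linarith
        then show ?thesis
        proof cases
          case 1
          then have "\<tau>0 r = 1" unfolding \<tau>0_def by (intro bump_props(4)) auto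
          then show ?thesis using C(2)[of k s r] nn by (simp add: distrib_left)
        next
          case 2
          then have "\<tau>1 r = 1" unfolding \<tau>1_def by (intro bump_props(4)) (use lt in auto)
          then show ?thesis using C(2)[of k s r] nn by (simp add: distrib_left)
        next
          case 3
          then show ?thesis using cut_outside[OF lt(3) 3, of k] nn by (simp add: distrib_left)
        next
          case 4
          then show ?thesis using cut_inside[OF lt(3), of s r k] k nn by (auto simp: distrib_left)
        qed
      qed
      have "E t c * F = integral\<^sup>L M (\<lambda>x. E t c * g x)" by (simp add: F_def)
      also have "\<dots> \<le> integral\<^sup>L M (H t s)"
        by (rule integral_mono[OF integrable_mult_right[OF ig] iH gH[OF t1]]) (use s in simp)
      also have "\<dots> \<le> D * C * t\<^sup>2 * integral\<^sup>L M (\<lambda>x. E t (lrho \<alpha> x) * (\<tau>0 (lrho \<alpha> x) + \<tau>1 (lrho \<alpha> x)) * ef x)"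
        unfolding H_def ef_def
        by (rule ce[where \<tau> = "\<lambda>s. \<tau>0 s + \<tau>1 s", OF t lt(3,6) C(1) admissible_add[OF adm0 adm1]])
          (use bnd \<tau>0 \<tau>1 in auto)
      also have "integral\<^sup>L M (\<lambda>x. E t (lrho \<alpha> x) * (\<tau>0 (lrho \<alpha> x) + \<tau>1 (lrho \<alpha> x)) * ef x)
          = I s + integral\<^sup>L M (\<lambda>x. E t (lrho \<alpha> x) * \<tau>1 (lrho \<alpha> x) * ef x)"
        unfolding distrib_left distrib_right I_def \<tau>0_def[symmetric]
        by (rule Bochner_Integration.integral_add; rule ief[OF admissible_mult(1)[OF cE]]) (rule adm0 adm1)+
      finally have le: "E t c * F \<le> D * C * t\<^sup>2 * (I s + integral\<^sup>L M (\<lambda>x. E t (lrho \<alpha> x) * \<tau>1 (lrho \<alpha> x) * ef x))" .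
      have "integral\<^sup>L M (\<lambda>x. E t (lrho \<alpha> x) * \<tau>1 (lrho \<alpha> x) * ef x) \<le> integral\<^sup>L M (\<lambda>x. E t p * (\<tau>1 (lrho \<alpha> x) * ef x))"
      proof (rule integral_mono[OF ief[OF admissible_mult(1)[OF cE adm1]] integrable_mult_right[OF ief[OF adm1]]])
        fix x
        show "E t (lrho \<alpha> x) * \<tau>1 (lrho \<alpha> x) * ef x \<le> E t p * (\<tau>1 (lrho \<alpha> x) * ef x)"
        proof (cases "p \<le> lrho \<alpha> x \<and> lrho \<alpha> x \<le> s3")
          case True
          have "E t (lrho \<alpha> x) \<le> exp (- 2 * t * (lrho \<alpha> x - p)) * E t p"
            by (rule cwt_ratio[OF e t1]) (use True lt in auto)
          also have "\<dots> \<le> 1 * E t p" using t1 True by (intro mult_right_mono) (auto simp: cwt_pos less_imp_le)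
          finally show ?thesis unfolding mult.assoc using \<tau>1[of "lrho \<alpha> x"] ef0[of x] by (intro mult_right_mono) auto
        next
          case False
          then have "\<tau>1 (lrho \<alpha> x) = 0" unfolding \<tau>1_def by (intro bump_props(5)) (use lt in auto)
          then show ?thesis by simp
        qed
      qed
      also have "\<dots> = E t p * K" by (simp add: K_def)
      finally show ?thesis using D C by (intro order_trans[OF le] mult_left_mono add_left_mono) auto
    qed
    \<comment> \<open>The limit s to minus infinity at fixed t removes the inner error;
      \<open>C\<close>, \<open>D\<close> and \<open>K\<close> do not depend on s.\<close>
    have "E t c * F \<le> D * C * t\<^sup>2 * (0 + E t p * K)"
    proof (rule tendsto_lowerbound)
      show "((\<lambda>s. D * C * t\<^sup>2 * (I s + E t p * K)) \<longlongrightarrow> D * C * t\<^sup>2 * (0 + E t p * K)) at_bot"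
        by (intro tendsto_intros I)
      have "eventually (\<lambda>s. s < min (a - 1) (L - 2)) at_bot" by (rule eventually_gt_at_bot)
      then show "eventually (\<lambda>s. E t c * F \<le> D * C * t\<^sup>2 * (I s + E t p * K)) at_bot"
        by eventually_elim (auto intro: step)
    qed simp
    also have "\<dots> \<le> D * C * t\<^sup>2 * (exp (- 2 * t * (p - c)) * E t c * K)"
      using cwt_ratio[OF e t1, of c p L] lt K D C by (intro mult_left_mono) (simp_all add: mult_right_mono)
    also have "\<dots> = E t c * (D * C * K * (t\<^sup>2 * exp (- 2 * t * (p - c))))" by (simp only: mult_ac)
    finally show ?thesis using cwt_pos[of \<epsilon> L t c] by (simp add: mult_le_cancel_left)
  qed
  \<comment> \<open>\<open>F\<close> and \<open>K\<close> are independent of t, and the exponential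
    decay beats the polynomial loss t^2.\<close>
  have "F \<le> D * C * K * 0"
  proof (rule tendsto_lowerbound)
    define d where "d = 2 * (p - c)"
    have d: "d > 0" using lt by (simp add: d_def)
    have "((\<lambda>t. (d * t)\<^sup>2 / exp (d * t)) \<longlongrightarrow> 0) at_top"
      by (rule filterlim_compose[OF tendsto_power_div_exp_0])
        (rule filterlim_tendsto_pos_mult_at_top[OF tendsto_const d filterlim_ident])
    from tendsto_mult_right_zero[OF this, of "1 / d\<^sup>2"]
    have "((\<lambda>t. 1 / d\<^sup>2 * ((d * t)\<^sup>2 / exp (d * t))) \<longlongrightarrow> 0) at_top" .
    moreover have "1 / d\<^sup>2 * ((d * t)\<^sup>2 / exp (d * t)) = t\<^sup>2 * exp (- 2 * t * (p - c))" for t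
    proof -
      have "1 / d\<^sup>2 * ((d * t)\<^sup>2 / exp (d * t)) = t\<^sup>2 * exp (- (d * t))"
        using d by (simp add: exp_minus divide_inverse power_mult_distrib)
      also have "- (d * t) = - 2 * t * (p - c)" by (simp add: d_def algebra_simps)
      finally show ?thesis .
    qed
    ultimately show "((\<lambda>t. D * C * K * (t\<^sup>2 * exp (- 2 * t * (p - c)))) \<longlongrightarrow> D * C * K * 0) at_top"
      by (intro tendsto_mult_left) simp
    show "eventually (\<lambda>t. F \<le> D * C * K * (t\<^sup>2 * exp (- 2 * t * (p - c)))) at_top"
      using eventually_ge_at_top[of t0] by eventually_elim (rule Ft)
  qed simp
  moreover have "0 \<le> F" unfolding F_def by (intro integral_nonneg_AE AE_I2 g0)
  ultimately have "integral\<^sup>L M g = 0" by (simp add: F_def)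
  then have "AE x in M. g x = 0" using integral_nonneg_eq_0_iff_AE[OF ig AE_I2[OF g0]] by simp
  then show ?thesis
    using AE_M_nonzero
  proof eventually_elim
    case (elim x)
    show ?case
    proof
      assume "x \<in> shell \<alpha> a c"
      then show "u x = 0" using elim ceta_pos[of \<epsilon> L "lrho \<alpha> x"] by (simp add: g_def)
    qed
  qed
qed

text \<open>Countably many shells exhaust the ball without its centre.\<close>

lemma unique_continuation:
  assumes van: "vanishes_to_infinite_order \<alpha> u"
  shows "AE x in M. u x = 0"
proof -
  have "AE x in M. \<forall>n. x \<in> shell \<alpha> (- real n) (L - inverse (real (Suc n))) \<longrightarrow> u x = 0"
    unfolding AE_all_countable by (intro allI vanishes_on_shell[OF van]) simp
  then show ?thesis
    using V_radial
  proof eventually_elim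
    case (elim x)
    have "L - lrho \<alpha> x > 0" using elim(2) by simp
    from reals_Archimedean[OF this] obtain n1 where n1: "inverse (real (Suc n1)) < L - lrho \<alpha> x" by blast
    obtain n2 where n2: "- lrho \<alpha> x < real n2" using reals_Archimedean2 by blast
    define n where "n = max n1 n2"
    have "inverse (real (Suc n)) \<le> inverse (real (Suc n1))" by (rule le_imp_inverse_le) (auto simp: n_def)
    with n1 have "lrho \<alpha> x \<le> L - inverse (real (Suc n))" by linarith
    moreover have "- real n \<le> lrho \<alpha> x" using n2 by (simp add: n_def)
    ultimately have "x \<in> shell \<alpha> (- real n) (L - inverse (real (Suc n)))"
      using elim(2) by (simp add: shell_def del: of_nat_Suc)
    with elim(1) show ?case by blast
  qed
qed

end

theorem theorem1p1:
  fixes \<alpha> R :: real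
    and u V :: "('m::{finite,linorder}, 'k::{finite,linorder}) point \<Rightarrow> real"
  assumes "CARD('m) \<ge> 3"
    and "0 < \<alpha>" and "\<alpha> \<le> 1" and "R > 0"
    and "V \<in> borel_measurable (lebesgue_on (gauge_ball \<alpha> R))"
    and "\<exists>C\<^sub>0>1. \<exists>\<delta>\<in>{0<..2}.
           (\<forall>x\<in>gauge_ball \<alpha> R. x \<noteq> 0 \<longrightarrow> \<bar>V x\<bar> \<le> C\<^sub>0 / gauge_rho \<alpha> x powr (2 - \<delta>)) \<and>
           (\<delta> = 2 \<longrightarrow> \<bar>V 0\<bar> \<le> C\<^sub>0)"
    and "u \<in> S_space \<alpha> 2 2 (gauge_ball \<alpha> R)"
    and "AE x in lebesgue_on (gauge_ball \<alpha> R). baouendi \<alpha> (gauge_ball \<alpha> R) u x = V x * u x"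
    and "vanishes_to_infinite_order \<alpha> u"
  shows "AE x in lebesgue_on (gauge_ball \<alpha> R). u x = 0"
proof -
  let ?\<Omega> = "gauge_ball \<alpha> R :: ('m, 'k) point set"
  obtain C0 \<delta> where C0: "C0 > 1" and \<delta>: "0 < \<delta>" "\<delta> \<le> 2"
      and V: "\<And>x. x \<in> ?\<Omega> \<Longrightarrow> x \<noteq> 0 \<Longrightarrow> \<bar>V x\<bar> \<le> C0 / gauge_rho \<alpha> x powr (2 - \<delta>)"
    using assms(6) by force
  obtain h P Q where hPQ: "\<And>n. C_k_on 2 (h n) ?\<Omega>" "L2lim (lebesgue_on ?\<Omega>) h u"
      "\<And>i. L2lim (lebesgue_on ?\<Omega>) (\<lambda>n x. fw \<alpha> i x * pd i (h n) x) (P i)"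
      "L2lim (lebesgue_on ?\<Omega>) (\<lambda>n. grushin \<alpha> (h n)) (baouendi \<alpha> ?\<Omega> u)"
      "\<And>a b. L2lim (lebesgue_on ?\<Omega>) (\<lambda>n. hgrad \<alpha> (Inr b) (\<lambda>c. pd (Inl c) (pd (Inr b) (h n))) (pd (Inr b) (h n)) a) (Q a b)"
    using S_space_approximation[OF assms(2) open_gauge_ball[OF assms(2,4)] assms(7)] by blast
  interpret limit_solution \<alpha> R "(homdim \<alpha> TYPE('m) TYPE('k) - 2) / 2" u "baouendi \<alpha> ?\<Omega> u" h P Q
    by unfold_locales (use assms(1-4) hPQ in auto)
  interpret carleman \<alpha> R "(homdim \<alpha> TYPE('m) TYPE('k) - 2) / 2" u "baouendi \<alpha> ?\<Omega> u" h P Q C0 \<delta>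
  proof
    show "AE x in lebesgue_on ?\<Omega>. \<bar>baouendi \<alpha> ?\<Omega> u x\<bar> \<le> C0 * exp ((\<delta> - 2) * lrho \<alpha> x) * \<bar>u x\<bar>"
      \<comment> \<open>Discarding the null set z = 0 also discards the origin, where the bound on
        \<open>V\<close> may be void.\<close>
      using assms(8) AE_M_nonzero AE_space
    proof eventually_elim
      case (elim x)
      then have x: "x \<in> ?\<Omega>" "x \<noteq> 0" by auto
      have "C0 / gauge_rho \<alpha> x powr (2 - \<delta>) = C0 * exp ((\<delta> - 2) * lrho \<alpha> x)"
        using x(2) assms(2) by (simp add: gauge_rho_eq exp_powr_real divide_inverse exp_minus[symmetric] algebra_simps)
      then show ?case using V[OF x] elim(1) by (simp add: abs_mult mult_right_mono)
    qed
  qed (use C0 \<delta> in auto)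
  show ?thesis by (rule unique_continuation[OF assms(9)])
qed

end
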